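(* Let $1\le p_1,p_2,q_1,q_2,p,q\le\infty$ be indices such that $$p_1,\,p_2',\,q_1,\,q_2'\le q'$$ and $$\frac1{p_1}+\frac1{p_2'}\ge\frac1{p'}+\frac1{q'},\qquad \frac1{q_1}+\frac1{q_2'}\ge\frac1{p'}+\frac1{q'} .$$ Let $m\in\mathcal{M}_v(\mathbb{R}^{2d})$. For every $\tau\in[0,1]$, the $\tau$-pseudodifferential operator $\operatorname{Op}_\tau(a)$ with symbol $a\in M^{p,q}_{1\otimes v_J}(\mathbb{R}^{2d})$ is a bounded operator from $M^{p_1,q_1}_m(\mathbb{R}^d)$ to $M^{p_2,q_2}_m(\mathbb{R}^d)$, with $$\|\operatorname{Op}_\tau(a)f\|_{M^{p_2,q_2}_m}\le C\,\|a\|_{M^{p,q}_{1\otimes v_J}}\,\|f\|_{M^{p_1,q_1}_m},\qquad f\in M^{p_1,q_1}_m(\mathbb{R}^d),$$ where $C>0$ is independent of $\tau\in[0,1]$ (and of $a$ and $f$).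
   Context: $p'$ denotes the conjugate exponent of $p\in[1,\infty]$: $1/p+1/p'=1$. $\langle\cdot,\cdot\rangle$ is the $L^2$ inner product or the duality pairing between $\mathcal{S}'$ and $\mathcal{S}$ (antilinear in the second argument), extended where possible to dual pairs of function spaces. Weights: $v$ is a fixed continuous, positive, even, submultiplicative weight on $\mathbb{R}^{2d}$: $v(0)=1$, $v(z)=v(-z)$, $v(z_1+z_2)\le v(z_1)v(z_2)$. $\mathcal{M}_v(\mathbb{R}^{2d})$ is the set of $v$-moderate weights: positive functions $m$ on $\mathbb{R}^{2d}$ for which there is $C>0$ with $m(z_1+z_2)\le Cv(z_1)m(z_2)$ for all $z_1,z_2$. $v_J(z)=v(Jz)$, with $J=\begin{pmatrix}0&I_d\\-I_d&0\end{pmatrix}$; $(1\otimes v_J)(z,\zeta)=v_J(\zeta)$ for $z,\zeta\in\mathbb{R}^{2d}$. Short-time Fourier transform on $\mathbb{R}^n$ ($n=d$ or $2d$): for a nonzero $g\in\mathcal{S}(\mathbb{R}^n)$ and $f\in\mathcal{S}'(\mathbb{R}^n)$, $V_gf(x,\xi)=\langle f,M_\xi T_xg\rangle=\int_{\mathbb{R}^n}f(t)\overline{g(t-x)}e^{-2\pi i t\xi}\,dt$, where $T_xg(t)=g(t-x)$, $M_\xi g(t)=e^{2\pi i\xi t}g(t)$. For a weight $\mu$ on $\mathbb{R}^{2n}$, the modulation space $M^{p,q}_\mu(\mathbb{R}^n)$ consists of all $f\in\mathcal{S}'(\mathbb{R}^n)$ with $\|f\|_{M^{p,q}_\mu}=\big(\int_{\mathbb{R}^n}(\int_{\mathbb{R}^n}|V_gf(x,\xi)|^p\mu(x,\xi)^p\,dx)^{q/p}d\xi\big)^{1/q}<\infty$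 (sup if $p$ or $q$ is $\infty$); a window $g$ is fixed, and different windows give equivalent norms. For $\tau\in[0,1]$ the (cross-)$\tau$-Wigner distribution is $W_\tau(f,g)(x,\xi)=\int_{\mathbb{R}^d}e^{-2\pi it\xi}f(x+\tau t)\overline{g(x-(1-\tau)t)}\,dt$ (extended to tempered distributions in the usual way). For $a\in\mathcal{S}'(\mathbb{R}^{2d})$ the $\tau$-pseudodifferential operator with symbol $a$ is defined by $\langle\operatorname{Op}_\tau(a)f,g\rangle=\langle a,W_\tau(g,f)\rangle$, $f,g\in\mathcal{S}(\mathbb{R}^d)$; formally $\operatorname{Op}_\tau(a)f(x)=\iint e^{2\pi i(x-y)\xi}a((1-\tau)x+\tau y,\xi)f(y)\,dy\,d\xi$. The same duality formula defines $\operatorname{Op}_\tau(a)f$ for $f\in M^{p_1,q_1}_m(\mathbb{R}^d)$, tested against $g\in M^{p_2',q_2'}_{1/m}(\mathbb{R}^d)$.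
   Formalization: The weight v is additionally assumed to grow at most polynomially; without this, different Schwartz windows need not give equivalent norms, and Op_τ(a)f can fail to be a tempered distribution (e.g. for v(x,ξ)=e^{|x|}, m=e^{-|x|}). *)

theory Defs
  imports "HOL-Analysis.Analysis"
begin

text \<open>
  Throughout, \<open>\<real>\<^sup>d\<close> is an arbitrary Euclidean space \<^typ>\<open>'a::euclidean_space\<close>, phase space
  \<open>\<real>\<^sup>2\<^sup>d\<close> is \<open>'a \<times> 'a\<close>, and weights on \<open>\<real>\<^sup>4\<^sup>d\<close> are functions on \<open>('a \<times> 'a) \<times> ('a \<times> 'a)\<close>.
\<close>

primrec iter_deriv :: "'a list \<Rightarrow> ('a::euclidean_space \<Rightarrow> complex) \<Rightarrow> 'a \<Rightarrow> complex" where
  "iter_deriv [] f = f"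
| "iter_deriv (b # bs) f = (\<lambda>x. frechet_derivative (iter_deriv bs f) (at x) b)"

definition schwartz :: "('a::euclidean_space \<Rightarrow> complex) \<Rightarrow> bool" where
  "schwartz f \<longleftrightarrow>
     (\<forall>bs. set bs \<subseteq> Basis \<longrightarrow>
        (\<forall>x. iter_deriv bs f differentiable (at x)) \<and>
        (\<forall>N::nat. bounded (range (\<lambda>x. (1 + norm x) ^ N *\<^sub>R iter_deriv bs f x))))"

definition schwartz_norm :: "nat \<Rightarrow> ('a::euclidean_space \<Rightarrow> complex) \<Rightarrow> real" where
  "schwartz_norm N f =
     (SUP (bs, x) \<in> {bs. set bs \<subseteq> Basis \<and> length bs \<le> N} \<times> UNIV.
        (1 + norm x) ^ N * norm (iter_deriv bs f x))"

type_synonym 'a dist = "('a \<Rightarrow> complex) \<Rightarrow> complex"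

text \<open>
  A distribution \<open>u\<close> is the map \<open>\<phi> \<mapsto> \<langle>u, \<phi>\<rangle>\<close>, which is \<^emph>\<open>antilinear\<close> in the test function.  It is
  normalised to \<open>0\<close> off the Schwartz space, so that equality of distributions is equality of maps.
\<close>

definition tempered :: "('a::euclidean_space) dist \<Rightarrow> bool" where
  "tempered u \<longleftrightarrow>
     (\<forall>\<phi> \<psi> c. schwartz \<phi> \<longrightarrow> schwartz \<psi> \<longrightarrow> u (\<lambda>x. c * \<phi> x + \<psi> x) = cnj c * u \<phi> + u \<psi>) \<and>
     (\<exists>N C. \<forall>\<phi>. schwartz \<phi> \<longrightarrow> norm (u \<phi>) \<le> C * schwartz_norm N \<phi>) \<and>
     (\<forall>\<phi>. \<not> schwartz \<phi> \<longrightarrow> u \<phi> = 0)"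

definition dist_of :: "('a::euclidean_space \<Rightarrow> complex) \<Rightarrow> 'a dist" where
  "dist_of f = (\<lambda>\<phi>. if schwartz \<phi> then LINT x|lborel. f x * cnj (\<phi> x) else 0)"

definition submultiplicative_weight :: "('z::euclidean_space \<Rightarrow> real) \<Rightarrow> bool" where
  "submultiplicative_weight v \<longleftrightarrow>
     continuous_on UNIV v \<and> (\<forall>z. 0 < v z) \<and> v 0 = 1 \<and> (\<forall>z. v (- z) = v z) \<and>
     (\<forall>z1 z2. v (z1 + z2) \<le> v z1 * v z2)"

text \<open>
  Standing convention when modulation spaces are built from tempered distributions and arbitrary
  Schwartz windows: it is exactly what makes all such windows give equivalent norms for all
  \<open>v\<close>-moderate weights.  (Submultiplicativity alone allows exponential growth.)
\<close>

definition polynomial_growth :: "('z::euclidean_space \<Rightarrow> real) \<Rightarrow> bool" where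
  "polynomial_growth v \<longleftrightarrow> (\<exists>C. \<exists>N::nat. \<forall>z. v z \<le> C * (1 + norm z) ^ N)"

definition moderate_weights :: "('z::euclidean_space \<Rightarrow> real) \<Rightarrow> ('z \<Rightarrow> real) set" where
  "moderate_weights v =
     {m. (\<forall>z. 0 < m z) \<and> (\<exists>C>0. \<forall>z1 z2. m (z1 + z2) \<le> C * v z1 * m z2)}"

definition symplectic_J :: "'a::euclidean_space \<times> 'a \<Rightarrow> 'a \<times> 'a" where
  "symplectic_J = (\<lambda>(x, \<xi>). (\<xi>, - x))"

definition one_tensor_J ::
    "('a::euclidean_space \<times> 'a \<Rightarrow> real) \<Rightarrow> ('a \<times> 'a) \<times> ('a \<times> 'a) \<Rightarrow> real" where
  "one_tensor_J v = (\<lambda>(z, \<zeta>). v (symplectic_J \<zeta>))"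

definition tf_shift :: "'a::euclidean_space \<Rightarrow> 'a \<Rightarrow> ('a \<Rightarrow> complex) \<Rightarrow> 'a \<Rightarrow> complex" where
  "tf_shift x \<xi> g = (\<lambda>t. cis (2 * pi * (\<xi> \<bullet> t)) * g (t - x))"

definition stft :: "('a::euclidean_space \<Rightarrow> complex) \<Rightarrow> 'a dist \<Rightarrow> 'a \<times> 'a \<Rightarrow> complex" where
  "stft g u = (\<lambda>(x, \<xi>). u (tf_shift x \<xi> g))"

text \<open>Conjugate exponent in \<open>[1,\<infinity>]\<close>; in \<^typ>\<open>ennreal\<close>, \<open>inverse 0 = \<infinity>\<close> and \<open>inverse \<infinity> = 0\<close>.\<close>

definition conj_exp :: "ennreal \<Rightarrow> ennreal" where
  "conj_exp p = inverse (1 - inverse p)"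

text \<open>Used for real exponents \<open>r > 0\<close> only.\<close>

definition epowr :: "ennreal \<Rightarrow> real \<Rightarrow> ennreal" where
  "epowr x r = (if x = \<infinity> then \<infinity> else ennreal (enn2real x powr r))"

text \<open>
  The \<open>L\<^sup>p\<close> norm for Lebesgue measure.  For \<open>p = \<infinity>\<close> the supremum is taken literally: it is applied to
  the continuous function \<open>V\<^sub>g f\<close> times a weight, and every moderate weight is comparable to a
  continuous one.  For the same reason no measurability of moderate weights is needed: the
  \<open>nn_integral\<close> is comparable to the one with a continuous weight.
\<close>

definition Lp_norm :: "ennreal \<Rightarrow> ('a::euclidean_space \<Rightarrow> ennreal) \<Rightarrow> ennreal" where
  "Lp_norm p F =
     (if p = \<infinity> then (SUP x. F x)
      else epowr (\<integral>\<^sup>+ x. epowr (F x) (enn2real p) \<partial>lborel) (1 / enn2real p))"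

definition mod_norm ::
    "('a::euclidean_space \<Rightarrow> complex) \<Rightarrow> ennreal \<Rightarrow> ennreal \<Rightarrow> ('a \<times> 'a \<Rightarrow> real) \<Rightarrow> 'a dist \<Rightarrow> ennreal"
  where
  "mod_norm g p q \<mu> u =
     Lp_norm q (\<lambda>\<xi>. Lp_norm p (\<lambda>x. ennreal (norm (stft g u (x, \<xi>)) * \<mu> (x, \<xi>))))"

definition mod_space ::
    "('a::euclidean_space \<Rightarrow> complex) \<Rightarrow> ennreal \<Rightarrow> ennreal \<Rightarrow> ('a \<times> 'a \<Rightarrow> real) \<Rightarrow> 'a dist set" where
  "mod_space g p q \<mu> = {u. tempered u \<and> mod_norm g p q \<mu> u < \<infinity>}"

text \<open>
  \<open>\<langle>u, w\<rangle> = c\<close> for two distributions, typically in dual modulation spaces.  By the orthogonality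
  relations, \<open>\<parallel>\<Phi>\<parallel>\<^sup>2 \<langle>u, w\<rangle> = \<integral> V\<^sub>\<Phi> u \<cdot> cnj (V\<^sub>\<Phi> w)\<close>.  The integral is required to converge absolutely and
  to give the same \<open>c\<close> for every window.
\<close>

definition has_pairing :: "('b::euclidean_space) dist \<Rightarrow> 'b dist \<Rightarrow> complex \<Rightarrow> bool" where
  "has_pairing u w c \<longleftrightarrow>
     (\<forall>\<Phi>. schwartz \<Phi> \<longrightarrow>
        has_bochner_integral lborel (\<lambda>z. stft \<Phi> u z * cnj (stft \<Phi> w z))
          (c * of_real (LINT x|lborel. (norm (\<Phi> x))\<^sup>2)))"

definition pairing :: "('b::euclidean_space) dist \<Rightarrow> 'b dist \<Rightarrow> complex" where
  "pairing u w = (THE c. has_pairing u w c)"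

definition wigner ::
    "real \<Rightarrow> ('a::euclidean_space \<Rightarrow> complex) \<Rightarrow> ('a \<Rightarrow> complex) \<Rightarrow> 'a \<times> 'a \<Rightarrow> complex" where
  "wigner \<tau> f g = (\<lambda>(x, \<xi>).
     LINT t|lborel. cis (- 2 * pi * (t \<bullet> \<xi>)) * f (x + \<tau> *\<^sub>R t) * cnj (g (x - (1 - \<tau>) *\<^sub>R t)))"

text \<open>
  Extension to distributions: \<open>W\<^sub>\<tau>(f,g)\<close> arises from \<open>f \<otimes> cnj g\<close> by the change of variables
  \<open>y = x + \<tau>t\<close>, \<open>s = x - (1-\<tau>)t\<close> (Jacobian 1, inverse \<open>x = (1-\<tau>)y + \<tau>s\<close>, \<open>t = y - s\<close>) and a partial
  Fourier transform \<open>t \<mapsto> \<xi>\<close>.  Transposing both gives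
  \<open>\<langle>W\<^sub>\<tau>(f,g), \<Psi>\<rangle> = \<langle>f \<otimes> cnj g, K\<rangle>\<close> with \<open>K = wigner_transpose \<tau> \<Psi>\<close>.
\<close>

definition wigner_transpose ::
    "real \<Rightarrow> ('a::euclidean_space \<times> 'a \<Rightarrow> complex) \<Rightarrow> 'a \<times> 'a \<Rightarrow> complex" where
  "wigner_transpose \<tau> \<Psi> = (\<lambda>(y, s).
     LINT \<xi>|lborel. cis (2 * pi * ((y - s) \<bullet> \<xi>)) * \<Psi> ((1 - \<tau>) *\<^sub>R y + \<tau> *\<^sub>R s, \<xi>))"

definition cnj_dist :: "('a::euclidean_space) dist \<Rightarrow> 'a dist" where
  "cnj_dist u = (\<lambda>\<phi>. cnj (u (\<lambda>x. cnj (\<phi> x))))"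

text \<open>The inner conjugation makes \<open>\<langle>u \<otimes> w, \<phi> \<otimes> \<psi>\<rangle> = \<langle>u, \<phi>\<rangle> \<langle>w, \<psi>\<rangle>\<close> for antilinear \<open>u\<close>, \<open>w\<close>.\<close>

definition tensor_dist ::
    "('a::euclidean_space) dist \<Rightarrow> ('b::euclidean_space) dist \<Rightarrow> ('a \<times> 'b) dist" where
  "tensor_dist u w =
     (\<lambda>\<Theta>. if schwartz \<Theta> then u (\<lambda>y. cnj (w (\<lambda>s. \<Theta> (y, s)))) else 0)"

definition wigner_dist :: "real \<Rightarrow> ('a::euclidean_space) dist \<Rightarrow> 'a dist \<Rightarrow> ('a \<times> 'a) dist" where
  "wigner_dist \<tau> f g =
     (\<lambda>\<Psi>. if schwartz \<Psi> then tensor_dist f (cnj_dist g) (wigner_transpose \<tau> \<Psi>) else 0)"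

text \<open>
  \<open>\<langle>Op\<^sub>\<tau>(a)f, g\<rangle> = \<langle>a, W\<^sub>\<tau>(g,f)\<rangle>\<close>, with the extended pairing on the right, for Schwartz \<open>g\<close>: this
  determines \<open>Op\<^sub>\<tau>(a)f\<close> as a tempered distribution.
\<close>

definition tau_op ::
    "real \<Rightarrow> ('a::euclidean_space \<times> 'a) dist \<Rightarrow> 'a dist \<Rightarrow> 'a dist" where
  "tau_op \<tau> a f =
     (\<lambda>g. if schwartz g then pairing a (wigner_dist \<tau> (dist_of g) f) else 0)"

end

theory Submission
  imports Defs "HOL-Probability.Probability"
begin

text \<open>
  Expand \<open>f\<close> and \<open>g\<close> in time-frequency shifts of the window \<open>\<phi>\<close>.  Up to a phase,
  \<open>W\<^sub>\<tau>\<close> of the shifts of \<open>\<phi>\<close> by \<open>z\<close> and \<open>z'\<close> is the shift of \<open>W\<^sub>\<tau>(\<phi>,\<phi>)\<close> by a point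
  \<open>gmap \<tau> z z'\<close> of \<open>\<real>\<^sup>4\<^sup>d\<close>, so \<open>\<langle>a, W\<^sub>\<tau>(g,f)\<rangle>\<close> becomes a double integral of
  \<open>cnj (V\<^sub>\<phi> g z) \<cdot> V\<^sub>\<phi> f z'\<close> against a kernel whose modulus is \<open>\<bar>V a\<bar>\<close> at \<open>gmap \<tau> z z'\<close>.
  The second component of \<open>gmap \<tau> z z'\<close> is \<open>J (z' - z)\<close> up to sign: it does not depend on \<open>\<tau>\<close>, and
  the weight \<open>1 \<otimes> v\<^sub>J\<close> absorbs the quotient of \<open>m z\<close> by \<open>m z'\<close>.  Boundedness thus is an inequality of
  Young type between mixed norms.  It is uniform in \<open>\<tau>\<close> because the windows \<open>W\<^sub>\<tau>(\<phi>,\<phi>)\<close>,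
  \<open>\<tau> \<in> [0,1]\<close>, form a bounded set of Schwartz functions.
\<close>

subsection \<open>Families of Schwartz functions\<close>

text \<open>With infinite exponents Schwartz functions are not dense in the modulation spaces, so
  the operator cannot be extended from them by continuity. Every identity is proved for tempered
  distributions directly, by absolutely convergent expansions and Fubini; the integral
  \<open>op_form\<close> is shown to be the value of both extended pairings. To take a distribution
  under an integral, or to be uniform in \<tau>, the Schwartz topology must be quantitative: a
  family of functions carries bounds polynomial in a weight of its index, and a distribution turns
  it into numbers bounded in the same way. The given exponents need not have the shape that Young's
  inequality wants. The reciprocals 1/p, 1/p1, 1/q1 are first decreased until they fit. This costs a
  convolution with a decaying kernel, which the reproducing formula supplies anyway, and the assumed
  inequalities ensure that the resulting output reciprocals are still at least 1/p2 and
  1/q2.\<close>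

definition bk :: "'a::real_normed_vector \<Rightarrow> real" where
  "bk x = 1 + norm x"

lemma bk_ge1: "1 \<le> bk x" and bk_pos: "0 < bk x" and bk_nonneg: "0 \<le> bk x"
  by (simp_all add: bk_def add_pos_nonneg)

lemma bk_zero [simp]: "bk 0 = 1"
  by (simp add: bk_def)

lemma bk_minus [simp]: "bk (- x) = bk x"
  by (simp add: bk_def)

lemma bk_norm [simp]: "bk (norm x) = bk x"
  by (simp add: bk_def)

lemma bk_diff_commute: "bk (x - y) = bk (y - x)"
  by (simp add: bk_def norm_minus_commute)

lemma norm_le_bk: "norm x \<le> bk x"
  by (simp add: bk_def)

lemma bk_power_ge1: "1 \<le> bk x ^ n"
  by (simp add: bk_ge1)

lemma bk_power_pos: "0 < bk x ^ n"
  by (simp add: bk_pos)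

lemma bk_power_mono: "m \<le> n \<Longrightarrow> bk x ^ m \<le> bk x ^ n"
  by (simp add: bk_ge1 power_increasing)

lemma bk_add_le: "bk (x + y) \<le> bk x * bk y"
proof -
  have "norm (x + y) \<le> norm x + norm y" by (rule norm_triangle_ineq)
  moreover have "0 \<le> norm x * norm y" by simp
  moreover have "bk x * bk y = 1 + norm x + norm y + norm x * norm y"
    by (simp add: bk_def algebra_simps)
  ultimately show ?thesis unfolding bk_def[of "_ + _"] bk_def[of "(_, _)"] by linarith
qed

lemma bk_add_power_le: "bk (x + y) ^ n \<le> bk x ^ n * bk y ^ n"
  by (metis bk_add_le bk_nonneg power_mono power_mult_distrib)

lemma bk_fst_le: "bk x \<le> bk (x, y)" and bk_snd_le: "bk y \<le> bk (x, y)"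
  by (simp_all add: bk_def norm_fst_le norm_snd_le)

lemma bk_Pair_le: "bk (x, y) \<le> bk x * bk y"
proof -
  have "norm (x, y) \<le> norm x + norm y" by (rule norm_Pair_le)
  moreover have "0 \<le> norm x * norm y" by simp
  moreover have "bk x * bk y = 1 + norm x + norm y + norm x * norm y"
    by (simp add: bk_def algebra_simps)
  ultimately show ?thesis unfolding bk_def[of "_ + _"] bk_def[of "(_, _)"] by linarith
qed

section \<open>Polynomial bounds in a weight of the index\<close>

text \<open>Leaving the constant and the exponent open makes the notion closed under sums, products
  and powers, so no seminorm index has to be tracked.\<close>

definition tame :: "('i \<Rightarrow> real) \<Rightarrow> ('i \<Rightarrow> real) \<Rightarrow> bool" where
  "tame w f \<longleftrightarrow> (\<exists>C M. \<forall>i. f i \<le> C * bk (w i) ^ M)"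

lemma tameI: "(\<And>i. f i \<le> C * bk (w i) ^ M) \<Longrightarrow> tame w f"
  unfolding tame_def by blast

lemma tameE:
  assumes "tame w f"
  obtains C M where "C \<ge> 0" "\<And>i. f i \<le> C * bk (w i) ^ M"
proof -
  obtain C M where *: "\<And>i. f i \<le> C * bk (w i) ^ M"
    using assms unfolding tame_def by blast
  have "f i \<le> max C 0 * bk (w i) ^ M" for i
    by (rule order_trans[OF *]) (auto intro!: mult_right_mono simp: bk_nonneg)
  then show ?thesis by (intro that[of "max C 0" M]) auto
qed

lemma tameE2:
  assumes "tame (\<lambda>(i, x). w i x) (\<lambda>(i, x). f i x)"
  obtains C M where "C \<ge> 0" "\<And>i x. f i x \<le> C * bk (w i x) ^ M"
proof (rule tameE[OF assms])
  fix C M assume "C \<ge> 0" and *: "\<And>p. (case p of (i, x) \<Rightarrow> f i x) \<le> C * bk (case p of (i, x) \<Rightarrow> w i x) ^ M"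
  then show thesis using *[of "(i, x)" for i x] by (intro that[of C M]) simp_all
qed

lemma tame_mono: "tame w g \<Longrightarrow> (\<And>i. f i \<le> g i) \<Longrightarrow> tame w f"
  unfolding tame_def by (meson order_trans)

lemma tame_const [simp]: "tame w (\<lambda>_. c)"
  by (rule tameI[where C=c and M=0]) simp

lemma tame_self [simp]: "tame w (\<lambda>i. bk (w i))"
  by (rule tameI[where C=1 and M=1]) simp

lemma tame_add:
  assumes "tame w f" "tame w g"
  shows "tame w (\<lambda>i. f i + g i)"
proof -
  obtain C M where 1: "C \<ge> 0" "\<And>i. f i \<le> C * bk (w i) ^ M" using tameE assms(1) by blast
  obtain D K where 2: "D \<ge> 0" "\<And>i. g i \<le> D * bk (w i) ^ K" using tameE assms(2) by blast
  show ?thesis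
  proof (rule tameI)
    fix i
    have "C * bk (w i) ^ M \<le> C * bk (w i) ^ (M + K)" "D * bk (w i) ^ K \<le> D * bk (w i) ^ (M + K)"
      using 1(1) 2(1) by (auto intro!: mult_left_mono bk_power_mono)
    then show "f i + g i \<le> (C + D) * bk (w i) ^ (M + K)"
      using 1(2)[of i] 2(2)[of i] by (simp add: distrib_right)
  qed
qed

lemma tame_mult:
  assumes "tame w f" "tame w g" "\<And>i. 0 \<le> g i"
  shows "tame w (\<lambda>i. f i * g i)"
proof -
  obtain C M where 1: "C \<ge> 0" "\<And>i. f i \<le> C * bk (w i) ^ M" using tameE assms(1) by blast
  obtain D K where 2: "D \<ge> 0" "\<And>i. g i \<le> D * bk (w i) ^ K" using tameE assms(2) by blast
  show ?thesis
  proof (rule tameI)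
    fix i
    have "f i * g i \<le> (C * bk (w i) ^ M) * (D * bk (w i) ^ K)"
      using 1 2 assms(3)[of i] bk_power_pos[of "w i" M] by (intro mult_mono) auto
    then show "f i * g i \<le> (C * D) * bk (w i) ^ (M + K)" by (simp add: power_add mult_ac)
  qed
qed

lemma tame_cmult: "tame w f \<Longrightarrow> c \<ge> 0 \<Longrightarrow> tame w (\<lambda>i. c * f i)"
  using tame_mult[of w f "\<lambda>_. c"] by (simp add: mult.commute)

lemma tame_power:
  assumes "tame w f" "\<And>i. 0 \<le> f i"
  shows "tame w (\<lambda>i. f i ^ n)"
  by (induction n) (use assms in \<open>auto intro!: tame_mult simp del: power_Suc simp: power_Suc2\<close>)

lemma tame_sum:
  assumes "finite A" "\<And>a. a \<in> A \<Longrightarrow> tame w (f a)"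
  shows "tame w (\<lambda>i. \<Sum>a\<in>A. f a i)"
  using assms by (induction rule: finite_induct) (auto intro!: tame_add)

text \<open>A polynomial bound substituted into a polynomial bound is again one; this is how
  families are reindexed.\<close>

lemma tame_reweight:
  assumes "tame w f" "tame v (\<lambda>j. bk (w (r j)))"
  shows "tame v (\<lambda>j. f (r j))"
proof -
  obtain C M where 1: "C \<ge> 0" "\<And>i. f i \<le> C * bk (w i) ^ M" using tameE assms(1) by blast
  have "tame v (\<lambda>j. C * bk (w (r j)) ^ M)"
    using assms(2) 1(1) by (intro tame_cmult tame_power) (auto simp: bk_nonneg)
  then show ?thesis by (rule tame_mono) (use 1 in auto)
qed

lemma tame_index: "tame w f \<Longrightarrow> tame (\<lambda>j. w (r j)) (\<lambda>j. f (r j))"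
  by (erule tame_reweight) simp

section \<open>Families with derivatives of controlled size\<close>

text \<open>The control \<open>A\<close> is a parameter so that one product rule serves decay,
  growth, and decay in half of the variables. Derivatives are taken in every direction, not only
  along the basis; the witness \<open>D\<close> is determined by \<open>F\<close>, being a Frechet
  derivative.\<close>

primrec Ck :: "(('i \<Rightarrow> 'a::euclidean_space \<Rightarrow> complex) \<Rightarrow> bool) \<Rightarrow> nat \<Rightarrow> ('i \<Rightarrow> 'a \<Rightarrow> complex) \<Rightarrow> bool" where
  "Ck A 0 F \<longleftrightarrow> A F"
| "Ck A (Suc k) F \<longleftrightarrow> A F \<and>
     (\<exists>D. (\<forall>i x. (F i has_derivative D i x) (at x)) \<and> (\<forall>b. Ck A k (\<lambda>i x. D i x b)))"

lemma Ck_Suc_imp: "Ck A (Suc k) F \<Longrightarrow> Ck A k F"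
proof (induction k arbitrary: F)
  case (Suc k)
  then obtain D where "A F" "\<forall>i x. (F i has_derivative D i x) (at x)" "\<And>b. Ck A (Suc k) (\<lambda>i x. D i x b)"
    unfolding Ck.simps(2)[of A "Suc k"] by blast
  then show ?case using Suc.IH unfolding Ck.simps(2)[of A k] by blast
qed simp

text \<open>The invariant is a class of families that satisfy \<open>A\<close> and are closed under
  directional derivatives. To show that an operation preserves Schwartz families, the class of all
  its results is taken, and only one derivative has to be computed.\<close>

lemma Ck_coinduct:
  assumes "P F"
    and "\<And>H. P H \<Longrightarrow> A H"
    and "\<And>H. P H \<Longrightarrow> \<exists>D. (\<forall>i x. (H i has_derivative D i x) (at x)) \<and> (\<forall>b. P (\<lambda>i x. D i x b))"
  shows "Ck A k F"
  using assms(1)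
proof (induction k arbitrary: F)
  case (Suc k)
  obtain D where "\<forall>i x. (F i has_derivative D i x) (at x)" "\<And>b. P (\<lambda>i x. D i x b)"
    using assms(3)[OF Suc.prems] by blast
  then show ?case using assms(2)[OF Suc.prems] Suc.IH unfolding Ck.simps by blast
qed (simp add: assms(2))

lemma Ck_add:
  assumes "\<And>F G. A F \<Longrightarrow> A G \<Longrightarrow> A (\<lambda>i x. F i x + G i x)"
  shows "Ck A k F \<Longrightarrow> Ck A k G \<Longrightarrow> Ck A k (\<lambda>i x. F i x + G i x)"
proof (induction k arbitrary: F G)
  case (Suc k)
  obtain D where D: "A F" "\<And>i x. (F i has_derivative D i x) (at x)" "\<And>b. Ck A k (\<lambda>i x. D i x b)"
    using Suc.prems(1) by auto
  obtain E where E: "A G" "\<And>i x. (G i has_derivative E i x) (at x)" "\<And>b. Ck A k (\<lambda>i x. E i x b)"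
    using Suc.prems(2) by auto
  show ?case
    using assms D E Suc.IH
    by (auto intro!: exI[of _ "\<lambda>i x b. D i x b + E i x b"] has_derivative_add)
qed (auto simp: assms)

text \<open>A derivative of the product is a sum of products of derivatives, each factor keeping its
  own control. The three controls may differ, as for growth times decay.\<close>

lemma Ck_mult:
  assumes add: "\<And>F G. C F \<Longrightarrow> C G \<Longrightarrow> C (\<lambda>i x. F i x + G i x)"
    and mult: "\<And>F G. A F \<Longrightarrow> B G \<Longrightarrow> C (\<lambda>i x. F i x * G i x)"
  shows "Ck A k F \<Longrightarrow> Ck B k G \<Longrightarrow> Ck C k (\<lambda>i x. F i x * G i x)"
proof (induction k arbitrary: F G)
  case (Suc k)
  obtain D where D: "A F" "\<And>i x. (F i has_derivative D i x) (at x)" "\<And>b. Ck A k (\<lambda>i x. D i x b)"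
    using Suc.prems(1) by auto
  obtain E where E: "B G" "\<And>i x. (G i has_derivative E i x) (at x)" "\<And>b. Ck B k (\<lambda>i x. E i x b)"
    using Suc.prems(2) by auto
  have "Ck A k F" "Ck B k G" using Suc.prems by (blast intro: Ck_Suc_imp)+
  then have "Ck C k (\<lambda>i x. F i x * E i x b + D i x b * G i x)" for b
    using Suc.IH D(3) E(3) by (intro Ck_add) (auto simp: add)
  moreover have "((\<lambda>x. F i x * G i x) has_derivative (\<lambda>b. F i x * E i x b + D i x b * G i x)) (at x)" for i x
    using has_derivative_mult[OF D(2) E(2)] .
  ultimately show ?case using mult[OF D(1) E(1)]
    by (auto intro!: exI[of _ "\<lambda>i x b. F i x * E i x b + D i x b * G i x"])
qed (auto simp: mult)

definition rapid :: "('i \<Rightarrow> real) \<Rightarrow> ('i \<Rightarrow> 'a::euclidean_space \<Rightarrow> complex) \<Rightarrow> bool" where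
  "rapid w F \<longleftrightarrow> (\<forall>N. tame (\<lambda>(i, x). w i) (\<lambda>(i, x). bk x ^ N * norm (F i x)))"

text \<open>The norm is that of the pair of weight and variable, so the growth may be polynomial in
  both at once.\<close>

definition slow :: "('i \<Rightarrow> real) \<Rightarrow> ('i \<Rightarrow> 'a::euclidean_space \<Rightarrow> complex) \<Rightarrow> bool" where
  "slow w F \<longleftrightarrow> tame (\<lambda>(i, x). norm (w i, x)) (\<lambda>(i, x). norm (F i x))"

lemma rapidD:
  assumes "rapid w F"
  obtains C M where "C \<ge> 0" "\<And>i x. bk x ^ N * norm (F i x) \<le> C * bk (w i) ^ M"
proof -
  have "tame (\<lambda>(i, x). w i) (\<lambda>(i, x). bk x ^ N * norm (F i x))"
    using assms unfolding rapid_def by blast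
  then show ?thesis by (rule tameE2) (rule that)
qed

lemma rapidI:
  assumes "\<And>N. \<exists>C M. \<forall>i x. bk x ^ N * norm (F i x) \<le> C * bk (w i) ^ M"
  shows "rapid w F"
  using assms unfolding rapid_def tame_def by auto

lemma slowD:
  assumes "slow w F"
  obtains C M where "C \<ge> 0" "\<And>i x. norm (F i x) \<le> C * bk (w i) ^ M * bk x ^ M"
proof -
  obtain C M where C: "C \<ge> 0" "\<And>i x. norm (F i x) \<le> C * bk (norm (w i, x)) ^ M"
    by (rule tameE2[OF assms[unfolded slow_def]]) (rule that)
  have "norm (F i x) \<le> C * bk (w i) ^ M * bk x ^ M" for i x
  proof -
    have "norm (F i x) \<le> C * bk (w i, x) ^ M" using C(2)[of i x] by simp
    also have "\<dots> \<le> C * (bk (w i) * bk x) ^ M"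
      using C(1) by (intro mult_left_mono power_mono bk_Pair_le) (auto simp: bk_nonneg)
    finally show ?thesis by (simp add: power_mult_distrib mult_ac)
  qed
  with C(1) show ?thesis by (rule that)
qed

lemma slowI:
  assumes "\<And>i x. norm (F i x) \<le> C * bk (w i) ^ M * bk x ^ K" "C \<ge> 0"
  shows "slow w F"
  unfolding slow_def
proof (rule tameI)
  fix p :: "'a \<times> 'b"
  obtain i x where p: "p = (i, x)" by (cases p)
  have "norm (F i x) \<le> C * bk (w i) ^ M * bk x ^ K" by fact
  also have "\<dots> \<le> C * bk (w i, x) ^ M * bk (w i, x) ^ K"
    using assms(2) by (intro mult_mono mult_left_mono power_mono bk_fst_le bk_snd_le) (auto simp: bk_nonneg)
  finally show "(\<lambda>(i, x). norm (F i x)) p \<le> C * bk ((\<lambda>(i, x). norm (w i, x)) p) ^ (M + K)"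
    by (simp add: p power_add mult_ac)
qed

lemma rapid_add:
  assumes "rapid w F" "rapid w G"
  shows "rapid w (\<lambda>i x. F i x + G i x)"
  unfolding rapid_def
proof
  fix N
  show "tame (\<lambda>(i, x). w i) (\<lambda>(i, x). bk x ^ N * norm (F i x + G i x))"
    by (rule tame_mono[OF tame_add[OF assms[unfolded rapid_def, THEN spec, of N]]])
       (auto simp: bk_nonneg distrib_left[symmetric] intro!: mult_left_mono norm_triangle_ineq)
qed

lemma slow_add:
  assumes "slow w F" "slow w G"
  shows "slow w (\<lambda>i x. F i x + G i x)"
  unfolding slow_def
  by (rule tame_mono[OF tame_add[OF assms[unfolded slow_def]]]) (auto intro: norm_triangle_ineq)

lemma slow_mult:
  assumes "slow w F" "slow w G"
  shows "slow w (\<lambda>i x. F i x * G i x)"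
  unfolding slow_def
  by (rule tame_mono[OF tame_mult[OF assms[unfolded slow_def]]]) (auto simp: norm_mult)

lemma slow_rapid_mult:
  assumes "slow w F" "rapid w G"
  shows "rapid w (\<lambda>i x. F i x * G i x)"
proof (rule rapidI)
  fix N
  obtain C M where 1: "C \<ge> 0" "\<And>i x. norm (F i x) \<le> C * bk (w i) ^ M * bk x ^ M"
    by (rule slowD[OF assms(1)]) (rule that)
  obtain D K where 2: "D \<ge> 0" "\<And>i x. bk x ^ (N + M) * norm (G i x) \<le> D * bk (w i) ^ K"
    by (rule rapidD[OF assms(2)]) (rule that)
  have "bk x ^ N * norm (F i x * G i x) \<le> (C * D) * bk (w i) ^ (M + K)" for i x
  proof -
    have "bk x ^ N * norm (F i x * G i x) \<le> bk x ^ N * ((C * bk (w i) ^ M * bk x ^ M) * norm (G i x))"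
      by (auto simp: norm_mult bk_nonneg intro!: mult_left_mono mult_right_mono 1)
    also have "\<dots> = C * bk (w i) ^ M * (bk x ^ (N + M) * norm (G i x))"
      by (simp add: power_add mult_ac)
    also have "\<dots> \<le> C * bk (w i) ^ M * (D * bk (w i) ^ K)"
      using 1(1) by (intro mult_left_mono 2) (auto simp: bk_nonneg)
    finally show ?thesis by (simp add: power_add mult_ac)
  qed
  then show "\<exists>C M. \<forall>i x. bk x ^ N * norm (F i x * G i x) \<le> C * bk (w i) ^ M" by blast
qed

text \<open>
  A family \<open>F\<close> is a Schwartz family if all Schwartz seminorms of \<open>F i\<close> are bounded by powers of
  \<open>1 + \<bar>w i\<bar>\<close>; for bounded \<open>w\<close> these are the bounded subsets of the Schwartz space.
\<close>

definition schwartz_family :: "('i \<Rightarrow> real) \<Rightarrow> ('i \<Rightarrow> 'a::euclidean_space \<Rightarrow> complex) \<Rightarrow> bool" where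
  "schwartz_family w F \<longleftrightarrow> (\<forall>k. Ck (rapid w) k F)"

definition slow_family :: "('i \<Rightarrow> real) \<Rightarrow> ('i \<Rightarrow> 'a::euclidean_space \<Rightarrow> complex) \<Rightarrow> bool" where
  "slow_family w F \<longleftrightarrow> (\<forall>k. Ck (slow w) k F)"

text \<open>Each order k comes with its own witness; uniqueness of the Frechet derivative identifies
  them all.\<close>

lemma Ck_all_deriv:
  assumes "\<And>k. Ck A k F"
  obtains D where "\<And>i x. (F i has_derivative D i x) (at x)" "\<And>b k. Ck A k (\<lambda>i x. D i x b)"
proof -
  obtain D where D: "\<And>i x. (F i has_derivative D i x) (at x)"
    using assms[of "Suc 0"] unfolding Ck.simps by blast
  have "Ck A k (\<lambda>i x. D i x b)" for k b
  proof -
    obtain E where E: "\<And>i x. (F i has_derivative E i x) (at x)" "\<And>b. Ck A k (\<lambda>i x. E i x b)"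
      using assms[of "Suc k"] unfolding Ck.simps by blast
    have "E = D" by (intro ext) (rule fun_cong[OF has_derivative_unique[OF E(1) D]])
    then show ?thesis using E(2) by simp
  qed
  with D show ?thesis by (rule that)
qed

lemma schwartz_family_rapid: "schwartz_family w F \<Longrightarrow> rapid w F"
  unfolding schwartz_family_def by (drule spec[of _ 0]) simp

lemma slow_family_slow: "slow_family w F \<Longrightarrow> slow w F"
  unfolding slow_family_def by (drule spec[of _ 0]) simp

lemma schwartz_family_add:
  "schwartz_family w F \<Longrightarrow> schwartz_family w G \<Longrightarrow> schwartz_family w (\<lambda>i x. F i x + G i x)"
  unfolding schwartz_family_def using Ck_add[of "rapid w", OF rapid_add] by blast

lemma slow_family_add:
  "slow_family w F \<Longrightarrow> slow_family w G \<Longrightarrow> slow_family w (\<lambda>i x. F i x + G i x)"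
  unfolding slow_family_def using Ck_add[of "slow w", OF slow_add] by blast

lemma slow_family_mult:
  "slow_family w F \<Longrightarrow> slow_family w G \<Longrightarrow> slow_family w (\<lambda>i x. F i x * G i x)"
  unfolding slow_family_def
  using Ck_mult[where C="slow w" and A="slow w" and B="slow w", OF slow_add slow_mult] by blast

lemma schwartz_family_mult:
  "slow_family w F \<Longrightarrow> schwartz_family w G \<Longrightarrow> schwartz_family w (\<lambda>i x. F i x * G i x)"
  unfolding slow_family_def schwartz_family_def
  using Ck_mult[where C="rapid w" and A="slow w" and B="rapid w", OF rapid_add slow_rapid_mult] by blast

lemma schwartz_family_zero: "schwartz_family w (\<lambda>i x. 0)"
  unfolding schwartz_family_def
proof (intro allI Ck_coinduct[where P="\<lambda>H. H = (\<lambda>i x. 0)"])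
  fix H :: "'a \<Rightarrow> 'b \<Rightarrow> complex" assume H: "H = (\<lambda>i x. 0)"
  show "rapid w H" by (simp add: H rapid_def split_def)
  show "\<exists>D. (\<forall>i x. (H i has_derivative D i x) (at x)) \<and> (\<forall>b. (\<lambda>i x. D i x b) = (\<lambda>i x. 0))"
    by (rule exI[of _ "\<lambda>i x b. 0"]) (simp add: H)
qed simp

lemma slow_family_zero: "slow_family w (\<lambda>i x. 0)"
  unfolding slow_family_def
proof (intro allI Ck_coinduct[where P="\<lambda>H. H = (\<lambda>i x. 0)"])
  fix H :: "'a \<Rightarrow> 'b \<Rightarrow> complex" assume H: "H = (\<lambda>i x. 0)"
  show "slow w H" by (simp add: H slow_def split_def)
  show "\<exists>D. (\<forall>i x. (H i has_derivative D i x) (at x)) \<and> (\<forall>b. (\<lambda>i x. D i x b) = (\<lambda>i x. 0))"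
    by (rule exI[of _ "\<lambda>i x b. 0"]) (simp add: H)
qed simp

lemma slow_family_const:
  assumes "tame w (\<lambda>i. norm (c i))"
  shows "slow_family w (\<lambda>i x. c i)"
  unfolding slow_family_def
proof (intro allI Ck_coinduct[of "\<lambda>H. \<exists>c. tame w (\<lambda>i. norm (c i)) \<and> H = (\<lambda>i x. c i)"])
  fix H :: "'a \<Rightarrow> 'b \<Rightarrow> complex"
  assume "\<exists>c. tame w (\<lambda>i. norm (c i)) \<and> H = (\<lambda>i x. c i)"
  then obtain c where c: "tame w (\<lambda>i. norm (c i))" "H = (\<lambda>i x. c i)" by blast
  obtain C M where "C \<ge> 0" "\<And>i. norm (c i) \<le> C * bk (w i) ^ M" using tameE[OF c(1)] by blast
  then show "slow w H" using slowI[of H C w M 0] by (simp add: c(2))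
  show "\<exists>D. (\<forall>i x. (H i has_derivative D i x) (at x)) \<and>
             (\<forall>b. \<exists>c. tame w (\<lambda>i. norm (c i)) \<and> (\<lambda>i x. D i x b) = (\<lambda>i x. c i))"
    by (auto simp: c(2) intro!: exI[of _ "\<lambda>i x b. 0"] exI[of _ "\<lambda>_. 0"])
qed (use assms in blast)

lemma schwartz_family_scale:
  "tame w (\<lambda>i. norm (c i)) \<Longrightarrow> schwartz_family w F \<Longrightarrow> schwartz_family w (\<lambda>i x. c i * F i x)"
  by (intro schwartz_family_mult slow_family_const)

lemma schwartz_family_sum:
  assumes "finite A" "\<And>a. a \<in> A \<Longrightarrow> schwartz_family w (F a)"
  shows "schwartz_family w (\<lambda>i x. \<Sum>a\<in>A. F a i x)"
  using assms by (induction rule: finite_induct) (auto intro!: schwartz_family_zero schwartz_family_add)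

lemma slow_family_sum:
  assumes "finite A" "\<And>a. a \<in> A \<Longrightarrow> slow_family w (F a)"
  shows "slow_family w (\<lambda>i x. \<Sum>a\<in>A. F a i x)"
  using assms by (induction rule: finite_induct) (auto intro!: slow_family_zero slow_family_add)

lemma bounded_linear_Basis_expand:
  fixes D :: "'a::euclidean_space \<Rightarrow> complex"
  assumes "bounded_linear D"
  shows "D b = (\<Sum>c\<in>Basis. of_real (b \<bullet> c) * D c)"
proof -
  interpret bounded_linear D by fact
  have "D b = D (\<Sum>c\<in>Basis. (b \<bullet> c) *\<^sub>R c)" by (simp add: euclidean_representation)
  also have "\<dots> = (\<Sum>c\<in>Basis. of_real (b \<bullet> c) * D c)" by (simp add: sum scaleR scaleR_conv_of_real)
  finally show ?thesis .
qed

text \<open>The direction may vary with the index, as it does under the chain rule. Expanded in the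
  basis it has finitely many coefficients, each bounded by \<open>norm (B i)\<close>.\<close>

lemma schwartz_family_deriv:
  assumes "schwartz_family w F"
  obtains D where "\<And>i x. (F i has_derivative D i x) (at x)"
    "\<And>B. tame w (\<lambda>i. norm (B i)) \<Longrightarrow> schwartz_family w (\<lambda>i x. D i x (B i))"
    "\<And>b. schwartz_family w (\<lambda>i x. D i x b)"
proof -
  obtain D where D: "\<And>i x. (F i has_derivative D i x) (at x)" "\<And>b k. Ck (rapid w) k (\<lambda>i x. D i x b)"
    by (rule Ck_all_deriv[of "rapid w" F]) (use assms in \<open>auto simp: schwartz_family_def\<close>)
  show ?thesis
  proof (rule that[of D])
    show *: "schwartz_family w (\<lambda>i x. D i x b)" for b
      using D(2) by (simp add: schwartz_family_def)
    fix B :: "'a \<Rightarrow> 'b" assume B: "tame w (\<lambda>i. norm (B i))"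
    have "D i x (B i) = (\<Sum>c\<in>Basis. of_real (B i \<bullet> c) * D i x c)" for i x
      using D(1) by (intro bounded_linear_Basis_expand) (auto simp: has_derivative_def)
    moreover have "schwartz_family w (\<lambda>i x. \<Sum>c\<in>Basis. of_real (B i \<bullet> c) * D i x c)"
      by (intro schwartz_family_sum schwartz_family_scale * tame_mono[OF B])
         (auto simp: Basis_le_norm)
    ultimately show "schwartz_family w (\<lambda>i x. D i x (B i))" by simp
  qed (fact D(1))
qed

lemma slow_family_deriv:
  assumes "slow_family w F"
  obtains D where "\<And>i x. (F i has_derivative D i x) (at x)" "\<And>b. slow_family w (\<lambda>i x. D i x b)"
  by (rule Ck_all_deriv[of "slow w" F]) (use assms that in \<open>auto simp: slow_family_def\<close>)

text \<open>The family property treats one fixed direction at a time. Summing over the basis gives a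
  bound linear in \<open>norm b\<close>, as needed for operator norms and for domination under an
  integral.\<close>

lemma schwartz_family_deriv_bound:
  assumes "schwartz_family w F" "\<And>i x. (F i has_derivative D i x) (at x)"
  obtains C M where "C \<ge> 0" "\<And>i x b. bk x ^ N * norm (D i x b) \<le> C * bk (w i) ^ M * norm b"
proof -
  obtain E where E: "\<And>i x. (F i has_derivative E i x) (at x)"
     "\<And>b. schwartz_family w (\<lambda>i x. E i x b)"
    by (rule schwartz_family_deriv[OF assms(1)]) (rule that)
  have ED: "E = D" by (intro ext) (rule fun_cong[OF has_derivative_unique[OF E(1) assms(2)]])
  have "tame (\<lambda>(i, x). w i) (\<lambda>p. \<Sum>c\<in>Basis. (\<lambda>(i, x). bk x ^ N * norm (D i x c)) p)"
    using E(2)[THEN schwartz_family_rapid] unfolding ED rapid_def by (intro tame_sum) auto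
  then have "tame (\<lambda>(i, x). w i) (\<lambda>(i, x). \<Sum>c\<in>Basis. bk x ^ N * norm (D i x c))"
    by (simp add: split_def)
  then obtain C M where C: "C \<ge> 0"
    "\<And>i x. (\<Sum>c\<in>Basis. bk x ^ N * norm (D i x c)) \<le> C * bk (w i) ^ M"
    by (rule tameE2) (rule that)
  have "bk x ^ N * norm (D i x b) \<le> C * bk (w i) ^ M * norm b" for i x b
  proof -
    have "D i x b = (\<Sum>c\<in>Basis. of_real (b \<bullet> c) * D i x c)"
      using assms(2) by (intro bounded_linear_Basis_expand) (auto simp: has_derivative_def)
    then have "norm (D i x b) \<le> (\<Sum>c\<in>Basis. norm b * norm (D i x c))"
      by (auto intro!: order_trans[OF norm_sum] sum_mono mult_right_mono simp: norm_mult Basis_le_norm)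
    then have "bk x ^ N * norm (D i x b) \<le> bk x ^ N * (\<Sum>c\<in>Basis. norm b * norm (D i x c))"
      by (simp add: bk_power_pos)
    also have "\<dots> = norm b * (\<Sum>c\<in>Basis. bk x ^ N * norm (D i x c))"
      by (simp add: sum_distrib_left mult_ac)
    also have "\<dots> \<le> norm b * (C * bk (w i) ^ M)"
      using C(2) by (intro mult_left_mono) auto
    finally show ?thesis by (simp add: mult_ac)
  qed
  with C(1) show ?thesis by (rule that)
qed

lemma schwartz_family_cnj:
  assumes "schwartz_family w F"
  shows "schwartz_family w (\<lambda>i x. cnj (F i x))"
  unfolding schwartz_family_def
proof (intro allI Ck_coinduct[of "\<lambda>H. \<exists>F. schwartz_family w F \<and> H = (\<lambda>i x. cnj (F i x))"])
  fix H :: "'a \<Rightarrow> 'b \<Rightarrow> complex"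
  assume "\<exists>F. schwartz_family w F \<and> H = (\<lambda>i x. cnj (F i x))"
  then obtain F where F: "schwartz_family w F" "H = (\<lambda>i x. cnj (F i x))" by blast
  show "rapid w H" using schwartz_family_rapid[OF F(1)] by (simp add: F(2) rapid_def)
  obtain D where "\<And>i x. (F i has_derivative D i x) (at x)" "\<And>b. schwartz_family w (\<lambda>i x. D i x b)"
    by (rule schwartz_family_deriv[OF F(1)]) (rule that)
  then show "\<exists>D. (\<forall>i x. (H i has_derivative D i x) (at x)) \<and>
         (\<forall>b. \<exists>F. schwartz_family w F \<and> (\<lambda>i x. D i x b) = (\<lambda>i x. cnj (F i x)))"
    by (auto simp: F(2) intro!: exI[of _ "\<lambda>i x b. cnj (D i x b)"] has_derivative_cnj)
qed (use assms in blast)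

lemma schwartz_family_index:
  assumes "schwartz_family w F" "tame v (\<lambda>j. bk (w (r j)))"
  shows "schwartz_family v (\<lambda>j. F (r j))"
  unfolding schwartz_family_def
proof (intro allI Ck_coinduct[of "\<lambda>H. \<exists>F. schwartz_family w F \<and> H = (\<lambda>j. F (r j))"])
  fix H :: "'c \<Rightarrow> 'b \<Rightarrow> complex"
  assume "\<exists>F. schwartz_family w F \<and> H = (\<lambda>j. F (r j))"
  then obtain F where F: "schwartz_family w F" "H = (\<lambda>j. F (r j))" by blast
  show "rapid v H" unfolding rapid_def F(2)
  proof
    fix N
    have 1: "tame (\<lambda>(i, x). w i) (\<lambda>(i, x). bk x ^ N * norm (F i x))"
      using schwartz_family_rapid[OF F(1)] unfolding rapid_def by blast
    show "tame (\<lambda>(i, x::'b). v i) (\<lambda>(i, x). bk x ^ N * norm (F (r i) x))"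
      using tame_reweight[OF 1, of "\<lambda>(i, x::'b). v i" "\<lambda>(i, x). (r i, x)"]
            tame_index[OF assms(2), of fst] by (simp add: split_def)
  qed
  obtain D where "\<And>i x. (F i has_derivative D i x) (at x)" "\<And>b. schwartz_family w (\<lambda>i x. D i x b)"
    by (rule schwartz_family_deriv[OF F(1)]) (rule that)
  then show "\<exists>D. (\<forall>i x. (H i has_derivative D i x) (at x)) \<and>
         (\<forall>b. \<exists>F. schwartz_family w F \<and> (\<lambda>i x. D i x b) = (\<lambda>j. F (r j)))"
    by (auto simp: F(2) intro!: exI[of _ "\<lambda>i x b. D (r i) x b"] exI[of _ "\<lambda>i x. D i x b" for b])
qed (use assms in blast)

text \<open>Each \<open>L i\<close> is affine, its derivative \<open>A i\<close> being the same at
  all points. The growth of \<open>A\<close> controls the chain rule; the inequality for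
  \<open>bk x\<close> is a quantitative properness of \<open>L i\<close>, which turns decay in
  \<open>L i x\<close> into decay in x.\<close>

lemma schwartz_family_compose:
  fixes F :: "'i \<Rightarrow> 'b::euclidean_space \<Rightarrow> complex" and L :: "'i \<Rightarrow> 'a::euclidean_space \<Rightarrow> 'b"
  assumes F: "schwartz_family w F"
    and L: "\<And>i x. (L i has_derivative A i) (at x)"
    and A: "\<And>b. tame w (\<lambda>i. norm (A i b))"
    and K: "\<And>i x. bk x \<le> C0 * bk (w i) ^ M0 * bk (L i x) ^ K" "C0 \<ge> 0"
  shows "schwartz_family w (\<lambda>i x. F i (L i x))"
  unfolding schwartz_family_def
proof (intro allI Ck_coinduct[of "\<lambda>H. \<exists>F. schwartz_family w F \<and> H = (\<lambda>i x. F i (L i x))"])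
  fix H :: "'i \<Rightarrow> 'a \<Rightarrow> complex"
  assume "\<exists>F. schwartz_family w F \<and> H = (\<lambda>i x. F i (L i x))"
  then obtain F where F: "schwartz_family w F" "H = (\<lambda>i x. F i (L i x))" by blast
  show "rapid w H"
  proof (rule rapidI)
    fix N
    obtain C M where C: "C \<ge> 0" "\<And>i x. bk x ^ (K * N) * norm (F i x) \<le> C * bk (w i) ^ M"
      by (rule rapidD[OF schwartz_family_rapid[OF F(1)]]) (rule that)
    have "bk x ^ N * norm (H i x) \<le> (C0 ^ N * C) * bk (w i) ^ (M0 * N + M)" for i x
    proof -
      have "bk x ^ N * norm (H i x) \<le> (C0 * bk (w i) ^ M0 * bk (L i x) ^ K) ^ N * norm (H i x)"
        by (intro mult_right_mono power_mono K) (auto simp: bk_nonneg)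
      also have "\<dots> = C0 ^ N * bk (w i) ^ (M0 * N) * (bk (L i x) ^ (K * N) * norm (F i (L i x)))"
        by (simp add: F(2) power_mult_distrib power_mult mult_ac)
      also have "\<dots> \<le> C0 ^ N * bk (w i) ^ (M0 * N) * (C * bk (w i) ^ M)"
        using K(2) by (intro mult_left_mono C) (auto simp: bk_nonneg)
      finally show ?thesis by (simp add: power_add mult_ac)
    qed
    then show "\<exists>C M. \<forall>i x. bk x ^ N * norm (H i x) \<le> C * bk (w i) ^ M" by blast
  qed
  obtain D where D: "\<And>i x. (F i has_derivative D i x) (at x)"
     "\<And>B. tame w (\<lambda>i. norm (B i)) \<Longrightarrow> schwartz_family w (\<lambda>i x. D i x (B i))"
    by (rule schwartz_family_deriv[OF F(1)]) (rule that)
  have "(H i has_derivative (\<lambda>b. D i (L i x) (A i b))) (at x)" for i x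
    unfolding F(2) using has_derivative_compose[OF L D(1)] .
  with D(2)[OF A] show "\<exists>D. (\<forall>i x. (H i has_derivative D i x) (at x)) \<and>
         (\<forall>b. \<exists>F. schwartz_family w F \<and> (\<lambda>i x. D i x b) = (\<lambda>i x. F i (L i x)))"
    by (intro exI[of _ "\<lambda>i x b. D i (L i x) (A i b)"]) (fastforce intro!: exI[of _ "\<lambda>i x. D i x (A i b)" for b])
qed (use assms in blast)

lemma abs_bk [simp]: "\<bar>bk x\<bar> = bk x"
  by (simp add: bk_nonneg)

text \<open>Neither factor decays in all variables: the first decays in \<open>fst p\<close>, the
  second in \<open>snd p\<close>, and only the product is rapid. Hence the separate controls
  \<open>A\<close> and \<open>B\<close>.\<close>

lemma schwartz_family_tensor:
  fixes F :: "'i \<Rightarrow> 'a::euclidean_space \<Rightarrow> complex" and G :: "'i \<Rightarrow> 'b::euclidean_space \<Rightarrow> complex"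
  assumes "schwartz_family w F" "schwartz_family w G"
  shows "schwartz_family w (\<lambda>i (x, y). F i x * G i y)"
proof -
  define A where "A = (\<lambda>H::'i \<Rightarrow> 'a \<times> 'b \<Rightarrow> complex. \<forall>N. \<exists>C M. C \<ge> 0 \<and> (\<forall>i p. bk (fst p) ^ N * norm (H i p) \<le> C * bk (w i) ^ M))"
  define B where "B = (\<lambda>H::'i \<Rightarrow> 'a \<times> 'b \<Rightarrow> complex. \<forall>N. \<exists>C M. C \<ge> 0 \<and> (\<forall>i p. bk (snd p) ^ N * norm (H i p) \<le> C * bk (w i) ^ M))"
  have 1: "Ck A k (\<lambda>i p. F i (fst p))" for k
  proof (rule Ck_coinduct[where P="\<lambda>H. \<exists>F. schwartz_family w F \<and> H = (\<lambda>i p. F i (fst p))"])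
    fix H :: "'i \<Rightarrow> 'a \<times> 'b \<Rightarrow> complex"
    assume "\<exists>F. schwartz_family w F \<and> H = (\<lambda>i p. F i (fst p))"
    then obtain F where F: "schwartz_family w F" "H = (\<lambda>i p. F i (fst p))" by blast
    show "A H" unfolding A_def F(2) using rapidD[OF schwartz_family_rapid[OF F(1)]] by metis
    obtain D where "\<And>i x. (F i has_derivative D i x) (at x)" "\<And>b. schwartz_family w (\<lambda>i x. D i x b)"
      by (rule schwartz_family_deriv[OF F(1)]) (rule that)
    then show "\<exists>D. (\<forall>i x. (H i has_derivative D i x) (at x)) \<and>
         (\<forall>b. \<exists>F. schwartz_family w F \<and> (\<lambda>i x. D i x b) = (\<lambda>i p. F i (fst p)))"
      by (intro exI[of _ "\<lambda>i p b. D i (fst p) (fst b)"] conjI allI exI[of _ "\<lambda>i x. D i x (fst b)" for b])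
         (auto simp: F(2) intro!: has_derivative_compose[OF has_derivative_fst[OF has_derivative_ident]])
  qed (use assms in blast)
  have 2: "Ck B k (\<lambda>i p. G i (snd p))" for k
  proof (rule Ck_coinduct[where P="\<lambda>H. \<exists>F. schwartz_family w F \<and> H = (\<lambda>i p. F i (snd p))"])
    fix H :: "'i \<Rightarrow> 'a \<times> 'b \<Rightarrow> complex"
    assume "\<exists>F. schwartz_family w F \<and> H = (\<lambda>i p. F i (snd p))"
    then obtain F where F: "schwartz_family w F" "H = (\<lambda>i p. F i (snd p))" by blast
    show "B H" unfolding B_def F(2) using rapidD[OF schwartz_family_rapid[OF F(1)]] by metis
    obtain D where "\<And>i x. (F i has_derivative D i x) (at x)" "\<And>b. schwartz_family w (\<lambda>i x. D i x b)"
      by (rule schwartz_family_deriv[OF F(1)]) (rule that)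
    then show "\<exists>D. (\<forall>i x. (H i has_derivative D i x) (at x)) \<and>
         (\<forall>b. \<exists>F. schwartz_family w F \<and> (\<lambda>i x. D i x b) = (\<lambda>i p. F i (snd p)))"
      by (intro exI[of _ "\<lambda>i p b. D i (snd p) (snd b)"] conjI allI exI[of _ "\<lambda>i x. D i x (snd b)" for b])
         (auto simp: F(2) intro!: has_derivative_compose[OF has_derivative_snd[OF has_derivative_ident]])
  qed (use assms in blast)
  have mult: "rapid w (\<lambda>i p. H i p * K i p)" if HK: "A H" "B K" for H K
  proof (rule rapidI)
    fix N
    obtain C M where C: "C \<ge> 0" "\<And>i p. bk (fst p) ^ N * norm (H i p) \<le> C * bk (w i) ^ M"
      using HK(1) unfolding A_def by blast
    obtain D L where D: "D \<ge> 0" "\<And>i p. bk (snd p) ^ N * norm (K i p) \<le> D * bk (w i) ^ L"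
      using HK(2) unfolding B_def by blast
    have "bk p ^ N * norm (H i p * K i p) \<le> (C * D) * bk (w i) ^ (M + L)" for i p
    proof -
      have "bk p ^ N \<le> (bk (fst p) * bk (snd p)) ^ N"
        by (metis bk_Pair_le bk_nonneg power_mono prod.collapse)
      then have "bk p ^ N * norm (H i p * K i p) \<le>
          (bk (fst p) ^ N * bk (snd p) ^ N) * (norm (H i p) * norm (K i p))"
        by (intro mult_mono) (auto simp: norm_mult power_mult_distrib bk_nonneg)
      also have "\<dots> = (bk (fst p) ^ N * norm (H i p)) * (bk (snd p) ^ N * norm (K i p))"
        by (simp add: mult_ac)
      also have "\<dots> \<le> (C * bk (w i) ^ M) * (D * bk (w i) ^ L)"
        by (intro mult_mono C D) (auto simp: bk_nonneg C(1))
      finally show ?thesis by (simp add: power_add mult_ac)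
    qed
    then show "\<exists>C M. \<forall>i x. bk x ^ N * norm (H i x * K i x) \<le> C * bk (w i) ^ M" by blast
  qed
  have "Ck (rapid w) k (\<lambda>i p. F i (fst p) * G i (snd p))" for k
    by (rule Ck_mult[where A=A and B=B, OF rapid_add mult 1 2])
  then show ?thesis by (simp add: schwartz_family_def split_def)
qed

lemma has_derivative_Pair_left: "((\<lambda>y. (x, y)) has_derivative (\<lambda>b. (0, b))) (at y)"
  by (auto intro!: derivative_eq_intros)

lemma has_derivative_Pair_right: "((\<lambda>x. (x, y)) has_derivative (\<lambda>b. (b, 0))) (at x)"
  by (auto intro!: derivative_eq_intros)

text \<open>The first variable moves into the index. The factor \<open>bk x ^ N\<close> records the
  decay of the sections in x, which a tempered distribution applied in y then inherits.\<close>

lemma schwartz_family_section: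
  fixes F :: "'i \<Rightarrow> 'a::euclidean_space \<times> 'b::euclidean_space \<Rightarrow> complex"
  assumes "schwartz_family w F"
  shows "schwartz_family (\<lambda>(i, x). w i) (\<lambda>(i, x) y. of_real (bk x ^ N) * F i (x, y))"
  unfolding schwartz_family_def
proof (intro allI Ck_coinduct[where P="\<lambda>H. \<exists>F. schwartz_family w F \<and>
      H = (\<lambda>(i, x) y. of_real (bk x ^ N) * F i (x, y))"])
  fix H :: "'i \<times> 'a \<Rightarrow> 'b \<Rightarrow> complex"
  assume "\<exists>F. schwartz_family w F \<and> H = (\<lambda>(i, x) y. of_real (bk x ^ N) * F i (x, y))"
  then obtain F where F: "schwartz_family w F" "H = (\<lambda>(i, x) y. of_real (bk x ^ N) * F i (x, y))"
    by blast
  show "rapid (\<lambda>(i, x). w i) H"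
  proof (rule rapidI)
    fix K
    obtain C M where C: "C \<ge> 0" "\<And>i p. bk p ^ (K + N) * norm (F i p) \<le> C * bk (w i) ^ M"
      by (rule rapidD[OF schwartz_family_rapid[OF F(1)]]) (rule that)
    have "bk y ^ K * norm (H (i, x) y) \<le> C * bk (w i) ^ M" for i x y
    proof -
      have "bk y ^ K * norm (H (i, x) y) = bk y ^ K * bk x ^ N * norm (F i (x, y))"
        using bk_power_pos[of x N] by (simp add: F(2) norm_mult norm_power)
      also have "\<dots> \<le> bk (x, y) ^ K * bk (x, y) ^ N * norm (F i (x, y))"
        by (intro mult_right_mono mult_mono power_mono bk_fst_le bk_snd_le) (auto simp: bk_nonneg)
      also have "\<dots> \<le> C * bk (w i) ^ M" using C(2)[of "(x, y)" i] by (simp add: power_add)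
      finally show ?thesis .
    qed
    then show "\<exists>C M. \<forall>p y. bk y ^ K * norm (H p y) \<le> C * bk (case p of (i, x) \<Rightarrow> w i) ^ M"
      by (intro exI[of _ C] exI[of _ M]) auto
  qed
  obtain D where D: "\<And>i x. (F i has_derivative D i x) (at x)" "\<And>b. schwartz_family w (\<lambda>i x. D i x b)"
    by (rule schwartz_family_deriv[OF F(1)]) (rule that)
  show "\<exists>D. (\<forall>p y. (H p has_derivative D p y) (at y)) \<and>
         (\<forall>b. \<exists>F. schwartz_family w F \<and> (\<lambda>p y. D p y b) = (\<lambda>(i, x) y. of_real (bk x ^ N) * F i (x, y)))"
  proof (intro exI[of _ "\<lambda>(i, x) y b. of_real (bk x ^ N) * D i (x, y) (0, b)"] conjI allI
      exI[of _ "\<lambda>i p. D i p (0, b)" for b])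
    fix p y
    show "(H p has_derivative (case p of (i, x) \<Rightarrow> \<lambda>y b. of_real (bk x ^ N) * D i (x, y) (0, b)) y) (at y)"
      unfolding F(2) split_def
      by (intro has_derivative_mult_right has_derivative_compose[OF has_derivative_Pair_left D(1)])
  qed (auto simp: D(2))
qed (use assms in blast)

lemma schwartz_family_section':
  assumes "schwartz_family w F"
  shows "schwartz_family (\<lambda>(i, x). w i) (\<lambda>(i, x) y. F i (x, y))"
  using schwartz_family_section[OF assms, of 0] by simp

text \<open>Lipschitz continuity of \<open>x \<mapsto> F i (x, -)\<close> as a map into the Schwartz space.\<close>

lemma schwartz_family_diff_quotient:
  fixes F :: "'i \<Rightarrow> 'a::euclidean_space \<times> 'b::euclidean_space \<Rightarrow> complex"
  assumes "schwartz_family w F"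
  shows "schwartz_family (\<lambda>(i, x, x'). w i)
           (\<lambda>(i, x, x') y. of_real (inverse (norm (x - x'))) * (F i (x, y) - F i (x', y)))"
    (is "schwartz_family ?w (?Q F)")
  unfolding schwartz_family_def
proof (intro allI Ck_coinduct[where P="\<lambda>H. \<exists>F. schwartz_family w F \<and> H = ?Q F"])
  fix H :: "'i \<times> 'a \<times> 'a \<Rightarrow> 'b \<Rightarrow> complex"
  assume "\<exists>F. schwartz_family w F \<and> H = ?Q F"
  then obtain F where F: "schwartz_family w F" "H = ?Q F" by blast
  obtain D where D: "\<And>i x. (F i has_derivative D i x) (at x)" "\<And>b. schwartz_family w (\<lambda>i x. D i x b)"
    by (rule schwartz_family_deriv[OF F(1)]) (rule that)
  show "rapid ?w H"
  proof (rule rapidI)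
    fix N
    obtain C M where C: "C \<ge> 0" "\<And>i p b. bk p ^ N * norm (D i p b) \<le> C * bk (w i) ^ M * norm b"
      by (rule schwartz_family_deriv_bound[OF F(1) D(1)]) (rule that)
    have "bk y ^ N * norm (H (i, x, x') y) \<le> C * bk (w i) ^ M" for i x x' y
    proof -
      \<comment> \<open>Mean value inequality in the first variable; the decay of the derivative in
        y is uniform along the segment.\<close>
      have "norm (F i (x, y) - F i (x', y)) \<le> (C * bk (w i) ^ M / bk y ^ N) * norm (x - x')"
      proof (rule differentiable_bound[where S=UNIV and f="\<lambda>x. F i (x, y)" and f'="\<lambda>x b. D i (x, y) (b, 0)"])
        fix z :: 'a
        show "((\<lambda>x. F i (x, y)) has_derivative (\<lambda>b. D i (z, y) (b, 0))) (at z)"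
          by (intro has_derivative_compose[OF has_derivative_Pair_right D(1)])
        show "onorm (\<lambda>b. D i (z, y) (b, 0)) \<le> C * bk (w i) ^ M / bk y ^ N"
        proof (rule onorm_bound)
          fix b :: 'a
          have "bk y ^ N * norm (D i (z, y) (b, 0)) \<le> bk (z, y) ^ N * norm (D i (z, y) (b, 0))"
            by (intro mult_right_mono power_mono bk_snd_le) (auto simp: bk_nonneg)
          also have "\<dots> \<le> C * bk (w i) ^ M * norm b" using C(2)[of "(z, y)" i "(b, 0)"] by (simp add: norm_Pair)
          finally show "norm (D i (z, y) (b, 0)) \<le> C * bk (w i) ^ M / bk y ^ N * norm b"
            using bk_power_pos[of y N] by (simp add: field_simps)
        qed (use C(1) in \<open>simp add: bk_nonneg\<close>)
      qed auto
      note bound = this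
      have "norm (H (i, x, x') y) = inverse (norm (x - x')) * norm (F i (x, y) - F i (x', y))"
        by (simp add: F(2) norm_mult norm_inverse)
      also have "\<dots> \<le> inverse (norm (x - x')) * ((C * bk (w i) ^ M / bk y ^ N) * norm (x - x'))"
        by (rule mult_left_mono[OF bound]) simp
      also have "\<dots> \<le> C * bk (w i) ^ M / bk y ^ N"
        using C(1) by (cases "x = x'") (auto simp: bk_nonneg field_simps)
      finally show ?thesis using bk_power_pos[of y N] by (simp add: field_simps)
    qed
    then show "\<exists>C M. \<forall>p y. bk y ^ N * norm (H p y) \<le> C * bk (?w p) ^ M"
      by (intro exI[of _ C] exI[of _ M]) auto
  qed
  show "\<exists>D. (\<forall>p y. (H p has_derivative D p y) (at y)) \<and>
         (\<forall>b. \<exists>F. schwartz_family w F \<and> (\<lambda>p y. D p y b) = ?Q F)"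
  proof (intro exI[of _ "\<lambda>(i, x, x') y b. of_real (inverse (norm (x - x'))) * (D i (x, y) (0, b) - D i (x', y) (0, b))"]
      conjI allI exI[of _ "\<lambda>i p. D i p (0, b)" for b])
    fix p y
    show "(H p has_derivative (case p of (i, x, x') \<Rightarrow> \<lambda>y b. of_real (inverse (norm (x - x'))) *
             (D i (x, y) (0, b) - D i (x', y) (0, b))) y) (at y)"
      unfolding F(2) split_def
      by (intro has_derivative_mult_right has_derivative_diff has_derivative_compose[OF has_derivative_Pair_left D(1)])
  qed (auto simp: D(2))
qed (use assms in blast)

text \<open>One derivative turns a linear form into the constant family \<open>A i b\<close>, for
  which all orders are known; so order \<open>Suc k\<close> is proved and then lowered to k.\<close>

lemma slow_family_linear:
  fixes A :: "'i \<Rightarrow> 'a::euclidean_space \<Rightarrow> real"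
  assumes lin: "\<And>i. bounded_linear (A i)" and A: "\<And>b. tame w (\<lambda>i. norm (A i b))"
  shows "slow_family w (\<lambda>i x. of_real (A i x))"
  unfolding slow_family_def
proof
  have "tame w (\<lambda>i. \<Sum>b\<in>Basis. norm (A i b))" by (intro tame_sum A) auto
  then obtain C M where C: "C \<ge> 0" "\<And>i. (\<Sum>b\<in>Basis. norm (A i b)) \<le> C * bk (w i) ^ M"
    by (rule tameE) (rule that)
  have "norm (of_real (A i x) :: complex) \<le> C * bk (w i) ^ M * bk x ^ 1" for i x
  proof -
    interpret bounded_linear "A i" by fact
    have "A i x = A i (\<Sum>b\<in>Basis. (x \<bullet> b) *\<^sub>R b)" by (simp add: euclidean_representation)
    also have "\<dots> = (\<Sum>b\<in>Basis. (x \<bullet> b) * A i b)" by (simp add: sum scaleR)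
    finally have "norm (A i x) \<le> (\<Sum>b\<in>Basis. bk x * norm (A i b))"
      by (auto intro!: order_trans[OF sum_abs] sum_mono mult_right_mono order_trans[OF Basis_le_norm norm_le_bk] simp: abs_mult)
    also have "\<dots> = bk x * (\<Sum>b\<in>Basis. norm (A i b))" by (simp add: sum_distrib_left)
    also have "\<dots> \<le> bk x * (C * bk (w i) ^ M)" using C by (intro mult_left_mono) (auto simp: bk_nonneg)
    finally show ?thesis by (simp add: mult_ac)
  qed
  then have slow: "slow w (\<lambda>i x. complex_of_real (A i x))" using C(1) by (rule slowI)
  have const: "slow_family w (\<lambda>i x::'a. complex_of_real (A i b))" for b
    using A by (intro slow_family_const) simp
  fix k
  have "Ck (slow w) (Suc k) (\<lambda>i x. complex_of_real (A i x))"
    unfolding Ck.simps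
    using slow const lin
    by (auto intro!: exI[of _ "\<lambda>i x b. complex_of_real (A i b)"] bounded_linear_imp_has_derivative
        bounded_linear_compose[OF bounded_linear_of_real] simp: slow_family_def)
  then show "Ck (slow w) k (\<lambda>i x. complex_of_real (A i x))" by (rule Ck_Suc_imp)
qed

text \<open>Products p cis r with slow p are closed under derivatives: the derivative is (p' + \<i>
  p r') cis r, and \<open>cis\<close> has modulus 1.\<close>

lemma slow_family_cis:
  assumes "slow_family w (\<lambda>i x. of_real (r i x))"
  shows "slow_family w (\<lambda>i x. cis (r i x))"
  unfolding slow_family_def
proof (intro allI Ck_coinduct[where P="\<lambda>H. \<exists>p. slow_family w p \<and> H = (\<lambda>i x. p i x * cis (r i x))"])
  show "\<exists>p. slow_family w p \<and> (\<lambda>i x. cis (r i x)) = (\<lambda>i x. p i x * cis (r i x))"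
    by (intro exI[of _ "\<lambda>i x. 1"] conjI slow_family_const) auto
  fix H :: "'a \<Rightarrow> 'b \<Rightarrow> complex"
  assume "\<exists>p. slow_family w p \<and> H = (\<lambda>i x. p i x * cis (r i x))"
  then obtain p where p: "slow_family w p" "H = (\<lambda>i x. p i x * cis (r i x))" by blast
  show "slow w H" using slow_family_slow[OF p(1)] by (simp add: slow_def p(2) norm_mult)
  obtain P where P: "\<And>i x. (p i has_derivative P i x) (at x)" "\<And>b. slow_family w (\<lambda>i x. P i x b)"
    by (rule slow_family_deriv[OF p(1)]) (rule that)
  obtain R where R: "\<And>i x. ((\<lambda>x. complex_of_real (r i x)) has_derivative R i x) (at x)"
      "\<And>b. slow_family w (\<lambda>i x. R i x b)"
    by (rule slow_family_deriv[OF assms]) (rule that)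
  have c: "((\<lambda>x. cis (r i x)) has_derivative (\<lambda>b. \<i> * R i x b * cis (r i x))) (at x)" for i x
  proof -
    have "((\<lambda>x. exp (\<i> * complex_of_real (r i x))) has_derivative
        (\<lambda>b. exp (\<i> * complex_of_real (r i x)) * (\<i> * R i x b))) (at x)"
      by (rule has_derivative_compose[OF has_derivative_mult_right[OF R(1)] DERIV_exp[unfolded has_field_derivative_def]])
    then show ?thesis by (simp add: cis_conv_exp mult_ac)
  qed
  have "(H i has_derivative (\<lambda>b. (P i x b + p i x * (\<i> * R i x b)) * cis (r i x))) (at x)" for i x
    unfolding p(2) using has_derivative_mult[OF P(1) c] by (simp add: algebra_simps)
  moreover have "slow_family w (\<lambda>i x. P i x b + p i x * (\<i> * R i x b))" for b
    by (intro slow_family_add slow_family_mult P R p slow_family_const) auto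
  ultimately show "\<exists>D. (\<forall>i x. (H i has_derivative D i x) (at x)) \<and>
         (\<forall>b. \<exists>p. slow_family w p \<and> (\<lambda>i x. D i x b) = (\<lambda>i x. p i x * cis (r i x)))"
    by (intro exI[of _ "\<lambda>i x b. (P i x b + p i x * (\<i> * R i x b)) * cis (r i x)"]) blast
qed

section \<open>Agreement with Schwartz functions; seminorms and tempered distributions\<close>

lemma Ck_sum:
  assumes add: "\<And>F G. A F \<Longrightarrow> A G \<Longrightarrow> A (\<lambda>i x. F i x + G i x)" and zero: "A (\<lambda>i x. 0)"
    and "finite I" "\<And>j. j \<in> I \<Longrightarrow> Ck A k (F j)"
  shows "Ck A k (\<lambda>i x. \<Sum>j\<in>I. F j i x)"
  using assms(3,4)
proof (induction rule: finite_induct)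
  case empty
  have "Ck A k (\<lambda>i x. 0)"
    by (rule Ck_coinduct[where P="\<lambda>H. H = (\<lambda>i x. 0)"]) (auto simp: zero intro!: exI[of _ "\<lambda>i x b. 0"])
  then show ?case by simp
next
  case (insert j J)
  then show ?case using add by (auto intro!: Ck_add)
qed

text \<open>Schwartz functions are defined through derivatives along basis vectors only. For the
  converse, the induction on k treats all words \<open>bs\<close> at once: a derivative of
  \<open>iter_deriv bs\<close> in any direction is a combination of the functions for the words
  \<open>c # bs\<close>.\<close>

lemma schwartz_family_iff_iter_deriv:
  "schwartz_family w F \<longleftrightarrow> (\<forall>bs. set bs \<subseteq> Basis \<longrightarrow>
     (\<forall>i x. iter_deriv bs (F i) differentiable (at x)) \<and> rapid w (\<lambda>i. iter_deriv bs (F i)))"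
    (is "_ \<longleftrightarrow> ?R")
proof
  assume F: "schwartz_family w F"
  have *: "schwartz_family w (\<lambda>i. iter_deriv bs (F i))" for bs
  proof (induction bs)
    case (Cons b bs)
    obtain D where D: "\<And>i x. (iter_deriv bs (F i) has_derivative D i x) (at x)"
       "\<And>b. schwartz_family w (\<lambda>i x. D i x b)"
      by (rule schwartz_family_deriv[OF Cons]) (rule that)
    then show ?case by (simp add: frechet_derivative_at[OF D(1), symmetric])
  qed (simp add: F)
  show ?R
  proof (intro allI impI conjI)
    fix bs i x
    show "rapid w (\<lambda>i. iter_deriv bs (F i))" by (rule schwartz_family_rapid[OF *])
    obtain D where "\<And>i x. (iter_deriv bs (F i) has_derivative D i x) (at x)"
      by (rule schwartz_family_deriv[OF *]) (rule that)
    then show "iter_deriv bs (F i) differentiable (at x)" by (auto simp: differentiable_def)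
  qed
next
  assume R: ?R
  have "\<forall>bs. set bs \<subseteq> Basis \<longrightarrow> Ck (rapid w) k (\<lambda>i. iter_deriv bs (F i))" for k
  proof (induction k)
    case (Suc k)
    show ?case
    proof (intro allI impI)
      fix bs :: "'b list" assume bs: "set bs \<subseteq> Basis"
      define D where "D i x = frechet_derivative (iter_deriv bs (F i)) (at x)" for i x
      have D: "(iter_deriv bs (F i) has_derivative D i x) (at x)" for i x
        using R bs unfolding D_def by (simp add: frechet_derivative_works[symmetric])
      have "D i x b = (\<Sum>c\<in>Basis. of_real (b \<bullet> c) * iter_deriv (c # bs) (F i) x)" for i x b
        unfolding iter_deriv.simps D_def[symmetric]
        by (rule bounded_linear_Basis_expand[OF has_derivative_bounded_linear[OF D]])
      moreover have "Ck (rapid w) k (\<lambda>i x. \<Sum>c\<in>Basis. of_real (b \<bullet> c) * iter_deriv (c # bs) (F i) x)" for b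
      proof (rule Ck_sum)
        fix c :: 'b assume "c \<in> Basis"
        then have 1: "Ck (rapid w) k (\<lambda>i. iter_deriv (c # bs) (F i))" using Suc.IH[rule_format, of "c # bs"] bs by simp
        have "slow_family w (\<lambda>i x::'b. complex_of_real (b \<bullet> c))"
          by (rule slow_family_const) simp
        then have 2: "Ck (slow w) k (\<lambda>i x::'b. complex_of_real (b \<bullet> c))"
          by (simp add: slow_family_def)
        show "Ck (rapid w) k (\<lambda>i x. of_real (b \<bullet> c) * iter_deriv (c # bs) (F i) x)"
          by (rule Ck_mult[where A="slow w" and B="rapid w", OF rapid_add slow_rapid_mult 2 1])
      qed (auto intro: rapid_add schwartz_family_rapid[OF schwartz_family_zero])
      ultimately have "Ck (rapid w) k (\<lambda>i x. D i x b)" for b by simp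
      then show "Ck (rapid w) (Suc k) (\<lambda>i. iter_deriv bs (F i))"
        using R bs D by auto
    qed
  qed (use R in auto)
  from this[rule_format, of "[]"] show "schwartz_family w F" by (simp add: schwartz_family_def)
qed

text \<open>A one-point index with weight 0 turns the polynomial bounds into constants, so facts on
  families apply to single functions.\<close>

lemma schwartz_iff_family: "schwartz f \<longleftrightarrow> schwartz_family (\<lambda>_::unit. 0) (\<lambda>_. f)"
proof -
  have eq: "(\<forall>N::nat. bounded (range (\<lambda>x. (1 + norm x) ^ N *\<^sub>R g x))) \<longleftrightarrow> rapid (\<lambda>_::unit. 0) (\<lambda>_. g)"
    for g :: "'a \<Rightarrow> complex"
  proof
    assume *: "\<forall>N::nat. bounded (range (\<lambda>x. (1 + norm x) ^ N *\<^sub>R g x))"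
    show "rapid (\<lambda>_::unit. 0) (\<lambda>_. g)"
    proof (rule rapidI)
      fix N
      obtain B where B: "\<And>x. norm ((1 + norm x) ^ N *\<^sub>R g x) \<le> B"
        using * unfolding bounded_iff by auto
      then have "bk x ^ N * norm (g x) \<le> B" for x
        using B[of x] bk_power_pos[of x N] by (simp add: bk_def)
      then show "\<exists>C M. \<forall>(i::unit) x. bk x ^ N * norm (g x) \<le> C * bk (0::real) ^ M" by auto
    qed
  next
    assume *: "rapid (\<lambda>_::unit. 0) (\<lambda>_. g)"
    show "\<forall>N::nat. bounded (range (\<lambda>x. (1 + norm x) ^ N *\<^sub>R g x))"
    proof
      fix N
      obtain C M where "C \<ge> 0" "\<And>(i::unit) x. bk x ^ N * norm (g x) \<le> C * bk (0::real) ^ M"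
        by (rule rapidD[OF *]) (rule that)
      then have "norm ((1 + norm x) ^ N *\<^sub>R g x) \<le> C" for x
        using bk_power_pos[of x N] by (simp add: bk_def)
      then show "bounded (range (\<lambda>x. (1 + norm x) ^ N *\<^sub>R g x))" unfolding bounded_iff by auto
    qed
  qed
  show ?thesis unfolding schwartz_def schwartz_family_iff_iter_deriv eq by simp
qed

lemma schwartz_family_const_iff: "schwartz_family w (\<lambda>_. f)" if "schwartz f"
  using schwartz_family_index[where r="\<lambda>_. ()", OF that[unfolded schwartz_iff_family], of w] by simp

lemma schwartz_family_imp_schwartz:
  assumes "schwartz_family w F" shows "schwartz (F i)"
  unfolding schwartz_iff_family
  by (rule schwartz_family_index[where r="\<lambda>_. i", OF assms]) simp

text \<open>There are finitely many words of length at most N, each giving a bounded function; thus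
  the real supremum in \<open>schwartz_norm\<close> is a true one.\<close>

lemma schwartz_norm_bdd:
  assumes "schwartz f"
  shows "bdd_above ((\<lambda>(bs, x). (1 + norm x) ^ N * norm (iter_deriv bs f x)) `
           ({bs. set bs \<subseteq> Basis \<and> length bs \<le> N} \<times> UNIV))"
proof -
  have "\<forall>bs. set bs \<subseteq> Basis \<longrightarrow> (\<exists>C. \<forall>x. bk x ^ N * norm (iter_deriv bs f x) \<le> C)"
  proof (intro allI impI)
    fix bs :: "'a list" assume "set bs \<subseteq> Basis"
    then have r: "rapid (\<lambda>_::unit. 0) (\<lambda>_. iter_deriv bs f)"
      using assms unfolding schwartz_iff_family schwartz_family_iff_iter_deriv by blast
    obtain C M where "\<And>(i::unit) x. bk x ^ N * norm (iter_deriv bs f x) \<le> C * bk (0::real) ^ M"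
      by (rule rapidD[OF r]) (rule that)
    then show "\<exists>C. \<forall>x. bk x ^ N * norm (iter_deriv bs f x) \<le> C" by auto
  qed
  then obtain C where C: "\<And>bs x. set bs \<subseteq> Basis \<Longrightarrow> bk x ^ N * norm (iter_deriv bs f x) \<le> C bs"
    by metis
  have fin: "finite {bs::'a list. set bs \<subseteq> Basis \<and> length bs \<le> N}"
    by (rule finite_lists_length_le) simp
  show ?thesis
  proof (rule bdd_aboveI2)
    fix p assume "p \<in> {bs::'a list. set bs \<subseteq> Basis \<and> length bs \<le> N} \<times> (UNIV :: 'a set)"
    then obtain bs x where p: "p = (bs, x)" "set bs \<subseteq> Basis" "length bs \<le> N" by auto
    then have "C bs \<le> Max (C ` {bs. set bs \<subseteq> Basis \<and> length bs \<le> N})"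
      using fin by (intro Max_ge) auto
    then show "(\<lambda>(bs, x). (1 + norm x) ^ N * norm (iter_deriv bs f x)) p \<le> Max (C ` {bs. set bs \<subseteq> Basis \<and> length bs \<le> N})"
      using C[OF p(2), of x] by (simp add: p(1) bk_def)
  qed
qed

lemma schwartz_norm_ge:
  assumes "schwartz f" "set bs \<subseteq> Basis" "length bs \<le> N"
  shows "bk x ^ N * norm (iter_deriv bs f x) \<le> schwartz_norm N f"
  unfolding schwartz_norm_def bk_def
  using cSUP_upper[OF _ schwartz_norm_bdd[OF assms(1)], of "(bs, x)" N] assms(2,3) by auto

lemma schwartz_norm_nonneg: "schwartz f \<Longrightarrow> 0 \<le> schwartz_norm N f"
  using schwartz_norm_ge[of f "[]" N 0] by (auto intro: order_trans[rotated])

lemma tame_schwartz_norm: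
  assumes "schwartz_family w F"
  shows "tame w (\<lambda>i. schwartz_norm N (F i))"
proof -
  have fin: "finite {bs::'b list. set bs \<subseteq> Basis \<and> length bs \<le> N}"
    by (rule finite_lists_length_le) simp
  have "\<forall>bs. set bs \<subseteq> Basis \<longrightarrow> (\<exists>C M. C \<ge> 0 \<and> (\<forall>i x. bk x ^ N * norm (iter_deriv bs (F i) x) \<le> C * bk (w i) ^ M))"
  proof (intro allI impI)
    fix bs :: "'b list" assume "set bs \<subseteq> Basis"
    then have "rapid w (\<lambda>i. iter_deriv bs (F i))"
      using assms unfolding schwartz_family_iff_iter_deriv by blast
    then show "\<exists>C M. C \<ge> 0 \<and> (\<forall>i x. bk x ^ N * norm (iter_deriv bs (F i) x) \<le> C * bk (w i) ^ M)"
      by (rule rapidD[of _ _ N]) blast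
  qed
  then obtain C M where C: "\<And>bs. set bs \<subseteq> Basis \<Longrightarrow> C bs \<ge> 0"
      "\<And>bs i x. set bs \<subseteq> Basis \<Longrightarrow> bk x ^ N * norm (iter_deriv bs (F i) x) \<le> C bs * bk (w i) ^ M bs"
    by metis
  have "tame w (\<lambda>i. \<Sum>bs\<in>{bs. set bs \<subseteq> Basis \<and> length bs \<le> N}. C bs * bk (w i) ^ M bs)"
    by (intro tame_sum fin tame_cmult tame_power) (auto simp: bk_nonneg C)
  then show ?thesis
  proof (rule tame_mono)
    fix i
    show "schwartz_norm N (F i) \<le> (\<Sum>bs\<in>{bs. set bs \<subseteq> Basis \<and> length bs \<le> N}. C bs * bk (w i) ^ M bs)"
      unfolding schwartz_norm_def
    proof (rule cSUP_least)
      fix p assume "p \<in> {bs::'b list. set bs \<subseteq> Basis \<and> length bs \<le> N} \<times> (UNIV :: 'b set)"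
      then obtain bs x where p: "p = (bs, x)" "set bs \<subseteq> Basis" "length bs \<le> N" by auto
      have "bk x ^ N * norm (iter_deriv bs (F i) x) \<le> C bs * bk (w i) ^ M bs"
        using C p by blast
      also have "\<dots> \<le> (\<Sum>bs\<in>{bs. set bs \<subseteq> Basis \<and> length bs \<le> N}. C bs * bk (w i) ^ M bs)"
        using p C(1) by (intro member_le_sum fin) (auto simp: bk_nonneg)
      finally show "(case p of (bs, x) \<Rightarrow> (1 + norm x) ^ N * norm (iter_deriv bs (F i) x)) \<le>
          (\<Sum>bs\<in>{bs. set bs \<subseteq> Basis \<and> length bs \<le> N}. C bs * bk (w i) ^ M bs)"
        by (simp add: p(1) bk_def)
    qed (auto intro!: exI[of _ "[]"])
  qed
qed

lemma tempered_antilinear: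
  "tempered u \<Longrightarrow> schwartz \<phi> \<Longrightarrow> schwartz \<psi> \<Longrightarrow> u (\<lambda>x. c * \<phi> x + \<psi> x) = cnj c * u \<phi> + u \<psi>"
  unfolding tempered_def by blast

lemma tempered_not_schwartz: "tempered u \<Longrightarrow> \<not> schwartz \<phi> \<Longrightarrow> u \<phi> = 0"
  unfolding tempered_def by blast

text \<open>Continuity of u involves one seminorm, and each seminorm of a family is polynomially
  bounded in the weight. The continuity of distributions enters all later arguments in this
  form.\<close>

lemma tempered_tame:
  assumes "tempered u" "schwartz_family w F"
  shows "tame w (\<lambda>i. norm (u (F i)))"
proof -
  obtain N C where C: "\<And>\<phi>. schwartz \<phi> \<Longrightarrow> norm (u \<phi>) \<le> C * schwartz_norm N \<phi>"
    using assms(1) unfolding tempered_def by blast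
  have "tame w (\<lambda>i. max C 0 * schwartz_norm N (F i))"
    by (intro tame_cmult tame_schwartz_norm assms) auto
  then show ?thesis
  proof (rule tame_mono)
    fix i
    have s: "schwartz (F i)" using schwartz_family_imp_schwartz[OF assms(2)] .
    show "norm (u (F i)) \<le> max C 0 * schwartz_norm N (F i)"
      by (rule order_trans[OF C[OF s]]) (auto intro!: mult_right_mono schwartz_norm_nonneg s)
  qed
qed

lemma iter_deriv_cmult:
  assumes "schwartz f" "set bs \<subseteq> Basis"
  shows "iter_deriv bs (\<lambda>x. c * f x) = (\<lambda>x. c * iter_deriv bs f x)"
  using assms(2)
proof (induction bs)
  case (Cons b bs)
  have "iter_deriv bs f differentiable (at x)" for x
    using assms(1) Cons.prems unfolding schwartz_def by simp
  then have D: "((\<lambda>x. c * iter_deriv bs f x) has_derivative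
      (\<lambda>h. c * frechet_derivative (iter_deriv bs f) (at x) h)) (at x)" for x
    by (intro has_derivative_mult_right) (simp add: frechet_derivative_works[symmetric])
  show ?case
    using Cons frechet_derivative_at[OF D, symmetric] by simp
qed simp

text \<open>Boundedness on bounded sequences suffices since the Schwartz space is metrizable.\<close>

lemma temperedI:
  assumes lin: "\<And>\<phi> \<psi> c. schwartz \<phi> \<Longrightarrow> schwartz \<psi> \<Longrightarrow> u (\<lambda>x. c * \<phi> x + \<psi> x) = cnj c * u \<phi> + u \<psi>"
    and zero: "\<And>\<phi>. \<not> schwartz \<phi> \<Longrightarrow> u \<phi> = 0"
    and bounded: "\<And>\<phi> :: nat \<Rightarrow> 'a::euclidean_space \<Rightarrow> complex.
       schwartz_family (\<lambda>_. 0) \<phi> \<Longrightarrow> \<exists>C. \<forall>n. norm (u (\<phi> n)) \<le> C"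
  shows "tempered u"
proof -
  have "\<exists>N C. \<forall>\<phi>. schwartz \<phi> \<longrightarrow> norm (u \<phi>) \<le> C * schwartz_norm N \<phi>"
  proof (rule ccontr)
    assume neg: "\<nexists>N C. \<forall>\<phi>. schwartz \<phi> \<longrightarrow> norm (u \<phi>) \<le> C * schwartz_norm N \<phi>"
    have "\<forall>n::nat. \<exists>\<phi>. schwartz \<phi> \<and> norm (u \<phi>) > real n * schwartz_norm n \<phi>"
    proof
      fix n :: nat
      show "\<exists>\<phi>. schwartz \<phi> \<and> norm (u \<phi>) > real n * schwartz_norm n \<phi>"
      proof (rule ccontr)
        assume "\<nexists>\<phi>. schwartz \<phi> \<and> norm (u \<phi>) > real n * schwartz_norm n \<phi>"
        then have "\<forall>\<phi>. schwartz \<phi> \<longrightarrow> norm (u \<phi>) \<le> real n * schwartz_norm n \<phi>"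
          by (meson not_le)
        with neg show False by blast
      qed
    qed
    then obtain \<phi> where \<phi>: "\<And>n::nat. schwartz (\<phi> n)" "\<And>n. norm (u (\<phi> n)) > real n * schwartz_norm n (\<phi> n)"
      by metis
    have pos: "norm (u (\<phi> n)) > 0" for n
      using \<phi>(2)[of n] schwartz_norm_nonneg[OF \<phi>(1), of n n]
      by (meson le_less_trans mult_nonneg_nonneg of_nat_0_le_iff)
    \<comment> \<open>Scaled so that u takes a value of modulus n at \<open>\<psi> n\<close>,
      although the n-th seminorm of \<open>\<psi> n\<close> is at most 1.\<close>
    define c where "c n = real n / norm (u (\<phi> n))" for n
    define \<psi> where "\<psi> n = (\<lambda>x. complex_of_real (c n) * \<phi> n x)" for n
    have c0: "c n \<ge> 0" for n unfolding c_def by simp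
    have sc: "c n * schwartz_norm n (\<phi> n) \<le> 1" for n
      using \<phi>(2)[of n] pos[of n] by (simp add: c_def field_simps)
    have it: "iter_deriv bs (\<psi> n) = (\<lambda>x. c n * iter_deriv bs (\<phi> n) x)" if "set bs \<subseteq> Basis" for bs n
      unfolding \<psi>_def by (rule iter_deriv_cmult[OF \<phi>(1) that])
    have "schwartz_family (\<lambda>_. 0) \<psi>"
      unfolding schwartz_family_iff_iter_deriv
    proof (intro allI impI conjI)
      fix bs :: "'a list" and n x assume bs: "set bs \<subseteq> Basis"
      show "iter_deriv bs (\<psi> n) differentiable at x"
        unfolding it[OF bs] using \<phi>(1)[of n] bs unfolding schwartz_def
        by (intro differentiable_mult) auto
      show "rapid (\<lambda>_. 0) (\<lambda>n. iter_deriv bs (\<psi> n))"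
      proof (rule rapidI)
        fix N
        \<comment> \<open>From n = K on, the n-th seminorm controls the derivative \<open>bs\<close>
          with weight N; the finitely many earlier terms are simply added up.\<close>
        define K where "K = max N (length bs)"
        have b: "c n * (bk x ^ N * norm (iter_deriv bs (\<phi> n) x)) \<le> c n * schwartz_norm (max K n) (\<phi> n)" for n x
        proof (rule mult_left_mono[OF _ c0])
          have "bk x ^ N * norm (iter_deriv bs (\<phi> n) x) \<le> bk x ^ (max K n) * norm (iter_deriv bs (\<phi> n) x)"
            by (intro mult_right_mono bk_power_mono) (auto simp: K_def)
          also have "\<dots> \<le> schwartz_norm (max K n) (\<phi> n)"
            by (rule schwartz_norm_ge[OF \<phi>(1) bs]) (auto simp: K_def)
          finally show "bk x ^ N * norm (iter_deriv bs (\<phi> n) x) \<le> schwartz_norm (max K n) (\<phi> n)" .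
        qed
        have "bk x ^ N * norm (iter_deriv bs (\<psi> n) x) \<le> 1 + (\<Sum>n<K. c n * schwartz_norm K (\<phi> n))" for n x
        proof -
          have "bk x ^ N * norm (iter_deriv bs (\<psi> n) x) = c n * (bk x ^ N * norm (iter_deriv bs (\<phi> n) x))"
            using c0[of n] by (simp add: it[OF bs] norm_mult)
          also have "\<dots> \<le> c n * schwartz_norm (max K n) (\<phi> n)" by (rule b)
          also have "\<dots> \<le> 1 + (\<Sum>n<K. c n * schwartz_norm K (\<phi> n))"
          proof (cases "n < K")
            case True
            then have "c n * schwartz_norm K (\<phi> n) \<le> (\<Sum>n<K. c n * schwartz_norm K (\<phi> n))"
              by (intro member_le_sum) (auto intro!: mult_nonneg_nonneg c0 schwartz_norm_nonneg \<phi>)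
            with True show ?thesis by (simp add: max_def)
          next
            case False
            have "0 \<le> (\<Sum>n<K. c n * schwartz_norm K (\<phi> n))"
              by (intro sum_nonneg) (auto intro!: mult_nonneg_nonneg c0 schwartz_norm_nonneg \<phi>)
            moreover have "max K n = n" using False by simp
            ultimately show ?thesis using sc[of n] by simp
          qed
          finally show ?thesis .
        qed
        then show "\<exists>C M. \<forall>n x. bk x ^ N * norm (iter_deriv bs (\<psi> n) x) \<le> C * bk (0::real) ^ M" by auto
      qed
    qed
    from bounded[OF this] obtain C where C: "\<And>n. norm (u (\<psi> n)) \<le> C" by blast
    have "norm (u (\<psi> n)) = real n" for n
    proof -
      have "u (\<lambda>x. 0 * \<phi> n x + \<phi> n x) = cnj 0 * u (\<phi> n) + u (\<phi> n)" by (rule lin[OF \<phi>(1) \<phi>(1)])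
      have z: "schwartz (\<lambda>x::'a. 0)"
        using schwartz_family_zero schwartz_iff_family by blast
      have "u (\<lambda>x. 1 * 0 + 0) = cnj 1 * u (\<lambda>x. 0) + u (\<lambda>x. 0)" by (rule lin[OF z z])
      then have "u (\<lambda>x. 0) = 0" by simp
      then have "u (\<psi> n) = of_real (c n) * u (\<phi> n)"
        using lin[OF \<phi>(1)[of n] z, of "of_real (c n)"] by (simp add: \<psi>_def)
      then show ?thesis using pos[of n] c0[of n] by (simp add: norm_mult norm_divide c_def)
    qed
    with C have "real n \<le> C" for n by metis
    then show False using reals_Archimedean2[of C] by (meson not_le)
  qed
  with lin zero show ?thesis unfolding tempered_def by blast
qed

lemma bk_nonzero [simp]: "bk x \<noteq> 0"
  using bk_pos[of x] by simp

section \<open>Lebesgue measure on Euclidean spaces\<close>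

lemma integral_lborel_translate:
  fixes f :: "'a::euclidean_space \<Rightarrow> 'b::{banach, second_countable_topology}"
  assumes [measurable]: "f \<in> borel_measurable borel"
  shows "(LINT x|lborel. f (c + x)) = (LINT x|lborel. f x)"
  by (subst (2) lborel_distr_plus[of c, symmetric]) (simp add: integral_distr)

lemma nn_integral_lborel_translate:
  fixes f :: "'a::euclidean_space \<Rightarrow> ennreal"
  assumes [measurable]: "f \<in> borel_measurable borel"
  shows "(\<integral>\<^sup>+ x. f (c + x) \<partial>lborel) = (\<integral>\<^sup>+ x. f x \<partial>lborel)"
  by (subst (2) lborel_distr_plus[of c, symmetric]) (simp add: nn_integral_distr)

lemma integrable_lborel_translate:
  fixes f :: "'a::euclidean_space \<Rightarrow> 'b::{banach, second_countable_topology}"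
  assumes "integrable lborel f"
  shows "integrable lborel (\<lambda>x. f (c + x))"
proof -
  have "integrable (distr lborel borel ((+) c)) f" by (simp add: lborel_distr_plus assms)
  then show ?thesis by (subst (asm) integrable_distr_eq) (use assms in auto)
qed

lemma integral_lborel_scale:
  fixes f :: "'a::euclidean_space \<Rightarrow> 'b::{banach, second_countable_topology}"
  assumes [measurable]: "f \<in> borel_measurable borel" and c: "c \<noteq> 0"
  shows "(LINT x|lborel. f x) = \<bar>c\<bar> ^ DIM('a) *\<^sub>R (LINT x|lborel. f (c *\<^sub>R x))"
  by (subst lborel_affine[OF c, of 0])
     (simp add: integral_density integral_distr)

lemma nn_integral_lborel_scale:
  fixes f :: "'a::euclidean_space \<Rightarrow> ennreal"
  assumes [measurable]: "f \<in> borel_measurable borel" and c: "c \<noteq> 0"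
  shows "(\<integral>\<^sup>+ x. f x \<partial>lborel) = ennreal (\<bar>c\<bar> ^ DIM('a)) * (\<integral>\<^sup>+ x. f (c *\<^sub>R x) \<partial>lborel)"
  by (subst lborel_affine[OF c, of 0])
     (simp add: nn_integral_density nn_integral_distr nn_integral_cmult)

lemma nn_integral_lborel_reflect:
  fixes f :: "'a::euclidean_space \<Rightarrow> ennreal"
  assumes [measurable]: "f \<in> borel_measurable borel"
  shows "(\<integral>\<^sup>+ x. f (c - x) \<partial>lborel) = (\<integral>\<^sup>+ x. f x \<partial>lborel)"
  using nn_integral_lborel_scale[of "\<lambda>x. f (c + x)" "-1"] nn_integral_lborel_translate[of f c] by simp

lemma integral_lborel_reflect:
  fixes f :: "'a::euclidean_space \<Rightarrow> 'b::{banach, second_countable_topology}"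
  assumes [measurable]: "f \<in> borel_measurable borel"
  shows "(LINT x|lborel. f (c - x)) = (LINT x|lborel. f x)"
  using integral_lborel_scale[of "\<lambda>x. f (c + x)" "-1"] integral_lborel_translate[of f c] by simp

lemma fubini_lborel:
  fixes f :: "'a::euclidean_space \<Rightarrow> 'b::euclidean_space \<Rightarrow> 'c::{banach, second_countable_topology}"
  assumes "integrable lborel (\<lambda>(x, y). f x y)"
  shows "(LINT x|lborel. LINT y|lborel. f x y) = (LINT p|lborel. f (fst p) (snd p))"
    "(LINT y|lborel. LINT x|lborel. f x y) = (LINT p|lborel. f (fst p) (snd p))"
    "integrable lborel (\<lambda>x. LINT y|lborel. f x y)"
    "integrable lborel (\<lambda>y. LINT x|lborel. f x y)"
    "AE x in lborel. integrable lborel (f x)"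
  using lborel_pair.integral_fst'[of "\<lambda>(x, y). f x y"] lborel_pair.integral_snd[of f]
    lborel_pair.integrable_fst'[of "\<lambda>(x, y). f x y"] lborel_pair.integrable_snd[of f]
    lborel_pair.AE_integrable_fst'[of "\<lambda>(x, y). f x y"] assms
  by (simp_all add: lborel_prod split_def)

lemma fubini_lborel_swap:
  fixes f :: "'a::euclidean_space \<Rightarrow> 'b::euclidean_space \<Rightarrow> 'c::{banach, second_countable_topology}"
  assumes "integrable lborel (\<lambda>(x, y). f x y)"
  shows "(LINT x|lborel. LINT y|lborel. f x y) = (LINT y|lborel. LINT x|lborel. f x y)"
  using fubini_lborel(1,2)[OF assms] by simp

lemma nn_integral_lborel_pair:
  fixes f :: "'a::euclidean_space \<times> 'b::euclidean_space \<Rightarrow> ennreal"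
  assumes [measurable]: "f \<in> borel_measurable borel"
  shows "(\<integral>\<^sup>+ p. f p \<partial>lborel) = (\<integral>\<^sup>+ x. \<integral>\<^sup>+ y. f (x, y) \<partial>lborel \<partial>lborel)"
    "(\<integral>\<^sup>+ p. f p \<partial>lborel) = (\<integral>\<^sup>+ y. \<integral>\<^sup>+ x. f (x, y) \<partial>lborel \<partial>lborel)"
proof -
  have [measurable]: "f \<in> borel_measurable (lborel \<Otimes>\<^sub>M lborel)"
    using assms by (simp add: borel_prod[symmetric] cong: measurable_cong_sets)
  show "(\<integral>\<^sup>+ p. f p \<partial>lborel) = (\<integral>\<^sup>+ x. \<integral>\<^sup>+ y. f (x, y) \<partial>lborel \<partial>lborel)"
    by (subst lborel_prod[symmetric]) (simp add: lborel.nn_integral_fst)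
  show "(\<integral>\<^sup>+ p. f p \<partial>lborel) = (\<integral>\<^sup>+ y. \<integral>\<^sup>+ x. f (x, y) \<partial>lborel \<partial>lborel)"
    by (subst lborel_prod[symmetric]) (simp add: lborel_pair.nn_integral_snd[symmetric])
qed

lemma nn_integral_lborel_swap:
  fixes f :: "'a::euclidean_space \<Rightarrow> 'b::euclidean_space \<Rightarrow> ennreal"
  assumes "(\<lambda>(x, y). f x y) \<in> borel_measurable borel"
  shows "(\<integral>\<^sup>+ x. \<integral>\<^sup>+ y. f x y \<partial>lborel \<partial>lborel) = (\<integral>\<^sup>+ y. \<integral>\<^sup>+ x. f x y \<partial>lborel \<partial>lborel)"
  using nn_integral_lborel_pair[OF assms] by simp

lemma borel_measurable_bk [measurable]: "bk \<in> borel_measurable borel"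
  unfolding bk_def[abs_def] by measurable

lemma integrable_inverse_one_plus_square: "integrable lborel (\<lambda>x::real. inverse (1 + x\<^sup>2))"
proof -
  have "einterval (-\<infinity>) \<infinity> = (UNIV::real set)" by (auto simp: einterval_def)
  then show ?thesis
    using integrable_inverse_1_plus_square by (simp add: set_integrable_def)
qed

text \<open>In each coordinate the square of \<open>bk x\<close> dominates 1 plus the squared
  coordinate. So \<open>bk x ^ (2 * DIM('a))\<close> dominates a product whose reciprocal has a
  factorising integral; this is the origin of the exponent \<open>2 * DIM('a)\<close> in the later
  estimates.\<close>

lemma integrable_inverse_bk:
  assumes "2 * DIM('a) \<le> N"
  shows "integrable lborel (\<lambda>x::'a::euclidean_space. inverse (bk x ^ N))"
proof (rule integrableI_bounded)
  have "ennreal (norm (inverse (bk x ^ N))) \<le> (\<Prod>b\<in>Basis. ennreal (inverse (1 + (x \<bullet> b)\<^sup>2)))" for x :: 'a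
  proof -
    have "(\<Prod>b\<in>Basis. 1 + (x \<bullet> b)\<^sup>2) \<le> (\<Prod>b\<in>(Basis::'a set). (bk x)\<^sup>2)"
    proof (rule prod_mono, safe)
      fix b :: 'a assume b: "b \<in> Basis"
      have "(x \<bullet> b)\<^sup>2 \<le> (norm x)\<^sup>2"
        using power_mono[OF Basis_le_norm[OF b, of x], of 2] by simp
      then show "1 + (x \<bullet> b)\<^sup>2 \<le> (bk x)\<^sup>2" by (simp add: bk_def power2_eq_square algebra_simps)
          (smt (verit) mult_nonneg_nonneg norm_ge_zero)
    qed auto
    also have "\<dots> = bk x ^ (2 * DIM('a))" by (simp add: power_mult)
    also have "\<dots> \<le> bk x ^ N" by (rule bk_power_mono[OF assms])
    finally have "(\<Prod>b\<in>Basis. 1 + (x \<bullet> b)\<^sup>2) \<le> bk x ^ N" .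
    moreover have "0 < (\<Prod>b\<in>Basis. 1 + (x \<bullet> b)\<^sup>2)"
      by (intro prod_pos) (auto intro: add_pos_nonneg)
    ultimately have "inverse (bk x ^ N) \<le> inverse (\<Prod>b\<in>Basis. 1 + (x \<bullet> b)\<^sup>2)"
      by (intro le_imp_inverse_le)
    also have "\<dots> = (\<Prod>b\<in>Basis. inverse (1 + (x \<bullet> b)\<^sup>2))" by (simp add: prod_inversef[symmetric] comp_def)
    finally show ?thesis
      by (subst prod_ennreal) (auto intro!: ennreal_leI simp: bk_nonneg)
  qed
  then have "(\<integral>\<^sup>+ x. ennreal (norm (inverse (bk (x::'a) ^ N))) \<partial>lborel)
    \<le> (\<integral>\<^sup>+ x. (\<Prod>b\<in>Basis. ennreal (inverse (1 + ((x::'a) \<bullet> b)\<^sup>2))) \<partial>lborel)"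
    by (intro nn_integral_mono) auto
  also have "\<dots> = (\<Prod>b\<in>(Basis::'a set). \<integral>\<^sup>+ y. ennreal (inverse (1 + y\<^sup>2)) \<partial>lborel)"
    by (rule nn_integral_lborel_prod[where f="\<lambda>b y. ennreal (inverse (1 + y\<^sup>2))"]) auto
  also have "\<dots> < \<infinity>"
  proof -
    have "(\<integral>\<^sup>+ y. ennreal (inverse (1 + y\<^sup>2)) \<partial>lborel) < \<infinity>"
      using integrable_inverse_one_plus_square by (simp add: integrable_iff_bounded)
    then show ?thesis by (simp add: power_less_top_ennreal)
  qed
  finally show "(\<integral>\<^sup>+ x. ennreal (norm (inverse (bk (x::'a) ^ N))) \<partial>lborel) < \<infinity>" .
qed measurable

section \<open>Parameter integrals and differentiation under the integral sign\<close>

text \<open>The remainder divided by \<open>norm h\<close> is at most 2 g: once g by the mean value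
  inequality on the ball, once g for the linear term. Dominated convergence concerns sequences, so
  the limit is tested along sequences tending to 0.\<close>

lemma has_derivative_integral_dominated:
  fixes f :: "'z \<Rightarrow> 'a::euclidean_space \<Rightarrow> complex"
  assumes r: "0 < r"
    and der: "\<And>z x. x \<in> ball x0 r \<Longrightarrow> (f z has_derivative f' z x) (at x)"
    and bound: "\<And>z x b. x \<in> ball x0 r \<Longrightarrow> norm (f' z x b) \<le> g z * norm b"
    and g: "integrable M g"
    and f: "\<And>x. x \<in> ball x0 r \<Longrightarrow> integrable M (\<lambda>z. f z x)"
    and meas: "\<And>b. (\<lambda>z. f' z x0 b) \<in> borel_measurable M"
  shows "((\<lambda>x. LINT z|M. f z x) has_derivative (\<lambda>b. LINT z|M. f' z x0 b)) (at x0)"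
proof -
  have x0: "x0 \<in> ball x0 r" using r by simp
  have int': "integrable M (\<lambda>z. f' z x0 b)" for b
    by (rule Bochner_Integration.integrable_bound[OF integrable_mult_left[OF g, of "norm b"] meas])
       (auto intro!: AE_I2 order_trans[OF bound[OF x0]])
  have lin: "bounded_linear (f' z x0)" for z
    using der[OF x0] by (rule has_derivative_bounded_linear)
  have bl: "bounded_linear (\<lambda>b. LINT z|M. f' z x0 b)"
  proof (rule bounded_linear_intro[where K="LINT z|M. g z"])
    show "(LINT z|M. f' z x0 (b + c)) = (LINT z|M. f' z x0 b) + (LINT z|M. f' z x0 c)" for b c
      using int' by (simp add: bounded_linear.linear[OF lin, THEN linear_add])
    show "(LINT z|M. f' z x0 (s *\<^sub>R b)) = s *\<^sub>R (LINT z|M. f' z x0 b)" for s b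
      using int' by (simp add: bounded_linear.linear[OF lin, THEN linear_scale])
    show "norm (LINT z|M. f' z x0 b) \<le> norm b * (LINT z|M. g z)" for b
    proof -
      have "norm (LINT z|M. f' z x0 b) \<le> (LINT z|M. norm (f' z x0 b))" by (rule integral_norm_bound)
      also have "\<dots> \<le> (LINT z|M. g z * norm b)"
        using int' g bound[OF x0] by (intro integral_mono) auto
      finally show ?thesis by (simp add: mult.commute)
    qed
  qed
  have "(\<lambda>h. norm ((LINT z|M. f z (x0 + h)) - (LINT z|M. f z x0) - (LINT z|M. f' z x0 h)) / norm h) \<midarrow>0\<rightarrow> 0"
  proof (subst tendsto_at_iff_sequentially, intro allI impI)
    fix S :: "nat \<Rightarrow> 'a"
    assume S: "\<forall>i. S i \<in> UNIV - {0}" "S \<longlonglongrightarrow> 0"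
    have "\<forall>\<^sub>F n in sequentially. dist (S n) 0 < r" using tendstoD[OF S(2) r] .
    then obtain n0 where n0: "\<And>n. n \<ge> n0 \<Longrightarrow> norm (S n) < r"
      unfolding eventually_sequentially by (auto simp: dist_norm)
    define T where "T n = S (n + n0)" for n
    have T: "T n \<noteq> 0" "x0 + T n \<in> ball x0 r" for n
      using S(1) n0 by (auto simp: T_def dist_norm)
    have Tlim: "T \<longlonglongrightarrow> 0" unfolding T_def using S(2) by (rule LIMSEQ_ignore_initial_segment)
    define R where "R n z = (f z (x0 + T n) - f z x0 - f' z x0 (T n)) /\<^sub>R norm (T n)" for n z
    have intR: "integrable M (R n)" for n
      unfolding R_def using f[OF T(2)] f[OF x0] int' by (intro integrable_scaleR_right integrable_diff) auto
    have "(\<lambda>n. LINT z|M. R n z) \<longlonglongrightarrow> (LINT z|M. 0)"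
    proof (rule integral_dominated_convergence[where w="\<lambda>z. 2 * g z"])
      show "integrable M (\<lambda>z. 2 * g z)" using g by simp
      show "AE z in M. (\<lambda>n. R n z) \<longlonglongrightarrow> 0"
      proof (intro AE_I2)
        fix z
        have "(\<lambda>h. norm (f z (x0 + h) - f z x0 - f' z x0 h) / norm h) \<midarrow>0\<rightarrow> 0"
          using der[OF x0, of z] by (simp add: has_derivative_at)
        then have "(\<lambda>n. norm (f z (x0 + T n) - f z x0 - f' z x0 (T n)) / norm (T n)) \<longlonglongrightarrow> 0"
          using T Tlim by (subst (asm) tendsto_at_iff_sequentially) (auto simp: comp_def)
        then have "(\<lambda>n. norm (R n z)) \<longlonglongrightarrow> 0"
          by (simp add: R_def divide_inverse mult.commute)
        then show "(\<lambda>n. R n z) \<longlonglongrightarrow> 0" by (rule tendsto_norm_zero_cancel)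
      qed
      show "AE z in M. norm (R n z) \<le> 2 * g z" for n
      proof (intro AE_I2)
        fix z
        have "norm (f z (x0 + T n) - f z x0) \<le> g z * norm (x0 + T n - x0)"
        proof (rule differentiable_bound[where S="ball x0 r" and f'="f' z"])
          show "\<And>x. x \<in> ball x0 r \<Longrightarrow> (f z has_derivative f' z x) (at x within ball x0 r)"
            using der by (blast intro: has_derivative_at_withinI)
          show "onorm (f' z x) \<le> g z" if "x \<in> ball x0 r" for x
          proof (rule onorm_bound)
            obtain b :: 'a where b: "b \<in> Basis" using nonempty_Basis by blast
            show "0 \<le> g z" using bound[OF x0, of z b] b by (auto intro: order_trans[OF norm_ge_zero])
          qed (use bound[OF that] in auto)
        qed (use x0 T(2) in auto)
        moreover have "norm (f' z x0 (T n)) \<le> g z * norm (T n)" by (rule bound[OF x0])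
        ultimately have "norm (f z (x0 + T n) - f z x0 - f' z x0 (T n)) \<le> 2 * g z * norm (T n)"
          using norm_triangle_ineq4[of "f z (x0 + T n) - f z x0" "f' z x0 (T n)"] by simp
        note * = this
        have "norm (R n z) = norm (f z (x0 + T n) - f z x0 - f' z x0 (T n)) / norm (T n)"
          by (simp add: R_def divide_inverse mult.commute)
        also have "\<dots> \<le> 2 * g z"
          using * T(1)[of n] by (subst pos_divide_le_eq) auto
        finally show "norm (R n z) \<le> 2 * g z" .
      qed
    qed (use intR in auto)
    then have "(\<lambda>n. norm (LINT z|M. R n z)) \<longlonglongrightarrow> 0" by (simp add: tendsto_norm_zero)
    moreover have "(LINT z|M. R n z) = ((LINT z|M. f z (x0 + T n)) - (LINT z|M. f z x0) - (LINT z|M. f' z x0 (T n))) /\<^sub>R norm (T n)" for n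
      unfolding R_def using f[OF T(2)] f[OF x0] int' by simp
    ultimately have "(\<lambda>n. norm ((LINT z|M. f z (x0 + T n)) - (LINT z|M. f z x0) - (LINT z|M. f' z x0 (T n))) / norm (T n)) \<longlonglongrightarrow> 0"
      by (simp add: divide_inverse mult.commute)
    then show "((\<lambda>h. norm ((LINT z|M. f z (x0 + h)) - (LINT z|M. f z x0) - (LINT z|M. f' z x0 h)) / norm h) \<circ> S) \<longlonglongrightarrow> 0"
      unfolding T_def comp_def by (rule LIMSEQ_offset)
  qed
  with bl show ?thesis by (simp add: has_derivative_at)
qed

lemma schwartz_family_continuous:
  assumes "schwartz_family w F" shows "continuous_on UNIV (F i)"
proof -
  obtain D where "\<And>i x. (F i has_derivative D i x) (at x)"
    by (rule schwartz_family_deriv[OF assms]) (rule that)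
  then show ?thesis by (meson continuous_at_imp_continuous_on has_derivative_continuous)
qed

lemma schwartz_family_measurable:
  assumes "schwartz_family w F" shows "F i \<in> borel_measurable borel"
  using schwartz_family_continuous[OF assms] by (rule borel_measurable_continuous_onI)

lemma schwartz_continuous: "schwartz f \<Longrightarrow> continuous_on UNIV f"
  unfolding schwartz_iff_family by (rule schwartz_family_continuous)

lemma schwartz_measurable: "schwartz f \<Longrightarrow> f \<in> borel_measurable borel"
  unfolding schwartz_iff_family by (rule schwartz_family_measurable)

lemma bk_prod_bound:
  assumes "bk (z, x) ^ (A + B) * t \<le> (C::real)" "0 \<le> t"
  shows "t \<le> C * inverse (bk z ^ A) * inverse (bk x ^ B)"
proof -
  have "bk z ^ A * bk x ^ B * t \<le> bk (z, x) ^ A * bk (z, x) ^ B * t"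
    using assms(2) by (intro mult_right_mono mult_mono power_mono bk_fst_le bk_snd_le) (auto simp: bk_nonneg)
  also have "\<dots> \<le> C" using assms(1) by (simp add: power_add)
  finally show ?thesis using bk_power_pos[of z A] bk_power_pos[of x B] by (simp add: field_simps)
qed

lemma schwartz_family_prod_bound:
  assumes "schwartz_family w F"
  obtains C M where "C \<ge> 0"
    "\<And>i z x. norm (F i (z, x)) \<le> C * bk (w i) ^ M * inverse (bk z ^ A) * inverse (bk x ^ B)"
proof -
  obtain C M where C: "C \<ge> 0" "\<And>i p. bk p ^ (A + B) * norm (F i p) \<le> C * bk (w i) ^ M"
    by (rule rapidD[OF schwartz_family_rapid[OF assms]]) (rule that)
  show ?thesis by (rule that[OF C(1), of M]) (rule bk_prod_bound[OF C(2)], simp)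
qed

lemma schwartz_family_decay:
  assumes "schwartz_family w F"
  obtains C M where "C \<ge> 0" "\<And>i x. norm (F i x) \<le> C * bk (w i) ^ M * inverse (bk x ^ A)"
proof -
  obtain C M where C: "C \<ge> 0" "\<And>i x. bk x ^ A * norm (F i x) \<le> C * bk (w i) ^ M"
    by (rule rapidD[OF schwartz_family_rapid[OF assms]]) (rule that)
  have "norm (F i x) \<le> C * bk (w i) ^ M * inverse (bk x ^ A)" for i x
    using C(2)[of x i] bk_power_pos[of x A] by (simp add: field_simps)
  with C(1) show ?thesis by (rule that)
qed

lemma schwartz_decay:
  assumes "schwartz f"
  obtains C where "C \<ge> 0" "\<And>x. norm (f x) \<le> C * inverse (bk x ^ A)"
proof -
  obtain C M where "C \<ge> 0" "\<And>(i::unit) x. norm (f x) \<le> C * bk (0::real) ^ M * inverse (bk x ^ A)"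
    by (rule schwartz_family_decay[OF assms[unfolded schwartz_iff_family]]) (rule that)
  then show ?thesis by (intro that[of C]) auto
qed

lemma integrable_bound_bk:
  fixes f :: "'a::euclidean_space \<Rightarrow> 'b::{banach, second_countable_topology}"
  assumes "f \<in> borel_measurable borel" "\<And>x. norm (f x) \<le> C * inverse (bk x ^ N)" "2 * DIM('a) \<le> N"
  shows "integrable lborel f"
  by (rule Bochner_Integration.integrable_bound[OF integrable_mult_right[OF integrable_inverse_bk[OF assms(3)], of C]])
     (use assms in \<open>auto intro!: AE_I2 order_trans[OF assms(2)]\<close>)

lemma schwartz_integrable:
  assumes "schwartz (f :: 'a::euclidean_space \<Rightarrow> complex)" shows "integrable lborel f"
proof -
  obtain C where "\<And>x. norm (f x) \<le> C * inverse (bk x ^ (2 * DIM('a)))"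
    by (rule schwartz_decay[OF assms]) (rule that)
  then show ?thesis by (rule integrable_bound_bk[OF schwartz_measurable[OF assms]]) simp
qed

lemma slow_function_bound:
  assumes F: "\<And>z. norm (F z) \<le> C1 * bk z ^ K" "C1 \<ge> 0"
    and t: "norm t \<le> C * inverse (bk z ^ (K + N))"
  shows "norm (F z * t :: complex) \<le> C1 * C * inverse (bk z ^ N)"
proof -
  have "norm (F z * t) \<le> (C1 * bk z ^ K) * (C * inverse (bk z ^ (K + N)))"
    unfolding norm_mult using F t by (intro mult_mono) (auto simp: bk_nonneg)
  also have "\<dots> = C1 * C * inverse (bk z ^ N)"
    using bk_power_pos[of z K] by (simp add: power_add)
  finally show ?thesis .
qed

lemma schwartz_family_integral_aux:
  fixes G :: "'i \<Rightarrow> 'z::euclidean_space \<times> 'a::euclidean_space \<Rightarrow> complex"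
  assumes G: "schwartz_family w G" and Fm: "F \<in> borel_measurable borel"
    and Fb: "\<And>z. norm (F z) \<le> C1 * bk z ^ K" "C1 \<ge> 0"
  shows schwartz_family_integral_measurable: "(\<lambda>z. F z * G i (z, x)) \<in> borel_measurable borel"
    and schwartz_family_integrable: "integrable lborel (\<lambda>z. F z * G i (z, x))"
proof -
  let ?d = "2 * DIM('z)"
  show meas: "(\<lambda>z. F z * G i (z, x)) \<in> borel_measurable borel"
    using schwartz_family_measurable[OF G, of i] Fm by measurable
  obtain C M where C: "C \<ge> 0" "\<And>i z x. norm (G i (z, x)) \<le> C * bk (w i) ^ M * inverse (bk z ^ (K + ?d)) * inverse (bk x ^ 0)"
    by (rule schwartz_family_prod_bound[OF G]) (rule that)
  show "integrable lborel (\<lambda>z. F z * G i (z, x))"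
    using slow_function_bound[OF Fb, of "G i (z, x)" "C * bk (w i) ^ M" z ?d for z] C
    by (intro integrable_bound_bk[OF meas]) auto
qed

lemma schwartz_family_integral_deriv:
  fixes G :: "'i \<Rightarrow> 'z::euclidean_space \<times> 'a::euclidean_space \<Rightarrow> complex"
  assumes G: "schwartz_family w G" and Fm: "F \<in> borel_measurable borel"
    and Fb: "\<And>z. norm (F z) \<le> C1 * bk z ^ K" "C1 \<ge> 0"
    and D: "\<And>i x. (G i has_derivative D i x) (at x)"
  shows "((\<lambda>x. LINT z|lborel. F z * G i (z, x)) has_derivative
           (\<lambda>b. LINT z|lborel. F z * D i (z, x) (0, b))) (at x)"
proof -
  let ?d = "2 * DIM('z)"
  have D': "schwartz_family w (\<lambda>i x. D i x b)" for b
  proof -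
    obtain E where E: "\<And>i x. (G i has_derivative E i x) (at x)" "\<And>b. schwartz_family w (\<lambda>i x. E i x b)"
      by (rule schwartz_family_deriv[OF G]) (rule that)
    have "E = D" by (intro ext) (rule fun_cong[OF has_derivative_unique[OF E(1) D]])
    with E(2) show ?thesis by simp
  qed
  obtain C' M' where C': "C' \<ge> 0" "\<And>i p b. bk p ^ (K + ?d) * norm (D i p b) \<le> C' * bk (w i) ^ M' * norm b"
    by (rule schwartz_family_deriv_bound[OF G D]) (rule that)
  show ?thesis
  proof (rule has_derivative_integral_dominated[where r=1 and g="\<lambda>z. C1 * (C' * bk (w i) ^ M') * inverse (bk z ^ ?d)"])
    fix z :: 'z and y b :: 'a
    show "((\<lambda>x. F z * G i (z, x)) has_derivative (\<lambda>b. F z * D i (z, y) (0, b))) (at y)"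
      by (intro has_derivative_mult_right has_derivative_compose[OF has_derivative_Pair_left D])
    have "norm (D i (z, y) (0, b)) \<le> C' * bk (w i) ^ M' * norm b * inverse (bk z ^ (K + ?d)) * inverse (bk y ^ 0)"
      using C'(2)[of "(z, y)" i "(0, b)"] by (intro bk_prod_bound) (auto simp: norm_Pair)
    then show "norm (F z * D i (z, y) (0, b)) \<le> C1 * (C' * bk (w i) ^ M') * inverse (bk z ^ ?d) * norm b"
      using slow_function_bound[OF Fb, of "D i (z, y) (0, b)" "C' * bk (w i) ^ M' * norm b" z ?d] by (simp add: mult_ac)
    show "(\<lambda>z. F z * D i (z, x) (0, b)) \<in> borel_measurable lborel"
      using schwartz_family_integral_measurable[OF D' Fm Fb] by simp
  qed (auto intro!: schwartz_family_integrable[OF G Fm Fb] integrable_mult_right integrable_inverse_bk)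
qed

text \<open>Integrals of this kind are closed under derivatives, since a derivative in x falls on
  \<open>G\<close> alone; the growth of \<open>F\<close> is paid by the decay of \<open>G\<close> in
  z.\<close>

lemma schwartz_family_integral:
  fixes G :: "'i \<Rightarrow> 'z::euclidean_space \<times> 'a::euclidean_space \<Rightarrow> complex"
  assumes G: "schwartz_family w G" and Fm: "F \<in> borel_measurable borel"
    and Fb: "\<And>z. norm (F z) \<le> C1 * bk z ^ K" "C1 \<ge> 0"
  shows "schwartz_family w (\<lambda>i x. LINT z|lborel. F z * G i (z, x))"
  unfolding schwartz_family_def
proof (intro allI Ck_coinduct[where P="\<lambda>H. \<exists>G. schwartz_family w G \<and> H = (\<lambda>i x. LINT z|lborel. F z * G i (z, x))"])
  let ?d = "2 * DIM('z)"
  fix H :: "'i \<Rightarrow> 'a \<Rightarrow> complex"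
  assume "\<exists>G. schwartz_family w G \<and> H = (\<lambda>i x. LINT z|lborel. F z * G i (z, x))"
  then obtain G where G: "schwartz_family w G" "H = (\<lambda>i x. LINT z|lborel. F z * G i (z, x))" by blast
  have int: "integrable lborel (\<lambda>z. F z * G i (z, x))" for i x
    by (rule schwartz_family_integrable[OF G(1) Fm Fb])
  show "rapid w H"
  proof (rule rapidI)
    fix N
    obtain C M where C: "C \<ge> 0" "\<And>i z x. norm (G i (z, x)) \<le> C * bk (w i) ^ M * inverse (bk z ^ (K + ?d)) * inverse (bk x ^ N)"
      by (rule schwartz_family_prod_bound[OF G(1)]) (rule that)
    have "bk x ^ N * norm (H i x) \<le> C1 * C * (LINT z|lborel. inverse (bk (z::'z) ^ ?d)) * bk (w i) ^ M" for i x
    proof -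
      have b: "norm (F z * G i (z, x)) \<le> C1 * (C * bk (w i) ^ M * inverse (bk x ^ N)) * inverse (bk z ^ ?d)" for z
        using slow_function_bound[OF Fb, of "G i (z, x)" "C * bk (w i) ^ M * inverse (bk x ^ N)" z ?d] C by (simp add: mult_ac)
      have "norm (H i x) \<le> (LINT z|lborel. norm (F z * G i (z, x)))"
        unfolding G(2) by (rule integral_norm_bound)
      also have "\<dots> \<le> (LINT z|lborel. C1 * (C * bk (w i) ^ M * inverse (bk x ^ N)) * inverse (bk (z::'z) ^ ?d))"
        by (intro integral_mono integrable_norm int integrable_mult_right integrable_inverse_bk b) auto
      also have "\<dots> = C1 * (C * bk (w i) ^ M * inverse (bk x ^ N)) * (LINT z|lborel. inverse (bk (z::'z) ^ ?d))" by simp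
      finally have "bk x ^ N * norm (H i x) \<le> bk x ^ N * \<dots>"
        by (intro mult_left_mono) (auto simp: bk_nonneg)
      also have "\<dots> = C1 * C * (LINT z|lborel. inverse (bk (z::'z) ^ ?d)) * bk (w i) ^ M"
        using bk_power_pos[of x N] by (simp add: mult_ac)
      finally show ?thesis .
    qed
    then show "\<exists>C M. \<forall>i x. bk x ^ N * norm (H i x) \<le> C * bk (w i) ^ M" by blast
  qed
  obtain D where D: "\<And>i x. (G i has_derivative D i x) (at x)" "\<And>b. schwartz_family w (\<lambda>i x. D i x b)"
    by (rule schwartz_family_deriv[OF G(1)]) (rule that)
  have "(H i has_derivative (\<lambda>b. LINT z|lborel. F z * D i (z, x) (0, b))) (at x)" for i x
    unfolding G(2) by (rule schwartz_family_integral_deriv[OF G(1) Fm Fb D(1)])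
  then show "\<exists>D. (\<forall>i x. (H i has_derivative D i x) (at x)) \<and>
         (\<forall>b. \<exists>G. schwartz_family w G \<and> (\<lambda>i x. D i x b) = (\<lambda>i x. LINT z|lborel. F z * G i (z, x)))"
    by (intro exI[of _ "\<lambda>i x b. LINT z|lborel. F z * D i (z, x) (0, b)"] conjI allI
        exI[of _ "\<lambda>i p. D i p (0, b)" for b]) (auto simp: D(2))
qed (use assms in blast)

subsection \<open>Fourier inversion\<close>

text \<open>By translation invariance the integral of f (z + y) over z is constant in y; it is
  differentiated under the integral sign at y = 0. This is the source of integration by
  parts.\<close>

lemma schwartz_integral_deriv_eq_0:
  fixes f :: "'a::euclidean_space \<Rightarrow> complex"
  assumes f: "schwartz f" and D: "\<And>x. (f has_derivative D x) (at x)"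
  shows "(LINT x|lborel. D x b) = 0"
proof -
  let ?d = "2 * DIM('a)"
  have fam: "schwartz_family (\<lambda>_::unit. 0) (\<lambda>_. f)" using f by (simp add: schwartz_iff_family)
  obtain C M where C: "C \<ge> 0" "\<And>(i::unit) x b. bk x ^ ?d * norm (D x b) \<le> C * bk (0::real) ^ M * norm b"
    by (rule schwartz_family_deriv_bound[OF fam D]) (rule that)
  obtain E where E: "\<And>(i::unit) x. (f has_derivative E i x) (at x)" "\<And>b. schwartz_family (\<lambda>_::unit. 0) (\<lambda>i x. E i x b)"
    by (rule schwartz_family_deriv[OF fam]) (rule that)
  have ED: "E () x = D x" for x by (rule has_derivative_unique[OF E(1) D])
  have Dm [measurable]: "(\<lambda>x. D x b) \<in> borel_measurable borel" for b
    using schwartz_family_measurable[OF E(2), of "()" b] by (simp add: ED)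
  have "((\<lambda>y. LINT z|lborel. f (z + y)) has_derivative (\<lambda>b. LINT z|lborel. D (z + 0) b)) (at 0)"
  proof (rule has_derivative_integral_dominated[where r=1 and g="\<lambda>z. 2 ^ ?d * C * inverse (bk z ^ ?d)"])
    fix z y b :: 'a
    have "((\<lambda>y. z + y) has_derivative (\<lambda>b. b)) (at y)" by (auto intro!: derivative_eq_intros)
    from has_derivative_compose[OF this D]
    show "((\<lambda>y. f (z + y)) has_derivative D (z + y)) (at y)" by simp
    assume y: "y \<in> ball 0 1"
    \<comment> \<open>For \<bar>y\<bar> < 1 the factor \<open>bk y\<close> is at most 2, whence the
      constant \<open>2 ^ ?d\<close> in the dominating function.\<close>
    have "bk z ^ ?d = bk ((z + y) + (- y)) ^ ?d" by simp
    also have "\<dots> \<le> bk (z + y) ^ ?d * bk y ^ ?d" using bk_add_power_le[of "z + y" "- y" ?d] by simp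
    also have "\<dots> \<le> bk (z + y) ^ ?d * 2 ^ ?d"
      using y by (intro mult_left_mono power_mono) (auto simp: bk_def bk_nonneg dist_norm)
    finally have "bk z ^ ?d * norm (D (z + y) b) \<le> (bk (z + y) ^ ?d * 2 ^ ?d) * norm (D (z + y) b)"
      by (rule mult_right_mono) simp
    also have "\<dots> \<le> 2 ^ ?d * (C * norm b)" using C(2)[of "z + y" b] by (simp add: mult_ac)
    finally show "norm (D (z + y) b) \<le> 2 ^ ?d * C * inverse (bk z ^ ?d) * norm b"
      using bk_power_pos[of z ?d] by (simp add: field_simps)
  next
    fix y :: 'a
    show "integrable lborel (\<lambda>z. f (z + y))"
      using integrable_lborel_translate[OF schwartz_integrable[OF f], of y] by (simp add: add.commute)
  qed (auto intro!: integrable_mult_right integrable_inverse_bk)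
  moreover have "(LINT z|lborel. f (z + y)) = (LINT z|lborel. f z)" for y
    using integral_lborel_translate[OF schwartz_measurable[OF f], of y] by (simp add: add.commute)
  ultimately have "((\<lambda>y::'a. LINT z|lborel. f z) has_derivative (\<lambda>b. LINT z|lborel. D z b)) (at 0)" by simp
  from has_derivative_unique[OF this has_derivative_const]
  show ?thesis by (rule fun_cong)
qed

section \<open>Partial Fourier transforms of Schwartz families\<close>

text \<open>The first variable is a parameter. The sign s = -1 gives the direct transform and s = 1
  the inverse one; the estimates are made for all nonzero s.\<close>

definition partial_ft :: "real \<Rightarrow> ('a::euclidean_space \<times> 'b::euclidean_space \<Rightarrow> complex) \<Rightarrow> 'a \<times> 'b \<Rightarrow> complex" where
  "partial_ft s F = (\<lambda>(x, \<xi>). LINT t|lborel. cis (s * (2 * pi) * (t \<bullet> \<xi>)) * F (x, t))"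

lemma borel_measurable_cis [measurable]: "cis \<in> borel_measurable borel"
  by (intro borel_measurable_continuous_onI continuous_intros)

lemma slow_family_inner_right:
  fixes r :: "'i \<Rightarrow> 'a::euclidean_space"
  assumes "tame w (\<lambda>i. norm (r i))"
  shows "slow_family w (\<lambda>i x. complex_of_real (c * (x \<bullet> r i)))"
proof (rule slow_family_linear[where A="\<lambda>i x. c * (x \<bullet> r i)"])
  show "bounded_linear (\<lambda>x. c * (x \<bullet> r i))" for i
    by (intro bounded_linear_compose[OF bounded_linear_mult_right] bounded_linear_inner_left)
  fix b :: 'a
  have "tame w (\<lambda>i. \<bar>c\<bar> * (norm b * norm (r i)))" by (intro tame_cmult assms) auto
  then show "tame w (\<lambda>i. norm (c * (b \<bullet> r i)))"
    by (rule tame_mono) (auto simp: abs_mult intro!: mult_left_mono Cauchy_Schwarz_ineq2)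
qed

lemma schwartz_family_modulate:
  assumes "schwartz_family w F" "tame w (\<lambda>i. norm (r i))"
  shows "schwartz_family w (\<lambda>i x. cis (c * (x \<bullet> r i)) * F i x)"
  using assms by (intro schwartz_family_mult slow_family_cis slow_family_inner_right)

lemma schwartz_section:
  assumes "schwartz G" shows "schwartz (\<lambda>y. G (x, y))"
  using schwartz_family_imp_schwartz[OF schwartz_family_section'[OF assms[unfolded schwartz_iff_family]], of "((), x)"]
  by simp

text \<open>Induction on the power of \<open>bk \<xi>\<close>, for all families at once: a
  coordinate of \<xi> times the transform is, up to a constant, the transform of a partial
  derivative (\<open>parts\<close>), and these derivatives form Schwartz families again.\<close>

lemma partial_ft_bound_aux:
  fixes F :: "'i \<Rightarrow> 'a::euclidean_space \<times> 'b::euclidean_space \<Rightarrow> complex"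
  assumes "schwartz_family w F" "s \<noteq> 0"
  shows "tame (\<lambda>(i, x, \<xi>). w i) (\<lambda>(i, x, \<xi>). bk x ^ A * bk \<xi> ^ N * norm (partial_ft s (F i) (x, \<xi>)))"
  using assms(1)
proof (induction N arbitrary: F)
  case 0
  let ?d = "2 * DIM('b)"
  obtain C M where C: "C \<ge> 0" "\<And>i x t. norm (F i (x, t)) \<le> C * bk (w i) ^ M * inverse (bk x ^ A) * inverse (bk t ^ ?d)"
    by (rule schwartz_family_prod_bound[OF 0]) (rule that)
  show ?case
  proof (rule tameI, clarify)
    fix i x \<xi>
    have [measurable]: "F i \<in> borel_measurable borel" by (rule schwartz_family_measurable[OF 0])
    have m: "(\<lambda>t. F i (x, t)) \<in> borel_measurable borel" by measurable
    have "norm (partial_ft s (F i) (x, \<xi>)) \<le> (LINT t|lborel. norm (cis (s * (2 * pi) * (t \<bullet> \<xi>)) * F i (x, t)))"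
      unfolding partial_ft_def by simp
    also have "\<dots> \<le> (LINT t|lborel. C * bk (w i) ^ M * inverse (bk x ^ A) * inverse (bk (t::'b) ^ ?d))"
      using integrable_bound_bk[OF m C(2)]
      by (intro integral_mono integrable_mult_right integrable_inverse_bk) (auto simp: norm_mult C)
    also have "\<dots> = C * bk (w i) ^ M * inverse (bk x ^ A) * (LINT t|lborel. inverse (bk (t::'b) ^ ?d))" by simp
    finally have "bk x ^ A * norm (partial_ft s (F i) (x, \<xi>)) \<le> bk x ^ A * \<dots>"
      by (intro mult_left_mono) (auto simp: bk_nonneg)
    also have "\<dots> = C * (LINT t|lborel. inverse (bk (t::'b) ^ ?d)) * bk (w i) ^ M" by simp
    finally show "bk x ^ A * bk \<xi> ^ 0 * norm (partial_ft s (F i) (x, \<xi>)) \<le>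
        C * (LINT t|lborel. inverse (bk (t::'b) ^ ?d)) * bk (w i) ^ M" by simp
  qed
next
  case (Suc N)
  obtain D where D: "\<And>i x. (F i has_derivative D i x) (at x)" "\<And>b. schwartz_family w (\<lambda>i x. D i x b)"
    by (rule schwartz_family_deriv[OF Suc.prems]) (rule that)
  define k where "k = 1 / \<bar>s * (2 * pi)\<bar>"
  have parts: "\<bar>\<xi> \<bullet> c\<bar> * norm (partial_ft s (F i) (x, \<xi>)) = k * norm (partial_ft s (\<lambda>p. D i p (0, c)) (x, \<xi>))"
    if c: "c \<in> Basis" for i x \<xi> c
  proof -
    have sF: "schwartz (\<lambda>t. F i (x, t))" by (rule schwartz_section[OF schwartz_family_imp_schwartz[OF Suc.prems]])
    have sD: "schwartz (\<lambda>t. D i (x, t) (0, c))" by (rule schwartz_section[OF schwartz_family_imp_schwartz[OF D(2)]])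
    have mod: "schwartz (\<lambda>t. cis (s * (2 * pi) * (t \<bullet> \<xi>)) * f t)" if "schwartz f" for f :: "'b \<Rightarrow> complex"
      unfolding schwartz_iff_family
      by (rule schwartz_family_modulate[where r="\<lambda>_. \<xi>"]) (use that in \<open>auto simp: schwartz_iff_family\<close>)
    have der: "((\<lambda>t. cis (s * (2 * pi) * (t \<bullet> \<xi>)) * F i (x, t)) has_derivative
       (\<lambda>b. cis (s * (2 * pi) * (t \<bullet> \<xi>)) * D i (x, t) (0, b) +
            ((s * (2 * pi) * (b \<bullet> \<xi>)) *\<^sub>R (\<i> * cis (s * (2 * pi) * (t \<bullet> \<xi>)))) * F i (x, t))) (at t)" for t
      by (intro has_derivative_mult has_derivative_cis has_derivative_compose[OF has_derivative_Pair_left D(1)])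
         (auto intro!: derivative_eq_intros)
    let ?I1 = "LINT t|lborel. cis (s * (2 * pi) * (t \<bullet> \<xi>)) * D i (x, t) (0, c)"
    let ?I2 = "LINT t|lborel. cis (s * (2 * pi) * (t \<bullet> \<xi>)) * F i (x, t)"
    \<comment> \<open>The derivative of the modulated function integrates to 0; its two terms are
      the transform of the derivative and a multiple of the transform itself.\<close>
    have "0 = (LINT t|lborel. cis (s * (2 * pi) * (t \<bullet> \<xi>)) * D i (x, t) (0, c) +
            ((s * (2 * pi) * (c \<bullet> \<xi>)) *\<^sub>R (\<i> * cis (s * (2 * pi) * (t \<bullet> \<xi>)))) * F i (x, t))"
      using schwartz_integral_deriv_eq_0[OF mod[OF sF] der, of c] by simp
    also have "\<dots> = (LINT t|lborel. cis (s * (2 * pi) * (t \<bullet> \<xi>)) * D i (x, t) (0, c) +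
            (of_real (s * (2 * pi) * (c \<bullet> \<xi>)) * \<i>) * (cis (s * (2 * pi) * (t \<bullet> \<xi>)) * F i (x, t)))"
      by (simp add: scaleR_conv_of_real mult_ac)
    also have "\<dots> = ?I1 + of_real (s * (2 * pi) * (c \<bullet> \<xi>)) * \<i> * ?I2"
      using schwartz_integrable[OF mod[OF sF]] schwartz_integrable[OF mod[OF sD]]
      by (subst Bochner_Integration.integral_add) auto
    finally have "?I1 = - (of_real (s * (2 * pi) * (c \<bullet> \<xi>)) * \<i> * ?I2)"
      by (simp add: add_eq_0_iff)
    then have "norm ?I1 = \<bar>s * (2 * pi)\<bar> * (\<bar>\<xi> \<bullet> c\<bar> * norm ?I2)"
      by (simp add: norm_mult abs_mult inner_commute)
    then show ?thesis using assms(2) by (simp add: partial_ft_def k_def)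
  qed
  have "tame (\<lambda>(i, x, \<xi>). w i) (\<lambda>p. (\<lambda>(i, x, \<xi>). bk x ^ A * bk \<xi> ^ N * norm (partial_ft s (F i) (x, \<xi>))) p +
    (\<Sum>c\<in>Basis. k * (\<lambda>(i, x, \<xi>). bk x ^ A * bk \<xi> ^ N * norm (partial_ft s (\<lambda>p. D i p (0, c)) (x, \<xi>))) p))"
    by (intro tame_add Suc.IH Suc.prems tame_sum tame_cmult D(2)) (auto simp: k_def)
  then show ?case
  proof (rule tame_mono, clarify)
    fix i x \<xi>
    let ?P = "norm (partial_ft s (F i) (x, \<xi>))"
    \<comment> \<open>One more factor \<open>bk \<xi>\<close> is spread over the coordinates of
      \<xi>, each of which is traded for a derivative.\<close>
    have "bk \<xi> \<le> 1 + (\<Sum>c\<in>Basis. \<bar>\<xi> \<bullet> c\<bar>)" unfolding bk_def using norm_le_l1[of \<xi>] by simp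
    then have "bk x ^ A * bk \<xi> ^ N * ?P * bk \<xi> \<le> bk x ^ A * bk \<xi> ^ N * ?P * (1 + (\<Sum>c\<in>Basis. \<bar>\<xi> \<bullet> c\<bar>))"
      by (intro mult_left_mono) (auto simp: bk_nonneg)
    also have "\<dots> = bk x ^ A * bk \<xi> ^ N * ?P + (\<Sum>c\<in>Basis. bk x ^ A * bk \<xi> ^ N * (\<bar>\<xi> \<bullet> c\<bar> * ?P))"
      by (simp add: distrib_left sum_distrib_left sum_distrib_right mult_ac)
    also have "(\<Sum>c\<in>Basis. bk x ^ A * bk \<xi> ^ N * (\<bar>\<xi> \<bullet> c\<bar> * ?P)) =
       (\<Sum>c\<in>Basis. k * (bk x ^ A * bk \<xi> ^ N * norm (partial_ft s (\<lambda>p. D i p (0, c)) (x, \<xi>))))"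
      by (intro sum.cong refl) (simp add: parts mult_ac)
    finally show "bk x ^ A * bk \<xi> ^ Suc N * ?P \<le> bk x ^ A * bk \<xi> ^ N * ?P +
       (\<Sum>c\<in>Basis. k * (bk x ^ A * bk \<xi> ^ N * norm (partial_ft s (\<lambda>p. D i p (0, c)) (x, \<xi>))))"
      by (simp add: mult_ac)
  qed
qed

lemma schwartz_family_partial_ft:
  fixes F :: "'i \<Rightarrow> 'a::euclidean_space \<times> 'b::euclidean_space \<Rightarrow> complex"
  assumes "schwartz_family w F" "s \<noteq> 0"
  shows "schwartz_family w (\<lambda>i. partial_ft s (F i))"
  unfolding schwartz_family_def
proof (intro allI Ck_coinduct[where P="\<lambda>H. \<exists>F. schwartz_family w F \<and> H = (\<lambda>i. partial_ft s (F i))"])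
  let ?d = "2 * DIM('b)"
  fix H :: "'i \<Rightarrow> 'a \<times> 'b \<Rightarrow> complex"
  assume "\<exists>F. schwartz_family w F \<and> H = (\<lambda>i. partial_ft s (F i))"
  then obtain F where F: "schwartz_family w F" "H = (\<lambda>i. partial_ft s (F i))" by blast
  show "rapid w H"
  proof (rule rapidI)
    fix N
    have "tame (\<lambda>(i, q). w i) (\<lambda>(i, q). bk (fst q) ^ N * bk (snd q) ^ N * norm (partial_ft s (F i) q))"
      using partial_ft_bound_aux[OF F(1) assms(2), of N N] by (simp add: split_def)
    then obtain C M where C: "C \<ge> 0" "\<And>i q. bk (fst q) ^ N * bk (snd q) ^ N * norm (partial_ft s (F i) q) \<le> C * bk (w i) ^ M"
      by (rule tameE2) (rule that)
    have "bk q ^ N * norm (H i q) \<le> C * bk (w i) ^ M" for i q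
    proof -
      have "bk q ^ N \<le> (bk (fst q) * bk (snd q)) ^ N"
        by (metis bk_Pair_le bk_nonneg power_mono prod.collapse)
      then have "bk q ^ N * norm (H i q) \<le> bk (fst q) ^ N * bk (snd q) ^ N * norm (H i q)"
        by (intro mult_right_mono) (auto simp: power_mult_distrib)
      also have "\<dots> \<le> C * bk (w i) ^ M" using C(2) by (simp add: F(2))
      finally show ?thesis .
    qed
    then show "\<exists>C M. \<forall>i q. bk q ^ N * norm (H i q) \<le> C * bk (w i) ^ M" by blast
  qed
  obtain D where D: "\<And>i x. (F i has_derivative D i x) (at x)" "\<And>b. schwartz_family w (\<lambda>i x. D i x b)"
    by (rule schwartz_family_deriv[OF F(1)]) (rule that)
  \<comment> \<open>The derivative of the transform in direction b is the transform of
    \<open>F' b\<close>: the first half of b differentiates F, the second half brings down a factor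
    from the phase.\<close>
  define F' where "F' b = (\<lambda>i p. D i p (fst b, 0) + (\<i> * complex_of_real (s * (2 * pi) * (snd p \<bullet> snd b))) * F i p)" for b :: "'a \<times> 'b"
  have lin: "slow_family w (\<lambda>i p. \<i> * complex_of_real (s * (2 * pi) * (snd p \<bullet> snd b)))" for b :: "'a \<times> 'b"
    using slow_family_mult[OF slow_family_const slow_family_inner_right, of w "\<lambda>_. \<i>" "\<lambda>_. (0, snd b)" "s * (2 * pi)"]
    by (simp add: inner_prod_def)
  have F': "schwartz_family w (F' b)" for b
    unfolding F'_def by (intro schwartz_family_add D schwartz_family_mult lin F)
  have [measurable]: "F i \<in> borel_measurable borel" for i by (rule schwartz_family_measurable[OF F(1)])
  have [measurable]: "F' b i \<in> borel_measurable borel" for b i by (rule schwartz_family_measurable[OF F'])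
  \<comment> \<open>The exponent is \<open>Suc ?d\<close> because the factor from the phase costs
    one power of \<open>bk t\<close>.\<close>
  obtain C M where C: "C \<ge> 0" "\<And>i x t. norm (F i (x, t)) \<le> C * bk (w i) ^ M * inverse (bk x ^ 0) * inverse (bk t ^ Suc ?d)"
    by (rule schwartz_family_prod_bound[OF F(1)]) (rule that)
  obtain C' M' where C': "C' \<ge> 0" "\<And>i p b. bk p ^ (0 + ?d) * norm (D i p b) \<le> C' * bk (w i) ^ M' * norm b"
    by (rule schwartz_family_deriv_bound[OF F(1) D(1)]) (rule that)
  have "(H i has_derivative (\<lambda>b. partial_ft s (F' b i) q)) (at q)" for i q
  proof -
    let ?K = "C' * bk (w i) ^ M' + \<bar>s * (2 * pi)\<bar> * (C * bk (w i) ^ M)"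
    have "((\<lambda>q. LINT t|lborel. cis (s * (2 * pi) * (t \<bullet> snd q)) * F i (fst q, t)) has_derivative
      (\<lambda>b. LINT t|lborel. cis (s * (2 * pi) * (t \<bullet> snd q)) * F' b i (fst q, t))) (at q)"
    proof (rule has_derivative_integral_dominated[where r=1 and g="\<lambda>t. ?K * inverse (bk t ^ ?d)"])
      fix t :: 'b and y b :: "'a \<times> 'b"
      have "((\<lambda>q. cis (s * (2 * pi) * (t \<bullet> snd q)) * F i (fst q, t)) has_derivative
        (\<lambda>b. cis (s * (2 * pi) * (t \<bullet> snd y)) * D i (fst y, t) (fst b, 0) +
             ((s * (2 * pi) * (t \<bullet> snd b)) *\<^sub>R (\<i> * cis (s * (2 * pi) * (t \<bullet> snd y)))) * F i (fst y, t))) (at y)"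
        by (intro has_derivative_mult has_derivative_cis
            has_derivative_compose[OF has_derivative_compose[OF has_derivative_fst[OF has_derivative_ident] has_derivative_Pair_right] D(1)])
           (auto intro!: derivative_eq_intros)
      then show "((\<lambda>q. cis (s * (2 * pi) * (t \<bullet> snd q)) * F i (fst q, t)) has_derivative
        (\<lambda>b. cis (s * (2 * pi) * (t \<bullet> snd y)) * F' b i (fst y, t))) (at y)"
        by (rule has_derivative_eq_rhs) (auto simp: F'_def algebra_simps scaleR_conv_of_real)
      have nb: "norm (fst b) \<le> norm b" "norm (snd b) \<le> norm b"
        by (metis norm_fst_le norm_snd_le prod.collapse)+
      have "norm (D i (fst y, t) (fst b, 0)) \<le> C' * bk (w i) ^ M' * norm (fst b) * inverse (bk (fst y) ^ 0) * inverse (bk t ^ ?d)"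
        using C'(2)[of "(fst y, t)" i "(fst b, 0)"] by (intro bk_prod_bound) (auto simp: norm_Pair)
      also have "\<dots> \<le> C' * bk (w i) ^ M' * norm b * inverse (bk t ^ ?d)"
        using C'(1) nb(1)
        by (auto intro!: mult_left_mono mult_right_mono simp: bk_nonneg)
      finally have 1: "norm (D i (fst y, t) (fst b, 0)) \<le> C' * bk (w i) ^ M' * norm b * inverse (bk t ^ ?d)" .
      have "norm (\<i> * complex_of_real (s * (2 * pi) * (t \<bullet> snd b)) * F i (fst y, t)) =
          \<bar>s * (2 * pi)\<bar> * (\<bar>t \<bullet> snd b\<bar> * norm (F i (fst y, t)))"
        by (simp add: norm_mult abs_mult)
      also have "\<dots> \<le> \<bar>s * (2 * pi)\<bar> * ((bk t * norm b) * (C * bk (w i) ^ M * inverse (bk t ^ Suc ?d)))"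
      proof (intro mult_left_mono mult_mono)
        show "\<bar>t \<bullet> snd b\<bar> \<le> bk t * norm b"
          by (rule order_trans[OF Cauchy_Schwarz_ineq2]) (auto intro!: mult_mono norm_le_bk nb bk_nonneg)
        show "norm (F i (fst y, t)) \<le> C * bk (w i) ^ M * inverse (bk t ^ Suc ?d)" using C(2)[of i "fst y" t] by simp
      qed (auto simp: bk_nonneg)
      also have "\<dots> = \<bar>s * (2 * pi)\<bar> * (C * bk (w i) ^ M) * inverse (bk t ^ ?d) * norm b"
        by (simp add: field_simps)
      finally have 2: "norm (\<i> * complex_of_real (s * (2 * pi) * (t \<bullet> snd b)) * F i (fst y, t)) \<le> \<dots>" .
      show "norm (cis (s * (2 * pi) * (t \<bullet> snd y)) * F' b i (fst y, t)) \<le> ?K * inverse (bk t ^ ?d) * norm b"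
        unfolding F'_def norm_mult[of "cis _"] norm_cis mult_1 snd_conv
        by (rule order_trans[OF norm_triangle_ineq order_trans[OF add_mono[OF 1 2]]]) (simp add: algebra_simps)
    next
      fix y :: "'a \<times> 'b"
      show "integrable lborel (\<lambda>t. cis (s * (2 * pi) * (t \<bullet> snd y)) * F i (fst y, t))"
        using C(2)[of i "fst y"] by (intro integrable_bound_bk[where N="Suc ?d"]) (auto simp: norm_mult)
    next
      fix b
      show "(\<lambda>t. cis (s * (2 * pi) * (t \<bullet> snd q)) * F' b i (fst q, t)) \<in> borel_measurable lborel" by measurable
    qed (auto intro!: integrable_mult_right integrable_inverse_bk)
    then show ?thesis by (simp add: F(2) partial_ft_def split_def)
  qed
  then show "\<exists>D. (\<forall>i x. (H i has_derivative D i x) (at x)) \<and>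
         (\<forall>b. \<exists>F. schwartz_family w F \<and> (\<lambda>i x. D i x b) = (\<lambda>i. partial_ft s (F i)))"
    by (intro exI[of _ "\<lambda>i q b. partial_ft s (F' b i) q"] conjI allI exI[of _ "F' b" for b]) (auto simp: F')
qed (use assms in blast)

section \<open>Gaussians and the inversion theorem\<close>

lemma gaussian_integrable_real: "integrable lborel (\<lambda>y::real. exp (- (pi * y\<^sup>2)))"
proof (rule Bochner_Integration.integrable_bound[OF integrable_inverse_one_plus_square])
  show "AE y in lborel. norm (exp (- (pi * y\<^sup>2))) \<le> norm (inverse (1 + y\<^sup>2))" for y :: real
  proof (intro AE_I2)
    fix y :: real
    have "1 + y\<^sup>2 \<le> 1 + pi * y\<^sup>2" using pi_ge_two by (simp add: mult_le_cancel_right1)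
    also have "\<dots> \<le> exp (pi * y\<^sup>2)" by (rule exp_ge_add_one_self)
    finally have "inverse (exp (pi * y\<^sup>2)) \<le> inverse (1 + y\<^sup>2)"
      by (intro le_imp_inverse_le) (auto intro: add_pos_nonneg)
    then show "norm (exp (- (pi * y\<^sup>2))) \<le> norm (inverse (1 + y\<^sup>2))" by (simp add: exp_minus)
  qed
qed simp

text \<open>Rescaling y by \<open>sqrt (2 * pi)\<close> gives the characteristic function of the
  standard normal distribution at \<open>sqrt (2 * pi) * \<eta>\<close>.\<close>

lemma gaussian_ft_real:
  "(LINT y|lborel. complex_of_real (exp (- (pi * y\<^sup>2))) * cis (2 * pi * (y * \<eta>))) = of_real (exp (- (pi * \<eta>\<^sup>2)))"
proof -
  define t where "t = sqrt (2 * pi) * \<eta>"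
  have s: "sqrt (2 * pi) > 0" by simp
  have "char std_normal_distribution t = (LINT x|lborel. std_normal_density x *\<^sub>R iexp (t * x))"
    unfolding char_def by (subst integral_density) (auto simp: normal_density_nonneg)
  also have "\<dots> = sqrt (2 * pi) *\<^sub>R (LINT y|lborel. std_normal_density (sqrt (2 * pi) * y) *\<^sub>R iexp (t * (sqrt (2 * pi) * y)))"
    using lborel_integral_real_affine[of "sqrt (2 * pi)" "\<lambda>x. std_normal_density x *\<^sub>R iexp (t * x)" 0] by simp
  also have "\<dots> = (LINT y|lborel. sqrt (2 * pi) *\<^sub>R (std_normal_density (sqrt (2 * pi) * y) *\<^sub>R iexp (t * (sqrt (2 * pi) * y))))"
    by (simp only: integral_scaleR_right)
  also have "\<dots> = (LINT y|lborel. complex_of_real (exp (- (pi * y\<^sup>2))) * cis (2 * pi * (y * \<eta>)))"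
  proof (intro Bochner_Integration.integral_cong refl)
    fix y :: real
    have "std_normal_density (sqrt (2 * pi) * y) = exp (- (pi * y\<^sup>2)) / sqrt (2 * pi)"
      by (simp add: std_normal_density_def power_mult_distrib)
    moreover have "t * (sqrt (2 * pi) * y) = 2 * pi * (y * \<eta>)"
      using real_sqrt_mult_self[of "2 * pi"] by (simp add: t_def mult_ac)
    then have "iexp (t * (sqrt (2 * pi) * y)) = cis (2 * pi * (y * \<eta>))"
      by (simp only: cis_conv_exp)
    ultimately show "sqrt (2 * pi) *\<^sub>R (std_normal_density (sqrt (2 * pi) * y) *\<^sub>R iexp (t * (sqrt (2 * pi) * y))) =
       complex_of_real (exp (- (pi * y\<^sup>2))) * cis (2 * pi * (y * \<eta>))"
      by (simp add: scaleR_conv_of_real del: of_real_mult)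
  qed
  finally have "(LINT y|lborel. complex_of_real (exp (- (pi * y\<^sup>2))) * cis (2 * pi * (y * \<eta>))) = of_real (exp (- (t\<^sup>2) / 2))"
    by (simp add: char_std_normal_distribution)
  moreover have "t\<^sup>2 / 2 = pi * \<eta>\<^sup>2" by (simp add: t_def power_mult_distrib)
  ultimately show ?thesis by simp
qed

text \<open>Lebesgue measure is the image of a product of one-dimensional measures under
  coordinates, so products of functions of single coordinates integrate factor by factor.\<close>

lemma lborel_integral_prod_Basis:
  fixes f :: "'a::euclidean_space \<Rightarrow> real \<Rightarrow> complex"
  assumes "\<And>b. b \<in> Basis \<Longrightarrow> integrable lborel (f b)"
  shows "(LINT x|lborel. (\<Prod>b\<in>Basis. f b (x \<bullet> b))) = (\<Prod>b\<in>Basis. (LINT y|lborel. f b y))"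
    and "integrable lborel (\<lambda>x. \<Prod>b\<in>Basis. f b (x \<bullet> b))"
proof -
  interpret product_sigma_finite "\<lambda>_::'a. lborel :: real measure" by standard
  have [measurable]: "f b \<in> borel_measurable borel" if "b \<in> Basis" for b using assms[OF that] by simp
  have T: "(\<lambda>g. \<Sum>b\<in>Basis. g b *\<^sub>R b) \<in> (\<Pi>\<^sub>M b\<in>Basis. lborel :: real measure) \<rightarrow>\<^sub>M (borel :: 'a measure)" by measurable
  have m: "(\<lambda>x::'a. \<Prod>b\<in>Basis. f b (x \<bullet> b)) \<in> borel_measurable borel" by measurable
  have c: "(\<Sum>b\<in>Basis. g b *\<^sub>R b) \<bullet> c = g c" if "c \<in> Basis" for g :: "'a \<Rightarrow> real" and c
    using that by simp
  have eq: "(\<Prod>b\<in>Basis. f b ((\<Sum>b\<in>Basis. g b *\<^sub>R b) \<bullet> b)) = (\<Prod>b\<in>Basis. f b (g b))" for g :: "'a \<Rightarrow> real"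
    by (intro prod.cong refl) (simp only: c)
  show "(LINT x|lborel. (\<Prod>b\<in>Basis. f b (x \<bullet> b))) = (\<Prod>b\<in>Basis. (LINT y|lborel. f b y))"
    by (subst lborel_eq) (simp only: integral_distr[OF T m] eq product_integral_prod[OF finite_Basis assms])
  show "integrable lborel (\<lambda>x. \<Prod>b\<in>Basis. f b (x \<bullet> b))"
    by (subst lborel_eq) (simp only: integrable_distr_eq[OF T m] eq product_integrable_prod[OF finite_Basis assms])
qed

definition gaussian :: "'a::euclidean_space \<Rightarrow> real" where
  "gaussian x = exp (- (pi * (norm x)\<^sup>2))"

lemma gaussian_prod: "gaussian x = (\<Prod>b\<in>Basis. exp (- (pi * (x \<bullet> b)\<^sup>2)))"
proof -
  have "(norm x)\<^sup>2 = (\<Sum>b\<in>Basis. (x \<bullet> b)\<^sup>2)"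
    by (subst power2_norm_eq_inner, subst euclidean_inner) (simp add: power2_eq_square)
  then show ?thesis
    by (simp add: gaussian_def exp_sum[symmetric] sum_distrib_left sum_negf[symmetric])
qed

lemma gaussian_bounds: "0 \<le> gaussian x" "gaussian x \<le> 1"
  by (auto simp: gaussian_def)

lemma gaussian_measurable [measurable]: "gaussian \<in> borel_measurable borel"
  unfolding gaussian_def[abs_def] by measurable

lemma cis_sum: "finite A \<Longrightarrow> cis (\<Sum>a\<in>A. f a) = (\<Prod>a\<in>A. cis (f a))"
  by (induction rule: finite_induct) (auto simp: cis_mult[symmetric])

lemma gaussian_ft_integrable:
  fixes \<xi> :: "'a::euclidean_space"
  shows gaussian_ft: "(LINT x|lborel. complex_of_real (gaussian x) * cis (2 * pi * (x \<bullet> \<xi>))) = of_real (gaussian \<xi>)"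
    and gaussian_integrable: "integrable lborel (gaussian :: 'a::euclidean_space \<Rightarrow> real)"
proof -
  have i: "integrable lborel (\<lambda>y. complex_of_real (exp (- (pi * y\<^sup>2))) * cis (2 * pi * (y * \<eta>)))" for \<eta>
    by (rule Bochner_Integration.integrable_bound[OF gaussian_integrable_real]) (auto simp: norm_mult)
  have "complex_of_real (gaussian x) * cis (2 * pi * (x \<bullet> \<xi>)) =
      (\<Prod>b\<in>Basis. complex_of_real (exp (- (pi * (x \<bullet> b)\<^sup>2))) * cis (2 * pi * ((x \<bullet> b) * (\<xi> \<bullet> b))))" for x \<xi> :: 'a
    by (subst euclidean_inner) (simp add: gaussian_prod prod.distrib cis_sum[symmetric] sum_distrib_left)
  note eq = this
  show "(LINT x|lborel. complex_of_real (gaussian x) * cis (2 * pi * (x \<bullet> \<xi>))) = of_real (gaussian \<xi>)"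
    unfolding eq
    by (subst lborel_integral_prod_Basis(1)[where f="\<lambda>b y. complex_of_real (exp (- (pi * y\<^sup>2))) * cis (2 * pi * (y * (\<xi> \<bullet> b)))", OF i])
       (simp only: gaussian_ft_real gaussian_prod of_real_prod)
  have "integrable lborel (\<lambda>x::'a. complex_of_real (gaussian x))"
    using lborel_integral_prod_Basis(2)[where f="\<lambda>b y. complex_of_real (exp (- (pi * y\<^sup>2))) * cis (2 * pi * (y * ((0::'a) \<bullet> b)))", OF i]
    unfolding eq[symmetric] by simp
  then show "integrable lborel (gaussian :: 'a \<Rightarrow> real)"
    by (simp add: complex_of_real_integrable_eq)
qed

lemma gaussian_integral: "(LINT x|lborel. gaussian (x::'a::euclidean_space)) = 1"
proof -
  have "complex_of_real (LINT x|lborel. gaussian (x::'a)) = 1"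
    using gaussian_ft[of "0::'a"] by (simp add: gaussian_def)
  then show ?thesis by simp
qed

lemma integrable_lborel_scale:
  fixes f :: "'a::euclidean_space \<Rightarrow> 'b::{banach, second_countable_topology}"
  assumes f: "integrable lborel f" and c: "c \<noteq> 0"
  shows "integrable lborel (\<lambda>x. f (c *\<^sub>R x))"
proof (rule integrableI_bounded)
  have [measurable]: "f \<in> borel_measurable borel" using f by auto
  show "(\<lambda>x. f (c *\<^sub>R x)) \<in> borel_measurable lborel" by measurable
  have "(\<integral>\<^sup>+ x. ennreal (norm (f x)) \<partial>lborel) =
      ennreal (\<bar>c\<bar> ^ DIM('a)) * (\<integral>\<^sup>+ x. ennreal (norm (f (c *\<^sub>R x))) \<partial>lborel)"
    by (rule nn_integral_lborel_scale[OF _ c]) measurable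
  moreover have "(\<integral>\<^sup>+ x. ennreal (norm (f x)) \<partial>lborel) < \<infinity>"
    using f by (simp add: integrable_iff_bounded)
  ultimately show "(\<integral>\<^sup>+ x. ennreal (norm (f (c *\<^sub>R x))) \<partial>lborel) < \<infinity>"
    using c by (auto simp: ennreal_mult_less_top)
qed

lemma lborel_integrable_prod:
  fixes f :: "'a::euclidean_space \<Rightarrow> complex" and g :: "'b::euclidean_space \<Rightarrow> complex"
  assumes f: "integrable lborel f" and g: "integrable lborel g"
  shows "integrable lborel (\<lambda>(x, y). f x * g y)"
proof (rule integrableI_bounded)
  have [measurable]: "f \<in> borel_measurable borel" "g \<in> borel_measurable borel" using f g by auto
  have m: "(\<lambda>(x, y). f x * g y) \<in> borel_measurable borel"
    by (subst borel_prod[symmetric]) measurable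
  then show "(\<lambda>(x, y). f x * g y) \<in> borel_measurable lborel" by simp
  have "(\<integral>\<^sup>+ p. ennreal (norm (case p of (x, y) \<Rightarrow> f x * g y)) \<partial>lborel) =
      (\<integral>\<^sup>+ x. \<integral>\<^sup>+ y. ennreal (norm (f x)) * ennreal (norm (g y)) \<partial>lborel \<partial>lborel)"
    using m by (subst nn_integral_lborel_pair(1)) (auto simp: norm_mult ennreal_mult')
  also have "\<dots> = (\<integral>\<^sup>+ x. ennreal (norm (f x)) \<partial>lborel) * (\<integral>\<^sup>+ y. ennreal (norm (g y)) \<partial>lborel)"
    by (simp add: nn_integral_cmult nn_integral_multc)
  also have "\<dots> < \<infinity>" using f g by (auto simp: integrable_iff_bounded ennreal_mult_less_top)
  finally show "(\<integral>\<^sup>+ p. ennreal (norm (case p of (x, y) \<Rightarrow> f x * g y)) \<partial>lborel) < \<infinity>" .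
qed

lemma schwartz_partial_ft: "schwartz F \<Longrightarrow> s \<noteq> 0 \<Longrightarrow> schwartz (partial_ft s F)"
  unfolding schwartz_iff_family by (rule schwartz_family_partial_ft)

lemma gaussian_scaled_ft:
  fixes u :: "'a::euclidean_space"
  assumes "0 < \<epsilon>"
  shows "(LINT \<xi>|lborel. complex_of_real (gaussian (\<epsilon> *\<^sub>R \<xi>)) * cis (2 * pi * (\<xi> \<bullet> u))) =
    of_real ((1 / \<epsilon>) ^ DIM('a) * gaussian ((1 / \<epsilon>) *\<^sub>R u))"
proof -
  have "(LINT \<xi>|lborel. complex_of_real (gaussian (\<epsilon> *\<^sub>R \<xi>)) * cis (2 * pi * (\<xi> \<bullet> u))) =
     \<bar>1 / \<epsilon>\<bar> ^ DIM('a) *\<^sub>R (LINT \<eta>|lborel. complex_of_real (gaussian (\<epsilon> *\<^sub>R (1 / \<epsilon>) *\<^sub>R \<eta>)) * cis (2 * pi * (((1 / \<epsilon>) *\<^sub>R \<eta>) \<bullet> u)))"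
    using assms by (intro integral_lborel_scale) auto
  also have "\<dots> = \<bar>1 / \<epsilon>\<bar> ^ DIM('a) *\<^sub>R (LINT \<eta>|lborel. complex_of_real (gaussian \<eta>) * cis (2 * pi * (\<eta> \<bullet> ((1 / \<epsilon>) *\<^sub>R u))))"
    using assms by simp
  finally show ?thesis
    unfolding gaussian_ft using assms by (simp add: scaleR_conv_of_real)
qed

text \<open>The inverse integral is damped by a Gaussian of width 1 / \<open>e n\<close>. Fubini and
  the transform of the Gaussian turn it into a Gaussian average of f (y - e n s) over s. As
  \<open>e n\<close> tends to 0, dominated convergence gives the undamped integral on one side and f
  y on the other.\<close>

theorem partial_ft_inversion:
  fixes F :: "'a::euclidean_space \<times> 'b::euclidean_space \<Rightarrow> complex"
  assumes F: "schwartz F"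
  shows "partial_ft 1 (partial_ft (-1) F) = F"
proof (intro ext, clarify)
  fix x :: 'a and y :: 'b
  define f where "f t = F (x, t)" for t
  define h where "h \<xi> = partial_ft (-1) F (x, \<xi>)" for \<xi>
  have sf: "schwartz f" unfolding f_def[abs_def] by (rule schwartz_section[OF F])
  have sh: "schwartz h" unfolding h_def[abs_def] by (rule schwartz_section[OF schwartz_partial_ft[OF F]]) simp
  note [measurable] = schwartz_measurable[OF sf] schwartz_measurable[OF sh]
  have h: "h \<xi> = (LINT t|lborel. cis (- (2 * pi * (t \<bullet> \<xi>))) * f t)" for \<xi>
    by (simp add: h_def partial_ft_def f_def)
  define e where "e n = inverse (real (Suc n))" for n
  have e: "e n > 0" for n by (simp add: e_def)
  have e0: "e \<longlonglongrightarrow> 0" unfolding e_def by (rule LIMSEQ_inverse_real_of_nat)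
  define K where "K n = (LINT \<xi>|lborel. complex_of_real (gaussian (e n *\<^sub>R \<xi>)) * (cis (2 * pi * (\<xi> \<bullet> y)) * h \<xi>))" for n
  have lim1: "K \<longlonglongrightarrow> (LINT \<xi>|lborel. cis (2 * pi * (\<xi> \<bullet> y)) * h \<xi>)"
    unfolding K_def
  proof (rule integral_dominated_convergence[where w="\<lambda>\<xi>. norm (h \<xi>)"])
    show "integrable lborel (\<lambda>\<xi>. norm (h \<xi>))" using schwartz_integrable[OF sh] by simp
    show "AE \<xi> in lborel. (\<lambda>n. complex_of_real (gaussian (e n *\<^sub>R \<xi>)) * (cis (2 * pi * (\<xi> \<bullet> y)) * h \<xi>)) \<longlonglongrightarrow> cis (2 * pi * (\<xi> \<bullet> y)) * h \<xi>"
    proof (intro AE_I2)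
      fix \<xi> :: 'b
      have "(\<lambda>n. gaussian (e n *\<^sub>R \<xi>)) \<longlonglongrightarrow> exp (- (pi * (norm (0 *\<^sub>R \<xi>))\<^sup>2))"
        unfolding gaussian_def by (intro tendsto_intros e0)
      then have "(\<lambda>n. complex_of_real (gaussian (e n *\<^sub>R \<xi>))) \<longlonglongrightarrow> 1"
        using tendsto_of_real by fastforce
      then show "(\<lambda>n. complex_of_real (gaussian (e n *\<^sub>R \<xi>)) * (cis (2 * pi * (\<xi> \<bullet> y)) * h \<xi>)) \<longlonglongrightarrow> cis (2 * pi * (\<xi> \<bullet> y)) * h \<xi>"
        using tendsto_mult_right[of _ 1] by fastforce
    qed
  qed (auto simp: norm_mult gaussian_bounds intro!: mult_left_le_one_le)
  have K: "K n = (LINT s|lborel. f (y - e n *\<^sub>R s) * of_real (gaussian s))" for n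
  proof -
    define Q where "Q \<xi> t = complex_of_real (gaussian (e n *\<^sub>R \<xi>)) * cis (2 * pi * (\<xi> \<bullet> (y - t))) * f t" for \<xi> t
    have gi: "integrable lborel (\<lambda>\<xi>::'b. complex_of_real (gaussian (e n *\<^sub>R \<xi>)))"
      using integrable_lborel_scale[OF gaussian_integrable, of "e n"] e[of n] by (simp add: complex_of_real_integrable_eq)
    have Qm: "(\<lambda>(\<xi>, t). Q \<xi> t) \<in> borel_measurable borel"
      unfolding Q_def by (subst borel_prod[symmetric]) measurable
    have Qi: "integrable lborel (\<lambda>(\<xi>, t). Q \<xi> t)"
    proof (rule Bochner_Integration.integrable_bound[OF lborel_integrable_prod[OF gi schwartz_integrable[OF sf]]])
      show "(\<lambda>(\<xi>, t). Q \<xi> t) \<in> borel_measurable lborel" using Qm by simp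
    qed (auto simp: Q_def norm_mult)
    have "K n = (LINT \<xi>|lborel. LINT t|lborel. Q \<xi> t)"
      unfolding K_def
    proof (intro Bochner_Integration.integral_cong refl)
      fix \<xi> :: 'b
      have "Q \<xi> t = complex_of_real (gaussian (e n *\<^sub>R \<xi>)) * cis (2 * pi * (\<xi> \<bullet> y)) * (cis (- (2 * pi * (t \<bullet> \<xi>))) * f t)" for t
        by (simp add: Q_def inner_diff_right inner_commute cis_mult right_diff_distrib algebra_simps)
      then show "complex_of_real (gaussian (e n *\<^sub>R \<xi>)) * (cis (2 * pi * (\<xi> \<bullet> y)) * h \<xi>) = (LINT t|lborel. Q \<xi> t)"
        by (simp add: h mult.assoc)
    qed
    also have "\<dots> = (LINT t|lborel. LINT \<xi>|lborel. Q \<xi> t)" by (rule fubini_lborel_swap[OF Qi])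
    also have "\<dots> = (LINT t|lborel. of_real ((1 / e n) ^ DIM('b) * gaussian ((1 / e n) *\<^sub>R (y - t))) * f t)"
      unfolding Q_def by (simp add: gaussian_scaled_ft[OF e])
    also have "\<dots> = (LINT t|lborel. of_real ((1 / e n) ^ DIM('b) * gaussian ((1 / e n) *\<^sub>R (y - (y - t)))) * f (y - t))"
      by (rule integral_lborel_reflect[symmetric]) measurable
    also have "\<dots> = \<bar>e n\<bar> ^ DIM('b) *\<^sub>R (LINT t|lborel. of_real ((1 / e n) ^ DIM('b) * gaussian ((1 / e n) *\<^sub>R (y - (y - e n *\<^sub>R t)))) * f (y - e n *\<^sub>R t))"
      using e[of n] by (intro integral_lborel_scale) auto
    also have "\<dots> = \<bar>e n\<bar> ^ DIM('b) *\<^sub>R (LINT t|lborel. of_real ((1 / e n) ^ DIM('b)) * (f (y - e n *\<^sub>R t) * of_real (gaussian t)))"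
      using e[of n] by (simp add: mult_ac)
    also have "\<dots> = (LINT s|lborel. f (y - e n *\<^sub>R s) * of_real (gaussian s))"
      using e[of n] by (simp only: integral_mult_right_zero) (simp add: scaleR_conv_of_real power_one_over)
    finally show ?thesis .
  qed
  moreover have "(\<lambda>n. LINT s|lborel. f (y - e n *\<^sub>R s) * of_real (gaussian s)) \<longlonglongrightarrow> (LINT s|lborel. f y * complex_of_real (gaussian (s::'b)))"
  proof -
    obtain B where B: "B \<ge> 0" "\<And>t. norm (f t) \<le> B * inverse (bk t ^ 0)" by (rule schwartz_decay[OF sf]) (rule that)
    show ?thesis
    proof (rule integral_dominated_convergence[where w="\<lambda>s. B * gaussian s"])
      show "integrable lborel (\<lambda>s::'b. B * gaussian s)"
        by (intro integrable_mult_right gaussian_integrable)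
      show "AE s in lborel. (\<lambda>n. f (y - e n *\<^sub>R s) * of_real (gaussian s)) \<longlonglongrightarrow> f y * of_real (gaussian s)"
      proof (intro AE_I2 tendsto_mult tendsto_const)
        fix s :: 'b
        have "(\<lambda>n. y - e n *\<^sub>R s) \<longlonglongrightarrow> y - 0 *\<^sub>R s" by (intro tendsto_intros e0)
        then show "(\<lambda>n. f (y - e n *\<^sub>R s)) \<longlonglongrightarrow> f y"
          using schwartz_continuous[OF sf] isCont_tendsto_compose[of y f] by (simp add: continuous_on_eq_continuous_at)
      qed
    qed (use B in \<open>auto simp: norm_mult gaussian_bounds intro!: AE_I2 mult_right_mono\<close>)
  qed
  moreover have "(LINT s|lborel. f y * complex_of_real (gaussian (s::'b))) = f y"
    by (simp add: gaussian_integral)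
  ultimately have "K \<longlonglongrightarrow> f y" by (simp only: K[symmetric])
  with lim1 have "(LINT \<xi>|lborel. cis (2 * pi * (\<xi> \<bullet> y)) * h \<xi>) = f y" by (rule LIMSEQ_unique)
  then show "partial_ft 1 (partial_ft (-1) F) (x, y) = F (x, y)"
    by (simp add: partial_ft_def[of 1] h_def f_def)
qed

subsection \<open>Integration under a tempered distribution\<close>

text \<open>
  Riemann sums over \<open>cbox (-k) k\<close> that converge at a rate depending only on a Lipschitz constant and
  a decay bound of the integrand, hence simultaneously for all seminorms of a Schwartz function.
\<close>

lemma uniform_riemann_sums:
  "\<exists>p::('z \<times> 'z set) set. finite p \<and> (\<forall>f::'z::euclidean_space \<Rightarrow> complex. \<forall>C\<ge>0. \<forall>L\<ge>0.
     (\<forall>z. norm (f z) \<le> C * inverse (bk z ^ Suc (2 * DIM('z)))) \<longrightarrow>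
     (\<forall>z z'. norm (f z - f z') \<le> L * norm (z - z')) \<longrightarrow>
     norm ((LINT z|lborel. f z) - (\<Sum>(z, Q)\<in>p. of_real (measure lborel Q) * f z))
       \<le> (C * (LINT z|lborel. inverse (bk (z::'z) ^ (2 * DIM('z)))) + L) / real (Suc k))"
proof -
  let ?d = "2 * DIM('z)"
  define B where "B = cbox (- (real k *\<^sub>R (One::'z))) (real k *\<^sub>R One)"
  \<comment> \<open>The error on the box is at most L \<delta> times its measure, hence at most L /
    \<open>Suc k\<close>. The summand 1 keeps the denominator positive when the box is a point, as
    for k = 0.\<close>
  define \<delta> where "\<delta> = 1 / (real (Suc k) * (measure lborel B + 1))"
  have mB: "measure lborel B \<ge> 0" by simp
  then have m1: "\<not> measure lborel B + 1 < 0" by linarith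
  have \<delta>: "\<delta> > 0" unfolding \<delta>_def using mB by (intro divide_pos_pos mult_pos_pos add_nonneg_pos) auto
  have "gauge (\<lambda>x::'z. ball x \<delta>)" using \<delta> by (rule gauge_ball)
  then obtain p where p: "p tagged_division_of B" "(\<lambda>x. ball x \<delta>) fine p"
    using fine_division_exists unfolding B_def by blast
  have fin: "finite p" using p(1) by blast
  show ?thesis
  proof (intro exI[of _ p] conjI fin allI impI)
    fix f :: "'z \<Rightarrow> complex" and C L :: real
    assume C: "C \<ge> 0" and L: "L \<ge> 0" and fb: "\<forall>z. norm (f z) \<le> C * inverse (bk z ^ Suc ?d)"
      and fL: "\<forall>z z'. norm (f z - f z') \<le> L * norm (z - z')"
    have cont: "continuous_on UNIV f"
    proof (rule continuous_on_subset[OF lipschitz_on_continuous_on[of L]])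
      show "L-lipschitz_on UNIV f" using fL L by (intro lipschitz_onI) (auto simp: dist_norm)
    qed simp
    have fm: "f \<in> borel_measurable borel" using cont by (rule borel_measurable_continuous_onI)
    have int: "integrable lborel f" using fb by (intro integrable_bound_bk[OF fm, where N="Suc ?d"]) auto
    have fB: "f integrable_on B" unfolding B_def using cont by (intro integrable_continuous) (blast intro: continuous_on_subset)
    have Bm: "B \<in> sets lborel" unfolding B_def by simp
    have sB: "set_integrable lborel B f" unfolding set_integrable_def
      using int Bm by (intro integrable_mult_indicator) auto
    have hk: "(LINT z:B|lborel. f z) = integral B f" using sB by (rule set_borel_integral_eq_integral)
    have split: "(LINT z|lborel. f z) - (LINT z:B|lborel. f z) = (LINT z|lborel. indicator (- B) z *\<^sub>R f z)"
    proof -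
      have "integrable lborel (\<lambda>z. indicator B z *\<^sub>R f z)" using sB by (simp add: set_integrable_def)
      then have "(LINT z|lborel. f z) - (LINT z:B|lborel. f z) = (LINT z|lborel. f z - indicator B z *\<^sub>R f z)"
        unfolding set_lebesgue_integral_def using int by simp
      also have "\<dots> = (LINT z|lborel. indicator (- B) z *\<^sub>R f z)"
        by (intro Bochner_Integration.integral_cong) (auto simp: indicator_def)
      finally show ?thesis .
    qed
    \<comment> \<open>Outside the box \<open>bk z\<close> is at least \<open>Suc k\<close>, so the
      one power of decay beyond \<open>?d\<close> supplies the factor 1 /
      \<open>Suc k\<close>.\<close>
    have tail: "norm (indicator (- B) z *\<^sub>R f z) \<le> (C / real (Suc k)) * inverse (bk z ^ ?d)" for z
    proof (cases "z \<in> B")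
      case False
      then obtain b where b: "b \<in> Basis" "\<not> (- real k \<le> z \<bullet> b \<and> z \<bullet> b \<le> real k)"
        unfolding B_def cbox_def by auto
      then have "real k < \<bar>z \<bullet> b\<bar>" by auto
      also have "\<dots> \<le> norm z" using b by (simp add: Basis_le_norm)
      finally have k: "real (Suc k) \<le> bk z" by (simp add: bk_def)
      have "norm (f z) \<le> C * inverse (bk z ^ ?d) * inverse (bk z)" using fb by (simp add: mult_ac)
      also have "\<dots> \<le> C * inverse (bk z ^ ?d) * inverse (real (Suc k))"
        using C k by (intro mult_left_mono le_imp_inverse_le) (auto simp: bk_nonneg)
      finally show ?thesis using False by (simp add: divide_inverse mult_ac)
    qed (use C in \<open>auto simp: bk_nonneg\<close>)
    have "norm ((LINT z|lborel. f z) - integral B f) \<le> (LINT z|lborel. norm (indicator (- B) z *\<^sub>R f z))"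
      unfolding hk[symmetric] split by (rule integral_norm_bound)
    also have "\<dots> \<le> (LINT z|lborel. (C / real (Suc k)) * inverse (bk (z::'z) ^ ?d))"
    proof (rule integral_mono[OF _ _ tail])
      show "integrable lborel (\<lambda>z. norm (indicator (- B) z *\<^sub>R f z))"
        using int Bm by (intro integrable_norm integrable_mult_indicator) auto
    qed (auto intro!: integrable_mult_right integrable_inverse_bk)
    finally have 1: "norm ((LINT z|lborel. f z) - integral B f) \<le> C * (LINT z|lborel. inverse (bk (z::'z) ^ ?d)) / real (Suc k)"
      by simp
    have "integral B f - (\<Sum>(z, Q)\<in>p. of_real (measure lborel Q) * f z) =
       (\<Sum>(z, Q)\<in>p. integral Q f - of_real (measure lborel Q) * f z)"
      using integral_combine_tagged_division_topdown[OF fB[unfolded B_def] p(1)[unfolded B_def]]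
      by (simp add: B_def sum_subtractf split_def)
    also have "norm \<dots> \<le> (\<Sum>(z, Q)\<in>p. L * \<delta> * measure lborel Q)"
    proof (rule sum_norm_le, clarify)
      fix z Q assume zQ: "(z, Q) \<in> p"
      then obtain a b where Q: "Q = cbox a b" using p(1) by blast
      have sub: "Q \<subseteq> ball z \<delta>" using p(2) zQ unfolding fine_def by blast
      have fQ: "f integrable_on Q" unfolding Q using cont by (intro integrable_continuous) (blast intro: continuous_on_subset)
      have "integral Q f - of_real (measure lborel Q) * f z = integral Q (\<lambda>y. f y - f z)"
        using fQ by (subst Henstock_Kurzweil_Integration.integral_diff) (auto simp: Q scaleR_conv_of_real)
      also have "norm \<dots> \<le> L * \<delta> * measure lborel (cbox a b)"
        unfolding Q
      proof (rule Henstock_Kurzweil_Integration.integrable_bound)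
        fix y assume "y \<in> cbox a b"
        then have "norm (y - z) \<le> \<delta>" using sub Q by (force simp: dist_norm norm_minus_commute)
        then show "norm (f y - f z) \<le> L * \<delta>" using fL L by (meson mult_left_mono order_trans)
      qed (use L \<delta> in \<open>auto intro!: integrable_continuous continuous_intros continuous_on_subset[OF cont]\<close>)
      finally show "norm (integral Q f - of_real (measure lborel Q) * f z) \<le> L * \<delta> * measure lborel Q"
        by (simp add: Q)
    qed
    also have "\<dots> = L * \<delta> * (\<Sum>(z, Q)\<in>p. measure lborel Q)" by (simp add: sum_distrib_left split_def)
    also have "(\<Sum>(z, Q)\<in>p. measure lborel Q) = measure lborel B"
      using additive_content_tagged_division[OF p(1)[unfolded B_def]] by (simp add: B_def)
    also have "L * \<delta> * measure lborel B \<le> L / real (Suc k)"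
    proof -
      have "\<delta> * measure lborel B \<le> 1 / real (Suc k)"
        unfolding \<delta>_def using m1 by (auto simp: divide_simps)
      then have "L * (\<delta> * measure lborel B) \<le> L * (1 / real (Suc k))" using L by (rule mult_left_mono)
      then show ?thesis by simp
    qed
    finally have 2: "norm (integral B f - (\<Sum>(z, Q)\<in>p. of_real (measure lborel Q) * f z)) \<le> L / real (Suc k)" .
    have "norm ((LINT z|lborel. f z) - (\<Sum>(z, Q)\<in>p. of_real (measure lborel Q) * f z)) \<le>
       norm ((LINT z|lborel. f z) - integral B f) + norm (integral B f - (\<Sum>(z, Q)\<in>p. of_real (measure lborel Q) * f z))"
      by (rule order_trans[OF _ norm_triangle_ineq]) simp
    with 1 2 show "norm ((LINT z|lborel. f z) - (\<Sum>(z, Q)\<in>p. of_real (measure lborel Q) * f z))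
       \<le> (C * (LINT z|lborel. inverse (bk (z::'z) ^ ?d)) + L) / real (Suc k)"
      by (simp add: add_divide_distrib)
  qed
qed

lemma schwartz_add: "schwartz f \<Longrightarrow> schwartz g \<Longrightarrow> schwartz (\<lambda>x. f x + g x)"
  unfolding schwartz_iff_family by (rule schwartz_family_add)

lemma schwartz_cmult: "schwartz f \<Longrightarrow> schwartz (\<lambda>x. c * f x)"
  unfolding schwartz_iff_family by (rule schwartz_family_scale) simp_all

lemma schwartz_zero: "schwartz (\<lambda>x. 0)"
  unfolding schwartz_iff_family by (rule schwartz_family_zero)

lemma schwartz_cnj: "schwartz f \<Longrightarrow> schwartz (\<lambda>x. cnj (f x))"
  unfolding schwartz_iff_family by (rule schwartz_family_cnj)

lemma schwartz_sum:
  "finite A \<Longrightarrow> (\<And>a. a \<in> A \<Longrightarrow> schwartz (f a)) \<Longrightarrow> schwartz (\<lambda>x. \<Sum>a\<in>A. f a x)"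
  unfolding schwartz_iff_family by (rule schwartz_family_sum)

lemma tempered_zero: "tempered u \<Longrightarrow> u (\<lambda>x. 0) = 0"
  using tempered_antilinear[OF _ schwartz_zero schwartz_zero, of u 1] by simp

lemma tempered_cmult: "tempered u \<Longrightarrow> schwartz f \<Longrightarrow> u (\<lambda>x. c * f x) = cnj c * u f"
  using tempered_antilinear[OF _ _ schwartz_zero, of u f c] by (simp add: tempered_zero)

lemma tempered_add: "tempered u \<Longrightarrow> schwartz f \<Longrightarrow> schwartz g \<Longrightarrow> u (\<lambda>x. f x + g x) = u f + u g"
  using tempered_antilinear[of u f g 1] by simp

lemma tempered_diff: "tempered u \<Longrightarrow> schwartz f \<Longrightarrow> schwartz g \<Longrightarrow> u (\<lambda>x. f x - g x) = u f - u g"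
  using tempered_antilinear[of u g f "-1"] by simp

lemma tempered_sum:
  assumes "tempered u" "finite A" "\<And>a. a \<in> A \<Longrightarrow> schwartz (f a)"
  shows "u (\<lambda>x. \<Sum>a\<in>A. f a x) = (\<Sum>a\<in>A. u (f a))"
  using assms(2,3) by (induction rule: finite_induct)
    (simp_all add: tempered_zero[OF assms(1)] tempered_add[OF assms(1)] schwartz_sum)

lemma schwartz_sections:
  assumes "schwartz G"
  shows "schwartz_family (\<lambda>_. 0) (\<lambda>z x. of_real (bk z ^ N) * G (z, x))"
  using schwartz_family_index[OF schwartz_family_section[OF schwartz_family_const_iff[OF assms, of "\<lambda>_::unit. 0"], of N],
      of "\<lambda>_. 0" "\<lambda>z. ((), z)"] by simp

lemma schwartz_diff_quotients:
  assumes "schwartz G"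
  shows "schwartz_family (\<lambda>_. 0)
     (\<lambda>p x. of_real (inverse (norm (fst p - snd p))) * (G (fst p, x) - G (snd p, x)))"
  using schwartz_family_index[OF schwartz_family_diff_quotient[OF schwartz_family_const_iff[OF assms, of "\<lambda>_::unit. 0"]],
      of "\<lambda>_. 0" "\<lambda>p. ((), p)"] by (simp add: split_def)

lemma schwartz_lipschitz_decay:
  assumes G: "schwartz (G :: 'z::euclidean_space \<times> 'a::euclidean_space \<Rightarrow> complex)"
  obtains C L where "C \<ge> 0" "L \<ge> 0"
    "\<And>z x. norm (G (z, x)) \<le> C * inverse (bk z ^ A) * inverse (bk x ^ N)"
    "\<And>z z' x. norm (G (z, x) - G (z', x)) \<le> L * norm (z - z') * inverse (bk x ^ N)"
proof -
  have fam: "schwartz_family (\<lambda>_::unit. 0) (\<lambda>_. G)" using G by (simp add: schwartz_iff_family)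
  obtain C M where C: "C \<ge> 0" "\<And>(i::unit) z x. norm (G (z, x)) \<le> C * bk (0::real) ^ M * inverse (bk z ^ A) * inverse (bk x ^ N)"
    by (rule schwartz_family_prod_bound[OF fam]) (rule that)
  obtain L M' where L: "L \<ge> 0" "\<And>p x. norm (of_real (inverse (norm (fst p - snd p))) * (G (fst p, x) - G (snd p, x))) \<le>
       L * bk (0::real) ^ M' * inverse (bk x ^ N)"
    by (rule schwartz_family_decay[OF schwartz_diff_quotients[OF G]]) (rule that)
  have "norm (G (z, x) - G (z', x)) \<le> L * norm (z - z') * inverse (bk x ^ N)" for z z' x
  proof (cases "z = z'")
    case False
    then show ?thesis
      using L(2)[of "(z, z')" x] by (simp add: norm_mult norm_inverse norm_divide field_simps)
  qed (use L(1) in simp)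
  with C L(1) show ?thesis by (intro that[of C L]) auto
qed

text \<open>The same Riemann sums are used inside and outside u. Their errors, multiplied by
  \<open>Suc k\<close>, form a bounded set of Schwartz functions, on which u is bounded; so u of the
  errors tends to 0. The scalar function z \<mapsto> u (G (z, -)) has decay and a Lipschitz constant
  too, hence the sums converge to both sides.\<close>

theorem tempered_integral:
  fixes G :: "'z::euclidean_space \<times> 'a::euclidean_space \<Rightarrow> complex"
  assumes u: "tempered u" and G: "schwartz G"
  shows "integrable lborel (\<lambda>z. u (\<lambda>x. G (z, x)))" (is ?int)
    and "u (\<lambda>x. LINT z|lborel. G (z, x)) = (LINT z|lborel. u (\<lambda>x. G (z, x)))" (is ?eq)
    and "continuous_on UNIV (\<lambda>z. u (\<lambda>x. G (z, x)))" (is ?cont)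
proof -
  let ?d = "2 * DIM('z)"
  define I0 where "I0 = (LINT z|lborel. inverse (bk (z::'z) ^ ?d))"
  have I0: "I0 \<ge> 0" unfolding I0_def by (intro integral_nonneg_AE AE_I2) (simp add: bk_nonneg)
  define F where "F z = u (\<lambda>x. G (z, x))" for z
  have fam: "schwartz_family (\<lambda>_::unit. 0) (\<lambda>_. G)" using G by (simp add: schwartz_iff_family)
  have sec: "schwartz (\<lambda>x. G (z, x))" for z by (rule schwartz_section[OF G])
  obtain CF where CF: "CF \<ge> 0" "\<And>z. norm (u (\<lambda>x. of_real (bk z ^ Suc ?d) * G (z, x))) \<le> CF"
    by (rule tameE[OF tempered_tame[OF u schwartz_sections[OF G, of "Suc ?d"]]])
       (use that in \<open>simp del: power_Suc of_real_power\<close>)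
  have F1: "norm (F z) \<le> CF * inverse (bk z ^ Suc ?d)" for z
  proof -
    have "norm (u (\<lambda>x. of_real (bk z ^ Suc ?d) * G (z, x))) = bk z ^ Suc ?d * norm (F z)"
      unfolding tempered_cmult[OF u sec] F_def by (simp add: norm_mult norm_power)
    with CF(2)[of z] show ?thesis using bk_power_pos[of z "Suc ?d"] by (simp add: field_simps del: power_Suc)
  qed
  obtain LF where LF: "LF \<ge> 0" "\<And>z z'. norm (u (\<lambda>x. of_real (inverse (norm (z - z'))) * (G (z, x) - G (z', x)))) \<le> LF"
  proof (rule tameE[OF tempered_tame[OF u schwartz_diff_quotients[OF G]]])
    fix C M assume "C \<ge> 0" and *: "\<And>p. norm (u (\<lambda>x. of_real (inverse (norm (fst p - snd p))) * (G (fst p, x) - G (snd p, x)))) \<le> C * bk (0::real) ^ M"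
    show thesis using \<open>C \<ge> 0\<close> *[of "(z, z')" for z z'] by (intro that[of C]) simp_all
  qed
  have F2: "norm (F z - F z') \<le> LF * norm (z - z')" for z z'
  proof (cases "z = z'")
    case False
    have eq: "u (\<lambda>x. of_real (inverse (norm (z - z'))) * (G (z, x) - G (z', x))) = of_real (inverse (norm (z - z'))) * (F z - F z')"
      unfolding F_def using sec schwartz_add[OF sec schwartz_cmult[OF sec, of "-1"]]
      by (subst tempered_cmult[OF u]) (auto simp: tempered_diff[OF u])
    have "norm (u (\<lambda>x. of_real (inverse (norm (z - z'))) * (G (z, x) - G (z', x)))) =
        inverse (norm (z - z')) * norm (F z - F z')" unfolding eq norm_mult norm_of_real by simp
    then have "inverse (norm (z - z')) * norm (F z - F z') \<le> LF" using LF(2)[of z z'] by (simp only:)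
    then have "norm (F z - F z') / norm (z - z') \<le> LF" by (simp only: divide_inverse mult.commute)
    moreover have "0 < norm (z - z')" using False by simp
    ultimately show ?thesis by (simp only: pos_divide_le_eq)
  qed simp
  have cont: "continuous_on UNIV F"
    using F2 LF(1) by (intro lipschitz_on_continuous_on[of LF] lipschitz_onI) (auto simp: dist_norm)
  then show ?cont unfolding F_def .
  have "F \<in> borel_measurable borel" using cont by (rule borel_measurable_continuous_onI)
  then have "integrable lborel F" by (rule integrable_bound_bk[OF _ F1]) simp
  then show ?int unfolding F_def .
  define good where "good k p \<longleftrightarrow> finite p \<and> (\<forall>f::'z \<Rightarrow> complex. \<forall>C\<ge>0. \<forall>L\<ge>0.
     (\<forall>z. norm (f z) \<le> C * inverse (bk z ^ Suc ?d)) \<longrightarrow>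
     (\<forall>z z'. norm (f z - f z') \<le> L * norm (z - z')) \<longrightarrow>
     norm ((LINT z|lborel. f z) - (\<Sum>(z, Q)\<in>p. of_real (measure lborel Q) * f z)) \<le> (C * I0 + L) / real (Suc k))"
    for k and p :: "('z \<times> 'z set) set"
  have "\<forall>k. \<exists>p. good k p"
    unfolding I0_def good_def by (rule allI) (rule uniform_riemann_sums)
  from choice[OF this] obtain p where good: "\<forall>k. good k (p k)" ..
  have fin: "finite (p k)" for k using good unfolding good_def by (elim allE conjE)
  have p: "norm ((LINT z|lborel. f z) - (\<Sum>(z, Q)\<in>p k. of_real (measure lborel Q) * f z)) \<le> (C * I0 + L) / real (Suc k)"
    if "C \<ge> 0" "L \<ge> 0" "\<And>z. norm (f z) \<le> C * inverse (bk z ^ Suc ?d)"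
      "\<And>z z'. norm (f z - f z') \<le> L * norm (z - z')" for k and f :: "'z \<Rightarrow> complex" and C L
    using good[rule_format, of k] that unfolding good_def by (elim conjE allE impE) auto
  \<comment> \<open>The rescaled errors of the Riemann sums. Differentiating in x replaces G by a
    derivative of G, so one pointwise estimate serves all seminorms.\<close>
  define R where "R G = (\<lambda>k x. of_nat (Suc k) * ((LINT z|lborel. G (z, x)) - (\<Sum>(z, Q)\<in>p k. of_real (measure lborel Q) * G (z, x))))"
    for G :: "'z \<times> 'a \<Rightarrow> complex"
  have R: "schwartz_family (\<lambda>_. 0) (R G)"
    unfolding schwartz_family_def
  proof (intro allI Ck_coinduct[where P="\<lambda>H. \<exists>G. schwartz G \<and> H = R G"])
    fix H assume "\<exists>G. schwartz G \<and> H = R G"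
    then obtain G where G: "schwartz G" "H = R G" by blast
    show "rapid (\<lambda>_. 0) H"
    proof (rule rapidI)
      fix N
      obtain C L where C: "C \<ge> 0" "L \<ge> 0"
         "\<And>z x. norm (G (z, x)) \<le> C * inverse (bk z ^ Suc ?d) * inverse (bk x ^ N)"
         "\<And>z z' x. norm (G (z, x) - G (z', x)) \<le> L * norm (z - z') * inverse (bk x ^ N)"
        by (rule schwartz_lipschitz_decay[OF G(1)]) (rule that)
      have "bk x ^ N * norm (H k x) \<le> C * I0 + L" for k x
      proof -
        have "norm ((LINT z|lborel. G (z, x)) - (\<Sum>(z, Q)\<in>p k. of_real (measure lborel Q) * G (z, x))) \<le>
          (C * inverse (bk x ^ N) * I0 + L * inverse (bk x ^ N)) / real (Suc k)"
          using C by (intro p) (auto simp: mult_ac bk_nonneg simp del: power_Suc)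
        then have "norm (H k x) \<le> real (Suc k) * \<dots>"
          unfolding G(2) R_def norm_mult by (intro mult_mono) (auto simp: norm_of_nat simp del: of_nat_Suc)
        then have "bk x ^ N * norm (H k x) \<le> bk x ^ N * (C * inverse (bk x ^ N) * I0 + L * inverse (bk x ^ N))"
          by (intro mult_left_mono) (auto simp: bk_nonneg)
        then show ?thesis by (simp add: algebra_simps)
      qed
      then show "\<exists>C M. \<forall>k x. bk x ^ N * norm (H k x) \<le> C * bk (0::real) ^ M" by auto
    qed
    have famG: "schwartz_family (\<lambda>_::unit. 0) (\<lambda>_. G)" using G(1) by (simp add: schwartz_iff_family)
    obtain D0 where D0: "\<And>(i::unit) x. (G has_derivative D0 i x) (at x)" "\<And>b. schwartz_family (\<lambda>_::unit. 0) (\<lambda>i x. D0 i x b)"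
      by (rule schwartz_family_deriv[OF famG]) (rule that)
    define D where "D = D0 ()"
    have D: "\<And>x. (G has_derivative D x) (at x)" using D0(1) by (simp add: D_def)
    have sD: "schwartz (\<lambda>x. D x b)" for b
      unfolding D_def by (rule schwartz_family_imp_schwartz[OF D0(2), of "()"])
    have "(H k has_derivative (\<lambda>b. R (\<lambda>q. D q (0, b)) k x)) (at x)" for k x
    proof -
      have i: "((\<lambda>x. LINT z|lborel. 1 * G (z, x)) has_derivative (\<lambda>b. LINT z|lborel. 1 * D (z, x) (0, b))) (at x)"
        by (rule schwartz_family_integral_deriv[OF famG, where ?C1.0=1 and K=0]) (use D in auto)
      show ?thesis
        unfolding G(2) R_def split_def
        using i by (intro has_derivative_mult_right has_derivative_diff has_derivative_sum
            has_derivative_compose[OF has_derivative_Pair_left D]) auto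
    qed
    then show "\<exists>D. (\<forall>k x. (H k has_derivative D k x) (at x)) \<and> (\<forall>b. \<exists>G. schwartz G \<and> (\<lambda>k x. D k x b) = R G)"
      using sD by (intro exI[of _ "\<lambda>k x b. R (\<lambda>q. D q (0, b)) k x"] conjI allI exI[of _ "\<lambda>q. D q (0, b)" for b]) auto
  qed (use G in blast)
  obtain CR where CR: "\<And>k. norm (u (R G k)) \<le> CR"
    by (rule tameE[OF tempered_tame[OF u R]]) (rule that, simp)
  define S where "S k = (\<Sum>(z, Q)\<in>p k. of_real (measure lborel Q) * F z)" for k
  have sH: "schwartz (\<lambda>x. LINT z|lborel. G (z, x))"
    using schwartz_family_imp_schwartz[OF schwartz_family_integral[OF fam, of "\<lambda>_. 1" 1 0]] by simp
  have uS: "u (R G k) = of_nat (Suc k) * (u (\<lambda>x. LINT z|lborel. G (z, x)) - S k)" for k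
  proof -
    have s: "schwartz (\<lambda>x. \<Sum>q\<in>p k. of_real (measure lborel (snd q)) * G (fst q, x))"
      by (intro schwartz_sum fin schwartz_cmult sec)
    have "schwartz (\<lambda>x. (LINT z|lborel. G (z, x)) - (\<Sum>q\<in>p k. of_real (measure lborel (snd q)) * G (fst q, x)))"
      using schwartz_add[OF sH schwartz_cmult[OF s, of "-1"]] by simp
    then show ?thesis
      unfolding R_def S_def split_def
      by (subst tempered_cmult[OF u])
         (auto simp: tempered_diff[OF u sH s] tempered_sum[OF u fin] schwartz_cmult sec tempered_cmult[OF u] F_def)
  qed
  have b1: "norm (u (\<lambda>x. LINT z|lborel. G (z, x)) - S k) \<le> CR / real (Suc k)" for k
    using CR[of k] unfolding uS norm_mult by (simp add: field_simps norm_of_nat del: of_nat_Suc)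
  have b2: "norm ((LINT z|lborel. F z) - S k) \<le> (CF * I0 + LF) / real (Suc k)" for k
    unfolding S_def by (rule p[OF CF(1) LF(1) F1 F2])
  have lim0: "(\<lambda>k. c / real (Suc k)) \<longlonglongrightarrow> 0" for c
    using tendsto_mult[OF tendsto_const LIMSEQ_inverse_real_of_nat, of c] by (simp add: divide_inverse)
  have "S \<longlonglongrightarrow> u (\<lambda>x. LINT z|lborel. G (z, x))"
    by (rule metric_tendsto_imp_tendsto[OF lim0[of CR]])
       (auto simp: dist_norm norm_minus_commute[of "S _"] intro!: always_eventually order_trans[OF b1] divide_right_mono)
  moreover have "S \<longlonglongrightarrow> (LINT z|lborel. F z)"
    by (rule metric_tendsto_imp_tendsto[OF lim0[of "CF * I0 + LF"]])
       (auto simp: dist_norm norm_minus_commute[of "S _"] intro!: always_eventually order_trans[OF b2] divide_right_mono)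
  ultimately show ?eq unfolding F_def by (rule LIMSEQ_unique)
qed

subsection \<open>The short-time Fourier transform\<close>

definition tfz :: "'a::euclidean_space \<times> 'a \<Rightarrow> ('a \<Rightarrow> complex) \<Rightarrow> 'a \<Rightarrow> complex" where
  "tfz z g = tf_shift (fst z) (snd z) g"

lemma tfz_apply: "tfz z g t = cis (2 * pi * (snd z \<bullet> t)) * g (t - fst z)"
  by (simp add: tfz_def tf_shift_def)

lemma stft_eq: "stft g u z = u (tfz z g)"
  by (simp add: stft_def tfz_def split_def)

text \<open>A translation changes \<open>bk\<close> by at most the factor \<open>bk z\<close>, and a
  modulation brings down powers of the frequency: the seminorms of shifts grow polynomially in z.
  Through \<open>tempered_tame\<close> this gives the polynomial growth of short-time Fourier
  transforms.\<close>

lemma schwartz_family_tfz: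
  assumes "schwartz g" shows "schwartz_family norm (\<lambda>z. tfz z g)"
proof -
  have "schwartz_family norm (\<lambda>(z::'a \<times> 'a) t. g (t - fst z))"
  proof (rule schwartz_family_compose[OF schwartz_family_const_iff[OF assms], where A="\<lambda>_ b. b" and ?C0.0=1 and ?M0.0=1 and K=1])
    fix z :: "'a \<times> 'a" and x b :: 'a
    show "((\<lambda>t. t - fst z) has_derivative (\<lambda>b. b)) (at x)" by (auto intro!: derivative_eq_intros)
    have "bk x \<le> bk (x - fst z) * bk (fst z)" using bk_add_le[of "x - fst z" "fst z"] by simp
    also have "\<dots> \<le> bk (x - fst z) * bk z"
      using bk_fst_le[of "fst z" "snd z"] by (intro mult_left_mono) (auto simp: bk_nonneg)
    finally show "bk x \<le> 1 * bk (norm z) ^ 1 * bk (x - fst z) ^ 1" by (simp add: mult.commute)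
  qed auto
  then have "schwartz_family norm (\<lambda>z t. cis (2 * pi * (t \<bullet> snd z)) * g (t - fst z))"
  proof (rule schwartz_family_modulate)
    have "norm (snd z) \<le> bk z" for z :: "'a \<times> 'a"
      using bk_snd_le[of "snd z" "fst z"] norm_le_bk[of "snd z"] by simp
    then show "tame norm (\<lambda>z::'a \<times> 'a. norm (snd z))" by (intro tame_mono[OF tame_self]) simp
  qed
  then show ?thesis by (simp add: tfz_apply[abs_def] inner_commute)
qed

lemma schwartz_tfz: "schwartz g \<Longrightarrow> schwartz (tfz z g)"
  using schwartz_family_imp_schwartz[OF schwartz_family_tfz] by blast

lemma borel_measurable_cnj [measurable]: "cnj \<in> borel_measurable borel"
  by (intro borel_measurable_continuous_onI continuous_intros)

text \<open>The transform of a function as an integral, kept apart from \<open>stft\<close>, which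
  acts on distributions; the two are related through \<open>dist_of\<close>.\<close>

definition fstft :: "('a::euclidean_space \<Rightarrow> complex) \<Rightarrow> ('a \<Rightarrow> complex) \<Rightarrow> 'a \<times> 'a \<Rightarrow> complex" where
  "fstft g h z = (LINT t|lborel. h t * cnj (tfz z g t))"

lemma stft_dist_of: "schwartz g \<Longrightarrow> stft g (dist_of h) z = fstft g h z"
  by (simp add: stft_eq dist_of_def fstft_def schwartz_tfz)

lemma fstft_partial_ft: "fstft g h = partial_ft (-1) (\<lambda>(x, t). h t * cnj (g (t - x)))"
  by (auto simp: fun_eq_iff fstft_def partial_ft_def tfz_apply cis_cnj inner_commute mult_ac intro!: Bochner_Integration.integral_cong)

text \<open>The left inverse \<open>M\<close> bounds \<open>norm x\<close> by a multiple of
  \<open>norm (L x)\<close>, the properness needed for composition. It serves shears and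
  permutations of coordinates.\<close>

lemma schwartz_family_linear_iso:
  fixes L :: "'a::euclidean_space \<Rightarrow> 'b::euclidean_space"
  assumes F: "schwartz_family w F" and L: "bounded_linear L" and M: "bounded_linear M" and inv: "\<And>x. M (L x) = x"
  shows "schwartz_family w (\<lambda>i x. F i (L x))"
proof -
  obtain K where K: "K > 0" "\<And>y. norm (M y) \<le> norm y * K" using bounded_linear.pos_bounded[OF M] by blast
  show ?thesis
  proof (rule schwartz_family_compose[OF F, where A="\<lambda>_. L" and ?C0.0="1 + K" and ?M0.0=0 and K=1])
    fix i x
    show "(L has_derivative L) (at x)" by (rule bounded_linear_imp_has_derivative[OF L])
    have "norm x \<le> norm (L x) * K" using K(2)[of "L x"] by (simp add: inv)
    also have "\<dots> \<le> bk (L x) * K" using K(1) norm_le_bk by (intro mult_right_mono) auto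
    finally show "bk x \<le> (1 + K) * bk (w i) ^ 0 * bk (L x) ^ 1"
      using bk_ge1[of "L x"] by (simp add: bk_def[of x] algebra_simps)
  qed (use K in auto)
qed

lemma schwartz_linear_iso:
  fixes L :: "'a::euclidean_space \<Rightarrow> 'b::euclidean_space"
  assumes "schwartz F" "bounded_linear L" "bounded_linear M" "\<And>x. M (L x) = x"
  shows "schwartz (\<lambda>x. F (L x))"
  using assms unfolding schwartz_iff_family by (rule schwartz_family_linear_iso)

lemma schwartz_family_fstft:
  assumes g: "schwartz_family w g" and h: "schwartz_family w h"
  shows "schwartz_family w (\<lambda>i. fstft (g i) (h i))"
proof -
  have 1: "schwartz_family w (\<lambda>i (x, t). cnj (g i x) * h i t)"
    by (intro schwartz_family_tensor schwartz_family_cnj g h)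
  have "schwartz_family w (\<lambda>i p. (\<lambda>(x, t). cnj (g i x) * h i t) (snd p - fst p, snd p))"
    by (rule schwartz_family_linear_iso[OF 1, where M="\<lambda>p. (snd p - fst p, snd p)"])
       (auto intro!: bounded_linear_intros)
  then have "schwartz_family w (\<lambda>i (x, t). h i t * cnj (g i (t - x)))"
    by (simp add: split_def mult.commute)
  then show ?thesis unfolding fstft_partial_ft by (rule schwartz_family_partial_ft) simp
qed

lemma schwartz_fstft: "schwartz g \<Longrightarrow> schwartz h \<Longrightarrow> schwartz (fstft g h)"
  unfolding schwartz_iff_family by (rule schwartz_family_fstft)

text \<open>Covariance: the substitution of \<open>fst z + t\<close> for t moves the shift of h onto
  the window, and composing the two shifts leaves a phase.\<close>

lemma fstft_tfz:
  fixes g h :: "'a::euclidean_space \<Rightarrow> complex"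
  assumes "h \<in> borel_measurable borel" "g \<in> borel_measurable borel"
  shows "fstft g (tfz z h) z' = cis (2 * pi * ((snd z - snd z') \<bullet> fst z)) * fstft g h (z' - z)"
proof -
  note [measurable] = assms
  have "fstft g (tfz z h) z' = (LINT t|lborel. tfz z h t * cnj (tfz z' g t))" by (simp add: fstft_def)
  also have "\<dots> = (LINT t|lborel. tfz z h (fst z + t) * cnj (tfz z' g (fst z + t)))"
    by (rule integral_lborel_translate[symmetric]) (simp add: tfz_apply[abs_def])
  also have "\<dots> = (LINT t|lborel. cis (2 * pi * ((snd z - snd z') \<bullet> fst z)) * (h t * cnj (tfz (z' - z) g t)))"
  proof (intro Bochner_Integration.integral_cong refl)
    fix t
    have "tfz z h (fst z + t) * cnj (tfz z' g (fst z + t)) =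
      (cis (2 * pi * (snd z \<bullet> (fst z + t))) * cis (- (2 * pi * (snd z' \<bullet> (fst z + t))))) * (h t * cnj (g (t - (fst z' - fst z))))"
      by (simp add: tfz_apply cis_cnj algebra_simps)
    also have "cis (2 * pi * (snd z \<bullet> (fst z + t))) * cis (- (2 * pi * (snd z' \<bullet> (fst z + t)))) =
      cis (2 * pi * ((snd z - snd z') \<bullet> fst z)) * cis (- (2 * pi * (snd (z' - z) \<bullet> t)))"
      unfolding cis_mult by (rule arg_cong[where f=cis]) (simp add: inner_simps algebra_simps)
    finally show "tfz z h (fst z + t) * cnj (tfz z' g (fst z + t)) =
        cis (2 * pi * ((snd z - snd z') \<bullet> fst z)) * (h t * cnj (tfz (z' - z) g t))"
      by (simp add: tfz_apply cis_cnj mult_ac)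
  qed
  finally show ?thesis by (simp add: fstft_def)
qed

lemma norm_fstft_tfz:
  assumes "h \<in> borel_measurable borel" "g \<in> borel_measurable borel"
  shows "norm (fstft g (tfz z h) z') = norm (fstft g h (z' - z))"
  by (simp add: fstft_tfz[OF assms] norm_mult)

abbreviation energy :: "('a::euclidean_space \<Rightarrow> complex) \<Rightarrow> real" where
  "energy g \<equiv> LINT x|lborel. (norm (g x))\<^sup>2"

lemma schwartz_mult: "schwartz f \<Longrightarrow> schwartz g \<Longrightarrow> schwartz (\<lambda>x. f x * g x)"
proof -
  assume f: "schwartz f" and g: "schwartz g"
  have "slow_family (\<lambda>_::unit. 0) (\<lambda>_. f)"
    unfolding slow_family_def
  proof (intro allI Ck_coinduct[where P="\<lambda>H. schwartz_family (\<lambda>_::unit. 0) H"])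
    show "schwartz_family (\<lambda>_::unit. 0) (\<lambda>_. f)" using f by (simp add: schwartz_iff_family)
    fix H :: "unit \<Rightarrow> 'a \<Rightarrow> complex" assume H: "schwartz_family (\<lambda>_. 0) H"
    obtain C M where "C \<ge> 0" "\<And>i x. norm (H i x) \<le> C * bk (0::real) ^ M * inverse (bk x ^ 0)"
      by (rule schwartz_family_decay[OF H]) (rule that)
    then show "slow (\<lambda>_. 0) H" by (intro slowI[where C=C and M=0 and K=0]) auto
    obtain D where "\<And>i x. (H i has_derivative D i x) (at x)" "\<And>b. schwartz_family (\<lambda>_. 0) (\<lambda>i x. D i x b)"
      by (rule schwartz_family_deriv[OF H]) (rule that)
    then show "\<exists>D. (\<forall>i x. (H i has_derivative D i x) (at x)) \<and> (\<forall>b. schwartz_family (\<lambda>_. 0) (\<lambda>i x. D i x b))"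
      by blast
  qed
  then show ?thesis using g unfolding schwartz_iff_family by (rule schwartz_family_mult)
qed

lemma energy_complex:
  assumes "schwartz g"
  shows "(LINT a|lborel. g (x - a) * cnj (g (x - a))) = of_real (energy g)"
proof -
  have [measurable]: "g \<in> borel_measurable borel" by (rule schwartz_measurable[OF assms])
  have "(LINT a|lborel. g (x - a) * cnj (g (x - a))) = (LINT a|lborel. g a * cnj (g a))"
    by (rule integral_lborel_reflect) measurable
  also have "\<dots> = (LINT a|lborel. complex_of_real ((norm (g a))\<^sup>2))"
    by (intro Bochner_Integration.integral_cong refl) (rule complex_norm_square[symmetric])
  finally show ?thesis by (simp del: of_real_power)
qed

lemma continuous_AE_zero:
  fixes g :: "'a::euclidean_space \<Rightarrow> 'b::real_normed_vector"
  assumes "continuous_on UNIV g" "AE x in lborel. g x = 0"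
  shows "g x = 0"
proof (rule ccontr)
  assume "g x \<noteq> 0"
  have op: "open {x. g x \<noteq> 0}" using assms(1) by (intro open_Collect_neq continuous_on_const)
  then have "\<not> negligible {x. g x \<noteq> 0}" using \<open>g x \<noteq> 0\<close> by (intro open_not_negligible) auto
  moreover have "{x. g x \<noteq> 0} \<in> null_sets lborel"
    using op assms(2) by (subst AE_iff_null_sets) auto
  ultimately show False using negligible_iff_null_sets null_sets_completionI by blast
qed

lemma energy_pos:
  assumes g: "schwartz g" and nz: "g \<noteq> (\<lambda>_. 0)"
  shows "energy g > 0"
proof -
  have [measurable]: "g \<in> borel_measurable borel" by (rule schwartz_measurable[OF g])
  have int: "integrable lborel (\<lambda>x. (norm (g x))\<^sup>2)"
  proof -
    have "integrable lborel (\<lambda>x. norm (g x * cnj (g x)))"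
      by (intro integrable_norm schwartz_integrable schwartz_mult schwartz_cnj g)
    then show ?thesis by (simp add: norm_mult power2_eq_square)
  qed
  have "energy g \<noteq> 0"
  proof
    assume "energy g = 0"
    then have "AE x in lborel. g x = 0"
      using int by (subst (asm) integral_nonneg_eq_0_iff_AE) auto
    then have "g x = 0" for x by (rule continuous_AE_zero[OF schwartz_continuous[OF g]])
    with nz show False by (simp add: fun_eq_iff)
  qed
  moreover have "energy g \<ge> 0" by (intro integral_nonneg_AE AE_I2) simp
  ultimately show ?thesis by linarith
qed

text \<open>For phases that are quadratic in the joint variable: the inner product is expanded over
  the basis into products of linear forms.\<close>

lemma slow_family_bilinear:
  fixes f g :: "'a::euclidean_space \<Rightarrow> 'b::euclidean_space"
  assumes "bounded_linear f" "bounded_linear g"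
  shows "slow_family w (\<lambda>_ x. complex_of_real (c * (f x \<bullet> g x)))"
proof -
  have lin: "slow_family w (\<lambda>_ x. complex_of_real (k x \<bullet> b))" if "bounded_linear k" for k :: "'a \<Rightarrow> 'b" and b
    using that by (intro slow_family_linear[where A="\<lambda>_ x. k x \<bullet> b"])
      (auto intro: bounded_linear_compose[OF bounded_linear_inner_left])
  have "slow_family w (\<lambda>_ x. complex_of_real c * (\<Sum>b\<in>Basis. complex_of_real (f x \<bullet> b) * complex_of_real (g x \<bullet> b)))"
    by (intro slow_family_mult slow_family_sum lin assms slow_family_const) auto
  then show ?thesis by (subst euclidean_inner) simp
qed

text \<open>The integrand of the inversion formula as one function of z and x. Being jointly
  Schwartz, it is a legitimate argument of \<open>tempered_integral\<close>.\<close>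

definition synth :: "('a::euclidean_space \<Rightarrow> complex) \<Rightarrow> ('a \<Rightarrow> complex) \<Rightarrow> ('a \<times> 'a) \<times> 'a \<Rightarrow> complex" where
  "synth g h = (\<lambda>(z, x). fstft g h z * tfz z g x)"

lemma schwartz_synth:
  assumes g: "schwartz g" and h: "schwartz h"
  shows "schwartz (synth g h)"
proof -
  have 1: "schwartz_family (\<lambda>_::unit. 0) (\<lambda>_ (z, x). fstft g h z * g x)"
    using schwartz_fstft[OF g h] g unfolding schwartz_iff_family by (intro schwartz_family_tensor)
  have 2: "schwartz_family (\<lambda>_::unit. 0) (\<lambda>_ p. (\<lambda>(z, x). fstft g h z * g x) (fst p, snd p - fst (fst p)))"
    by (rule schwartz_family_linear_iso[OF 1, where M="\<lambda>p. (fst p, snd p + fst (fst p))"])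
       (auto intro!: bounded_linear_intros)
  have "slow_family (\<lambda>_::unit. 0) (\<lambda>_ p. cis (2 * pi * (snd (fst p) \<bullet> (snd p :: 'a))))"
    by (intro slow_family_cis slow_family_bilinear) (auto intro!: bounded_linear_intros)
  from schwartz_family_mult[OF this 2] show ?thesis
    unfolding schwartz_iff_family by (simp add: synth_def split_def tfz_apply mult_ac)
qed

text \<open>For a fixed position a, the frequency integral inverts a partial Fourier transform and
  returns h x times the conjugate of g (x - a); integrating this against g (x - a) over a leaves the
  energy of g.\<close>

theorem fstft_inversion:
  assumes g: "schwartz g" and h: "schwartz h"
  shows "(LINT z|lborel. fstft g h z * tfz z g x) = of_real (energy g) * h x"
proof -
  let ?P = "\<lambda>(a, t). h t * cnj (g (t - a))"
  have sP: "schwartz ?P"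
  proof -
    have 1: "schwartz (\<lambda>(a, t). cnj (g a) * h t)"
      using g h schwartz_cnj[OF g] unfolding schwartz_iff_family by (intro schwartz_family_tensor)
    have "schwartz (\<lambda>p. (\<lambda>(a, t). cnj (g a) * h t) (snd p - fst p, snd p))"
      by (rule schwartz_linear_iso[OF 1, where M="\<lambda>p. (snd p - fst p, snd p)"])
         (auto intro!: bounded_linear_intros)
    then show ?thesis by (simp add: split_def mult.commute)
  qed
  have inv: "(LINT \<xi>|lborel. cis (2 * pi * (\<xi> \<bullet> x)) * fstft g h (a, \<xi>)) = h x * cnj (g (x - a))" for a
    using fun_cong[OF partial_ft_inversion[OF sP], of "(a, x)"]
    by (simp add: partial_ft_def[of 1] fstft_partial_ft)
  have "schwartz (\<lambda>p. synth g h (snd p, fst p))"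
    by (rule schwartz_linear_iso[OF schwartz_synth[OF g h], where L="\<lambda>p. (snd p, fst p)" and M="\<lambda>p. (snd p, fst p)"])
       (auto intro!: bounded_linear_intros)
  from schwartz_section[OF this, of x] have "schwartz (\<lambda>z. fstft g h z * tfz z g x)"
    by (simp add: synth_def)
  from schwartz_integrable[OF this]
  have int: "integrable lborel (\<lambda>(a, \<xi>). fstft g h (a, \<xi>) * tfz (a, \<xi>) g x)" by (simp add: split_def)
  have "(LINT z|lborel. fstft g h z * tfz z g x) = (LINT a|lborel. LINT \<xi>|lborel. fstft g h (a, \<xi>) * tfz (a, \<xi>) g x)"
    using fubini_lborel(1)[OF int] by simp
  also have "\<dots> = (LINT a|lborel. LINT \<xi>|lborel. g (x - a) * (cis (2 * pi * (\<xi> \<bullet> x)) * fstft g h (a, \<xi>)))"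
    by (simp add: tfz_apply mult_ac)
  also have "\<dots> = (LINT a|lborel. h x * (g (x - a) * cnj (g (x - a))))"
    unfolding integral_mult_right_zero inv by (simp add: mult_ac)
  also have "\<dots> = of_real (energy g) * h x"
    by (simp add: energy_complex[OF g])
  finally show ?thesis .
qed

text \<open>The inversion formula for h with u taken under the integral; antilinearity of u
  conjugates the coefficient \<open>fstft g h z\<close>.\<close>

theorem stft_reproducing:
  assumes u: "tempered u" and g: "schwartz g" and h: "schwartz h"
  shows "integrable lborel (\<lambda>z. stft g u z * cnj (fstft g h z))"
    and "(LINT z|lborel. stft g u z * cnj (fstft g h z)) = of_real (energy g) * u h"
proof -
  have eq: "u (\<lambda>x. synth g h (z, x)) = stft g u z * cnj (fstft g h z)" for z
    unfolding synth_def by (simp add: tempered_cmult[OF u schwartz_tfz[OF g]] stft_eq)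
  show "integrable lborel (\<lambda>z. stft g u z * cnj (fstft g h z))"
    using tempered_integral(1)[OF u schwartz_synth[OF g h]] by (simp add: eq)
  have "(LINT z|lborel. stft g u z * cnj (fstft g h z)) = u (\<lambda>x. LINT z|lborel. synth g h (z, x))"
    using tempered_integral(2)[OF u schwartz_synth[OF g h]] by (simp add: eq)
  also have "(\<lambda>x. LINT z|lborel. synth g h (z, x)) = (\<lambda>x. of_real (energy g) * h x)"
    by (simp add: synth_def fstft_inversion[OF g h])
  finally show "(LINT z|lborel. stft g u z * cnj (fstft g h z)) = of_real (energy g) * u h"
    by (simp add: tempered_cmult[OF u h])
qed

lemma stft_growth:
  assumes u: "tempered u" and g: "schwartz g"
  obtains C K where "C \<ge> 0" "\<And>z. norm (stft g u z) \<le> C * bk z ^ K"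
proof -
  from tempered_tame[OF u schwartz_family_tfz[OF g]] obtain C K where
    "C \<ge> 0" "\<And>z. norm (u (tfz z g)) \<le> C * bk (norm z) ^ K" by (rule tameE) (rule that)
  then show ?thesis by (intro that[of C K]) (auto simp: stft_eq)
qed

lemma borel_measurable_fst_prod [measurable]:
    "fst \<in> borel_measurable (borel :: ('a::euclidean_space \<times> 'b::euclidean_space) measure)"
  and borel_measurable_snd_prod [measurable]:
    "snd \<in> borel_measurable (borel :: ('a::euclidean_space \<times> 'b::euclidean_space) measure)"
  by (intro borel_measurable_continuous_onI continuous_intros)+

subsection \<open>Mixed norms\<close>

text \<open>Powers on \<open>[0,\<infinity>]\<close> with the convention \<open>x\<^sup>0 = 1\<close>, also for \<open>x = 0\<close> and \<open>x = \<infinity>\<close>.\<close>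

definition pw :: "ennreal \<Rightarrow> real \<Rightarrow> ennreal" where
  "pw x r = (if r = 0 then 1 else epowr x r)"

lemma pw_0 [simp]: "pw x 0 = 1"
  by (simp add: pw_def)

lemma pw_1 [simp]: "pw x 1 = x"
  by (cases x) (auto simp: pw_def epowr_def)

lemma pw_real: "0 < a \<Longrightarrow> pw (ennreal a) r = ennreal (a powr r)"
  by (simp add: pw_def epowr_def)

lemma pw_top: "0 < r \<Longrightarrow> pw top r = top"
  by (simp add: pw_def epowr_def)

lemma pw_zero: "0 < r \<Longrightarrow> pw 0 r = 0"
  by (simp add: pw_def epowr_def)

lemma pw_one [simp]: "pw 1 r = 1"
  using pw_real[of 1 r] by simp

lemma ennreal_cases3: obtains "x = (0::ennreal)" | a where "0 < a" "x = ennreal a" | "x = \<infinity>"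
  by (cases x) (metis ennreal_0 infinity_ennreal_def less_eq_real_def)+

lemma pw_eq_0_iff: "0 < r \<Longrightarrow> pw x r = 0 \<longleftrightarrow> x = 0"
  by (cases x rule: ennreal_cases3) (auto simp: pw_zero pw_top pw_real)

lemma pw_eq_top_iff: "0 < r \<Longrightarrow> pw x r = top \<longleftrightarrow> x = top"
  by (cases x rule: ennreal_cases3) (auto simp: pw_zero pw_top pw_real)

lemma pw_finite: "0 \<le> r \<Longrightarrow> x < top \<Longrightarrow> pw x r < top"
  using pw_eq_top_iff[of r x] by (cases "r = 0") (auto simp: less_top)

lemma pw_add:
  assumes "0 \<le> r" "0 \<le> s" shows "pw x (r + s) = pw x r * pw x s"
proof (cases "r = 0 \<or> s = 0")
  case False
  then have "0 < r" "0 < s" using assms by auto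
  then show ?thesis
    by (cases x rule: ennreal_cases3) (auto simp: pw_zero pw_top pw_real powr_add ennreal_mult')
qed auto

lemma pw_mult:
  assumes "0 \<le> r" shows "pw (x * y) r = pw x r * pw y r"
proof (cases "r = 0")
  case False
  then have r: "0 < r" using assms by simp
  then show ?thesis
    by (cases x rule: ennreal_cases3; cases y rule: ennreal_cases3)
       (auto simp: pw_zero pw_top pw_real powr_mult ennreal_mult'[symmetric] ennreal_mult_top ennreal_top_mult)
qed simp

lemma pw_pw:
  assumes "0 \<le> r" "0 \<le> s" shows "pw (pw x r) s = pw x (r * s)"
proof (cases "r = 0 \<or> s = 0")
  case False
  then have "0 < r" "0 < s" using assms by auto
  then show ?thesis
    by (cases x rule: ennreal_cases3) (auto simp: pw_zero pw_top pw_real powr_powr)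
qed auto

lemma pw_mono:
  assumes "0 \<le> r" "x \<le> y" shows "pw x r \<le> pw y r"
proof (cases "r = 0")
  case False
  then have r: "0 < r" using assms by simp
  then show ?thesis using assms(2)
    by (cases x rule: ennreal_cases3; cases y rule: ennreal_cases3)
       (auto simp: pw_zero pw_top pw_real powr_mono2 top_unique)
qed simp

lemma borel_measurable_pw [measurable]: "(\<lambda>x. pw x r) \<in> borel_measurable borel"
  unfolding pw_def epowr_def by measurable

lemma ennreal_mult_div_cancel: "c \<noteq> 0 \<Longrightarrow> c \<noteq> top \<Longrightarrow> c * (x / c) = (x::ennreal)"
  by (metis ennreal_times_divide mult.commute mult_divide_eq_ennreal)

section \<open>Hoelder's inequality with several factors\<close>

lemma amgm_real:
  assumes "finite I" "I \<noteq> {}" "(\<Sum>i\<in>I. l i) = 1" "\<And>i. i \<in> I \<Longrightarrow> 0 \<le> l i" "\<And>i. i \<in> I \<Longrightarrow> 0 < (x i :: real)"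
  shows "(\<Prod>i\<in>I. x i powr l i) \<le> (\<Sum>i\<in>I. l i * x i)"
proof -
  have "exp (\<Sum>i\<in>I. l i *\<^sub>R ln (x i)) \<le> (\<Sum>i\<in>I. l i * exp (ln (x i)))"
    using assms by (intro convex_on_sum[OF _ _ exp_convex]) auto
  moreover have "exp (\<Sum>i\<in>I. l i *\<^sub>R ln (x i)) = (\<Prod>i\<in>I. x i powr l i)"
    using assms(1) less_imp_neq[OF assms(5)] by (subst exp_sum) (auto intro!: prod.cong simp: powr_def)
  moreover have "(\<Sum>i\<in>I. l i * exp (ln (x i))) = (\<Sum>i\<in>I. l i * x i)"
    using assms(5) by (intro sum.cong) auto
  ultimately show ?thesis by simp
qed

lemma amgm_pw:
  assumes fin: "finite I" and l: "(\<Sum>i\<in>I. l i) = 1" "\<And>i. i \<in> I \<Longrightarrow> 0 \<le> l i"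
  shows "(\<Prod>i\<in>I. pw (x i) (l i)) \<le> (\<Sum>i\<in>I. ennreal (l i) * x i)"
proof -
  define J where "J = {i\<in>I. 0 < l i}"
  have J: "finite J" "\<And>i. i \<in> J \<Longrightarrow> 0 < l i" using fin by (auto simp: J_def)
  have z: "l i = 0" if "i \<in> I - J" for i using that l(2)[of i] by (auto simp: J_def)
  have JI: "J \<subseteq> I" by (auto simp: J_def)
  have "(\<Sum>i\<in>I. l i) = (\<Sum>i\<in>J. l i)" by (rule sum.mono_neutral_right[OF fin JI]) (simp add: z)
  then have sJ: "(\<Sum>i\<in>J. l i) = 1" using l(1) by simp
  then have ne: "J \<noteq> {}" by auto
  have e1: "(\<Prod>i\<in>I. pw (x i) (l i)) = (\<Prod>i\<in>J. pw (x i) (l i))"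
    by (rule prod.mono_neutral_right[OF fin JI]) (simp add: z)
  have e2: "(\<Sum>i\<in>I. ennreal (l i) * x i) = (\<Sum>i\<in>J. ennreal (l i) * x i)"
    by (rule sum.mono_neutral_right[OF fin JI]) (simp add: z)
  consider "\<exists>i\<in>J. x i = \<infinity>" | "\<forall>i\<in>J. x i \<noteq> \<infinity>" "\<exists>i\<in>J. x i = 0" | "\<forall>i\<in>J. x i \<noteq> \<infinity> \<and> x i \<noteq> 0" by blast
  then show ?thesis
  proof cases
    case 1
    then obtain i where i: "i \<in> J" "x i = \<infinity>" by blast
    then have "ennreal (l i) * x i = \<infinity>" using J(2)[OF i(1)] by (simp add: ennreal_mult_top)
    then have "(\<Sum>i\<in>J. ennreal (l i) * x i) = \<infinity>"
      using member_le_sum[OF i(1) _ J(1), of "\<lambda>i. ennreal (l i) * x i"] by (simp add: top_unique)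
    then show ?thesis by (simp add: e2)
  next
    case 2
    then obtain i where "i \<in> J" "x i = 0" by blast
    then have "(\<Prod>i\<in>J. pw (x i) (l i)) = 0" using J by (auto intro!: prod_zero bexI[of _ i] simp: pw_zero)
    then show ?thesis by (simp only: e1 zero_le)
  next
    case 3
    define y where "y i = enn2real (x i)" for i
    have y: "0 < y i" "x i = ennreal (y i)" if "i \<in> J" for i
      using 3 that by (auto simp: y_def enn2real_positive_iff less_top zero_less_iff_neq_zero)
    have "(\<Prod>i\<in>J. pw (x i) (l i)) = (\<Prod>i\<in>J. ennreal (y i powr l i))"
      using y by (intro prod.cong refl) (simp add: pw_real)
    also have "\<dots> = ennreal (\<Prod>i\<in>J. y i powr l i)" by (rule prod_ennreal) simp
    also have "\<dots> \<le> ennreal (\<Sum>i\<in>J. l i * y i)"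
      using J y ne sJ by (intro ennreal_leI amgm_real) (auto intro: less_imp_le)
    also have "\<dots> = (\<Sum>i\<in>J. ennreal (l i * y i))"
      using J(2) y(1) by (intro sum_ennreal[symmetric]) (meson less_imp_le mult_nonneg_nonneg)
    also have "\<dots> = (\<Sum>i\<in>J. ennreal (l i) * x i)"
    proof (intro sum.cong refl)
      fix i assume "i \<in> J"
      then show "ennreal (l i * y i) = ennreal (l i) * x i"
        using J(2)[of i] y[of i] by (simp add: ennreal_mult'')
    qed
    finally show ?thesis by (simp add: e1 e2)
  qed
qed

text \<open>Factors divided by their integrals are bounded by the weighted inequality of arithmetic
  and geometric means, whose right side integrates to 1 or less. A vanishing integral of positive
  exponent makes the left side vanish; if there is none, an infinite one makes the right side
  infinite. Exponent 0 contributes the factor 1.\<close>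

lemma holder_pw:
  assumes fin: "finite I" and l: "(\<Sum>i\<in>I. l i) = 1" "\<And>i. i \<in> I \<Longrightarrow> 0 \<le> l i"
    and [measurable]: "\<And>i. f i \<in> borel_measurable M"
  shows "(\<integral>\<^sup>+ x. (\<Prod>i\<in>I. pw (f i x) (l i)) \<partial>M) \<le> (\<Prod>i\<in>I. pw (\<integral>\<^sup>+ x. f i x \<partial>M) (l i))"
proof -
  define c where "c i = (\<integral>\<^sup>+ x. f i x \<partial>M)" for i
  consider "\<exists>i\<in>I. 0 < l i \<and> c i = 0" | "\<forall>i\<in>I. 0 < l i \<longrightarrow> c i \<noteq> 0" "\<exists>i\<in>I. 0 < l i \<and> c i = \<infinity>"
    | "\<forall>i\<in>I. 0 < l i \<longrightarrow> c i \<noteq> 0 \<and> c i \<noteq> \<infinity>" by blast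
  then show ?thesis
  proof cases
    case 1
    then obtain i where i: "i \<in> I" "0 < l i" "c i = 0" by blast
    then have "AE x in M. f i x = 0" unfolding c_def by (subst (asm) nn_integral_0_iff_AE) auto
    then have "AE x in M. (\<Prod>i\<in>I. pw (f i x) (l i)) = 0"
      by (rule AE_mp) (use i fin in \<open>auto intro!: AE_I2 prod_zero bexI[of _ i] simp: pw_zero\<close>)
    then have "(\<integral>\<^sup>+ x. (\<Prod>i\<in>I. pw (f i x) (l i)) \<partial>M) = 0" by (subst nn_integral_0_iff_AE) auto
    then show ?thesis by simp
  next
    case 2
    then obtain i where i: "i \<in> I" "0 < l i" "c i = \<infinity>" by blast
    have "pw (c j) (l j) \<noteq> 0" if "j \<in> I" for j
      using 2(1) that l(2)[OF that] by (cases "l j = 0") (auto simp: pw_eq_0_iff)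
    then have "(\<Prod>i\<in>I. pw (c i) (l i)) = \<infinity>"
      using i fin by (auto simp: ennreal_prod_eq_top pw_top intro!: bexI[of _ i])
    then show ?thesis by (simp add: c_def)
  next
    case 3
    define g where "g i x = (if 0 < l i then f i x / c i else 1)" for i x
    have [measurable]: "g i \<in> borel_measurable M" for i unfolding g_def by measurable
    have eq: "pw (f i x) (l i) = pw (c i) (l i) * pw (g i x) (l i)" if "i \<in> I" for i x
    proof (cases "0 < l i")
      case True
      have "f i x = c i * g i x" using 3 that True
by (simp add: g_def ennreal_mult_div_cancel)
      then show ?thesis using True by (simp add: pw_mult)
    qed (use l(2)[OF that] in simp)
    have "(\<integral>\<^sup>+ x. (\<Prod>i\<in>I. pw (f i x) (l i)) \<partial>M) = (\<integral>\<^sup>+ x. (\<Prod>i\<in>I. pw (c i) (l i)) * (\<Prod>i\<in>I. pw (g i x) (l i)) \<partial>M)"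
      using eq by (intro nn_integral_cong) (simp add: prod.distrib[symmetric])
    also have "\<dots> = (\<Prod>i\<in>I. pw (c i) (l i)) * (\<integral>\<^sup>+ x. (\<Prod>i\<in>I. pw (g i x) (l i)) \<partial>M)"
      by (rule nn_integral_cmult) measurable
    also have "(\<integral>\<^sup>+ x. (\<Prod>i\<in>I. pw (g i x) (l i)) \<partial>M) \<le> (\<integral>\<^sup>+ x. (\<Sum>i\<in>I. ennreal (l i) * g i x) \<partial>M)"
      by (intro nn_integral_mono amgm_pw fin l)
    also have "\<dots> = (\<Sum>i\<in>I. ennreal (l i) * (\<integral>\<^sup>+ x. g i x \<partial>M))"
      by (simp add: nn_integral_sum nn_integral_cmult)
    also have "\<dots> \<le> (\<Sum>i\<in>I. ennreal (l i))"
    proof (rule sum_mono)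
      fix i assume i: "i \<in> I"
      show "ennreal (l i) * (\<integral>\<^sup>+ x. g i x \<partial>M) \<le> ennreal (l i)"
      proof (cases "0 < l i")
        case True
        then have "(\<integral>\<^sup>+ x. g i x \<partial>M) = c i / c i" by (simp add: g_def c_def nn_integral_divide)
        also have "\<dots> \<le> 1" using 3 i True by (simp add: less_top)
        finally show ?thesis using mult_left_mono[of _ 1 "ennreal (l i)"] by simp
      qed (use l(2)[OF i] in simp)
    qed
    also have "\<dots> = 1" using l by (simp add: sum_ennreal)
    finally show ?thesis by (simp add: c_def mult_left_mono)
  qed
qed

lemma holder4:
  assumes w: "a + b + c + d = 1" "0 \<le> a" "0 \<le> b" "0 \<le> c" "0 \<le> d"
    and m: "f \<in> borel_measurable M" "g \<in> borel_measurable M" "h \<in> borel_measurable M" "k \<in> borel_measurable M"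
  shows "(\<integral>\<^sup>+ x. pw (f x) a * pw (g x) b * pw (h x) c * pw (k x) d \<partial>M) \<le>
    pw (\<integral>\<^sup>+ x. f x \<partial>M) a * pw (\<integral>\<^sup>+ x. g x \<partial>M) b * pw (\<integral>\<^sup>+ x. h x \<partial>M) c * pw (\<integral>\<^sup>+ x. k x \<partial>M) d"
proof -
  let ?F = "\<lambda>i::nat. if i = 0 then f else if i = 1 then g else if i = 2 then h else k"
  let ?l = "\<lambda>i::nat. if i = 0 then a else if i = 1 then b else if i = 2 then c else d"
  have "(\<integral>\<^sup>+ x. (\<Prod>i\<in>{0,1,2,3}. pw (?F i x) (?l i)) \<partial>M) \<le> (\<Prod>i\<in>{0,1,2,3}. pw (\<integral>\<^sup>+ x. ?F i x \<partial>M) (?l i))"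
    using w m by (intro holder_pw) auto
  then show ?thesis by (simp add: mult.assoc)
qed

lemma ennreal_div_self [simp]: "x \<noteq> 0 \<Longrightarrow> x \<noteq> top \<Longrightarrow> x / x = (1::ennreal)"
  by (simp add: less_top)

text \<open>
  \<open>mixed_le s r F N\<close> says that the \<open>L\<^sup>p(du)\<close>-\<open>L\<^sup>q(d\<omega>)\<close> mixed norm of \<open>F\<close> is at most \<open>N\<close>, where
  \<open>s = 1/p\<close> and \<open>r = 1/q\<close>: up to the factor \<open>N\<close>, \<open>F\<close> is bounded by \<open>F0\<^sup>s f0\<^sup>r\<close> with normalised
  \<open>F0\<close>, \<open>f0\<close>.  In this form the mixed-norm inequalities reduce to Hoelder's inequality, and no
  exponent needs a special case.
\<close>

definition mixed_le :: "real \<Rightarrow> real \<Rightarrow> ('u::euclidean_space \<times> 'w::euclidean_space \<Rightarrow> ennreal) \<Rightarrow> ennreal \<Rightarrow> bool" where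
  "mixed_le s r F N \<longleftrightarrow> (\<exists>F0 f0. F0 \<in> borel_measurable borel \<and> f0 \<in> borel_measurable borel \<and>
     (\<forall>\<omega>. (\<integral>\<^sup>+ u. F0 (u, \<omega>) \<partial>lborel) \<le> 1) \<and> (\<integral>\<^sup>+ \<omega>. f0 \<omega> \<partial>lborel) \<le> 1 \<and>
     (\<forall>u \<omega>. F (u, \<omega>) \<le> N * pw (F0 (u, \<omega>)) s * pw (f0 \<omega>) r))"

lemma mixed_leE:
  assumes "mixed_le s r F N"
  obtains F0 f0 where "F0 \<in> borel_measurable borel" "f0 \<in> borel_measurable borel"
    "\<And>\<omega>. (\<integral>\<^sup>+ u. F0 (u, \<omega>) \<partial>lborel) \<le> 1" "(\<integral>\<^sup>+ \<omega>. f0 \<omega> \<partial>lborel) \<le> 1"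
    "\<And>u \<omega>. F (u, \<omega>) \<le> N * pw (F0 (u, \<omega>)) s * pw (f0 \<omega>) r"
  using assms unfolding mixed_le_def by blast

text \<open>Masses \<open>K1\<close>, \<open>K2\<close> in place of 1 are divided out of the two
  densities and reappear in the constant with the powers s and r.\<close>

lemma mixed_leI:
  fixes F0 :: "'u::euclidean_space \<times> 'w::euclidean_space \<Rightarrow> ennreal"
  assumes [measurable]: "F0 \<in> borel_measurable borel" "f0 \<in> borel_measurable borel"
    and b: "\<And>\<omega>. (\<integral>\<^sup>+ u. F0 (u, \<omega>) \<partial>lborel) \<le> K1" "(\<integral>\<^sup>+ \<omega>. f0 \<omega> \<partial>lborel) \<le> K2"
    and K: "0 < K1" "K1 < \<infinity>" "0 < K2" "K2 < \<infinity>"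
    and F: "\<And>u \<omega>. F (u, \<omega>) \<le> N * pw (F0 (u, \<omega>)) s * pw (f0 \<omega>) r" and sr: "0 \<le> s" "0 \<le> r"
  shows "mixed_le s r F (N * pw K1 s * pw K2 r)"
  unfolding mixed_le_def
proof (intro exI[of _ "\<lambda>p. F0 p / K1"] exI[of _ "\<lambda>\<omega>. f0 \<omega> / K2"] conjI allI)
  have K': "K1 \<noteq> 0" "K1 \<noteq> top" "K2 \<noteq> 0" "K2 \<noteq> top" using K by auto
  show "(\<integral>\<^sup>+ u. F0 (u, \<omega>) / K1 \<partial>lborel) \<le> 1" for \<omega>
  proof -
    have "(\<integral>\<^sup>+ u. F0 (u, \<omega>) / K1 \<partial>lborel) = (\<integral>\<^sup>+ u. F0 (u, \<omega>) \<partial>lborel) / K1" by (rule nn_integral_divide) measurable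
    also have "\<dots> \<le> K1 / K1" by (intro divide_right_mono_ennreal b)
    also have "\<dots> = 1" using K' by simp
    finally show ?thesis .
  qed
  have "(\<integral>\<^sup>+ \<omega>. f0 \<omega> / K2 \<partial>lborel) \<le> K2 / K2"
    using b(2) by (simp add: nn_integral_divide divide_right_mono_ennreal)
  then show "(\<integral>\<^sup>+ \<omega>. f0 \<omega> / K2 \<partial>lborel) \<le> 1" using K' by simp
  fix u \<omega>
  have "pw (F0 (u, \<omega>)) s = pw K1 s * pw (F0 (u, \<omega>) / K1) s" "pw (f0 \<omega>) r = pw K2 r * pw (f0 \<omega> / K2) r"
    using K' sr by (simp_all add: pw_mult[symmetric] ennreal_mult_div_cancel)
  then show "F (u, \<omega>) \<le> N * pw K1 s * pw K2 r * pw (F0 (u, \<omega>) / K1) s * pw (f0 \<omega> / K2) r"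
    using F[of u \<omega>] by (simp add: mult_ac)
qed (use assms in measurable)

lemma mixed_le_mono:
  assumes "mixed_le s r F N" "\<And>p. G p \<le> c * F p" "c * N \<le> N'"
  shows "mixed_le s r G N'"
proof -
  obtain F0 f0 where F: "F0 \<in> borel_measurable borel" "f0 \<in> borel_measurable borel"
    "\<And>\<omega>. (\<integral>\<^sup>+ u. F0 (u, \<omega>) \<partial>lborel) \<le> 1" "(\<integral>\<^sup>+ \<omega>. f0 \<omega> \<partial>lborel) \<le> 1"
    "\<And>u \<omega>. F (u, \<omega>) \<le> N * pw (F0 (u, \<omega>)) s * pw (f0 \<omega>) r"
    by (rule mixed_leE[OF assms(1)]) (rule that)
  have "G (u, \<omega>) \<le> N' * pw (F0 (u, \<omega>)) s * pw (f0 \<omega>) r" for u \<omega>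
  proof -
    have "G (u, \<omega>) \<le> c * (N * pw (F0 (u, \<omega>)) s * pw (f0 \<omega>) r)"
      by (rule order_trans[OF assms(2)]) (intro mult_left_mono F(5) zero_le)
    also have "\<dots> = (c * N) * pw (F0 (u, \<omega>)) s * pw (f0 \<omega>) r" by (simp add: mult_ac)
    also have "\<dots> \<le> N' * pw (F0 (u, \<omega>)) s * pw (f0 \<omega>) r" by (intro mult_right_mono assms(3)) auto
    finally show ?thesis .
  qed
  with F show ?thesis unfolding mixed_le_def by blast
qed

lemma nn_integral_gaussian: "(\<integral>\<^sup>+ x. ennreal (gaussian (x::'a::euclidean_space)) \<partial>lborel) = 1"
  using nn_integral_eq_integral[OF gaussian_integrable[where 'a='a]]
  by (simp add: gaussian_bounds gaussian_integral)

lemma gaussian_pos: "0 < gaussian x"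
  by (simp add: gaussian_def)

text \<open>Conditional density times marginal. Adding a product of Gaussians makes the marginal k
  positive, at the price of total mass 2. Where k is infinite, a Gaussian serves as
  \<open>I0\<close>, since a positive number times infinity bounds everything.\<close>

lemma disintegrate:
  fixes I :: "'u::euclidean_space \<times> 'w::euclidean_space \<Rightarrow> ennreal"
  assumes [measurable]: "I \<in> borel_measurable borel" and I: "(\<integral>\<^sup>+ \<omega>. \<integral>\<^sup>+ u. I (u, \<omega>) \<partial>lborel \<partial>lborel) \<le> 1"
  obtains I0 k where "I0 \<in> borel_measurable borel" "k \<in> borel_measurable borel"
    "\<And>\<omega>. (\<integral>\<^sup>+ u. I0 (u, \<omega>) \<partial>lborel) \<le> 1" "(\<integral>\<^sup>+ \<omega>. k \<omega> \<partial>lborel) \<le> 2" "\<And>u \<omega>. I (u, \<omega>) \<le> I0 (u, \<omega>) * k \<omega>"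
proof -
  define J where "J p = I p + ennreal (gaussian (fst p)) * ennreal (gaussian (snd p))" for p
  have [measurable]: "J \<in> borel_measurable borel" unfolding J_def by measurable
  define k where "k \<omega> = (\<integral>\<^sup>+ u. J (u, \<omega>) \<partial>lborel)" for \<omega>
  have [measurable]: "k \<in> borel_measurable borel" unfolding k_def by measurable
  have k: "k \<omega> = (\<integral>\<^sup>+ u. I (u, \<omega>) \<partial>lborel) + ennreal (gaussian \<omega>)" for \<omega>
    by (simp add: k_def J_def nn_integral_add nn_integral_multc nn_integral_gaussian)
  have k0: "k \<omega> \<noteq> 0" for \<omega> using gaussian_pos[of \<omega>] by (simp add: k add_eq_0_iff_both_eq_0)
  define I0 where "I0 p = (if k (snd p) = top then ennreal (gaussian (fst p)) else J p / k (snd p))" for p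
  show ?thesis
  proof (rule that[of I0 k])
    show "I0 \<in> borel_measurable borel" unfolding I0_def by measurable
    show "k \<in> borel_measurable borel" by measurable
    show "(\<integral>\<^sup>+ u. I0 (u, \<omega>) \<partial>lborel) \<le> 1" for \<omega>
    proof (cases "k \<omega> = top")
      case False
      have "(\<integral>\<^sup>+ u. J (u, \<omega>) / k \<omega> \<partial>lborel) = k \<omega> / k \<omega>" by (simp add: nn_integral_divide k_def)
      then show ?thesis using False k0 by (simp add: I0_def)
    qed (simp add: I0_def nn_integral_gaussian)
    have "(\<integral>\<^sup>+ \<omega>. k \<omega> \<partial>lborel) = (\<integral>\<^sup>+ \<omega>. \<integral>\<^sup>+ u. I (u, \<omega>) \<partial>lborel \<partial>lborel) + 1"
      unfolding k by (subst nn_integral_add) (auto simp: nn_integral_gaussian)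
    also have "\<dots> \<le> 1 + 1" by (intro add_mono I order_refl)
    finally show "(\<integral>\<^sup>+ \<omega>. k \<omega> \<partial>lborel) \<le> 2" by simp
    show "I (u, \<omega>) \<le> I0 (u, \<omega>) * k \<omega>" for u \<omega>
    proof (cases "k \<omega> = top")
      case True
      then show ?thesis using gaussian_pos[of u] by (simp add: I0_def ennreal_mult_top)
    next
      case False
      have "I (u, \<omega>) \<le> J (u, \<omega>)" by (simp add: J_def)
      then show ?thesis using False k0[of \<omega>] by (simp add: I0_def mult.commute[of _ "k \<omega>"] ennreal_mult_div_cancel)
    qed
  qed
qed

text \<open>Duality of mixed norms: Hoelder in u with exponents s and 1 - s, then in \<omega> with r
  and 1 - r.\<close>

lemma mixed_pairing:
  fixes H G :: "'u::euclidean_space \<times> 'w::euclidean_space \<Rightarrow> ennreal"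
  assumes "mixed_le s r H N" "mixed_le (1 - s) (1 - r) G N'" "0 \<le> s" "s \<le> 1" "0 \<le> r" "r \<le> 1"
  shows "(\<integral>\<^sup>+ p. H p * G p \<partial>lborel) \<le> N * N'"
proof -
  obtain H0 h0 where H: "H0 \<in> borel_measurable borel" "h0 \<in> borel_measurable borel"
    "\<And>\<omega>. (\<integral>\<^sup>+ u. H0 (u, \<omega>) \<partial>lborel) \<le> 1" "(\<integral>\<^sup>+ \<omega>. h0 \<omega> \<partial>lborel) \<le> 1"
    "\<And>u \<omega>. H (u, \<omega>) \<le> N * pw (H0 (u, \<omega>)) s * pw (h0 \<omega>) r"
    by (rule mixed_leE[OF assms(1)]) (rule that)
  obtain G0 g0 where G: "G0 \<in> borel_measurable borel" "g0 \<in> borel_measurable borel"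
    "\<And>\<omega>. (\<integral>\<^sup>+ u. G0 (u, \<omega>) \<partial>lborel) \<le> 1" "(\<integral>\<^sup>+ \<omega>. g0 \<omega> \<partial>lborel) \<le> 1"
    "\<And>u \<omega>. G (u, \<omega>) \<le> N' * pw (G0 (u, \<omega>)) (1 - s) * pw (g0 \<omega>) (1 - r)"
    by (rule mixed_leE[OF assms(2)]) (rule that)
  note [measurable] = H(1,2) G(1,2)
  have h2: "(\<integral>\<^sup>+ x. pw (f x) a * pw (g x) (1 - a) \<partial>M) \<le> 1"
    if "(\<integral>\<^sup>+ x. f x \<partial>M) \<le> 1" "(\<integral>\<^sup>+ x. g x \<partial>M) \<le> 1" "0 \<le> a" "a \<le> 1"
      "f \<in> borel_measurable M" "g \<in> borel_measurable M" for f g a and M :: "'z measure"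
  proof -
    have "(\<integral>\<^sup>+ x. pw (f x) a * pw (g x) (1 - a) \<partial>M) \<le> pw (\<integral>\<^sup>+ x. f x \<partial>M) a * pw (\<integral>\<^sup>+ x. g x \<partial>M) (1 - a)"
      using holder4[of a "1 - a" 0 0 f M g f f] that by simp
    also have "\<dots> \<le> pw 1 a * pw 1 (1 - a)" using that by (intro mult_mono pw_mono) auto
    finally show ?thesis by simp
  qed
  have "(\<integral>\<^sup>+ p. H p * G p \<partial>lborel) \<le> (\<integral>\<^sup>+ p. (N * N') * ((pw (h0 (snd p)) r * pw (g0 (snd p)) (1 - r)) *
     (pw (H0 p) s * pw (G0 p) (1 - s))) \<partial>lborel)"
  proof (intro nn_integral_mono)
    fix p :: "'u \<times> 'w"
    have "H p * G p \<le> (N * pw (H0 p) s * pw (h0 (snd p)) r) * (N' * pw (G0 p) (1 - s) * pw (g0 (snd p)) (1 - r))"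
      using H(5)[of "fst p" "snd p"] G(5)[of "fst p" "snd p"] by (intro mult_mono) auto
    then show "H p * G p \<le> (N * N') * ((pw (h0 (snd p)) r * pw (g0 (snd p)) (1 - r)) * (pw (H0 p) s * pw (G0 p) (1 - s)))"
      by (simp add: mult_ac)
  qed
  also have "\<dots> = (N * N') * (\<integral>\<^sup>+ \<omega>. \<integral>\<^sup>+ u. (pw (h0 \<omega>) r * pw (g0 \<omega>) (1 - r)) * (pw (H0 (u, \<omega>)) s * pw (G0 (u, \<omega>)) (1 - s)) \<partial>lborel \<partial>lborel)"
    by (subst nn_integral_cmult, measurable, subst nn_integral_lborel_pair(2)) simp_all
  also have "\<dots> = (N * N') * (\<integral>\<^sup>+ \<omega>. (pw (h0 \<omega>) r * pw (g0 \<omega>) (1 - r)) * (\<integral>\<^sup>+ u. (pw (H0 (u, \<omega>)) s * pw (G0 (u, \<omega>)) (1 - s)) \<partial>lborel) \<partial>lborel)"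
    by (subst nn_integral_cmult) simp_all
  also have "\<dots> \<le> (N * N') * (\<integral>\<^sup>+ \<omega>. (pw (h0 \<omega>) r * pw (g0 \<omega>) (1 - r)) * 1 \<partial>lborel)"
    by (intro mult_left_mono nn_integral_mono h2 H G assms) simp_all
  also have "\<dots> \<le> (N * N') * 1"
    by (intro mult_left_mono) (simp_all add: h2 H G assms)
  finally show ?thesis by simp
qed

section \<open>Convolution with decaying kernels\<close>

text \<open>The product form lets the inner and the outer integral of a mixed norm be estimated
  separately.\<close>

definition prod_kernel :: "nat \<Rightarrow> 'u::euclidean_space \<times> 'w::euclidean_space \<Rightarrow> real" where
  "prod_kernel n y = inverse (bk (fst y) ^ n) * inverse (bk (snd y) ^ n)"

definition smear :: "nat \<Rightarrow> ('u::euclidean_space \<times> 'w::euclidean_space \<Rightarrow> ennreal) \<Rightarrow> 'u \<times> 'w \<Rightarrow> ennreal" where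
  "smear n F p = (\<integral>\<^sup>+ y. F (p - y) * ennreal (prod_kernel n y) \<partial>lborel)"

lemma nn_integral_inverse_bk:
  assumes "2 * DIM('a) \<le> n"
  shows "(\<integral>\<^sup>+ x. ennreal (inverse (bk (x::'a::euclidean_space) ^ n)) \<partial>lborel) < \<infinity>"
    and "0 < (\<integral>\<^sup>+ x. ennreal (inverse (bk (x::'a::euclidean_space) ^ n)) \<partial>lborel)"
proof -
  show "(\<integral>\<^sup>+ x. ennreal (inverse (bk (x::'a) ^ n)) \<partial>lborel) < \<infinity>"
    using integrable_inverse_bk[OF assms] by (simp add: integrable_iff_bounded bk_nonneg)
  have "(\<integral>\<^sup>+ x. ennreal (inverse (bk (x::'a) ^ n)) \<partial>lborel) \<noteq> 0"
  proof
    assume "(\<integral>\<^sup>+ x. ennreal (inverse (bk (x::'a) ^ n)) \<partial>lborel) = 0"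
    then have "AE x in lborel. ennreal (inverse (bk (x::'a) ^ n)) = 0" by (subst (asm) nn_integral_0_iff_AE) auto
    then have "AE x::'a in lborel. False"
      by (rule AE_mp) (auto intro!: AE_I2 simp: ennreal_eq_0_iff bk_pos not_le)
    then show False by (simp add: eventually_False ae_filter_eq_bot_iff)
  qed
  then show "0 < (\<integral>\<^sup>+ x. ennreal (inverse (bk (x::'a) ^ n)) \<partial>lborel)" by (simp add: zero_less_iff_neq_zero)
qed

text \<open>
  Convolution with a rapidly decaying kernel preserves mixed norms and even makes the exponents
  larger; the latter replaces the embeddings between modulation spaces.
\<close>

lemma mixed_le_smear:
  assumes n: "2 * DIM('u) \<le> n" "2 * DIM('w) \<le> n"
    and sr: "0 \<le> s'" "s' \<le> s" "s \<le> 1" "0 \<le> r'" "r' \<le> r" "r \<le> 1"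
  obtains C where "C < \<infinity>"
    "\<And>(F :: 'u::euclidean_space \<times> 'w::euclidean_space \<Rightarrow> ennreal) N. mixed_le s r F N \<Longrightarrow> mixed_le s' r' (smear n F) (C * N)"
proof -
  define k1 where "k1 y = ennreal (inverse (bk (y::'u) ^ n))" for y
  define k2 where "k2 y = ennreal (inverse (bk (y::'w) ^ n))" for y
  have [measurable]: "k1 \<in> borel_measurable borel" "k2 \<in> borel_measurable borel" unfolding k1_def k2_def by measurable
  have kle: "k1 y \<le> 1" "k2 z \<le> 1" for y z
    unfolding k1_def k2_def by (auto intro!: ennreal_le_1[THEN iffD2] simp: inverse_le_1_iff bk_power_ge1)
  define c1 where "c1 = (\<integral>\<^sup>+ y. k1 y \<partial>lborel)"
  define c2 where "c2 = (\<integral>\<^sup>+ y. k2 y \<partial>lborel)"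
  have c: "0 < c1" "c1 < \<infinity>" "0 < c2" "c2 < \<infinity>"
    using nn_integral_inverse_bk[OF n(1)] nn_integral_inverse_bk[OF n(2)] by (auto simp: c1_def c2_def k1_def k2_def)
  \<comment> \<open>The exponents m, s - m, r - m and 1 - s - r + m = 1 - max s r are nonnegative
    with sum 1. In Hoelder's inequality they belong to F0 f0 K, F0 K, f0 K and K.\<close>
  define m where "m = min s r"
  have m: "0 \<le> m" "m \<le> s" "m \<le> r" "0 \<le> 1 - s - r + m" using sr by (auto simp: m_def)
  define B where "B = 1 + c2"
  define K1 where "K1 = c1 + c1 * c2"
  define D where "D = pw c1 (r - m) * pw (c1 * c2) (1 - s - r + m) * pw B (s - s') * pw K1 s' * pw c2 r'"
  have K1: "0 < K1" "K1 < \<infinity>" using c by (auto simp: K1_def ennreal_mult_less_top add_pos_nonneg)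
  have "D < \<infinity>"
    unfolding D_def using m sr c K1 by (auto simp: ennreal_mult_less_top B_def intro!: pw_finite)
  moreover have "mixed_le s' r' (smear n F) (D * N)" if FN: "mixed_le s r F N" for F :: "'u \<times> 'w \<Rightarrow> ennreal" and N
  proof -
    obtain F0 f0 where F: "F0 \<in> borel_measurable borel" "f0 \<in> borel_measurable borel"
      "\<And>\<omega>. (\<integral>\<^sup>+ u. F0 (u, \<omega>) \<partial>lborel) \<le> 1" "(\<integral>\<^sup>+ \<omega>. f0 \<omega> \<partial>lborel) \<le> 1"
      "\<And>u \<omega>. F (u, \<omega>) \<le> N * pw (F0 (u, \<omega>)) s * pw (f0 \<omega>) r"
      by (rule mixed_leE[OF FN]) (rule that)
    note [measurable] = F(1,2)
    define K where "K y = k1 (fst y) * k2 (snd y)" for y :: "'u \<times> 'w"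
    have [measurable]: "K \<in> borel_measurable borel" unfolding K_def by measurable
    define X where "X p = (\<integral>\<^sup>+ y. F0 (p - y) * f0 (snd p - snd y) * K y \<partial>lborel)" for p
    define Z where "Z p = (\<integral>\<^sup>+ y. F0 (p - y) * K y \<partial>lborel)" for p
    define s0 where "s0 \<omega> = (\<integral>\<^sup>+ y. f0 (\<omega> - y) * k2 y \<partial>lborel)" for \<omega>
    have [measurable]: "X \<in> borel_measurable borel" "Z \<in> borel_measurable borel" "s0 \<in> borel_measurable borel"
      unfolding X_def Z_def s0_def by measurable
    have Y: "(\<integral>\<^sup>+ y. f0 (\<omega> - snd y) * K y \<partial>lborel) = c1 * s0 \<omega>" for \<omega>
    proof -
      have "(\<integral>\<^sup>+ y. f0 (\<omega> - snd y) * K y \<partial>lborel) = (\<integral>\<^sup>+ y2. \<integral>\<^sup>+ y1. (f0 (\<omega> - y2) * k2 y2) * k1 y1 \<partial>lborel \<partial>lborel)"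
        by (subst nn_integral_lborel_pair(2)) (auto simp: K_def mult_ac)
      then show ?thesis by (simp add: nn_integral_cmult nn_integral_multc c1_def s0_def mult.commute)
    qed
    have cc: "(\<integral>\<^sup>+ y. K y \<partial>lborel) = c1 * c2"
      by (subst nn_integral_lborel_pair(2)) (auto simp: K_def nn_integral_multc nn_integral_cmult c1_def c2_def)
    have F0r: "(\<integral>\<^sup>+ y1. F0 (u - y1, \<omega>) \<partial>lborel) \<le> 1" for u \<omega>
      using nn_integral_lborel_reflect[of "\<lambda>y. F0 (y, \<omega>)" u] F(3)[of \<omega>] by simp
    have F0t: "(\<integral>\<^sup>+ u. F0 (u - a, \<omega>) \<partial>lborel) \<le> 1" for a \<omega>
      using nn_integral_lborel_translate[of "\<lambda>u. F0 (u, \<omega>)" "- a"] F(3)[of \<omega>] by simp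
    have split: "(\<integral>\<^sup>+ y. F0 (p - y) * g (snd y) * K y \<partial>lborel) \<le> (\<integral>\<^sup>+ y2. g y2 * k2 y2 \<partial>lborel)"
      if [measurable]: "g \<in> borel_measurable borel" for p and g :: "'w \<Rightarrow> ennreal"
    proof -
      have "(\<integral>\<^sup>+ y. F0 (p - y) * g (snd y) * K y \<partial>lborel) \<le> (\<integral>\<^sup>+ y. (g (snd y) * k2 (snd y)) * F0 (p - y) \<partial>lborel)"
      proof (intro nn_integral_mono)
        fix y :: "'u \<times> 'w"
        have "F0 (p - y) * g (snd y) * K y = (g (snd y) * k2 (snd y) * F0 (p - y)) * k1 (fst y)" by (simp add: K_def mult_ac)
        also have "\<dots> \<le> (g (snd y) * k2 (snd y) * F0 (p - y)) * 1" by (intro mult_left_mono kle) simp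
        finally show "F0 (p - y) * g (snd y) * K y \<le> (g (snd y) * k2 (snd y)) * F0 (p - y)" by simp
      qed
      also have "\<dots> = (\<integral>\<^sup>+ y2. \<integral>\<^sup>+ y1. (g y2 * k2 y2) * F0 (fst p - y1, snd p - y2) \<partial>lborel \<partial>lborel)"
        by (subst nn_integral_lborel_pair(2)) (auto simp: minus_prod_def)
      also have "\<dots> = (\<integral>\<^sup>+ y2. (g y2 * k2 y2) * (\<integral>\<^sup>+ y1. F0 (fst p - y1, snd p - y2) \<partial>lborel) \<partial>lborel)"
        by (subst nn_integral_cmult) simp_all
      also have "\<dots> \<le> (\<integral>\<^sup>+ y2. (g y2 * k2 y2) * 1 \<partial>lborel)"
        by (intro nn_integral_mono mult_left_mono F0r) simp
      finally show ?thesis by simp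
    qed
    have split': "(\<integral>\<^sup>+ u. \<integral>\<^sup>+ y. F0 ((u, \<omega>) - y) * g (snd y) * K y \<partial>lborel \<partial>lborel) \<le> (\<integral>\<^sup>+ y. g (snd y) * K y \<partial>lborel)"
      if [measurable]: "g \<in> borel_measurable borel" for \<omega> and g :: "'w \<Rightarrow> ennreal"
    proof -
      have "(\<integral>\<^sup>+ u. \<integral>\<^sup>+ y. F0 ((u, \<omega>) - y) * g (snd y) * K y \<partial>lborel \<partial>lborel) =
         (\<integral>\<^sup>+ y. \<integral>\<^sup>+ u. (g (snd y) * K y) * F0 ((u, \<omega>) - y) \<partial>lborel \<partial>lborel)"
        by (subst nn_integral_lborel_swap) (auto simp: mult_ac)
      also have "\<dots> = (\<integral>\<^sup>+ y. (g (snd y) * K y) * (\<integral>\<^sup>+ u. F0 (u - fst y, \<omega> - snd y) \<partial>lborel) \<partial>lborel)"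
        by (subst nn_integral_cmult) (simp_all add: minus_prod_def)
      also have "\<dots> \<le> (\<integral>\<^sup>+ y. (g (snd y) * K y) * 1 \<partial>lborel)"
        by (intro nn_integral_mono mult_left_mono F0t) simp
      finally show ?thesis by simp
    qed
    have X1: "X p \<le> s0 (snd p)" for p unfolding X_def s0_def using split[of "\<lambda>y2. f0 (snd p - y2)" p] by simp
    have X2: "(\<integral>\<^sup>+ u. X (u, \<omega>) \<partial>lborel) \<le> c1 * s0 \<omega>" for \<omega>
      unfolding X_def Y[symmetric] using split'[of "\<lambda>y2. f0 (\<omega> - y2)" \<omega>] by simp
    have Z1: "Z p \<le> c2" for p unfolding Z_def c2_def using split[of "\<lambda>_. 1" p] by simp
    have Z2: "(\<integral>\<^sup>+ u. Z (u, \<omega>) \<partial>lborel) \<le> c1 * c2" for \<omega>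
      unfolding Z_def cc[symmetric] using split'[of "\<lambda>_. 1" \<omega>] by simp
    have s1: "s0 \<omega> \<le> 1" for \<omega>
    proof -
      have "s0 \<omega> \<le> (\<integral>\<^sup>+ y. f0 (\<omega> - y) * 1 \<partial>lborel)" unfolding s0_def by (intro nn_integral_mono mult_left_mono kle) simp
      then show ?thesis using nn_integral_lborel_reflect[of f0 \<omega>] F(4) by simp
    qed
    have s2: "(\<integral>\<^sup>+ \<omega>. s0 \<omega> \<partial>lborel) \<le> c2"
    proof -
      have "(\<integral>\<^sup>+ \<omega>. s0 \<omega> \<partial>lborel) = (\<integral>\<^sup>+ y. \<integral>\<^sup>+ \<omega>. f0 (- y + \<omega>) * k2 y \<partial>lborel \<partial>lborel)"
        unfolding s0_def by (subst nn_integral_lborel_swap) auto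
      also have "\<dots> = (\<integral>\<^sup>+ y. (\<integral>\<^sup>+ \<omega>. f0 \<omega> \<partial>lborel) * k2 y \<partial>lborel)"
        by (subst nn_integral_multc) (simp_all only: nn_integral_lborel_translate[OF F(2)], measurable)
      also have "\<dots> \<le> (\<integral>\<^sup>+ y. 1 * k2 y \<partial>lborel)" by (intro nn_integral_mono mult_right_mono F) simp
      finally show ?thesis by (simp add: c2_def)
    qed
    define T where "T p = X p / s0 (snd p) + Z p" for p
    have [measurable]: "T \<in> borel_measurable borel" unfolding T_def by measurable
    have s0top: "s0 \<omega> \<noteq> top" for \<omega> using s1[of \<omega>] by (auto simp: top_unique)
    have XT: "X p \<le> T p * s0 (snd p)" for p
    proof (cases "s0 (snd p) = 0")
      case False
      then have "X p = X p / s0 (snd p) * s0 (snd p)" using s0top by (simp add: mult.commute[of _ "s0 _"] ennreal_mult_div_cancel)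
      also have "\<dots> \<le> T p * s0 (snd p)" by (intro mult_right_mono) (auto simp: T_def)
      finally show ?thesis .
    qed (use X1[of p] in simp)
    have TB: "T p \<le> B" for p
    proof -
      have "X p / s0 (snd p) \<le> 1"
        using X1[of p] s0top[of "snd p"] by (cases "s0 (snd p) = 0")
          (auto simp: divide_right_mono_ennreal intro!: order_trans[OF divide_right_mono_ennreal[OF X1]])
      then show ?thesis unfolding T_def B_def by (intro add_mono Z1)
    qed
    have T1: "(\<integral>\<^sup>+ u. T (u, \<omega>) \<partial>lborel) \<le> K1" for \<omega>
    proof -
      have "(\<integral>\<^sup>+ u. X (u, \<omega>) / s0 \<omega> \<partial>lborel) \<le> c1"
      proof (cases "s0 \<omega> = 0")
        case True
        then show ?thesis using X1[of "(_, \<omega>)"] by simp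
      next
        case False
        have "(\<integral>\<^sup>+ u. X (u, \<omega>) / s0 \<omega> \<partial>lborel) = (\<integral>\<^sup>+ u. X (u, \<omega>) \<partial>lborel) / s0 \<omega>" by (rule nn_integral_divide) measurable
        also have "\<dots> \<le> c1 * s0 \<omega> / s0 \<omega>" by (intro divide_right_mono_ennreal X2)
        finally show ?thesis using False s0top by (simp add: mult_divide_eq_ennreal)
      qed
      then show ?thesis unfolding T_def K1_def using Z2[of \<omega>] by (simp add: nn_integral_add add_mono)
    qed
    have main: "smear n F p \<le> (N * (pw c1 (r - m) * pw (c1 * c2) (1 - s - r + m) * pw B (s - s'))) * pw (T p) s' * pw (s0 (snd p)) r'" for p
    proof -
      have "smear n F p \<le> (\<integral>\<^sup>+ y. N * (pw (F0 (p - y) * f0 (snd p - snd y) * K y) m * pw (F0 (p - y) * K y) (s - m) *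
          pw (f0 (snd p - snd y) * K y) (r - m) * pw (K y) (1 - s - r + m)) \<partial>lborel)"
        unfolding smear_def
      proof (intro nn_integral_mono)
        fix y :: "'u \<times> 'w"
        have Ke: "ennreal (prod_kernel n y) = K y"
          by (simp add: prod_kernel_def K_def k1_def k2_def ennreal_mult' bk_nonneg)
        have e: "pw x s = pw x m * pw x (s - m)" "pw x r = pw x m * pw x (r - m)"
          "x = pw x m * pw x (s - m) * pw x (r - m) * pw x (1 - s - r + m)" for x
          using m by (simp_all add: pw_add[symmetric])
        have "F (p - y) * K y \<le> (N * pw (F0 (p - y)) s * pw (f0 (snd p - snd y)) r) * K y"
          using F(5)[of "fst (p - y)" "snd (p - y)"] by (intro mult_right_mono) (auto simp: minus_prod_def)
        also have "\<dots> = N * (pw (F0 (p - y) * f0 (snd p - snd y) * K y) m * pw (F0 (p - y) * K y) (s - m) *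
          pw (f0 (snd p - snd y) * K y) (r - m) * pw (K y) (1 - s - r + m))"
          using m by (subst e(1), subst e(2), subst e(3)[of "K y"]) (simp add: pw_mult mult_ac)
        finally show "F (p - y) * ennreal (prod_kernel n y) \<le> \<dots>" unfolding Ke .
      qed
      also have "\<dots> = N * (\<integral>\<^sup>+ y. (pw (F0 (p - y) * f0 (snd p - snd y) * K y) m * pw (F0 (p - y) * K y) (s - m) *
          pw (f0 (snd p - snd y) * K y) (r - m) * pw (K y) (1 - s - r + m)) \<partial>lborel)"
        by (rule nn_integral_cmult) measurable
      also have "\<dots> \<le> N * (pw (X p) m * pw (Z p) (s - m) * pw (c1 * s0 (snd p)) (r - m) * pw (c1 * c2) (1 - s - r + m))"
        unfolding X_def Z_def Y[symmetric] cc[symmetric] using m by (intro mult_left_mono holder4) auto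
      also have "\<dots> \<le> N * ((pw (T p) m * pw (s0 (snd p)) m) * pw (T p) (s - m) * (pw c1 (r - m) * pw (s0 (snd p)) (r - m)) * pw (c1 * c2) (1 - s - r + m))"
        using m by (intro mult_left_mono mult_mono) (auto simp: pw_mult[symmetric] T_def intro!: pw_mono XT[unfolded T_def])
      also have "\<dots> = N * (pw c1 (r - m) * pw (c1 * c2) (1 - s - r + m)) * (pw (T p) m * pw (T p) (s - m)) * (pw (s0 (snd p)) m * pw (s0 (snd p)) (r - m))"
        by (simp add: mult_ac)
      also have "pw (T p) m * pw (T p) (s - m) = pw (T p) s' * pw (T p) (s - s')" using m sr by (simp add: pw_add[symmetric])
      also have "pw (s0 (snd p)) m * pw (s0 (snd p)) (r - m) = pw (s0 (snd p)) r' * pw (s0 (snd p)) (r - r')" using m sr by (simp add: pw_add[symmetric])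
      also have "N * (pw c1 (r - m) * pw (c1 * c2) (1 - s - r + m)) * (pw (T p) s' * pw (T p) (s - s')) * (pw (s0 (snd p)) r' * pw (s0 (snd p)) (r - r')) \<le>
         N * (pw c1 (r - m) * pw (c1 * c2) (1 - s - r + m)) * (pw (T p) s' * pw B (s - s')) * (pw (s0 (snd p)) r' * pw 1 (r - r'))"
        using sr by (intro mult_mono mult_left_mono pw_mono TB s1) auto
      finally show ?thesis by (simp add: mult_ac)
    qed
    have "mixed_le s' r' (smear n F) ((N * (pw c1 (r - m) * pw (c1 * c2) (1 - s - r + m) * pw B (s - s'))) * pw K1 s' * pw c2 r')"
      by (rule mixed_leI[of T s0]) (use main T1 s2 K1 c sr in auto)
    then show ?thesis by (simp add: D_def mult_ac)
  qed
  ultimately show ?thesis by (rule that)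
qed

section \<open>Passage between iterated Lebesgue norms and normalised densities\<close>

abbreviation inv_exp :: "ennreal \<Rightarrow> real" where
  "inv_exp p \<equiv> enn2real (inverse p)"

lemma inv_exp_finite:
  assumes "1 \<le> p" "p \<noteq> top"
  shows "0 < inv_exp p" "enn2real p = 1 / inv_exp p"
proof -
  obtain a where a: "p = ennreal a" "0 \<le> a" using assms(2) by (cases p) auto
  have "1 \<le> a" using assms(1) a by (simp add: ennreal_le_iff[of a 1, simplified] flip: ennreal_1)
  then show "0 < inv_exp p" "enn2real p = 1 / inv_exp p"
    using a by (auto simp: inverse_ennreal divide_inverse)
qed

lemma inv_exp_bounds: "1 \<le> p \<Longrightarrow> 0 \<le> inv_exp p \<and> inv_exp p \<le> 1"
proof (cases "p = top")
  case False
  assume p: "1 \<le> p"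
  obtain a where a: "p = ennreal a" "0 \<le> a" using False by (cases p) auto
  then have "1 \<le> a" using p by (simp flip: ennreal_1)
  then show ?thesis using a by (simp add: inverse_ennreal inverse_le_1_iff)
qed simp

lemma Lp_norm_pw:
  assumes "1 \<le> p" "p \<noteq> top"
  shows "Lp_norm p F = pw (\<integral>\<^sup>+ x. pw (F x) (1 / inv_exp p) \<partial>lborel) (inv_exp p)"
  using inv_exp_finite(1)[OF assms] assms(2)
  unfolding Lp_norm_def inv_exp_finite(2)[OF assms] pw_def by simp

lemma Lp_norm_mono:
  assumes "1 \<le> p" "\<And>x. F x \<le> G x" shows "Lp_norm p F \<le> Lp_norm p G"
proof (cases "p = top")
  case True
  then show ?thesis using assms(2) by (auto simp: Lp_norm_def intro: SUP_mono)
next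
  case False
  then show ?thesis using inv_exp_finite(1)[OF assms(1) False] assms(2)
    by (auto simp: Lp_norm_pw[OF assms(1) False] intro!: pw_mono nn_integral_mono)
qed

lemma Lp_norm_cmult_pw_le:
  assumes p: "1 \<le> p" and [measurable]: "F0 \<in> borel_measurable borel" and F0: "(\<integral>\<^sup>+ x. F0 x \<partial>lborel) \<le> 1"
  shows "Lp_norm p (\<lambda>x. c * pw (F0 x) (inv_exp p)) \<le> c"
proof (cases "p = top")
  case False
  let ?s = "inv_exp p"
  have s: "0 < ?s" by (rule inv_exp_finite(1)[OF p False])
  have "Lp_norm p (\<lambda>x. c * pw (F0 x) ?s) = pw (\<integral>\<^sup>+ x. pw c (1 / ?s) * F0 x \<partial>lborel) ?s"
    using s by (simp add: Lp_norm_pw[OF p False] pw_mult pw_pw)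
  also have "\<dots> = pw (pw c (1 / ?s) * (\<integral>\<^sup>+ x. F0 x \<partial>lborel)) ?s" by (simp add: nn_integral_cmult)
  also have "\<dots> \<le> pw (pw c (1 / ?s) * 1) ?s" using s by (intro pw_mono mult_left_mono F0) auto
  also have "\<dots> = c" using s by (simp add: pw_pw)
  finally show ?thesis .
qed (simp add: Lp_norm_def)

lemma mixed_le_imp_Lp_norm:
  assumes pq: "1 \<le> p" "1 \<le> q" and F: "mixed_le (inv_exp p) (inv_exp q) F N"
  shows "Lp_norm q (\<lambda>\<omega>. Lp_norm p (\<lambda>u. F (u, \<omega>))) \<le> N"
proof -
  obtain F0 f0 where F: "F0 \<in> borel_measurable borel" "f0 \<in> borel_measurable borel"
    "\<And>\<omega>. (\<integral>\<^sup>+ u. F0 (u, \<omega>) \<partial>lborel) \<le> 1" "(\<integral>\<^sup>+ \<omega>. f0 \<omega> \<partial>lborel) \<le> 1"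
    "\<And>u \<omega>. F (u, \<omega>) \<le> N * pw (F0 (u, \<omega>)) (inv_exp p) * pw (f0 \<omega>) (inv_exp q)"
    by (rule mixed_leE[OF F]) (rule that)
  note [measurable] = F(1,2)
  have "Lp_norm p (\<lambda>u. F (u, \<omega>)) \<le> N * pw (f0 \<omega>) (inv_exp q)" for \<omega>
  proof -
    have "Lp_norm p (\<lambda>u. F (u, \<omega>)) \<le> Lp_norm p (\<lambda>u. (N * pw (f0 \<omega>) (inv_exp q)) * pw (F0 (u, \<omega>)) (inv_exp p))"
      using F(5) by (intro Lp_norm_mono pq) (simp add: mult_ac)
    also have "\<dots> \<le> N * pw (f0 \<omega>) (inv_exp q)" by (intro Lp_norm_cmult_pw_le pq F(3)) measurable
    finally show ?thesis .
  qed
  then have "Lp_norm q (\<lambda>\<omega>. Lp_norm p (\<lambda>u. F (u, \<omega>))) \<le> Lp_norm q (\<lambda>\<omega>. N * pw (f0 \<omega>) (inv_exp q))"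
    by (intro Lp_norm_mono pq)
  also have "\<dots> \<le> N" by (intro Lp_norm_cmult_pw_le pq F)
  finally show ?thesis .
qed

text \<open>For p = \<infinity> the inner norm is a supremum over uncountably many sections;
  continuity makes it lower semicontinuous, its superlevel sets being unions of open sets.\<close>

lemma Lp_norm_section_measurable:
  fixes Fr :: "'u::euclidean_space \<times> 'w::euclidean_space \<Rightarrow> real"
  assumes p: "1 \<le> p" and c: "continuous_on UNIV Fr"
  shows "(\<lambda>\<omega>. Lp_norm p (\<lambda>u. ennreal (Fr (u, \<omega>)))) \<in> borel_measurable borel"
proof (cases "p = top")
  case True
  have "{\<omega>. y < (SUP u. ennreal (Fr (u, \<omega>)))} = (\<Union>u. {\<omega>. y < ennreal (Fr (u, \<omega>))})" for y
    by (auto simp: less_SUP_iff)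
  moreover have "open {\<omega>. y < ennreal (Fr (u, \<omega>))}" for y u
    by (intro open_Collect_less continuous_on_const continuous_on_ennreal continuous_on_compose2[OF c] continuous_intros) auto
  ultimately show ?thesis using True
    by (intro borel_measurableI_greater) (simp add: Lp_norm_def borel_open open_UN)
next
  case False
  have [measurable]: "Fr \<in> borel_measurable borel" using c by (rule borel_measurable_continuous_onI)
  show ?thesis unfolding Lp_norm_pw[OF p False] by measurable
qed

text \<open>With h the inner norm and finite exponents, the densities are (F / h)^p and (h / N)^q.
  \<open>mixed_le\<close> is a pointwise statement, while h = 0 makes F vanish only almost
  everywhere; continuity closes this gap.\<close>

lemma Lp_norm_imp_mixed_le:
  fixes Fr :: "'u::euclidean_space \<times> 'w::euclidean_space \<Rightarrow> real"
  assumes pq: "1 \<le> p" "1 \<le> q" and c: "continuous_on UNIV Fr" and nn: "\<And>x. 0 \<le> Fr x"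
    and N: "Lp_norm q (\<lambda>\<omega>. Lp_norm p (\<lambda>u. ennreal (Fr (u, \<omega>)))) \<le> N" "0 < N" "N < top"
  shows "mixed_le (inv_exp p) (inv_exp q) (\<lambda>x. ennreal (Fr x)) N"
proof -
  let ?s = "inv_exp p" and ?r = "inv_exp q"
  define F where "F x = ennreal (Fr x)" for x
  define h where "h \<omega> = Lp_norm p (\<lambda>u. F (u, \<omega>))" for \<omega>
  have [measurable]: "h \<in> borel_measurable borel" unfolding h_def F_def by (rule Lp_norm_section_measurable[OF pq(1) c])
  have [measurable]: "F \<in> borel_measurable borel"
    using borel_measurable_continuous_onI[OF c] unfolding F_def by measurable
  have hN: "Lp_norm q h \<le> N" using N(1) unfolding h_def F_def .
  \<comment> \<open>Where h is infinite any positive density of mass 1 serves, since infinity times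
    a positive number bounds F.\<close>
  define F0 where "F0 x = (if h (snd x) = top then ennreal (gaussian (fst x)) else
     if p = top then 0 else pw (F x / h (snd x)) (1 / ?s))" for x
  define f0 where "f0 \<omega> = (if q = top then 0 else pw (h \<omega> / N) (1 / ?r))" for \<omega>
  have m: "F0 \<in> borel_measurable borel" "f0 \<in> borel_measurable borel" unfolding F0_def f0_def by measurable
  have F1: "F (u, \<omega>) \<le> h \<omega> * pw (F0 (u, \<omega>)) ?s" for u \<omega>
  proof (cases "p = top")
    case True
    then show ?thesis by (auto simp: h_def Lp_norm_def intro!: SUP_upper)
  next
    case False
    have s: "0 < ?s" by (rule inv_exp_finite(1)[OF pq(1) False])
    consider "h \<omega> = top" | "h \<omega> = 0" | "h \<omega> \<noteq> 0" "h \<omega> \<noteq> top" by blast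
    then show ?thesis
    proof cases
      case 1
      have "pw (F0 (u, \<omega>)) ?s \<noteq> 0" using 1 s gaussian_pos[of u] by (simp add: F0_def pw_eq_0_iff)
      then show ?thesis using 1 by (simp add: ennreal_top_mult)
    next
      case 2
      then have "(\<integral>\<^sup>+ u. pw (F (u, \<omega>)) (1 / ?s) \<partial>lborel) = 0"
        using s unfolding h_def Lp_norm_pw[OF pq(1) False] by (simp only: pw_eq_0_iff)
      then have "AE u in lborel. pw (F (u, \<omega>)) (1 / ?s) = 0" by (subst (asm) nn_integral_0_iff_AE) auto
      then have "AE u in lborel. Fr (u, \<omega>) = 0"
        using s by (rule_tac AE_mp) (auto simp: pw_eq_0_iff F_def ennreal_eq_0_iff intro!: AE_I2 antisym nn)
      moreover have "continuous_on UNIV (\<lambda>u. Fr (u, \<omega>))"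
        by (rule continuous_on_compose2[OF c]) (auto intro!: continuous_intros)
      ultimately have "Fr (u, \<omega>) = 0" by (intro continuous_AE_zero)
      then show ?thesis by (simp add: F_def)
    next
      case 3
      then show ?thesis using False s by (simp add: F0_def pw_pw ennreal_mult_div_cancel)
    qed
  qed
  have F2: "(\<integral>\<^sup>+ u. F0 (u, \<omega>) \<partial>lborel) \<le> 1" for \<omega>
  proof (cases "h \<omega> = top \<or> p = top")
    case True
    then show ?thesis by (cases "h \<omega> = top") (auto simp: F0_def nn_integral_gaussian)
  next
    case False
    then have pn: "p \<noteq> top" by simp
    have s: "0 < ?s" by (rule inv_exp_finite(1)[OF pq(1) pn])
    define I where "I = (\<integral>\<^sup>+ u. pw (F (u, \<omega>)) (1 / ?s) \<partial>lborel)"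
    have hI: "pw (h \<omega>) (1 / ?s) = I" using s by (simp add: h_def Lp_norm_pw[OF pq(1) pn] I_def pw_pw)
    show ?thesis
    proof (cases "h \<omega> = 0")
      case True
      then have "F (u, \<omega>) = 0" for u using F1[of u \<omega>] by simp
      then show ?thesis using False s by (simp add: F0_def True pw_zero)
    next
      case h0: False
      have I: "I \<noteq> 0" "I \<noteq> top" using h0 False s unfolding hI[symmetric] by (auto simp: pw_eq_0_iff pw_eq_top_iff)
      have "pw (F x / h \<omega>) (1 / ?s) = pw (F x) (1 / ?s) / I" for x
      proof -
        have "I * pw (F x / h \<omega>) (1 / ?s) = pw (F x) (1 / ?s)"
          unfolding hI[symmetric] using False h0 s by (simp add: pw_mult[symmetric] ennreal_mult_div_cancel)
        then show ?thesis using I by (metis mult.commute mult_divide_eq_ennreal)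
      qed
      then have "(\<integral>\<^sup>+ u. F0 (u, \<omega>) \<partial>lborel) = I / I" using False by (simp add: F0_def nn_integral_divide I_def)
      then show ?thesis using I by simp
    qed
  qed
  have f1: "h \<omega> \<le> N * pw (f0 \<omega>) ?r" for \<omega>
  proof (cases "q = top")
    case True
    then have "h \<omega> \<le> Lp_norm q h" by (simp add: Lp_norm_def SUP_upper)
    also have "\<dots> \<le> N" by (rule hN)
    finally show ?thesis using True by simp
  next
    case False
    then show ?thesis using inv_exp_finite(1)[OF pq(2) False] N(2,3)
      by (simp add: f0_def pw_pw ennreal_mult_div_cancel)
  qed
  have f2: "(\<integral>\<^sup>+ \<omega>. f0 \<omega> \<partial>lborel) \<le> 1"
  proof (cases "q = top")
    case False
    have r: "0 < ?r" by (rule inv_exp_finite(1)[OF pq(2) False])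
    have N': "pw N (1 / ?r) \<noteq> 0" "pw N (1 / ?r) \<noteq> top" using r N(2,3) by (auto simp: pw_eq_0_iff pw_eq_top_iff)
    have "pw N (1 / ?r) * (\<integral>\<^sup>+ \<omega>. f0 \<omega> \<partial>lborel) = (\<integral>\<^sup>+ \<omega>. pw N (1 / ?r) * f0 \<omega> \<partial>lborel)"
      by (rule nn_integral_cmult[symmetric]) (use m in simp)
    also have "\<dots> = (\<integral>\<^sup>+ \<omega>. pw (h \<omega>) (1 / ?r) \<partial>lborel)"
      using False r N(2,3) by (simp add: f0_def pw_mult[symmetric] ennreal_mult_div_cancel)
    also have "\<dots> = pw (Lp_norm q h) (1 / ?r)"
      using r by (simp add: Lp_norm_pw[OF pq(2) False] pw_pw)
    also have "\<dots> \<le> pw N (1 / ?r)" using r hN by (intro pw_mono) auto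
    finally have "pw N (1 / ?r) * (\<integral>\<^sup>+ \<omega>. f0 \<omega> \<partial>lborel) / pw N (1 / ?r) \<le> pw N (1 / ?r) / pw N (1 / ?r)"
      by (rule divide_right_mono_ennreal)
    then show ?thesis using N' by (simp add: mult_divide_eq_ennreal mult.commute[of "pw N _"])
  qed (simp add: f0_def)
  have "F (u, \<omega>) \<le> N * pw (F0 (u, \<omega>)) ?s * pw (f0 \<omega>) ?r" for u \<omega>
  proof -
    have "F (u, \<omega>) \<le> (N * pw (f0 \<omega>) ?r) * pw (F0 (u, \<omega>)) ?s"
      by (rule order_trans[OF F1 mult_right_mono[OF f1]]) simp
    then show ?thesis by (simp add: mult_ac)
  qed
  with m F2 f2 show ?thesis unfolding mixed_le_def F_def by blast
qed

section \<open>Young's inequality for the Gabor matrix\<close>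

definition gmap :: "real \<Rightarrow> 'a::euclidean_space \<times> 'a \<Rightarrow> 'a \<times> 'a \<Rightarrow> ('a \<times> 'a) \<times> ('a \<times> 'a)" where
  "gmap \<tau> z z' = (((1 - \<tau>) *\<^sub>R fst z + \<tau> *\<^sub>R fst z', \<tau> *\<^sub>R snd z + (1 - \<tau>) *\<^sub>R snd z'), (snd z - snd z', fst z' - fst z))"

lemma gmap_measurable [measurable]:
  assumes [measurable]: "f \<in> borel_measurable M" "g \<in> borel_measurable M"
  shows "(\<lambda>x. gmap \<tau> (f x) (g x)) \<in> borel_measurable M"
  unfolding gmap_def by measurable

text \<open>With z' = z - r, the second component depends on r alone and the first is a translate of
  z. The z-integral thus sees only \<open>A0\<close> and the r-integral only \<open>a0\<close>;
  \<tau> affects the translation but not the bound.\<close>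

lemma nn_integral_gmap:
  fixes A0 :: "('a::euclidean_space \<times> 'a) \<times> ('a \<times> 'a) \<Rightarrow> ennreal"
  assumes [measurable]: "A0 \<in> borel_measurable borel" "a0 \<in> borel_measurable borel"
    and A0: "\<And>\<zeta>. (\<integral>\<^sup>+ z. A0 (z, \<zeta>) \<partial>lborel) \<le> 1" and a0: "(\<integral>\<^sup>+ \<zeta>. a0 \<zeta> \<partial>lborel) \<le> 1"
  shows "(\<integral>\<^sup>+ z. \<integral>\<^sup>+ z'. A0 (gmap \<tau> z z') * a0 (snd (gmap \<tau> z z')) \<partial>lborel \<partial>lborel) \<le> 1"
proof -
  let ?c = "\<lambda>r::'a \<times> 'a. (\<tau> *\<^sub>R fst r, (1 - \<tau>) *\<^sub>R snd r)" and ?J = "\<lambda>r::'a \<times> 'a. (snd r, - fst r)"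
  have g: "gmap \<tau> z (z - r) = (- ?c r + z, ?J r)" for z r
    by (auto simp: gmap_def prod_eq_iff algebra_simps)
  have "(\<integral>\<^sup>+ z. \<integral>\<^sup>+ z'. A0 (gmap \<tau> z z') * a0 (snd (gmap \<tau> z z')) \<partial>lborel \<partial>lborel) =
     (\<integral>\<^sup>+ z. \<integral>\<^sup>+ r. A0 (gmap \<tau> z (z - r)) * a0 (snd (gmap \<tau> z (z - r))) \<partial>lborel \<partial>lborel)"
    by (intro nn_integral_cong nn_integral_lborel_reflect[symmetric]) measurable
  also have "\<dots> = (\<integral>\<^sup>+ r. \<integral>\<^sup>+ z. a0 (?J r) * A0 (- ?c r + z, ?J r) \<partial>lborel \<partial>lborel)"
    unfolding g by (subst nn_integral_lborel_swap) (measurable, simp add: mult.commute)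
  also have "\<dots> = (\<integral>\<^sup>+ r. a0 (?J r) * (\<integral>\<^sup>+ z. A0 (- ?c r + z, ?J r) \<partial>lborel) \<partial>lborel)"
    by (subst nn_integral_cmult) simp_all
  also have "\<dots> = (\<integral>\<^sup>+ r. a0 (?J r) * (\<integral>\<^sup>+ z. A0 (z, ?J r) \<partial>lborel) \<partial>lborel)"
    by (subst nn_integral_lborel_translate[of "\<lambda>z. A0 (z, _)"]) simp_all
  also have "\<dots> \<le> (\<integral>\<^sup>+ r. a0 (?J r) * 1 \<partial>lborel)" by (intro nn_integral_mono mult_left_mono A0) simp
  also have "\<dots> = (\<integral>\<^sup>+ r2. \<integral>\<^sup>+ r1. a0 (r2, 0 - r1) \<partial>lborel \<partial>lborel)"
    by (subst nn_integral_lborel_pair(2)) simp_all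
  also have "\<dots> = (\<integral>\<^sup>+ \<zeta>. a0 \<zeta> \<partial>lborel)"
    by (subst nn_integral_lborel_reflect) (simp_all add: nn_integral_lborel_pair(1))
  finally show ?thesis using a0 by (rule order_trans)
qed

text \<open>
  Young's inequality.  If \<open>A \<le> A0\<^sup>\<pi> a0\<^sup>\<theta>\<close>, then \<open>a0\<close> is evaluated at a function of \<open>z - z'\<close> only.
  Hence \<open>A0 a0\<close> is integrable over pairs \<open>(z, z')\<close>, and the remaining power of \<open>a0\<close> acts by
  convolution.
\<close>

theorem mixed_le_gabor_matrix:
  fixes \<pi> \<theta> \<sigma> \<rho> :: real
  assumes e: "0 \<le> \<pi>" "\<pi> \<le> \<theta>" "\<theta> \<le> 1" "1 - \<theta> \<le> \<sigma>" "\<sigma> \<le> 1 - \<pi>" "1 - \<theta> \<le> \<rho>" "\<rho> \<le> 1 - \<pi>"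
  obtains C where "C < top"
    "\<And>\<tau> (A :: ('a::euclidean_space \<times> 'a) \<times> ('a \<times> 'a) \<Rightarrow> ennreal) F NA NF.
       mixed_le \<pi> \<theta> A NA \<Longrightarrow> mixed_le \<sigma> \<rho> F NF \<Longrightarrow>
       mixed_le (\<pi> + (\<sigma> + \<theta> - 1)) (\<pi> + (\<rho> + \<theta> - 1)) (\<lambda>z. \<integral>\<^sup>+ z'. A (gmap \<tau> z z') * F z' \<partial>lborel) (C * (NA * NF))"
proof -
  \<comment> \<open>\<alpha> is the power of a0 left after \<pi> of it has joined A0. The exponents
    x1, x2, x3 accompany \<pi> in the Hoelder inequality over positions; x1, y2, y3, divided by
    their sum l, are used over frequencies.\<close>
  define l where "l = 1 - \<pi>"
  define \<alpha> where "\<alpha> = \<theta> - \<pi>"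
  define x1 x2 x3 where "x1 = 1 - \<theta>" and "x2 = \<sigma> + \<theta> - 1" and "x3 = 1 - \<pi> - \<sigma>"
  define y2 y3 where "y2 = \<rho> + \<theta> - 1" and "y3 = 1 - \<pi> - \<rho>"
  have x: "0 \<le> l" "0 \<le> \<alpha>" "0 \<le> x1" "0 \<le> x2" "0 \<le> x3" "0 \<le> y2" "0 \<le> y3" "0 \<le> l - x2"
    and xs: "\<sigma> = x1 + x2" "\<alpha> = x2 + x3" "\<rho> = x1 + y2" "\<alpha> = y2 + y3" "l = x1 + y2 + y3" "\<pi> + x1 + x2 + x3 = 1" "\<pi> + x2 + (l - x2) + 0 = 1" "\<theta> = \<pi> + \<alpha>"
    using e by (auto simp: l_def \<alpha>_def x1_def x2_def x3_def y2_def y3_def)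
  \<comment> \<open>The first factor comes from the mass 2 of \<open>a1\<close>, the second from
    adding two densities of mass 1 in u, the third from adding two of mass 2 in \<omega>.\<close>
  define C where "C = pw 2 y3 * pw 2 (\<pi> + x2) * pw 4 (\<pi> + y2)"
  have "C < top" unfolding C_def using e x by (auto simp: ennreal_mult_less_top intro!: pw_finite)
  moreover have "mixed_le (\<pi> + x2) (\<pi> + y2) (\<lambda>z. \<integral>\<^sup>+ z'. A (gmap \<tau> z z') * F z' \<partial>lborel) (C * (NA * NF))"
    if A: "mixed_le \<pi> \<theta> A NA" and F: "mixed_le \<sigma> \<rho> F NF"
    for \<tau> and A :: "('a \<times> 'a) \<times> ('a \<times> 'a) \<Rightarrow> ennreal" and F NA NF
  proof -
    obtain A0 a0 where A: "A0 \<in> borel_measurable borel" "a0 \<in> borel_measurable borel"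
      "\<And>\<omega>. (\<integral>\<^sup>+ u. A0 (u, \<omega>) \<partial>lborel) \<le> 1" "(\<integral>\<^sup>+ \<omega>. a0 \<omega> \<partial>lborel) \<le> 1"
      "\<And>u \<omega>. A (u, \<omega>) \<le> NA * pw (A0 (u, \<omega>)) \<pi> * pw (a0 \<omega>) \<theta>"
      by (rule mixed_leE[OF A]) (rule that)
    obtain F0 f0 where F: "F0 \<in> borel_measurable borel" "f0 \<in> borel_measurable borel"
      "\<And>\<omega>. (\<integral>\<^sup>+ u. F0 (u, \<omega>) \<partial>lborel) \<le> 1" "(\<integral>\<^sup>+ \<omega>. f0 \<omega> \<partial>lborel) \<le> 1"
      "\<And>u \<omega>. F (u, \<omega>) \<le> NF * pw (F0 (u, \<omega>)) \<sigma> * pw (f0 \<omega>) \<rho>"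
      by (rule mixed_leE[OF F]) (rule that)
    note [measurable] = A(1,2) F(1,2)
    \<comment> \<open>The argument of a0 is a frequency difference followed by a position
      difference. The swap makes b a density in the position difference, which matches the inner
      variable of F, and a1 its marginal in frequency.\<close>
    have a0m: "(\<lambda>p. a0 (snd p, fst p)) \<in> borel_measurable borel" by measurable
    have "(\<integral>\<^sup>+ \<omega>. \<integral>\<^sup>+ u. a0 (snd (u, \<omega>), fst (u, \<omega>)) \<partial>lborel \<partial>lborel) \<le> 1"
      using A(4) by (simp add: nn_integral_lborel_pair(1))
    then obtain b a1 where b: "b \<in> borel_measurable borel" "a1 \<in> borel_measurable borel"
      "\<And>\<omega>. (\<integral>\<^sup>+ u. b (u, \<omega>) \<partial>lborel) \<le> 1" "(\<integral>\<^sup>+ \<omega>. a1 \<omega> \<partial>lborel) \<le> 2" "\<And>u \<omega>. a0 (\<omega>, u) \<le> b (u, \<omega>) * a1 \<omega>"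
      by (rule disintegrate[OF a0m]) (rule that, simp_all)
    note [measurable] = b(1,2)
    define B where "B z z' = A0 (gmap \<tau> z z') * a0 (snd (gmap \<tau> z z'))" for z z'
    have Bm [measurable]: "(\<lambda>x. B (g x) (h x)) \<in> borel_measurable M"
      if [measurable]: "g \<in> borel_measurable M" "h \<in> borel_measurable M" for g h and M :: "'z measure"
      unfolding B_def by measurable
    define M where "M p \<omega>' = (\<integral>\<^sup>+ u'. F0 (u', \<omega>') * b (u' - fst p, snd p - \<omega>') \<partial>lborel)" for p \<omega>'
    have Mm [measurable]: "(\<lambda>x. M (g x) (h x)) \<in> borel_measurable N"
      if [measurable]: "g \<in> borel_measurable N" "h \<in> borel_measurable N" for g h and N :: "'z measure"
      unfolding M_def by measurable
    define q where "q \<omega> \<omega>' = pw (f0 \<omega>') \<rho> * pw (a1 (\<omega> - \<omega>')) \<alpha>" for \<omega> \<omega>'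
    have qm [measurable]: "q \<omega> \<in> borel_measurable borel" for \<omega> unfolding q_def by measurable
    define I where "I z = (\<integral>\<^sup>+ z'. B z z' \<partial>lborel)" for z
    have Im [measurable]: "I \<in> borel_measurable borel" unfolding I_def by measurable
    have I2: "I p = (\<integral>\<^sup>+ \<omega>'. \<integral>\<^sup>+ u'. B p (u', \<omega>') \<partial>lborel \<partial>lborel)" for p
      unfolding I_def by (rule nn_integral_lborel_pair(2)) measurable
    have brefl: "(\<integral>\<^sup>+ u. b (v - u, \<omega>) \<partial>lborel) \<le> 1" "(\<integral>\<^sup>+ u. b (u - v, \<omega>) \<partial>lborel) \<le> 1" for v \<omega>
      using nn_integral_lborel_reflect[of "\<lambda>u. b (u, \<omega>)" v] nn_integral_lborel_translate[of "\<lambda>u. b (u, \<omega>)" "- v"] b(3)[of \<omega>] by simp_all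
    \<comment> \<open>Hoelder over the position u' for fixed frequency \<omega>'. The factors F0 and
      b with exponents x1 and x3 have u'-mass at most 1 and drop out.\<close>
    have inner: "(\<integral>\<^sup>+ z'. A (gmap \<tau> p z') * F z' \<partial>lborel) \<le>
       (NA * NF) * (\<integral>\<^sup>+ \<omega>'. pw (\<integral>\<^sup>+ u'. B p (u', \<omega>') \<partial>lborel) \<pi> * pw (M p \<omega>') x2 * q (snd p) \<omega>' \<partial>lborel)" for p
    proof -
      let ?G = "\<lambda>u' \<omega>'. pw (B p (u', \<omega>')) \<pi> * pw (F0 (u', \<omega>')) x1 * pw (F0 (u', \<omega>') * b (u' - fst p, snd p - \<omega>')) x2 * pw (b (u' - fst p, snd p - \<omega>')) x3"
      have "(\<integral>\<^sup>+ z'. A (gmap \<tau> p z') * F z' \<partial>lborel) \<le> (\<integral>\<^sup>+ z'. (NA * NF) * (q (snd p) (snd z') * ?G (fst z') (snd z')) \<partial>lborel)"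
      proof (intro nn_integral_mono)
        fix z' :: "'a \<times> 'a"
        obtain u' \<omega>' where z': "z' = (u', \<omega>')" by (cases z')
        let ?b = "b (u' - fst p, snd p - \<omega>')" and ?a = "a1 (snd p - \<omega>')"
        have "A (gmap \<tau> p z') \<le> NA * pw (A0 (gmap \<tau> p z')) \<pi> * pw (a0 (snd (gmap \<tau> p z'))) \<theta>"
          using A(5)[of "fst (gmap \<tau> p z')" "snd (gmap \<tau> p z')"] by simp
        also have "\<dots> = NA * pw (B p z') \<pi> * pw (a0 (snd (gmap \<tau> p z'))) \<alpha>"
          using e x unfolding xs(8) B_def by (simp add: pw_add pw_mult mult_ac)
        also have "\<dots> \<le> NA * pw (B p z') \<pi> * pw (?b * ?a) \<alpha>"
          using x b(5)[of "snd p - \<omega>'" "u' - fst p"] by (intro mult_left_mono pw_mono) (auto simp: z' gmap_def)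
        finally have "A (gmap \<tau> p z') * F z' \<le> (NA * pw (B p z') \<pi> * pw (?b * ?a) \<alpha>) * (NF * pw (F0 z') \<sigma> * pw (f0 \<omega>') \<rho>)"
          using F(5)[of u' \<omega>'] by (intro mult_mono) (auto simp: z')
        also have "\<dots> = (NA * NF) * (q (snd p) \<omega>' * ?G u' \<omega>')"
        proof -
          have "pw (F0 z') \<sigma> = pw (F0 z') x1 * pw (F0 z') x2" using x by (simp add: xs(1) pw_add)
          moreover have "pw (?b * ?a) \<alpha> = (pw ?b x2 * pw ?b x3) * pw ?a \<alpha>"
            using x by (simp add: pw_mult pw_add[symmetric] xs(2)[symmetric])
          moreover have "pw (F0 (u', \<omega>') * ?b) x2 = pw (F0 z') x2 * pw ?b x2" using x by (simp add: pw_mult z')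
          ultimately show ?thesis by (simp add: q_def z' mult_ac)
        qed
        finally show "A (gmap \<tau> p z') * F z' \<le> (NA * NF) * (q (snd p) (snd z') * ?G (fst z') (snd z'))" by (simp add: z')
      qed
      also have "\<dots> = (NA * NF) * (\<integral>\<^sup>+ z'. q (snd p) (snd z') * ?G (fst z') (snd z') \<partial>lborel)"
        by (rule nn_integral_cmult) measurable
      also have "\<dots> \<le> (NA * NF) * (\<integral>\<^sup>+ \<omega>'. q (snd p) \<omega>' * (pw (\<integral>\<^sup>+ u'. B p (u', \<omega>') \<partial>lborel) \<pi> * pw (M p \<omega>') x2) \<partial>lborel)"
      proof (rule mult_left_mono)
      have "(\<integral>\<^sup>+ z'. q (snd p) (snd z') * ?G (fst z') (snd z') \<partial>lborel) = (\<integral>\<^sup>+ \<omega>'. \<integral>\<^sup>+ u'. q (snd p) \<omega>' * ?G u' \<omega>' \<partial>lborel \<partial>lborel)"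
        by (subst nn_integral_lborel_pair(2)) simp_all
      also have "\<dots> = (\<integral>\<^sup>+ \<omega>'. q (snd p) \<omega>' * (\<integral>\<^sup>+ u'. ?G u' \<omega>' \<partial>lborel) \<partial>lborel)"
        by (subst nn_integral_cmult) simp_all
      also have "\<dots> \<le> (\<integral>\<^sup>+ \<omega>'. q (snd p) \<omega>' * (pw (\<integral>\<^sup>+ u'. B p (u', \<omega>') \<partial>lborel) \<pi> * pw (M p \<omega>') x2) \<partial>lborel)"
      proof (intro nn_integral_mono mult_left_mono)
        fix \<omega>'
        have "(\<integral>\<^sup>+ u'. ?G u' \<omega>' \<partial>lborel) \<le> pw (\<integral>\<^sup>+ u'. B p (u', \<omega>') \<partial>lborel) \<pi> * pw (\<integral>\<^sup>+ u'. F0 (u', \<omega>') \<partial>lborel) x1 *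
           pw (M p \<omega>') x2 * pw (\<integral>\<^sup>+ u'. b (u' - fst p, snd p - \<omega>') \<partial>lborel) x3"
          unfolding M_def using e x xs(6) by (intro holder4) simp_all
        also have "\<dots> \<le> pw (\<integral>\<^sup>+ u'. B p (u', \<omega>') \<partial>lborel) \<pi> * pw 1 x1 * pw (M p \<omega>') x2 * pw 1 x3"
          using e x by (intro mult_mono pw_mono F(3) brefl) auto
        finally show "(\<integral>\<^sup>+ u'. ?G u' \<omega>' \<partial>lborel) \<le> pw (\<integral>\<^sup>+ u'. B p (u', \<omega>') \<partial>lborel) \<pi> * pw (M p \<omega>') x2" by simp
      qed simp
      finally show "(\<integral>\<^sup>+ z'. q (snd p) (snd z') * ?G (fst z') (snd z') \<partial>lborel) \<le> \<dots>" .
      qed simp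
      finally show ?thesis by (simp add: mult_ac)
    qed
    have "\<exists>J0 k2. J0 \<in> borel_measurable borel \<and> k2 \<in> borel_measurable borel \<and> (\<forall>\<omega>. (\<integral>\<^sup>+ u. J0 (u, \<omega>) \<partial>lborel) \<le> 1) \<and>
       (\<integral>\<^sup>+ \<omega>. k2 \<omega> \<partial>lborel) \<le> 2 \<and> (\<forall>p. (\<integral>\<^sup>+ z'. A (gmap \<tau> p z') * F z' \<partial>lborel) \<le>
          (NA * NF) * (pw (I p) \<pi> * pw (J0 p) x2 * (pw (k2 (snd p)) y2 * pw 2 y3)))"
    \<comment> \<open>The second Hoelder inequality, over \<omega>', divides exponents by l. For l =
      0 only the first power of B is left.\<close>
    proof (cases "l = 0")
      case True
      then have z: "x1 = 0" "x2 = 0" "y2 = 0" "y3 = 0" "\<pi> = 1" "\<rho> = 0" "\<alpha> = 0" using x xs by (auto simp: l_def)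
      have "(\<integral>\<^sup>+ z'. A (gmap \<tau> p z') * F z' \<partial>lborel) \<le> (NA * NF) * I p" for p
        using inner[of p] by (simp add: z q_def I2)
      then show ?thesis by (intro exI[of _ "\<lambda>_. 0"]) (simp add: z)
    next
      case False
      then have l: "0 < l" using x by simp
      \<comment> \<open>The l-th root of q, so that q splits into powers x2 and l - x2 of Q, fit for
        Hoelder with exponents \<pi>, x2, l - x2.\<close>
      define Q where "Q \<omega> \<omega>' = pw (f0 \<omega>') (\<rho> / l) * pw (a1 (\<omega> - \<omega>')) (\<alpha> / l)" for \<omega> \<omega>'
      have Qm [measurable]: "(\<lambda>x. Q (g x) (h x)) \<in> borel_measurable N"
        if [measurable]: "g \<in> borel_measurable N" "h \<in> borel_measurable N" for g h and N :: "'z measure"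
        unfolding Q_def by measurable
      have q: "q \<omega> \<omega>' = pw (Q \<omega> \<omega>') x2 * pw (Q \<omega> \<omega>') (l - x2)" for \<omega> \<omega>'
      proof -
        have "0 \<le> \<rho>" "0 \<le> \<alpha>" using e x by auto
        then have "q \<omega> \<omega>' = pw (Q \<omega> \<omega>') l" using l by (simp add: q_def Q_def pw_mult pw_pw)
        then show ?thesis using x by (simp add: pw_add[symmetric])
      qed
      define kk where "kk \<omega> = (\<integral>\<^sup>+ \<omega>'. Q \<omega> \<omega>' \<partial>lborel)" for \<omega>
      define k2 where "k2 \<omega> = (\<integral>\<^sup>+ \<omega>'. f0 \<omega>' * a1 (\<omega> - \<omega>') \<partial>lborel)" for \<omega>
      define J where "J p = (\<integral>\<^sup>+ \<omega>'. M p \<omega>' * Q (snd p) \<omega>' \<partial>lborel)" for p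
      have [measurable]: "kk \<in> borel_measurable borel" "k2 \<in> borel_measurable borel" "J \<in> borel_measurable borel"
        unfolding kk_def k2_def J_def by measurable
      \<comment> \<open>Dividing J by its bound kk gives a density in u. The power x2 of kk released
        in this way joins the power l - x2 to form the l-th power, which is bounded through the
        convolution k2 of f0 and a1.\<close>
      define J0 where "J0 p = (if kk (snd p) = top then ennreal (gaussian (fst p)) else J p / kk (snd p))" for p
      have [measurable]: "J0 \<in> borel_measurable borel" unfolding J0_def by measurable
      have arefl: "(\<integral>\<^sup>+ \<omega>'. a1 (\<omega> - \<omega>') \<partial>lborel) \<le> 2" "(\<integral>\<^sup>+ \<omega>. a1 (\<omega> - \<omega>') \<partial>lborel) \<le> 2" for \<omega> \<omega>'
        using nn_integral_lborel_reflect[of a1 \<omega>] nn_integral_lborel_translate[of a1 "- \<omega>'"] b(4) by simp_all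
      have kkle: "pw (kk \<omega>) l \<le> pw (k2 \<omega>) y2 * pw 2 y3" for \<omega>
      proof -
        have "kk \<omega> = (\<integral>\<^sup>+ \<omega>'. pw (f0 \<omega>') (x1 / l) * pw (f0 \<omega>' * a1 (\<omega> - \<omega>')) (y2 / l) * pw (a1 (\<omega> - \<omega>')) (y3 / l) * pw (f0 \<omega>') 0 \<partial>lborel)"
          unfolding kk_def Q_def xs(3,4) using x l
          by (intro nn_integral_cong) (simp add: add_divide_distrib pw_add pw_mult mult_ac)
        also have "\<dots> \<le> pw (\<integral>\<^sup>+ \<omega>'. f0 \<omega>' \<partial>lborel) (x1 / l) * pw (k2 \<omega>) (y2 / l) * pw (\<integral>\<^sup>+ \<omega>'. a1 (\<omega> - \<omega>') \<partial>lborel) (y3 / l) * pw (\<integral>\<^sup>+ \<omega>'. f0 \<omega>' \<partial>lborel) 0"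
          unfolding k2_def using x l xs(5) by (intro holder4) (simp_all add: add_divide_distrib[symmetric])
        also have "\<dots> \<le> pw 1 (x1 / l) * pw (k2 \<omega>) (y2 / l) * pw 2 (y3 / l) * pw 1 0"
          using x l by (intro mult_mono pw_mono F(4) arefl) auto
        finally have "pw (kk \<omega>) l \<le> pw (pw (k2 \<omega>) (y2 / l) * pw 2 (y3 / l)) l" using l by (intro pw_mono) simp_all
        also have "\<dots> = pw (k2 \<omega>) y2 * pw 2 y3" using l x by (simp add: pw_mult pw_pw)
        finally show ?thesis .
      qed
      have Mint: "(\<integral>\<^sup>+ u. M (u, \<omega>) \<omega>' \<partial>lborel) \<le> 1" for \<omega> \<omega>'
      proof -
        have "(\<integral>\<^sup>+ u. M (u, \<omega>) \<omega>' \<partial>lborel) = (\<integral>\<^sup>+ u'. \<integral>\<^sup>+ u. F0 (u', \<omega>') * b (u' - u, \<omega> - \<omega>') \<partial>lborel \<partial>lborel)"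
          unfolding M_def by (subst nn_integral_lborel_swap) simp_all
        also have "\<dots> = (\<integral>\<^sup>+ u'. F0 (u', \<omega>') * (\<integral>\<^sup>+ u. b (u' - u, \<omega> - \<omega>') \<partial>lborel) \<partial>lborel)"
          by (subst nn_integral_cmult) simp_all
        also have "\<dots> \<le> (\<integral>\<^sup>+ u'. F0 (u', \<omega>') * 1 \<partial>lborel)" by (intro nn_integral_mono mult_left_mono brefl) simp
        finally show ?thesis using F(3)[of \<omega>'] by simp
      qed
      have Jint: "(\<integral>\<^sup>+ u. J (u, \<omega>) \<partial>lborel) \<le> kk \<omega>" for \<omega>
      proof -
        have "(\<integral>\<^sup>+ u. J (u, \<omega>) \<partial>lborel) = (\<integral>\<^sup>+ \<omega>'. \<integral>\<^sup>+ u. M (u, \<omega>) \<omega>' * Q \<omega> \<omega>' \<partial>lborel \<partial>lborel)"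
          unfolding J_def by (subst nn_integral_lborel_swap) simp_all
        also have "\<dots> = (\<integral>\<^sup>+ \<omega>'. (\<integral>\<^sup>+ u. M (u, \<omega>) \<omega>' \<partial>lborel) * Q \<omega> \<omega>' \<partial>lborel)"
          by (subst nn_integral_multc) simp_all
        also have "\<dots> \<le> (\<integral>\<^sup>+ \<omega>'. 1 * Q \<omega> \<omega>' \<partial>lborel)" by (intro nn_integral_mono mult_right_mono Mint) simp
        finally show ?thesis by (simp add: kk_def)
      qed
      have J0int: "(\<integral>\<^sup>+ u. J0 (u, \<omega>) \<partial>lborel) \<le> 1" for \<omega>
      proof (cases "kk \<omega> = top")
        case False
        have "(\<integral>\<^sup>+ u. J0 (u, \<omega>) \<partial>lborel) = (\<integral>\<^sup>+ u. J (u, \<omega>) \<partial>lborel) / kk \<omega>"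
          using False by (simp add: J0_def nn_integral_divide)
        also have "\<dots> \<le> kk \<omega> / kk \<omega>" by (intro divide_right_mono_ennreal Jint)
        also have "\<dots> \<le> 1" using False by (cases "kk \<omega> = 0") auto
        finally show ?thesis .
      qed (simp add: J0_def nn_integral_gaussian)
      have JJ0: "J p \<le> J0 p * kk (snd p)" for p
      proof -
        consider "kk (snd p) = top" | "kk (snd p) = 0" | "kk (snd p) \<noteq> 0" "kk (snd p) \<noteq> top" by blast
        then show ?thesis
        proof cases
          case 1
          then show ?thesis using gaussian_pos[of "fst p"] by (simp add: J0_def ennreal_mult_top)
        next
          case 2
          then have "AE \<omega>' in lborel. Q (snd p) \<omega>' = 0" unfolding kk_def by (subst (asm) nn_integral_0_iff_AE) auto
          then have "AE \<omega>' in lborel. M p \<omega>' * Q (snd p) \<omega>' = 0" by eventually_elim simp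
          then have "J p = 0" unfolding J_def by (subst nn_integral_0_iff_AE) auto
          then show ?thesis by simp
        next
          case 3
          then show ?thesis by (simp add: J0_def mult.commute[of _ "kk _"] ennreal_mult_div_cancel)
        qed
      qed
      have "(\<integral>\<^sup>+ z'. A (gmap \<tau> p z') * F z' \<partial>lborel) \<le> (NA * NF) * (pw (I p) \<pi> * pw (J0 p) x2 * (pw (k2 (snd p)) y2 * pw 2 y3))" for p
      proof -
        have "(\<integral>\<^sup>+ \<omega>'. pw (\<integral>\<^sup>+ u'. B p (u', \<omega>') \<partial>lborel) \<pi> * pw (M p \<omega>') x2 * q (snd p) \<omega>' \<partial>lborel) =
          (\<integral>\<^sup>+ \<omega>'. pw (\<integral>\<^sup>+ u'. B p (u', \<omega>') \<partial>lborel) \<pi> * pw (M p \<omega>' * Q (snd p) \<omega>') x2 * pw (Q (snd p) \<omega>') (l - x2) * pw (f0 \<omega>') 0 \<partial>lborel)"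
          using x by (simp add: q pw_mult mult_ac)
        also have "\<dots> \<le> pw (I p) \<pi> * pw (J p) x2 * pw (kk (snd p)) (l - x2) * pw (\<integral>\<^sup>+ \<omega>'. f0 \<omega>' \<partial>lborel) 0"
          unfolding I2 J_def kk_def using e x xs(7) by (intro holder4) simp_all
        also have "\<dots> \<le> pw (I p) \<pi> * (pw (J0 p) x2 * pw (kk (snd p)) x2) * pw (kk (snd p)) (l - x2)"
          using x by (auto simp: pw_mult[symmetric] intro!: mult_mono pw_mono JJ0)
        also have "\<dots> = pw (I p) \<pi> * pw (J0 p) x2 * pw (kk (snd p)) l"
          using x by (simp add: mult.assoc pw_add[symmetric])
        also have "\<dots> \<le> pw (I p) \<pi> * pw (J0 p) x2 * (pw (k2 (snd p)) y2 * pw 2 y3)"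
          by (intro mult_left_mono kkle) simp
        finally show ?thesis by (intro order_trans[OF inner] mult_left_mono) simp_all
      qed
      moreover have "(\<integral>\<^sup>+ \<omega>. k2 \<omega> \<partial>lborel) \<le> 2"
      proof -
        have "(\<integral>\<^sup>+ \<omega>. k2 \<omega> \<partial>lborel) = (\<integral>\<^sup>+ \<omega>'. \<integral>\<^sup>+ \<omega>. f0 \<omega>' * a1 (\<omega> - \<omega>') \<partial>lborel \<partial>lborel)"
          unfolding k2_def by (subst nn_integral_lborel_swap) simp_all
        also have "\<dots> = (\<integral>\<^sup>+ \<omega>'. f0 \<omega>' * (\<integral>\<^sup>+ \<omega>. a1 (\<omega> - \<omega>') \<partial>lborel) \<partial>lborel)"
          by (subst nn_integral_cmult) simp_all
        also have "\<dots> \<le> (\<integral>\<^sup>+ \<omega>'. f0 \<omega>' * 2 \<partial>lborel)" by (intro nn_integral_mono mult_left_mono arefl) simp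
        also have "\<dots> \<le> 1 * 2" using mult_right_mono[OF F(4), of 2] by (simp add: nn_integral_multc)
        finally show ?thesis by simp
      qed
      ultimately show ?thesis using J0int by (intro exI[of _ J0] exI[of _ k2]) simp
    qed
    then obtain J0 k2 where J: "J0 \<in> borel_measurable borel" "k2 \<in> borel_measurable borel" "\<And>\<omega>. (\<integral>\<^sup>+ u. J0 (u, \<omega>) \<partial>lborel) \<le> 1"
       "(\<integral>\<^sup>+ \<omega>. k2 \<omega> \<partial>lborel) \<le> 2"
       "\<And>p. (\<integral>\<^sup>+ z'. A (gmap \<tau> p z') * F z' \<partial>lborel) \<le> (NA * NF) * (pw (I p) \<pi> * pw (J0 p) x2 * (pw (k2 (snd p)) y2 * pw 2 y3))"
      by blast
    note [measurable] = J(1,2)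
    have "(\<integral>\<^sup>+ \<omega>. \<integral>\<^sup>+ u. I (u, \<omega>) \<partial>lborel \<partial>lborel) \<le> 1"
      using nn_integral_gmap[OF A(1-4), of \<tau>] unfolding I_def B_def[symmetric]
      by (subst (asm) nn_integral_lborel_pair(2)) simp_all
    then obtain I0 k where I: "I0 \<in> borel_measurable borel" "k \<in> borel_measurable borel"
      "\<And>\<omega>. (\<integral>\<^sup>+ u. I0 (u, \<omega>) \<partial>lborel) \<le> 1" "(\<integral>\<^sup>+ \<omega>. k \<omega> \<partial>lborel) \<le> 2" "\<And>u \<omega>. I (u, \<omega>) \<le> I0 (u, \<omega>) * k \<omega>"
      by (rule disintegrate[OF Im]) (rule that)
    note [measurable] = I(1,2)
    \<comment> \<open>A sum of densities majorises each summand, so the powers \<pi> and x2,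
      respectively \<pi> and y2, of different densities merge into a single power.\<close>
    have "mixed_le (\<pi> + x2) (\<pi> + y2) (\<lambda>z. \<integral>\<^sup>+ z'. A (gmap \<tau> z z') * F z' \<partial>lborel) ((NA * NF * pw 2 y3) * pw 2 (\<pi> + x2) * pw 4 (\<pi> + y2))"
    proof (rule mixed_leI[of "\<lambda>p. I0 p + J0 p" "\<lambda>\<omega>. k \<omega> + k2 \<omega>"])
      show "(\<integral>\<^sup>+ u. I0 (u, \<omega>) + J0 (u, \<omega>) \<partial>lborel) \<le> 2" for \<omega>
        using add_mono[OF I(3)[of \<omega>] J(3)[of \<omega>]] by (subst nn_integral_add) simp_all
      show "(\<integral>\<^sup>+ \<omega>. k \<omega> + k2 \<omega> \<partial>lborel) \<le> 4"
        using add_mono[OF I(4) J(4)] by (subst nn_integral_add) simp_all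
      fix u \<omega> :: 'a
      let ?p = "(u, \<omega>)"
      have "pw (I ?p) \<pi> * pw (J0 ?p) x2 * (pw (k2 \<omega>) y2 * pw 2 y3) \<le>
         (pw (I0 ?p) \<pi> * pw (k \<omega>) \<pi>) * pw (J0 ?p) x2 * (pw (k2 \<omega>) y2 * pw 2 y3)"
        using e I(5)[of u \<omega>] by (auto simp: pw_mult[symmetric] intro!: mult_right_mono pw_mono)
      also have "\<dots> \<le> (pw (I0 ?p + J0 ?p) \<pi> * pw (k \<omega> + k2 \<omega>) \<pi>) * pw (I0 ?p + J0 ?p) x2 * (pw (k \<omega> + k2 \<omega>) y2 * pw 2 y3)"
        using e x by (intro mult_mono pw_mono) auto
      also have "\<dots> = pw 2 y3 * pw (I0 ?p + J0 ?p) (\<pi> + x2) * pw (k \<omega> + k2 \<omega>) (\<pi> + y2)"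
        using e x by (simp add: pw_add mult_ac)
      finally have "(NA * NF) * (pw (I ?p) \<pi> * pw (J0 ?p) x2 * (pw (k2 \<omega>) y2 * pw 2 y3)) \<le> (NA * NF) * \<dots>"
        by (intro mult_left_mono) simp_all
      with J(5)[of ?p] show "(\<integral>\<^sup>+ z'. A (gmap \<tau> ?p z') * F z' \<partial>lborel) \<le>
         (NA * NF * pw 2 y3) * pw (I0 ?p + J0 ?p) (\<pi> + x2) * pw (k \<omega> + k2 \<omega>) (\<pi> + y2)"
        by (simp add: mult_ac)
    qed (use e x in simp_all)
    then show ?thesis by (simp add: C_def mult_ac)
  qed
  ultimately show ?thesis by (intro that[of C]) (simp_all add: x2_def y2_def)
qed

subsection \<open>Weights and change of window\<close>

text \<open>\<open>tempered_integral\<close> gives continuity of the product of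
  \<open>stft g u\<close> with the conjugate of \<open>fstft g h\<close>, for every Schwartz h. For
  h the shift of g by z0, the second factor equals the energy of g at z0 and can be divided out near
  z0.\<close>

lemma stft_continuous:
  assumes u: "tempered u" and g: "schwartz g"
  shows "continuous_on UNIV (stft g u)"
proof (cases "g = (\<lambda>_. 0)")
  case True
  then have "stft g u = (\<lambda>z. 0)"
    by (simp add: fun_eq_iff stft_eq tfz_apply[abs_def] tempered_zero[OF u])
  then show ?thesis by simp
next
  case False
  have "isCont (stft g u) z0" for z0
  proof -
    define h where "h = tfz z0 g"
    have h: "schwartz h" unfolding h_def by (rule schwartz_tfz[OF g])
    have "(\<lambda>z. u (\<lambda>x. synth g h (z, x))) = (\<lambda>z. stft g u z * cnj (fstft g h z))"
      by (simp add: fun_eq_iff synth_def tempered_cmult[OF u schwartz_tfz[OF g]] stft_eq)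
    then have c1: "isCont (\<lambda>z. stft g u z * cnj (fstft g h z)) z0"
      using tempered_integral(3)[OF u schwartz_synth[OF g h]] by (simp add: continuous_on_eq_continuous_at del: split_paired_All)
    have c2: "isCont (\<lambda>z. cnj (fstft g h z)) z0"
      using schwartz_continuous[OF schwartz_fstft[OF g h]]
      by (intro continuous_intros) (simp add: continuous_on_eq_continuous_at del: split_paired_All)
    have "fstft g h z0 = of_real (energy g)"
      unfolding h_def using g fstft_tfz[OF schwartz_measurable[OF g] schwartz_measurable[OF g], of z0 z0] energy_complex[OF g, of 0]
        integral_lborel_reflect[of "\<lambda>x. g x * cnj (g x)" 0] schwartz_measurable[OF g]
      by (simp add: fstft_def tfz_apply zero_prod_def)
    then have nz: "cnj (fstft g h z0) \<noteq> 0" using energy_pos[OF g False] by simp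
    have "isCont (\<lambda>z. stft g u z * cnj (fstft g h z) / cnj (fstft g h z)) z0"
      by (rule continuous_at_within_divide[OF c1 c2 nz])
    moreover have "((\<lambda>z. cnj (fstft g h z)) \<longlongrightarrow> cnj (fstft g h z0)) (nhds z0)"
      using c2 tendsto_at_iff_tendsto_nhds[of "\<lambda>z. cnj (fstft g h z)" z0] unfolding isCont_def by blast
    then have "eventually (\<lambda>z. cnj (fstft g h z) \<noteq> 0) (nhds z0)"
      using nz by (rule tendsto_imp_eventually_ne)
    then have "eventually (\<lambda>z. stft g u z * cnj (fstft g h z) / cnj (fstft g h z) = stft g u z) (nhds z0)"
      by eventually_elim simp
    ultimately show ?thesis using isCont_cong by fastforce
  qed
  then show ?thesis by (simp add: continuous_on_eq_continuous_at del: split_paired_All)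
qed

text \<open>Moderateness with respect to a power of \<open>bk\<close>. In this form it passes to
  reciprocals, so it covers the regularised weight, its inverse and \<open>one_tensor_J v\<close>
  alike.\<close>

definition poly_weight :: "('z::euclidean_space \<Rightarrow> real) \<Rightarrow> bool" where
  "poly_weight m \<longleftrightarrow> continuous_on UNIV m \<and> (\<forall>z. 0 < m z) \<and> (\<exists>C K. C \<ge> 0 \<and> (\<forall>z h. m (z + h) \<le> C * bk h ^ K * m z))"

lemma poly_weight_inverse:
  assumes "poly_weight m" shows "poly_weight (\<lambda>z. 1 / m z)"
proof -
  obtain C K where m: "continuous_on UNIV m" "\<And>z. 0 < m z" "C \<ge> 0" "\<And>z h. m (z + h) \<le> C * bk h ^ K * m z"
    using assms unfolding poly_weight_def by blast
  have "1 / m (z + h) \<le> C * bk h ^ K * (1 / m z)" for z h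
    using m(4)[of "z + h" "- h"] m(2)[of z] m(2)[of "z + h"] by (simp add: divide_simps)
  moreover have "continuous_on UNIV (\<lambda>z. 1 / m z)"
    using m(1) less_imp_neq[OF m(2)] by (intro continuous_intros) (metis)+
  ultimately show ?thesis using m unfolding poly_weight_def by (auto intro!: exI[of _ C])
qed

text \<open>A moderate weight need not be measurable; the regularised weight is continuous.\<close>

lemma moderate_weight_regularize:
  assumes v: "submultiplicative_weight v" "polynomial_growth v" and m: "m \<in> moderate_weights v"
  obtains m' C where "poly_weight m'" "\<And>z. m z \<le> m' z" "C > 0" "\<And>z. m' z \<le> C * m z" "\<And>z h. m' (z + h) \<le> v h * m' z"
proof -
  obtain C where C: "C > 0" "\<And>z1 z2. m (z1 + z2) \<le> C * v z1 * m z2" and mp: "\<And>z. 0 < m z"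
    using m unfolding moderate_weights_def by blast
  have v': "continuous_on UNIV v" "\<And>z. 0 < v z" "v 0 = 1" "\<And>z. v (- z) = v z" "\<And>z1 z2. v (z1 + z2) \<le> v z1 * v z2"
    using v(1) unfolding submultiplicative_weight_def by auto
  \<comment> \<open>The smallest majorant of m that is v-moderate with constant 1. That constant
    gives m' z / v h \<le> m' (z + h) \<le> v h * m' z, whence continuity, since v tends to 1 at
    0.\<close>
  define m' where "m' z = (SUP w. m w / v (w - z))" for z
  have up: "m w / v (w - z) \<le> C * m z" for w z
    using C(2)[of "w - z" z] v'(2)[of "w - z"] by (simp add: divide_simps mult_ac)
  then have bdd: "bdd_above (range (\<lambda>w. m w / v (w - z)))" for z by (intro bdd_aboveI2[where M="C * m z"])
  have le: "m z \<le> m' z" for z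
    unfolding m'_def using cSUP_upper[OF _ bdd, of z z] v'(3) by simp
  have m'C: "m' z \<le> C * m z" for z unfolding m'_def by (intro cSUP_least up) simp
  have sub: "m' (z + h) \<le> v h * m' z" for z h
    unfolding m'_def[of "z + h"]
  proof (rule cSUP_least)
    fix w
    have "v (w - z) \<le> v (w - (z + h)) * v h" using v'(5)[of "w - (z + h)" h] by simp
    then have "m w / v (w - (z + h)) \<le> v h * (m w / v (w - z))"
      using v'(2)[of "w - z"] v'(2)[of "w - (z + h)"] mp[of w] by (simp add: divide_simps mult_ac)
    also have "\<dots> \<le> v h * m' z"
      unfolding m'_def using v'(2)[of h] by (intro mult_left_mono cSUP_upper bdd) auto
    finally show "m w / v (w - (z + h)) \<le> v h * m' z" .
  qed simp
  have pos: "0 < m' z" for z using le[of z] mp[of z] by simp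
  have "isCont m' z" for z
    unfolding isCont_iff
  proof (rule tendsto_sandwich)
    have v0: "(v \<longlongrightarrow> 1) (at 0)" using v'(1,3) by (metis UNIV_I continuous_on_eq_continuous_at isCont_def open_UNIV)
    show "((\<lambda>h. m' z / v h) \<longlongrightarrow> m' z) (at 0)" using tendsto_divide[OF tendsto_const v0, of "m' z"] by simp
    show "((\<lambda>h. v h * m' z) \<longlongrightarrow> m' z) (at 0)" using tendsto_mult[OF v0 tendsto_const, of "m' z"] by simp
    show "\<forall>\<^sub>F h in at 0. m' (z + h) \<le> v h * m' z" by (intro always_eventually allI sub)
    have "m' z / v h \<le> m' (z + h)" for h
      using sub[of "z + h" "- h"] v'(2)[of h] by (simp add: v'(4) divide_simps mult_ac)
    then show "\<forall>\<^sub>F h in at 0. m' z / v h \<le> m' (z + h)" by (intro always_eventually allI)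
  qed
  moreover obtain D N where "\<And>z. v z \<le> D * bk z ^ N" using v(2) unfolding polynomial_growth_def bk_def by blast
  then have "m' (z + h) \<le> max D 0 * bk h ^ N * m' z" for z h
    using sub[of z h] pos[of z] mult_right_mono[OF max.cobounded1[of D 0], of "bk h ^ N"] bk_power_pos[of h N]
    by (meson less_imp_le mult_right_mono order_trans)
  ultimately have "poly_weight m'"
    unfolding poly_weight_def using pos by (auto simp: continuous_on_eq_continuous_at intro!: exI[of _ "max D 0"])
  then show ?thesis using le C(1) m'C sub by (rule that)
qed

lemma poly_weight_one_tensor_J:
  assumes v: "submultiplicative_weight v" "polynomial_growth v"
  shows "poly_weight (one_tensor_J v)"
proof -
  have v': "continuous_on UNIV v" "\<And>z. 0 < v z" "\<And>z1 z2. v (z1 + z2) \<le> v z1 * v z2"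
    using v(1) unfolding submultiplicative_weight_def by auto
  obtain D N where D: "\<And>z. v z \<le> D * bk z ^ N" using v(2) unfolding polynomial_growth_def bk_def by blast
  have e: "one_tensor_J v Z = v (snd (snd Z), - fst (snd Z))" for Z
    by (simp add: one_tensor_J_def symplectic_J_def split_def)
  have "continuous_on UNIV (one_tensor_J v)"
    unfolding e[abs_def] by (intro continuous_on_compose2[OF v'(1)] continuous_intros) auto
  moreover have "one_tensor_J v (Z + H) \<le> max D 0 * bk H ^ N * one_tensor_J v Z" for Z H
  proof -
    let ?h = "(snd (snd H), - fst (snd H))" and ?z = "(snd (snd Z), - fst (snd Z))"
    have "one_tensor_J v (Z + H) \<le> v ?h * v ?z" using v'(3)[of ?h ?z] by (simp add: e add.commute)
    also have "\<dots> \<le> (D * bk ?h ^ N) * v ?z" using D less_imp_le[OF v'(2)] by (intro mult_right_mono)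
    also have "\<dots> \<le> (max D 0 * bk H ^ N) * v ?z"
    proof (intro mult_right_mono mult_mono power_mono)
      have "norm ?h = norm (snd H)" by (simp add: norm_prod_def add.commute)
      then show "bk ?h \<le> bk H" using norm_snd_le[of "snd H" "fst H"] by (simp add: bk_def)
    qed (auto simp: bk_nonneg less_imp_le[OF v'(2)])
    finally show ?thesis by (simp add: e)
  qed
  moreover have "0 < one_tensor_J v Z" for Z by (simp add: e v'(2))
  moreover have "0 \<le> max D 0" by simp
  ultimately show ?thesis unfolding poly_weight_def by blast
qed

lemma bk_prod_kernel: "inverse (bk y ^ (2 * n)) \<le> prod_kernel n y"
proof -
  have "bk (fst y) ^ n * bk (snd y) ^ n \<le> bk y ^ n * bk y ^ n"
    using bk_fst_le[of "fst y" "snd y"] bk_snd_le[of "snd y" "fst y"]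
    by (intro mult_mono power_mono) (auto simp: bk_nonneg)
  then have "inverse (bk y ^ n * bk y ^ n) \<le> inverse (bk (fst y) ^ n * bk (snd y) ^ n)"
    by (intro le_imp_inverse_le mult_pos_pos bk_power_pos)
  then show ?thesis by (simp add: prod_kernel_def mult_2 power_add)
qed

text \<open>Moving the weight from z to z' costs K powers of \<open>bk (z' - z)\<close>, paid by the
  decay of k; the other 2 n powers dominate the product kernel. C and K come from m alone, so the
  bound is linear in the decay constant D.\<close>

lemma smear_kernel:
  fixes m :: "'u::euclidean_space \<times> 'w::euclidean_space \<Rightarrow> real"
  assumes m: "poly_weight m"
  obtains C K where "C \<ge> 0" "\<forall>n f k D z. f \<in> borel_measurable borel \<longrightarrow> k \<in> borel_measurable borel \<longrightarrow> D \<ge> 0 \<longrightarrow>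
      (\<forall>y. 0 \<le> k y \<and> k y \<le> D * inverse (bk y ^ (2 * n + K))) \<longrightarrow>
      (\<integral>\<^sup>+ z'. f z' * ennreal (k (z' - z)) \<partial>lborel) * ennreal (m z) \<le> ennreal (C * D) * smear n (\<lambda>z. f z * ennreal (m z)) z"
proof -
  obtain C K where C: "continuous_on UNIV m" "\<And>z. 0 < m z" "C \<ge> 0" "\<And>z h. m (z + h) \<le> C * bk h ^ K * m z"
    using m unfolding poly_weight_def by blast
  have [measurable]: "m \<in> borel_measurable borel" using C(1) by (rule borel_measurable_continuous_onI)
  have "(\<integral>\<^sup>+ z'. f z' * ennreal (k (z' - z)) \<partial>lborel) * ennreal (m z) \<le> ennreal (C * D) * smear n (\<lambda>z. f z * ennreal (m z)) z"
    if [measurable]: "f \<in> borel_measurable borel" "k \<in> borel_measurable borel" and D: "D \<ge> 0"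
      and k: "\<And>y. 0 \<le> k y \<and> k y \<le> D * inverse (bk y ^ (2 * n + K))" for n f k D z
  proof -
    have pt: "k (z' - z) * m z \<le> (C * D) * (m z' * prod_kernel n (z - z'))" for z'
    proof -
      have "m z \<le> C * bk (z' - z) ^ K * m z'" using C(4)[of z' "z - z'"] by (simp add: bk_diff_commute)
      then have "k (z' - z) * m z \<le> (D * inverse (bk (z' - z) ^ (2 * n + K))) * (C * bk (z' - z) ^ K * m z')"
        using k[of "z' - z"] C(2)[of z] by (intro mult_mono) (auto intro: order_trans)
      also have "\<dots> = (C * D) * (m z' * inverse (bk (z - z') ^ (2 * n)))"
        by (simp add: power_add bk_diff_commute[of z'])
      also have "\<dots> \<le> (C * D) * (m z' * prod_kernel n (z - z'))"
        using C(3) D C(2)[of z'] by (intro mult_left_mono bk_prod_kernel) auto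
      finally show ?thesis .
    qed
    have "ennreal (m z) * (\<integral>\<^sup>+ z'. f z' * ennreal (k (z' - z)) \<partial>lborel) = (\<integral>\<^sup>+ z'. ennreal (m z) * (f z' * ennreal (k (z' - z))) \<partial>lborel)"
      by (rule nn_integral_cmult[symmetric]) measurable
    also have "\<dots> \<le> (\<integral>\<^sup>+ z'. ennreal (C * D) * ((f z' * ennreal (m z')) * ennreal (prod_kernel n (z - z'))) \<partial>lborel)"
    proof (intro nn_integral_mono)
      fix z'
      have "ennreal (m z) * (f z' * ennreal (k (z' - z))) = f z' * ennreal (k (z' - z) * m z)"
        using C(2)[of z] k[of "z' - z"] by (simp add: ennreal_mult' mult_ac)
      also have "\<dots> \<le> f z' * ennreal ((C * D) * (m z' * prod_kernel n (z - z')))" by (intro mult_left_mono ennreal_leI pt) simp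
      also have "\<dots> = ennreal (C * D) * ((f z' * ennreal (m z')) * ennreal (prod_kernel n (z - z')))"
        using C(3) D C(2)[of z'] by (simp add: ennreal_mult' less_imp_le mult_ac)
      finally show "ennreal (m z) * (f z' * ennreal (k (z' - z))) \<le> \<dots>" .
    qed
    also have "\<dots> = ennreal (C * D) * (\<integral>\<^sup>+ z'. (f z' * ennreal (m z')) * ennreal (prod_kernel n (z - z')) \<partial>lborel)"
      by (rule nn_integral_cmult) (simp add: prod_kernel_def)
    also have "(\<integral>\<^sup>+ z'. (f z' * ennreal (m z')) * ennreal (prod_kernel n (z - z')) \<partial>lborel) = smear n (\<lambda>z. f z * ennreal (m z)) z"
      unfolding smear_def
      using nn_integral_lborel_reflect[of "\<lambda>z'. (f z' * ennreal (m z')) * ennreal (prod_kernel n (z - z'))" z]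
      by (simp add: prod_kernel_def)
    finally show ?thesis by (simp add: mult.commute)
  qed
  with C(3) show ?thesis by (intro that) blast+
qed

text \<open>The reproducing formula with window g, applied to the shift of \<open>h i\<close> by z,
  represents the new transform at z as an integral of the old one; by covariance the kernel has
  modulus \<open>norm (fstft g (h i) (z' - z))\<close>, so the integral is dominated by a
  convolution. The constant does not depend on u.\<close>

lemma window_change:
  fixes g :: "'a::euclidean_space \<Rightarrow> complex" and m :: "'a \<times> 'a \<Rightarrow> real"
  assumes g: "schwartz g" "g \<noteq> (\<lambda>_. 0)" and h: "schwartz_family w h" and m: "poly_weight m"
  obtains C M where "C \<ge> 0" "\<And>u i z. tempered u \<Longrightarrow>
     ennreal (norm (stft (h i) u z) * m z) \<le> ennreal (C * bk (w i) ^ M) * smear n (\<lambda>z. ennreal (norm (stft g u z) * m z)) z"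
proof -
  obtain C0 K where C0: "C0 \<ge> 0" "\<forall>n f k D z. f \<in> borel_measurable borel \<longrightarrow> k \<in> borel_measurable borel \<longrightarrow> D \<ge> 0 \<longrightarrow>
      (\<forall>y. 0 \<le> k y \<and> k y \<le> D * inverse (bk y ^ (2 * n + K))) \<longrightarrow>
      (\<integral>\<^sup>+ z'. f z' * ennreal (k (z' - z)) \<partial>lborel) * ennreal (m z) \<le> ennreal (C0 * D) * smear n (\<lambda>z. f z * ennreal (m z)) z"
    by (rule smear_kernel[OF m])
  have mp: "0 < m z" for z using m unfolding poly_weight_def by blast
  have "schwartz_family w (\<lambda>i. fstft g (h i))" by (intro schwartz_family_fstft schwartz_family_const_iff g h)
  then obtain C1 M where C1: "C1 \<ge> 0" "\<And>i y. norm (fstft g (h i) y) \<le> C1 * bk (w i) ^ M * inverse (bk y ^ (2 * n + K))"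
    by (rule schwartz_family_decay) (rule that)
  have en: "0 < energy g" by (rule energy_pos[OF g])
  have "ennreal (norm (stft (h i) u z) * m z) \<le> ennreal (C0 * (C1 / energy g) * bk (w i) ^ M) * smear n (\<lambda>z. ennreal (norm (stft g u z) * m z)) z"
    if u: "tempered u" for u i z
  proof -
    have hi: "schwartz (h i)" by (rule schwartz_family_imp_schwartz[OF h])
    note R = stft_reproducing[OF u g(1) schwartz_tfz[OF hi, of z]]
    have "norm (LINT z'|lborel. stft g u z' * cnj (fstft g (tfz z (h i)) z')) = energy g * norm (stft (h i) u z)"
      unfolding R(2) stft_eq[of "h i"] using en by (simp add: norm_mult)
    then have "norm (stft (h i) u z) = (1 / energy g) * norm (LINT z'|lborel. stft g u z' * cnj (fstft g (tfz z (h i)) z'))"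
      using en by simp
    then have "ennreal (norm (stft (h i) u z)) = ennreal (1 / energy g) * ennreal (norm (LINT z'|lborel. stft g u z' * cnj (fstft g (tfz z (h i)) z')))"
      using en by (simp add: ennreal_mult'[symmetric])
    also have "\<dots> \<le> ennreal (1 / energy g) * (\<integral>\<^sup>+ z'. ennreal (norm (stft g u z' * cnj (fstft g (tfz z (h i)) z'))) \<partial>lborel)"
      by (intro mult_left_mono integral_norm_bound_ennreal R(1)) simp
    also have "(\<integral>\<^sup>+ z'. ennreal (norm (stft g u z' * cnj (fstft g (tfz z (h i)) z'))) \<partial>lborel) =
       (\<integral>\<^sup>+ z'. ennreal (norm (stft g u z')) * ennreal (norm (fstft g (h i) (z' - z))) \<partial>lborel)"
      by (simp add: norm_mult norm_fstft_tfz schwartz_measurable g hi ennreal_mult')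
    finally have "ennreal (norm (stft (h i) u z) * m z) \<le> ennreal (1 / energy g) * (\<integral>\<^sup>+ z'. ennreal (norm (stft g u z')) * ennreal (norm (fstft g (h i) (z' - z))) \<partial>lborel) * ennreal (m z)"
      using mp[of z] by (simp add: ennreal_mult' mult_right_mono less_imp_le)
    also have "\<dots> = ennreal (1 / energy g) * ((\<integral>\<^sup>+ z'. ennreal (norm (stft g u z')) * ennreal (norm (fstft g (h i) (z' - z))) \<partial>lborel) * ennreal (m z))"
      by (simp add: mult_ac)
    also have "\<dots> \<le> ennreal (1 / energy g) * (ennreal (C0 * (C1 * bk (w i) ^ M)) * smear n (\<lambda>z. ennreal (norm (stft g u z)) * ennreal (m z)) z)"
      using borel_measurable_continuous_onI[OF stft_continuous[OF u g(1)]] C1 schwartz_measurable[OF schwartz_fstft[OF g(1) hi]]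
      by (intro mult_left_mono C0(2)[rule_format, where k="\<lambda>y. norm (fstft g (h i) y)"]) (auto simp: bk_nonneg)
    also have "\<dots> = ennreal (C0 * (C1 / energy g) * bk (w i) ^ M) * smear n (\<lambda>z. ennreal (norm (stft g u z) * m z)) z"
      using en C0(1) C1(1) mp by (simp add: ennreal_mult'[symmetric] mult.assoc[symmetric] bk_nonneg)
    finally show ?thesis .
  qed
  then show ?thesis using C0(1) C1(1) en by (intro that[of "C0 * (C1 / energy g)" M]) auto
qed

subsection \<open>Wigner distributions\<close>

lemma wigner_partial_ft:
  "wigner \<tau> f g = partial_ft (-1) (\<lambda>(x, t). f (x + \<tau> *\<^sub>R t) * cnj (g (x - (1 - \<tau>) *\<^sub>R t)))"
  by (simp add: wigner_def partial_ft_def fun_eq_iff mult_ac)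

text \<open>The substitution (x, t) \<mapsto> (x + \<tau> t, x - (1 - \<tau>) t) is invertible for
  every \<tau>, end points included, and its inverse has coefficients affine in \<tau>; so it
  distorts \<open>bk\<close> by a factor at most linear in \<tau>. The partial Fourier transform
  that follows is the same for all \<tau>.\<close>

lemma schwartz_family_wigner:
  fixes f g :: "'i \<Rightarrow> 'a::euclidean_space \<Rightarrow> complex"
  assumes f: "schwartz_family w f" and g: "schwartz_family w g" and \<tau>: "tame w (\<lambda>i. norm (\<tau> i))"
  shows "schwartz_family w (\<lambda>i. wigner (\<tau> i) (f i) (g i))"
proof -
  have 1: "schwartz_family w (\<lambda>i (y, s). f i y * cnj (g i s))"
    by (intro schwartz_family_tensor schwartz_family_cnj f g)
  define L where "L i p = (fst p + \<tau> i *\<^sub>R snd p, fst p - (1 - \<tau> i) *\<^sub>R snd p)" for i and p :: "'a \<times> 'a"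
  have "tame w (\<lambda>i. 4 + 2 * norm (\<tau> i))" by (intro tame_add tame_cmult \<tau>) auto
  then obtain C M where C: "C \<ge> 0" "\<And>i. 4 + 2 * norm (\<tau> i) \<le> C * bk (w i) ^ M" by (rule tameE) (rule that)
  have Lb: "bounded_linear (L i)" for i
    unfolding L_def by (intro bounded_linear_intros)
  have "schwartz_family w (\<lambda>i p. (\<lambda>(y, s). f i y * cnj (g i s)) (L i p))"
  proof (rule schwartz_family_compose[OF 1, where A=L and ?C0.0=C and ?M0.0=M and K=1])
    fix i and p b :: "'a \<times> 'a"
    show "(L i has_derivative L i) (at p)" by (rule bounded_linear_imp_has_derivative[OF Lb])
    have "norm (L j b) \<le> 2 * norm (fst b) + (1 + 2 * norm (\<tau> j)) * norm (snd b)" for j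
    proof -
      have "norm (L j b) \<le> norm (fst b + \<tau> j *\<^sub>R snd b) + norm (fst b - (1 - \<tau> j) *\<^sub>R snd b)"
        unfolding L_def by (rule norm_Pair_le)
      also have "\<dots> \<le> (norm (fst b) + \<bar>\<tau> j\<bar> * norm (snd b)) + (norm (fst b) + \<bar>1 - \<tau> j\<bar> * norm (snd b))"
        by (intro add_mono order_trans[OF norm_triangle_ineq] order_trans[OF norm_triangle_ineq4]) auto
      also have "\<bar>1 - \<tau> j\<bar> * norm (snd b) \<le> (1 + \<bar>\<tau> j\<bar>) * norm (snd b)" by (intro mult_right_mono) auto
      finally show ?thesis by (simp add: algebra_simps)
    qed
    moreover have "tame w (\<lambda>j. 2 * norm (fst b) + norm (snd b) * (1 + 2 * norm (\<tau> j)))"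
      by (intro tame_add tame_cmult \<tau> tame_const) auto
    ultimately show "tame w (\<lambda>i. norm (L i b))" by (elim tame_mono) (simp add: mult.commute)
    obtain y s where q: "L i p = (y, s)" by (cases "L i p")
    have p: "p = (y - \<tau> i *\<^sub>R (y - s), y - s)" using q by (auto simp: L_def prod_eq_iff algebra_simps)
    have n: "norm y \<le> norm (L i p)" "norm s \<le> norm (L i p)"
      using norm_fst_le[of y s] norm_snd_le[of s y] by (auto simp: q)
    have "norm (y - s) \<le> norm y + norm s" by (rule norm_triangle_ineq4)
    with n have n: "norm (y - s) \<le> 2 * norm (L i p)" "norm y \<le> norm (L i p)" by linarith+
    have "norm p \<le> norm (y - \<tau> i *\<^sub>R (y - s)) + norm (y - s)" by (subst p) (rule norm_Pair_le)
    also have "\<dots> \<le> (norm y + \<bar>\<tau> i\<bar> * norm (y - s)) + norm (y - s)"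
      using norm_triangle_ineq4[of y "\<tau> i *\<^sub>R (y - s)"] by simp
    also have "\<dots> \<le> (norm (L i p) + \<bar>\<tau> i\<bar> * (2 * norm (L i p))) + 2 * norm (L i p)"
      by (intro add_mono mult_left_mono n) auto
    also have "\<dots> \<le> (3 + 2 * norm (\<tau> i)) * bk (L i p)"
      using mult_left_mono[OF norm_le_bk[of "L i p"], of "3 + 2 * norm (\<tau> i)"] by (simp add: algebra_simps)
    finally have "bk p \<le> (4 + 2 * norm (\<tau> i)) * bk (L i p)"
      using bk_ge1[of "L i p"] by (simp add: bk_def[of p] algebra_simps)
    also have "\<dots> \<le> C * bk (w i) ^ M * bk (L i p)" using C(2) by (intro mult_right_mono) (auto simp: bk_nonneg)
    finally show "bk p \<le> C * bk (w i) ^ M * bk (L i p) ^ 1" by simp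
  qed (use C in auto)
  then have "schwartz_family w (\<lambda>i (x, t). f i (x + \<tau> i *\<^sub>R t) * cnj (g i (x - (1 - \<tau> i) *\<^sub>R t)))"
    by (simp add: L_def split_def)
  then show ?thesis unfolding wigner_partial_ft by (rule schwartz_family_partial_ft) simp
qed

lemma schwartz_wigner: "schwartz f \<Longrightarrow> schwartz g \<Longrightarrow> schwartz (wigner \<tau> f g)"
  unfolding schwartz_iff_family by (rule schwartz_family_wigner[where \<tau>="\<lambda>_. \<tau>"]) simp_all

lemma schwartz_wigner_transpose:
  assumes "schwartz \<Psi>" shows "schwartz (wigner_transpose \<tau> \<Psi>)"
proof -
  have "schwartz (\<lambda>p. partial_ft 1 \<Psi> ((1 - \<tau>) *\<^sub>R fst p + \<tau> *\<^sub>R snd p, fst p - snd p))"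
    by (rule schwartz_linear_iso[OF schwartz_partial_ft[OF assms], where M="\<lambda>q. (fst q + \<tau> *\<^sub>R snd q, fst q - (1 - \<tau>) *\<^sub>R snd q)"])
       (auto intro!: bounded_linear_intros simp: prod_eq_iff algebra_simps)
  then show ?thesis by (simp add: wigner_transpose_def partial_ft_def split_def inner_commute)
qed

text \<open>The integral defining the transpose is inserted, the order changed by Fubini, and s = y
  - t, then y = x + \<tau> t substituted; both substitutions preserve the measure.\<close>

lemma wigner_transpose_pairing:
  fixes f g :: "'a::euclidean_space \<Rightarrow> complex"
  assumes \<Psi>: "schwartz \<Psi>" and f: "schwartz f" and g: "schwartz g"
  shows "(LINT y|lborel. LINT s|lborel. wigner_transpose \<tau> \<Psi> (y, s) * cnj (f y) * g s) =
         (LINT Z|lborel. \<Psi> Z * cnj (wigner \<tau> f g Z))"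
proof -
  define E where "E y s \<xi> = cis (2 * pi * ((y - s) \<bullet> \<xi>)) * \<Psi> ((1 - \<tau>) *\<^sub>R y + \<tau> *\<^sub>R s, \<xi>) * (cnj (f y) * g s)" for y s \<xi>
  note [measurable] = schwartz_measurable[OF \<Psi>] schwartz_measurable[OF f] schwartz_measurable[OF g]
  have Em [measurable]: "(\<lambda>p. E (a p) (b p) (c p)) \<in> borel_measurable M" if [measurable]: "a \<in> borel_measurable M" "b \<in> borel_measurable M" "c \<in> borel_measurable M"
    for a b c and M :: "'z measure" unfolding E_def by measurable
  let ?d = "2 * DIM('a)"
  obtain C where C: "C \<ge> 0" "\<And>Z. norm (\<Psi> Z) \<le> C * inverse (bk Z ^ ?d)" by (rule schwartz_decay[OF \<Psi>]) (rule that)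
  have Eb: "norm (E y s \<xi>) \<le> norm (complex_of_real (C * inverse (bk \<xi> ^ ?d)) * (f y * g s))" for y s \<xi>
  proof -
    have "norm (\<Psi> ((1 - \<tau>) *\<^sub>R y + \<tau> *\<^sub>R s, \<xi>)) \<le> C * inverse (bk \<xi> ^ ?d)"
      using C(1) by (intro order_trans[OF C(2)] mult_left_mono le_imp_inverse_le power_mono bk_snd_le bk_power_pos) (auto simp: bk_nonneg)
    then show ?thesis using C(1) by (auto simp: E_def norm_mult bk_nonneg norm_inverse norm_power intro!: mult_right_mono)
  qed
  have i\<xi>: "integrable lborel (\<lambda>\<xi>::'a. complex_of_real (C * inverse (bk \<xi> ^ ?d)))"
    by (simp only: complex_of_real_integrable_eq) (intro integrable_mult_right integrable_inverse_bk order_refl)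
  note ifg = lborel_integrable_prod[OF schwartz_integrable[OF f] schwartz_integrable[OF g]]
  have int: "integrable lborel (\<lambda>(\<xi>, (y, s)). E y s \<xi>)"
    by (rule Bochner_Integration.integrable_bound[OF lborel_integrable_prod[OF i\<xi> ifg]])
       (use Eb in \<open>auto simp: split_def\<close>)
  have inty: "integrable lborel (\<lambda>(y, t). E y (y - t) \<xi>)" for \<xi>
  proof (rule integrableI_bounded)
    have "(\<integral>\<^sup>+ p. ennreal (norm (case p of (y, t) \<Rightarrow> E y (y - t) \<xi>)) \<partial>lborel) = (\<integral>\<^sup>+ y. \<integral>\<^sup>+ t. ennreal (norm (E y (y - t) \<xi>)) \<partial>lborel \<partial>lborel)"
      by (subst nn_integral_lborel_pair(1)) (auto simp: split_def)
    also have "\<dots> = (\<integral>\<^sup>+ y. \<integral>\<^sup>+ s. ennreal (norm (E y s \<xi>)) \<partial>lborel \<partial>lborel)"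
      by (intro nn_integral_cong nn_integral_lborel_reflect) measurable
    also have "\<dots> = (\<integral>\<^sup>+ p. ennreal (norm (E (fst p) (snd p) \<xi>)) \<partial>lborel)"
      by (subst nn_integral_lborel_pair(1)) auto
    also have "\<dots> < \<infinity>"
    proof -
      have "integrable lborel (\<lambda>p. E (fst p) (snd p) \<xi>)"
        by (rule Bochner_Integration.integrable_bound[OF integrable_mult_right[OF ifg, of "complex_of_real (C * inverse (bk \<xi> ^ ?d))"]])
           (use Eb in \<open>auto simp: split_def\<close>)
      then show ?thesis by (simp add: integrable_iff_bounded)
    qed
    finally show "(\<integral>\<^sup>+ p. ennreal (norm (case p of (y, t) \<Rightarrow> E y (y - t) \<xi>)) \<partial>lborel) < \<infinity>" .
  qed (simp add: split_def)
  have K: "wigner_transpose \<tau> \<Psi> (y, s) * cnj (f y) * g s = (LINT \<xi>|lborel. E y s \<xi>)" for y s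
  proof -
    have "E y s \<xi> = cis (2 * pi * ((y - s) \<bullet> \<xi>)) * \<Psi> ((1 - \<tau>) *\<^sub>R y + \<tau> *\<^sub>R s, \<xi>) * (cnj (f y) * g s)" for \<xi>
      by (simp add: E_def)
    then have "(LINT \<xi>|lborel. E y s \<xi>) =
        (LINT \<xi>|lborel. cis (2 * pi * ((y - s) \<bullet> \<xi>)) * \<Psi> ((1 - \<tau>) *\<^sub>R y + \<tau> *\<^sub>R s, \<xi>)) * (cnj (f y) * g s)"
      by (simp only: integral_mult_left_zero)
    then show ?thesis by (simp only: wigner_transpose_def prod.case mult.assoc)
  qed
  have int1: "integrable lborel (\<lambda>((y, s), \<xi>). E y s \<xi>)"
    by (rule Bochner_Integration.integrable_bound[OF lborel_integrable_prod[OF ifg i\<xi>]])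
       (use Eb in \<open>auto simp: split_def mult.commute\<close>)
  have "(LINT y|lborel. LINT s|lborel. LINT \<xi>|lborel. E y s \<xi>) = (LINT p|lborel. LINT \<xi>|lborel. E (fst p) (snd p) \<xi>)"
    using fubini_lborel(1)[of "\<lambda>y s. LINT \<xi>|lborel. E y s \<xi>"] fubini_lborel(3)[of "\<lambda>p \<xi>. E (fst p) (snd p) \<xi>"] int1
    by (simp add: split_def)
  also have "\<dots> = (LINT \<xi>|lborel. LINT p|lborel. E (fst p) (snd p) \<xi>)"
    using fubini_lborel_swap[of "\<lambda>p \<xi>. E (fst p) (snd p) \<xi>"] int1 by (simp add: split_def)
  also have "\<dots> = (LINT \<xi>|lborel. LINT y|lborel. LINT s|lborel. E y s \<xi>)"
  proof (intro Bochner_Integration.integral_cong refl)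
    fix \<xi>
    have "integrable lborel (\<lambda>(y, s). E y s \<xi>)"
      by (rule Bochner_Integration.integrable_bound[OF integrable_mult_right[OF ifg, of "complex_of_real (C * inverse (bk \<xi> ^ ?d))"]])
         (use Eb in \<open>auto simp: split_def\<close>)
    from fubini_lborel(1)[OF this] show "(LINT p|lborel. E (fst p) (snd p) \<xi>) = (LINT y|lborel. LINT s|lborel. E y s \<xi>)" by simp
  qed
  also have "\<dots> = (LINT \<xi>|lborel. LINT y|lborel. LINT t|lborel. E y (y - t) \<xi>)"
    by (intro Bochner_Integration.integral_cong refl integral_lborel_reflect[symmetric]) measurable
  also have "\<dots> = (LINT \<xi>|lborel. LINT t|lborel. LINT y|lborel. E y (y - t) \<xi>)"
    by (intro Bochner_Integration.integral_cong refl fubini_lborel_swap inty)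
  also have "\<dots> = (LINT \<xi>|lborel. LINT t|lborel. LINT x|lborel. E (\<tau> *\<^sub>R t + x) (\<tau> *\<^sub>R t + x - t) \<xi>)"
    by (intro Bochner_Integration.integral_cong refl integral_lborel_translate[symmetric]) measurable
  also have "\<dots> = (LINT \<xi>|lborel. LINT x|lborel. LINT t|lborel. E (\<tau> *\<^sub>R t + x) (\<tau> *\<^sub>R t + x - t) \<xi>)"
  proof (rule Bochner_Integration.integral_cong[OF refl], rule fubini_lborel_swap)
    fix \<xi>
    show "integrable lborel (\<lambda>(t, x). E (\<tau> *\<^sub>R t + x) (\<tau> *\<^sub>R t + x - t) \<xi>)"
    proof (rule integrableI_bounded)
      have "(\<integral>\<^sup>+ p. ennreal (norm (case p of (t, x) \<Rightarrow> E (\<tau> *\<^sub>R t + x) (\<tau> *\<^sub>R t + x - t) \<xi>)) \<partial>lborel) =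
          (\<integral>\<^sup>+ t. \<integral>\<^sup>+ x. ennreal (norm (E (\<tau> *\<^sub>R t + x) (\<tau> *\<^sub>R t + x - t) \<xi>)) \<partial>lborel \<partial>lborel)"
        by (subst nn_integral_lborel_pair(1)) (auto simp: split_def)
      also have "\<dots> = (\<integral>\<^sup>+ t. \<integral>\<^sup>+ y. ennreal (norm (E y (y - t) \<xi>)) \<partial>lborel \<partial>lborel)"
        by (intro nn_integral_cong nn_integral_lborel_translate) measurable
      also have "\<dots> = (\<integral>\<^sup>+ p. ennreal (norm (case p of (y, t) \<Rightarrow> E y (y - t) \<xi>)) \<partial>lborel)"
        by (subst nn_integral_lborel_pair(2)) (auto simp: split_def)
      also have "\<dots> < \<infinity>" using inty[of \<xi>] by (simp add: integrable_iff_bounded)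
      finally show "(\<integral>\<^sup>+ p. ennreal (norm (case p of (t, x) \<Rightarrow> E (\<tau> *\<^sub>R t + x) (\<tau> *\<^sub>R t + x - t) \<xi>)) \<partial>lborel) < \<infinity>" .
    qed (simp add: split_def)
  qed
  also have "\<dots> = (LINT \<xi>|lborel. LINT x|lborel. \<Psi> (x, \<xi>) * cnj (wigner \<tau> f g (x, \<xi>)))"
  proof (intro Bochner_Integration.integral_cong refl)
    fix \<xi> x
    have "E (\<tau> *\<^sub>R t + x) (\<tau> *\<^sub>R t + x - t) \<xi> = \<Psi> (x, \<xi>) * cnj (cis (- 2 * pi * (t \<bullet> \<xi>)) * f (x + \<tau> *\<^sub>R t) * cnj (g (x - (1 - \<tau>) *\<^sub>R t)))" for t
      by (simp add: E_def cis_cnj algebra_simps)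
    then show "(LINT t|lborel. E (\<tau> *\<^sub>R t + x) (\<tau> *\<^sub>R t + x - t) \<xi>) = \<Psi> (x, \<xi>) * cnj (wigner \<tau> f g (x, \<xi>))"
      by (simp add: wigner_def del: complex_cnj_mult)
  qed
  also have "\<dots> = (LINT Z|lborel. \<Psi> Z * cnj (wigner \<tau> f g Z))"
    using fubini_lborel(2)[of "\<lambda>x \<xi>. \<Psi> (x, \<xi>) * cnj (wigner \<tau> f g (x, \<xi>))"]
      schwartz_integrable[OF schwartz_mult[OF \<Psi> schwartz_cnj[OF schwartz_wigner[OF f g, of \<tau>]]]]
    by (simp add: split_def)
  finally show ?thesis by (simp add: K)
qed

text \<open>Replacing t by \<open>fst z - fst z' + s\<close> aligns the two shifted arguments at x
  minus a common point. The phases then collect into a modulation by the second component of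
  \<open>gmap\<close> and a constant.\<close>

lemma wigner_tfz:
  fixes f g :: "'a::euclidean_space \<Rightarrow> complex"
  assumes [measurable]: "f \<in> borel_measurable borel" "g \<in> borel_measurable borel"
  shows "wigner \<tau> (tfz z f) (tfz z' g) =
    (\<lambda>Z. cis (2 * pi * ((fst z - fst z') \<bullet> (\<tau> *\<^sub>R snd z + (1 - \<tau>) *\<^sub>R snd z'))) * tfz (gmap \<tau> z z') (wigner \<tau> f g) Z)"
proof (intro ext, clarify)
  fix x \<xi> :: 'a
  let ?t = "fst z - fst z'" and ?\<xi> = "\<tau> *\<^sub>R snd z + (1 - \<tau>) *\<^sub>R snd z'" and ?x = "(1 - \<tau>) *\<^sub>R fst z + \<tau> *\<^sub>R fst z'"
  define E where "E t = cis (- 2 * pi * (t \<bullet> \<xi>)) * tfz z f (x + \<tau> *\<^sub>R t) * cnj (tfz z' g (x - (1 - \<tau>) *\<^sub>R t))" for t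
  have [measurable]: "E \<in> borel_measurable borel" unfolding E_def tfz_apply by measurable
  let ?c = "cis (2 * pi * (?t \<bullet> ?\<xi>))" and ?k = "cis (2 * pi * (snd (gmap \<tau> z z') \<bullet> (x, \<xi>)))"
  have E: "E (?t + s) = ?c * (?k * (cis (- 2 * pi * (s \<bullet> (\<xi> - ?\<xi>))) * f ((x - ?x) + \<tau> *\<^sub>R s) * cnj (g ((x - ?x) - (1 - \<tau>) *\<^sub>R s))))" for s
  proof -
    have a: "x + \<tau> *\<^sub>R (?t + s) - fst z = (x - ?x) + \<tau> *\<^sub>R s" "x - (1 - \<tau>) *\<^sub>R (?t + s) - fst z' = (x - ?x) - (1 - \<tau>) *\<^sub>R s"
      by (simp_all add: algebra_simps)
    have "E (?t + s) = (cis (- 2 * pi * ((?t + s) \<bullet> \<xi>)) * (cis (2 * pi * (snd z \<bullet> (x + \<tau> *\<^sub>R (?t + s)))) * cis (- (2 * pi * (snd z' \<bullet> (x - (1 - \<tau>) *\<^sub>R (?t + s))))))) *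
       (f ((x - ?x) + \<tau> *\<^sub>R s) * cnj (g ((x - ?x) - (1 - \<tau>) *\<^sub>R s)))"
      unfolding E_def tfz_apply a by (simp add: cis_cnj mult_ac)
    also have "cis (- 2 * pi * ((?t + s) \<bullet> \<xi>)) * (cis (2 * pi * (snd z \<bullet> (x + \<tau> *\<^sub>R (?t + s)))) * cis (- (2 * pi * (snd z' \<bullet> (x - (1 - \<tau>) *\<^sub>R (?t + s)))))) =
       ?c * (?k * cis (- 2 * pi * (s \<bullet> (\<xi> - ?\<xi>))))"
      unfolding cis_mult by (rule arg_cong[where f=cis]) (simp add: gmap_def inner_simps inner_commute algebra_simps)
    finally show ?thesis by (simp add: mult_ac)
  qed
  have "wigner \<tau> (tfz z f) (tfz z' g) (x, \<xi>) = (LINT t|lborel. E t)" by (simp add: wigner_def E_def)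
  also have "\<dots> = (LINT s|lborel. E (?t + s))" by (rule integral_lborel_translate[symmetric]) measurable
  also have "\<dots> = ?c * (?k * wigner \<tau> f g (x - ?x, \<xi> - ?\<xi>))" unfolding E by (simp add: wigner_def)
  also have "wigner \<tau> f g (x - ?x, \<xi> - ?\<xi>) = wigner \<tau> f g ((x, \<xi>) - fst (gmap \<tau> z z'))" by (simp add: gmap_def)
  finally show "wigner \<tau> (tfz z f) (tfz z' g) (x, \<xi>) = ?c * tfz (gmap \<tau> z z') (wigner \<tau> f g) (x, \<xi>)"
    by (simp only: tfz_apply[of _ "wigner \<tau> f g"])
qed

text \<open>The kernel of the expansion below. For \<Psi> a shifted window its values are conjugates
  of short-time Fourier transforms of Wigner distributions of shifts.\<close>

definition wigner_coeff :: "('a::euclidean_space \<Rightarrow> complex) \<Rightarrow> real \<Rightarrow> ('a \<times> 'a \<Rightarrow> complex) \<Rightarrow> 'a \<times> 'a \<Rightarrow> 'a \<times> 'a \<Rightarrow> complex" where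
  "wigner_coeff \<phi> \<tau> \<Psi> z z' = (LINT Z|lborel. \<Psi> Z * cnj (wigner \<tau> (tfz z \<phi>) (tfz z' \<phi>) Z))"

text \<open>The reproducing formula is applied to f in the variable s and then to g in y, each
  contributing one factor \<open>energy \<phi>\<close>. The transposition formula turns the
  remaining double integral of the kernel into \<open>wigner_coeff\<close>.\<close>

theorem wigner_dist_expansion:
  fixes \<phi> :: "'a::euclidean_space \<Rightarrow> complex"
  assumes f: "tempered f" and g: "tempered g" and \<phi>: "schwartz \<phi>" "\<phi> \<noteq> (\<lambda>_. 0)" and \<Psi>: "schwartz \<Psi>"
  shows "wigner_dist \<tau> g f \<Psi> * of_real ((energy \<phi>)\<^sup>2) =
    (LINT z|lborel. stft \<phi> g z * (LINT z'|lborel. cnj (stft \<phi> f z' * wigner_coeff \<phi> \<tau> \<Psi> z z')))"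
proof -
  define K where "K = wigner_transpose \<tau> \<Psi>"
  have K: "schwartz K" unfolding K_def by (rule schwartz_wigner_transpose[OF \<Psi>])
  have en: "energy \<phi> > 0" by (rule energy_pos[OF \<phi>])
  \<comment> \<open>Q is jointly Schwartz, so its integral against the slowly growing
    \<open>stft \<phi> f\<close> is a Schwartz function k of y, to which g may be applied.\<close>
  define Q where "Q p = (LINT s|lborel. K (snd p, s) * tfz (fst p) \<phi> s)" for p :: "('a \<times> 'a) \<times> 'a"
  have Q: "schwartz Q"
  proof -
    have 1: "schwartz (\<lambda>(a, q). \<phi> a * K q)"
      using \<phi>(1) K unfolding schwartz_iff_family by (intro schwartz_family_tensor)
    have 2: "schwartz (\<lambda>p. (\<lambda>(a, q). \<phi> a * K q) (snd p - fst (fst p), (snd (fst p), snd p)))"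
      by (rule schwartz_linear_iso[OF 1, where M="\<lambda>r. ((snd (snd r) - fst r, fst (snd r)), snd (snd r))"])
         (auto intro!: bounded_linear_intros)
    have "schwartz (\<lambda>p. partial_ft 1 (\<lambda>p. (\<lambda>(a, q). \<phi> a * K q) (snd p - fst (fst p), (snd (fst p), snd p))) ((fst (fst p), snd p), snd (fst p)))"
      by (rule schwartz_linear_iso[OF schwartz_partial_ft[OF 2], where M="\<lambda>r. ((fst (fst r), snd r), snd (fst r))"])
         (auto intro!: bounded_linear_intros)
    then show ?thesis by (simp add: partial_ft_def split_def Q_def[abs_def] tfz_apply inner_commute mult_ac)
  qed
  note V = borel_measurable_continuous_onI[OF stft_continuous[OF f \<phi>(1)]]
  obtain C1 N where C1: "C1 \<ge> 0" "\<And>z. norm (stft \<phi> f z) \<le> C1 * bk z ^ N" by (rule stft_growth[OF f \<phi>(1)]) (rule that)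
  have famQ: "schwartz_family (\<lambda>_::unit. 0) (\<lambda>_. Q)" using Q by (simp add: schwartz_iff_family)
  define k where "k y = (LINT z'|lborel. stft \<phi> f z' * Q (z', y))" for y
  have k: "schwartz k"
    using schwartz_family_imp_schwartz[OF schwartz_family_integral[OF famQ V C1(2,1)]] by (simp add: k_def[abs_def])
  have kf: "of_real (energy \<phi>) * f (\<lambda>s. cnj (K (y, s))) = k y" for y
  proof -
    have h: "schwartz (\<lambda>s. cnj (K (y, s)))" by (intro schwartz_cnj schwartz_section K)
    have "cnj (fstft \<phi> (\<lambda>s. cnj (K (y, s))) z') = Q (z', y)" for z'
      unfolding fstft_def Q_def by (simp only: Bochner_Integration.integral_cnj[symmetric] fst_conv snd_conv complex_cnj_mult complex_cnj_cnj)
    then show ?thesis using stft_reproducing(2)[OF f \<phi>(1) h] by (simp add: k_def)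
  qed
  have "wigner_dist \<tau> g f \<Psi> = g (\<lambda>y. f (\<lambda>s. cnj (K (y, s))))"
    using \<Psi> K by (simp add: wigner_dist_def tensor_dist_def cnj_dist_def K_def[symmetric])
  also have "(\<lambda>y. f (\<lambda>s. cnj (K (y, s)))) = (\<lambda>y. of_real (1 / energy \<phi>) * k y)"
    unfolding kf[symmetric] using en by simp
  also have "g \<dots> = of_real (1 / energy \<phi>) * g k" by (subst tempered_cmult[OF g k]) simp
  finally have "wigner_dist \<tau> g f \<Psi> * of_real ((energy \<phi>)\<^sup>2) = of_real (energy \<phi>) * g k"
    using en by (simp add: power2_eq_square field_simps)
  also have "\<dots> = (LINT z|lborel. stft \<phi> g z * cnj (fstft \<phi> k z))" using stft_reproducing(2)[OF g \<phi>(1) k] by simp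
  also have "\<dots> = (LINT z|lborel. stft \<phi> g z * (LINT z'|lborel. cnj (stft \<phi> f z' * wigner_coeff \<phi> \<tau> \<Psi> z z')))"
  proof (intro Bochner_Integration.integral_cong refl)
    fix z :: "'a \<times> 'a"
    have sz: "schwartz (tfz z \<phi>)" by (rule schwartz_tfz[OF \<phi>(1)])
    let ?d = "2 * DIM('a \<times> 'a)"
    obtain C2 M where C2: "C2 \<ge> 0" "\<And>(i::unit) z' y. norm (Q (z', y)) \<le> C2 * bk (0::real) ^ M * inverse (bk z' ^ (N + ?d)) * inverse (bk y ^ 0)"
      by (rule schwartz_family_prod_bound[OF famQ]) (rule that)
    have i1: "integrable lborel (\<lambda>z'::'a \<times> 'a. complex_of_real (C1 * C2 * inverse (bk z' ^ ?d)))"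
      by (simp only: complex_of_real_integrable_eq) (intro integrable_mult_right integrable_inverse_bk order_refl)
    have i2: "integrable lborel (\<lambda>(z', y). stft \<phi> f z' * Q (z', y) * cnj (tfz z \<phi> y))"
    proof (rule Bochner_Integration.integrable_bound[OF lborel_integrable_prod[OF i1 schwartz_integrable[OF sz]]])
      note [measurable] = V schwartz_measurable[OF Q] schwartz_measurable[OF sz]
      show "(\<lambda>(z', y). stft \<phi> f z' * Q (z', y) * cnj (tfz z \<phi> y)) \<in> borel_measurable lborel"
        unfolding split_def by measurable
      have "norm (stft \<phi> f z' * Q (z', y)) \<le> C1 * C2 * inverse (bk z' ^ ?d)" for z' y
        using C2(2)[of z' y] by (intro slow_function_bound[OF C1(2,1)]) simp
      then show "AE p in lborel. norm (case p of (z', y) \<Rightarrow> stft \<phi> f z' * Q (z', y) * cnj (tfz z \<phi> y)) \<le>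
          norm (case p of (z', y) \<Rightarrow> complex_of_real (C1 * C2 * inverse (bk z' ^ ?d)) * tfz z \<phi> y)"
        using C1(1) C2(1) by (intro AE_I2) (auto simp: norm_mult norm_inverse norm_power bk_nonneg intro!: mult_right_mono simp del: of_real_mult of_real_inverse)
    qed
    have "fstft \<phi> k z = (LINT y|lborel. LINT z'|lborel. stft \<phi> f z' * Q (z', y) * cnj (tfz z \<phi> y))"
      by (simp add: fstft_def k_def)
    also have "\<dots> = (LINT z'|lborel. LINT y|lborel. stft \<phi> f z' * Q (z', y) * cnj (tfz z \<phi> y))"
      by (rule fubini_lborel_swap[OF i2, symmetric])
    also have "\<dots> = (LINT z'|lborel. stft \<phi> f z' * wigner_coeff \<phi> \<tau> \<Psi> z z')"
    proof (intro Bochner_Integration.integral_cong refl)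
      fix z' :: "'a \<times> 'a"
      have "(LINT y|lborel. Q (z', y) * cnj (tfz z \<phi> y)) = (LINT y|lborel. LINT s|lborel. K (y, s) * cnj (tfz z \<phi> y) * tfz z' \<phi> s)"
        unfolding Q_def fst_conv snd_conv integral_mult_left_zero[symmetric]
        by (intro Bochner_Integration.integral_cong refl) (simp add: mult_ac)
      then show "(LINT y|lborel. stft \<phi> f z' * Q (z', y) * cnj (tfz z \<phi> y)) = stft \<phi> f z' * wigner_coeff \<phi> \<tau> \<Psi> z z'"
        unfolding K_def wigner_transpose_pairing[OF \<Psi> sz schwartz_tfz[OF \<phi>(1)]] wigner_coeff_def[symmetric]
        by (simp add: mult.assoc)
    qed
    finally show "stft \<phi> g z * cnj (fstft \<phi> k z) = stft \<phi> g z * (LINT z'|lborel. cnj (stft \<phi> f z' * wigner_coeff \<phi> \<tau> \<Psi> z z'))"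
      by (simp add: integral_cnj del: complex_cnj_mult)
  qed
  finally show ?thesis .
qed

section \<open>From modulation norms to mixed bounds for arbitrary windows\<close>

lemma stft_measurable: "tempered u \<Longrightarrow> schwartz g \<Longrightarrow> stft g u \<in> borel_measurable borel"
  by (intro borel_measurable_continuous_onI stft_continuous)

lemma poly_weight_measurable: "poly_weight m \<Longrightarrow> m \<in> borel_measurable borel"
  unfolding poly_weight_def by (auto intro: borel_measurable_continuous_onI)

lemma smear_measurable [measurable]:
  assumes [measurable]: "F \<in> borel_measurable borel"
  shows "smear n F \<in> borel_measurable borel"
  unfolding smear_def[abs_def] prod_kernel_def by measurable

lemma tempered_dist_of:
  assumes g: "schwartz g" shows "tempered (dist_of g)"
proof (rule temperedI)
  have i: "integrable lborel (\<lambda>x. g x * cnj (\<psi> x))" if "schwartz \<psi>" for \<psi>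
    by (intro schwartz_integrable schwartz_mult schwartz_cnj g that)
  fix \<psi> \<eta> :: "'a \<Rightarrow> complex" and c assume s: "schwartz \<psi>" "schwartz \<eta>"
  then have "schwartz (\<lambda>x. c * \<psi> x + \<eta> x)" by (intro schwartz_add schwartz_cmult)
  moreover have "(LINT x|lborel. g x * cnj (c * \<psi> x + \<eta> x)) =
      (LINT x|lborel. cnj c * (g x * cnj (\<psi> x)) + g x * cnj (\<eta> x))"
    by (intro Bochner_Integration.integral_cong refl) (simp add: algebra_simps)
  ultimately show "dist_of g (\<lambda>x. c * \<psi> x + \<eta> x) = cnj c * dist_of g \<psi> + dist_of g \<eta>"
    using i[OF s(1)] i[OF s(2)] s by (simp add: dist_of_def)
next
  fix \<psi> :: "nat \<Rightarrow> 'a \<Rightarrow> complex" assume \<psi>: "schwartz_family (\<lambda>_. 0::real) \<psi>"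
  obtain C M where C: "C \<ge> 0" "\<And>i x. norm (\<psi> i x) \<le> C * bk (0::real) ^ M * inverse (bk x ^ 0)"
    by (rule schwartz_family_decay[OF \<psi>]) (rule that)
  have "norm (dist_of g (\<psi> n)) \<le> (LINT x|lborel. norm (g x) * C)" for n
  proof -
    have s: "schwartz (\<psi> n)" by (rule schwartz_family_imp_schwartz[OF \<psi>])
    have "norm (LINT x|lborel. g x * cnj (\<psi> n x)) \<le> (LINT x|lborel. norm (g x) * C)"
    proof (rule order_trans[OF integral_norm_bound integral_mono])
      show "integrable lborel (\<lambda>x. norm (g x * cnj (\<psi> n x)))" by (intro integrable_norm schwartz_integrable schwartz_mult schwartz_cnj g s)
      show "integrable lborel (\<lambda>x. norm (g x) * C)" by (intro integrable_mult_left integrable_norm schwartz_integrable g)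
    qed (use C in \<open>auto simp: norm_mult intro!: mult_left_mono\<close>)
    then show ?thesis using s by (simp add: dist_of_def)
  qed
  then show "\<exists>C. \<forall>n. norm (dist_of g (\<psi> n)) \<le> C" by blast
qed (simp add: dist_of_def)

text \<open>The norm for the fixed window g gives a mixed bound; the change of window is a smearing,
  and smearing also permits smaller reciprocals s and r. The polynomial dependence on the window
  index yields uniformity in \<tau>. The bound is stated for a positive finite N above the norm, as
  the norm itself may be 0.\<close>

lemma mod_norm_mixed_le:
  fixes g :: "'a::euclidean_space \<Rightarrow> complex"
  assumes g: "schwartz g" "g \<noteq> (\<lambda>_. 0)" and h: "schwartz_family w h" and m: "poly_weight m"
    and pq: "1 \<le> p" "1 \<le> q" and s: "0 \<le> s" "s \<le> inv_exp p" "0 \<le> r" "r \<le> inv_exp q"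
  obtains C M where "C \<ge> 0"
    "\<forall>u i N. tempered u \<longrightarrow> mod_norm g p q m u \<le> N \<longrightarrow> 0 < N \<longrightarrow> N < top \<longrightarrow>
       mixed_le s r (\<lambda>z. ennreal (norm (stft (h i) u z)) * ennreal (m z)) (ennreal (C * bk (w i) ^ M) * N)"
proof -
  let ?n = "2 * DIM('a)"
  have mp: "0 < m z" for z using m unfolding poly_weight_def by blast
  have mc: "continuous_on UNIV m" using m unfolding poly_weight_def by blast
  obtain C M where C: "C \<ge> 0" "\<forall>u i z. tempered u \<longrightarrow>
     ennreal (norm (stft (h i) u z) * m z) \<le> ennreal (C * bk (w i) ^ M) * smear ?n (\<lambda>z. ennreal (norm (stft g u z) * m z)) z"
  proof (rule window_change[OF g h m])
    fix C M assume "0 \<le> C" "\<And>u i z. tempered u \<Longrightarrow>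
     ennreal (norm (stft (h i) u z) * m z) \<le> ennreal (C * bk (w i) ^ M) * smear ?n (\<lambda>z. ennreal (norm (stft g u z) * m z)) z"
    then show thesis by (intro that) auto
  qed
  obtain D where D: "D < \<infinity>" "\<forall>(F :: 'a \<times> 'a \<Rightarrow> ennreal) N. mixed_le (inv_exp p) (inv_exp q) F N \<longrightarrow> mixed_le s r (smear ?n F) (D * N)"
  proof (rule mixed_le_smear[where n = ?n and s = "inv_exp p" and s' = s and r = "inv_exp q" and r' = r and 'u = 'a and 'w = 'a])
    fix C :: ennreal assume "C < \<infinity>" "\<And>(F :: 'a \<times> 'a \<Rightarrow> ennreal) N. mixed_le (inv_exp p) (inv_exp q) F N \<Longrightarrow> mixed_le s r (smear ?n F) (C * N)"
    then show thesis by (intro that) auto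
  qed (use s inv_exp_bounds pq in auto)
  show ?thesis
  proof (rule that[of "C * enn2real D" M])
    show "0 \<le> C * enn2real D" using C(1) by simp
    show "\<forall>u i N. tempered u \<longrightarrow> mod_norm g p q m u \<le> N \<longrightarrow> 0 < N \<longrightarrow> N < top \<longrightarrow>
       mixed_le s r (\<lambda>z. ennreal (norm (stft (h i) u z)) * ennreal (m z)) (ennreal (C * enn2real D * bk (w i) ^ M) * N)"
    proof (intro allI impI)
      fix u i and N :: ennreal assume u: "tempered u" and N: "mod_norm g p q m u \<le> N" "0 < N" "N < top"
      have "mixed_le (inv_exp p) (inv_exp q) (\<lambda>z. ennreal (norm (stft g u z) * m z)) N"
        using N unfolding mod_norm_def
        by (intro Lp_norm_imp_mixed_le pq continuous_on_mult continuous_on_norm stft_continuous u g mc mult_nonneg_nonneg norm_ge_zero less_imp_le[OF mp])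
      then have "mixed_le s r (smear ?n (\<lambda>z. ennreal (norm (stft g u z) * m z))) (D * N)" using D(2) by blast
      from this show "mixed_le s r (\<lambda>z. ennreal (norm (stft (h i) u z)) * ennreal (m z)) (ennreal (C * enn2real D * bk (w i) ^ M) * N)"
      proof (rule mixed_le_mono)
        fix z
        show "ennreal (norm (stft (h i) u z)) * ennreal (m z) \<le> ennreal (C * bk (w i) ^ M) * smear ?n (\<lambda>z. ennreal (norm (stft g u z) * m z)) z"
          using C(2)[rule_format, OF u, of i z] less_imp_le[OF mp[of z]] by (simp only: ennreal_mult'')
        obtain d where d: "D = ennreal d" "0 \<le> d" using D(1) by (cases D) auto
        have "ennreal (C * bk (w i) ^ M) * (D * N) = ennreal ((C * bk (w i) ^ M) * d) * N"
          unfolding d(1) ennreal_mult''[OF d(2)] by (rule mult.assoc[symmetric])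
        then show "ennreal (C * bk (w i) ^ M) * (D * N) \<le> ennreal (C * enn2real D * bk (w i) ^ M) * N"
          using d by (simp add: mult_ac)
      qed
    qed
  qed
qed

text \<open>The two factors of the kernel are at most 1, hence bounded by their own powers of
  exponent at most 1.\<close>

lemma mixed_le_prod_kernel:
  assumes n: "2 * DIM('u) \<le> n" "2 * DIM('w) \<le> n" and s: "0 \<le> s" "s \<le> 1" "0 \<le> r" "r \<le> 1"
  shows "\<exists>N<top. mixed_le s r (\<lambda>z::'u::euclidean_space \<times> 'w::euclidean_space. ennreal (prod_kernel n z)) N"
proof -
  have le: "ennreal (inverse (bk x ^ n)) \<le> pw (ennreal (inverse (bk x ^ n))) t" if "t \<le> 1" for x :: "'b::euclidean_space" and t
  proof -
    have "inverse (bk x ^ n) powr 1 \<le> inverse (bk x ^ n) powr t"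
      using that bk_power_ge1[of x n] by (intro powr_mono') (auto simp: inverse_le_1_iff)
    then show ?thesis using bk_power_pos[of x n] by (simp add: pw_real ennreal_leI)
  qed
  let ?K1 = "\<integral>\<^sup>+ x. ennreal (inverse (bk (x::'u) ^ n)) \<partial>lborel" and ?K2 = "\<integral>\<^sup>+ x. ennreal (inverse (bk (x::'w) ^ n)) \<partial>lborel"
  have "mixed_le s r (\<lambda>z::'u \<times> 'w. ennreal (prod_kernel n z)) (1 * pw ?K1 s * pw ?K2 r)"
  proof (rule mixed_leI[where ?F0.0 = "\<lambda>p. ennreal (inverse (bk (fst p) ^ n))" and ?f0.0 = "\<lambda>x. ennreal (inverse (bk x ^ n))"])
    fix u :: 'u and \<omega> :: 'w
    have "ennreal (prod_kernel n (u, \<omega>)) = ennreal (inverse (bk u ^ n)) * ennreal (inverse (bk \<omega> ^ n))"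
      by (simp add: prod_kernel_def ennreal_mult' bk_nonneg)
    also have "\<dots> \<le> pw (ennreal (inverse (bk u ^ n))) s * pw (ennreal (inverse (bk \<omega> ^ n))) r"
      by (intro mult_mono le s) auto
    finally show "ennreal (prod_kernel n (u, \<omega>)) \<le> 1 * pw (ennreal (inverse (bk (fst (u, \<omega>)) ^ n))) s * pw (ennreal (inverse (bk \<omega> ^ n))) r"
      by simp
  qed (use nn_integral_inverse_bk[OF n(1)] nn_integral_inverse_bk[OF n(2)] s in auto)
  moreover have "1 * pw ?K1 s * pw ?K2 r < top"
    using nn_integral_inverse_bk(1)[OF n(1)] nn_integral_inverse_bk(1)[OF n(2)] s by (simp add: ennreal_mult_less_top pw_finite)
  ultimately show ?thesis by blast
qed

section \<open>Uniqueness of the extended pairing; the operator on Schwartz functions\<close>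

lemma has_pairing_unique:
  fixes u w :: "'b::euclidean_space dist" and \<Psi> :: "'b \<Rightarrow> complex"
  assumes "has_pairing u w c" "has_pairing u w c'" "schwartz \<Psi>" "\<Psi> \<noteq> (\<lambda>_. 0)"
  shows "c = c'"
proof -
  have "c * of_real (energy \<Psi>) = c' * of_real (energy \<Psi>)"
    using assms(1-3) unfolding has_pairing_def by (intro has_bochner_integral_eq[where M=lborel and f="\<lambda>z. stft \<Psi> u z * cnj (stft \<Psi> w z)"]) blast+
  then show ?thesis using energy_pos[OF assms(3,4)] by simp
qed

lemma pairing_eq:
  fixes u w :: "'b::euclidean_space dist" and \<Psi> :: "'b \<Rightarrow> complex"
  assumes "has_pairing u w c" "schwartz \<Psi>" "\<Psi> \<noteq> (\<lambda>_. 0)"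
  shows "pairing u w = c"
  unfolding pairing_def using assms by (intro the_equality has_pairing_unique)

lemma fstft_cmult: "fstft g (\<lambda>x. c * h x) z = c * fstft g h z"
  by (simp add: fstft_def mult.assoc)

lemma tempered_lincomb:
  fixes u w :: "'a::euclidean_space dist"
  assumes u: "tempered u" and w: "tempered w"
  shows "tempered (\<lambda>\<psi>. c * u \<psi> + w \<psi>)"
proof (rule temperedI)
  fix \<psi> \<eta> :: "'a \<Rightarrow> complex" and d assume s: "schwartz \<psi>" "schwartz \<eta>"
  show "c * u (\<lambda>x. d * \<psi> x + \<eta> x) + w (\<lambda>x. d * \<psi> x + \<eta> x) = cnj d * (c * u \<psi> + w \<psi>) + (c * u \<eta> + w \<eta>)"
    unfolding tempered_antilinear[OF u s] tempered_antilinear[OF w s] by (simp add: algebra_simps)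
next
  fix \<psi> :: "nat \<Rightarrow> 'a \<Rightarrow> complex" assume \<psi>: "schwartz_family (\<lambda>_. 0::real) \<psi>"
  obtain C M where C: "C \<ge> 0" "\<And>n. norm (u (\<psi> n)) \<le> C * bk (0::real) ^ M" by (rule tameE[OF tempered_tame[OF u \<psi>]]) (rule that)
  obtain D K where D: "D \<ge> 0" "\<And>n. norm (w (\<psi> n)) \<le> D * bk (0::real) ^ K" by (rule tameE[OF tempered_tame[OF w \<psi>]]) (rule that)
  have "norm (c * u (\<psi> n) + w (\<psi> n)) \<le> norm c * C + D" for n
    using C(2)[of n] D(2)[of n] mult_left_mono[OF C(2)[of n], of "norm c"]
    by (intro order_trans[OF norm_triangle_ineq]) (auto simp: norm_mult)
  then show "\<exists>C. \<forall>n. norm (c * u (\<psi> n) + w (\<psi> n)) \<le> C" by blast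
qed (simp add: tempered_not_schwartz u w)

lemma smear_mono: "(\<And>z. F z \<le> G z) \<Longrightarrow> smear n F z \<le> smear n G z"
  unfolding smear_def by (intro nn_integral_mono mult_right_mono) auto

lemma fstft_swap: "fstft g (tfz w h) z = cnj (fstft h (tfz z g) w)"
  unfolding fstft_def by (simp only: Bochner_Integration.integral_cnj[symmetric] complex_cnj_mult complex_cnj_cnj mult.commute)

text \<open>Consistency of the extension with the defining integral: the conjugate of the
  transposition formula.\<close>

lemma wigner_dist_dist_of:
  assumes \<Psi>: "schwartz \<Psi>" and f: "schwartz f" and g: "schwartz g"
  shows "wigner_dist \<tau> (dist_of g) (dist_of f) \<Psi> = dist_of (wigner \<tau> g f) \<Psi>"
proof -
  define K where "K = wigner_transpose \<tau> \<Psi>"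
  have K: "schwartz K" unfolding K_def by (rule schwartz_wigner_transpose[OF \<Psi>])
  have inner: "dist_of f (\<lambda>s. cnj (K (y, s))) = (LINT s|lborel. f s * K (y, s))" for y
    by (simp add: dist_of_def schwartz_cnj schwartz_section K)
  obtain C where C: "C \<ge> 0" "\<And>x. norm (f x) \<le> C * inverse (bk x ^ 0)" by (rule schwartz_decay[OF f]) (rule that)
  have "schwartz (\<lambda>p. K (snd p, fst p))"
    by (rule schwartz_linear_iso[OF K, where M="\<lambda>p. (snd p, fst p)"]) (auto intro!: bounded_linear_intros)
  then have 1: "schwartz_family (\<lambda>_::unit. 0::real) (\<lambda>_ p. K (snd p, fst p))" by (rule schwartz_family_const_iff)
  have 2: "norm (f z) \<le> C * bk z ^ 0" for z using C(2)[of z] by simp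
  have "schwartz (\<lambda>y. LINT s|lborel. f s * K (y, s))"
    using schwartz_family_imp_schwartz[OF schwartz_family_integral[OF 1 schwartz_measurable[OF f] 2 C(1)]] by simp
  then have "wigner_dist \<tau> (dist_of g) (dist_of f) \<Psi> = (LINT y|lborel. g y * cnj (LINT s|lborel. f s * K (y, s)))"
    using \<Psi> K by (simp add: wigner_dist_def tensor_dist_def cnj_dist_def K_def[symmetric] inner)
      (simp add: dist_of_def)
  also have "\<dots> = cnj (LINT y|lborel. LINT s|lborel. K (y, s) * cnj (g y) * f s)"
    by (simp add: Bochner_Integration.integral_cnj[symmetric] integral_mult_right_zero[symmetric] mult_ac
        del: Bochner_Integration.integral_cnj integral_mult_right_zero)
  also have "\<dots> = (LINT Z|lborel. wigner \<tau> g f Z * cnj (\<Psi> Z))"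
    unfolding K_def wigner_transpose_pairing[OF \<Psi> g f]
    by (simp only: Bochner_Integration.integral_cnj[symmetric] complex_cnj_mult complex_cnj_cnj mult.commute)
  finally show ?thesis using \<Psi> by (simp add: dist_of_def)
qed

text \<open>Here the Wigner distribution is a Schwartz function, and the reproducing formula for a
  says exactly that a evaluated at it is the extended pairing.\<close>

lemma tau_op_dist_of:
  fixes a :: "('a::euclidean_space \<times> 'a) dist" and \<Phi> :: "'a \<times> 'a \<Rightarrow> complex"
  assumes a: "tempered a" and f: "schwartz f" and g: "schwartz g" and \<Phi>: "schwartz \<Phi>" "\<Phi> \<noteq> (\<lambda>_. 0)"
  shows "tau_op \<tau> a (dist_of f) g = a (wigner \<tau> g f)"
proof -
  have W: "schwartz (wigner \<tau> g f)" by (rule schwartz_wigner[OF g f])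
  have "has_pairing a (wigner_dist \<tau> (dist_of g) (dist_of f)) (a (wigner \<tau> g f))"
    unfolding has_pairing_def
  proof (intro allI impI)
    fix \<Psi> :: "'a \<times> 'a \<Rightarrow> complex" assume \<Psi>: "schwartz \<Psi>"
    have "stft \<Psi> (wigner_dist \<tau> (dist_of g) (dist_of f)) Z = fstft \<Psi> (wigner \<tau> g f) Z" for Z
      unfolding stft_dist_of[OF \<Psi>, symmetric] stft_eq by (rule wigner_dist_dist_of[OF schwartz_tfz[OF \<Psi>] f g])
    then show "has_bochner_integral lborel (\<lambda>z. stft \<Psi> a z * cnj (stft \<Psi> (wigner_dist \<tau> (dist_of g) (dist_of f)) z))
        (a (wigner \<tau> g f) * of_real (energy \<Psi>))"
      using stft_reproducing[OF a \<Psi> W] by (simp add: has_bochner_integral_iff mult.commute)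
  qed
  then show ?thesis using g by (simp add: tau_op_def pairing_eq[OF _ \<Phi>])
qed

subsection \<open>The operator as a sesquilinear form\<close>

text \<open>The reciprocals are those of Young's inequality: \<pi>, \<theta> for the symbol,
  \<sigma>, \<rho> for the input; \<open>sx\<close> and \<open>rx\<close> will be those of the
  output. The weight is a regularised one, moderate with constant 1, so that it can be inserted
  without a factor.\<close>

locale tau_calculus =
  fixes v m :: "'a::euclidean_space \<times> 'a \<Rightarrow> real" and \<phi> :: "'a \<Rightarrow> complex" and \<pi> \<theta> \<sigma> \<rho> :: real
  assumes v: "submultiplicative_weight v" "polynomial_growth v"
    and m: "poly_weight m" and m_moderate: "\<And>z h. m (z + h) \<le> v h * m z"
    and \<phi>: "schwartz \<phi>" "\<phi> \<noteq> (\<lambda>_. 0)"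
    and e: "0 \<le> \<pi>" "\<pi> \<le> \<theta>" "\<theta> \<le> 1" "1 - \<theta> \<le> \<sigma>" "\<sigma> \<le> 1 - \<pi>" "1 - \<theta> \<le> \<rho>" "\<rho> \<le> 1 - \<pi>"
begin

abbreviation "\<mu> \<equiv> one_tensor_J v"
abbreviation "sx \<equiv> \<pi> + (\<sigma> + \<theta> - 1)"
abbreviation "rx \<equiv> \<pi> + (\<rho> + \<theta> - 1)"

text \<open>The Gabor matrix of the operator: its image of the shift of \<phi> by z', tested on the
  shift by z.\<close>

definition gabor_kernel :: "real \<Rightarrow> ('a \<times> 'a) dist \<Rightarrow> 'a \<times> 'a \<Rightarrow> 'a \<times> 'a \<Rightarrow> complex" where
  "gabor_kernel \<tau> a z z' = a (wigner \<tau> (tfz z \<phi>) (tfz z' \<phi>))"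

text \<open>The form obtained by expanding both f and g in shifts of \<phi>, hence the squared
  energy. An explicit integral can be compared with either of the two pairings.\<close>

definition op_form :: "real \<Rightarrow> ('a \<times> 'a) dist \<Rightarrow> 'a dist \<Rightarrow> 'a dist \<Rightarrow> complex" where
  "op_form \<tau> a f g = (LINT p|lborel. cnj (stft \<phi> g (fst p)) * stft \<phi> f (snd p) * gabor_kernel \<tau> a (fst p) (snd p)) / of_real ((energy \<phi>)\<^sup>2)"

definition gabor_form :: "real \<Rightarrow> (('a \<times> 'a) \<times> ('a \<times> 'a) \<Rightarrow> ennreal) \<Rightarrow> ('a \<times> 'a \<Rightarrow> ennreal) \<Rightarrow> ('a \<times> 'a \<Rightarrow> ennreal) \<Rightarrow> ennreal" where
  "gabor_form \<tau> A F G = (\<integral>\<^sup>+ p. A (gmap \<tau> (fst p) (snd p)) * F (snd p) * G (fst p) \<partial>lborel)"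

definition admissible_symbol :: "(('a \<times> 'a) \<times> ('a \<times> 'a) \<Rightarrow> ennreal) \<Rightarrow> bool" where
  "admissible_symbol A \<longleftrightarrow> A \<in> borel_measurable borel \<and> (\<exists>N<top. mixed_le \<pi> \<theta> A N)"

definition admissible_test :: "('a \<times> 'a \<Rightarrow> ennreal) \<Rightarrow> bool" where
  "admissible_test G \<longleftrightarrow> G \<in> borel_measurable borel \<and> (\<exists>N<top. mixed_le (1 - sx) (1 - rx) G N)"

text \<open>Defined by duality, through finiteness of all forms, rather than by
  \<open>mixed_le\<close>: sums of inputs are then inputs by additivity of the integral, and no
  triangle inequality for \<open>mixed_le\<close> has to be proved.\<close>

definition admissible_input :: "('a \<times> 'a \<Rightarrow> ennreal) \<Rightarrow> bool" where
  "admissible_input F \<longleftrightarrow> F \<in> borel_measurable borel \<and> (\<forall>\<tau> A G. admissible_symbol A \<longrightarrow> admissible_test G \<longrightarrow> gabor_form \<tau> A F G < top)"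

text \<open>Symbols and tests are controlled for all windows because \<open>has_pairing\<close>
  quantifies over all windows; inputs are only ever expanded with \<phi>.\<close>

definition symbols :: "('a \<times> 'a) dist set" where
  "symbols = {a. tempered a \<and> (\<forall>\<Psi>. schwartz \<Psi> \<longrightarrow> admissible_symbol (\<lambda>Z. ennreal (norm (stft \<Psi> a Z)) * ennreal (\<mu> Z)))}"

definition inputs :: "'a dist set" where
  "inputs = {f. tempered f \<and> admissible_input (\<lambda>z. ennreal (norm (stft \<phi> f z)) * ennreal (m z))}"

definition tests :: "'a dist set" where
  "tests = {g. tempered g \<and> (\<forall>\<Psi>. schwartz \<Psi> \<longrightarrow> admissible_test (\<lambda>z. ennreal (norm (stft \<Psi> g z)) * ennreal (1 / m z)))}"

lemma v_props: "continuous_on UNIV v" "0 < v z" "v (- z) = v z" "v (z + z') \<le> v z * v z'"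
  using v(1) unfolding submultiplicative_weight_def by blast+

lemma m_pos: "0 < m z"
  using m unfolding poly_weight_def by blast

lemma \<mu>_pos: "0 < \<mu> Z"
  by (simp add: one_tensor_J_def split_def v_props)

lemmas [measurable] = poly_weight_measurable[OF m] poly_weight_measurable[OF poly_weight_one_tensor_J[OF v]]

lemma weight_le: "m z \<le> \<mu> (gmap \<tau> z z') * m z'"
proof -
  have "symplectic_J (snd (gmap \<tau> z z')) = - (z - z')"
    by (simp add: gmap_def symplectic_J_def prod_eq_iff)
  then have "\<mu> (gmap \<tau> z z') = v (z - z')" unfolding one_tensor_J_def split_def by (simp only: v_props(3))
  then show ?thesis using m_moderate[of z' "z - z'"] by simp
qed

lemma wigner_window: "schwartz (wigner \<tau> \<phi> \<phi>)"
  by (intro schwartz_wigner \<phi>)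

lemma gabor_kernel_stft:
  assumes "tempered a"
  shows "gabor_kernel \<tau> a z z' = cnj (cis (2 * pi * ((fst z - fst z') \<bullet> (\<tau> *\<^sub>R snd z + (1 - \<tau>) *\<^sub>R snd z')))) * stft (wigner \<tau> \<phi> \<phi>) a (gmap \<tau> z z')"
  unfolding gabor_kernel_def wigner_tfz[OF schwartz_measurable[OF \<phi>(1)] schwartz_measurable[OF \<phi>(1)]]
  by (subst tempered_cmult[OF assms schwartz_tfz[OF wigner_window]]) (simp add: stft_eq)

lemma norm_gabor_kernel: "tempered a \<Longrightarrow> norm (gabor_kernel \<tau> a z z') = norm (stft (wigner \<tau> \<phi> \<phi>) a (gmap \<tau> z z'))"
  by (simp add: gabor_kernel_stft norm_mult)

lemma gabor_kernel_measurable: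
  assumes a: "tempered a" and [measurable]: "f \<in> borel_measurable M" "g \<in> borel_measurable M"
  shows "(\<lambda>x. gabor_kernel \<tau> a (f x) (g x)) \<in> borel_measurable M"
proof -
  note [measurable] = stft_measurable[OF a wigner_window]
  show ?thesis unfolding gabor_kernel_stft[OF a] by measurable
qed

lemma admissible_symbol_mono:
  assumes "admissible_symbol A" "B \<in> borel_measurable borel" "\<And>Z. B Z \<le> c * A Z" "c < top"
  shows "admissible_symbol B"
proof -
  obtain N where N: "N < top" "mixed_le \<pi> \<theta> A N" using assms(1) unfolding admissible_symbol_def by blast
  have "mixed_le \<pi> \<theta> B (c * N)" by (rule mixed_le_mono[OF N(2) assms(3)]) simp
  then show ?thesis unfolding admissible_symbol_def using assms(2,4) N(1) by (auto simp: ennreal_mult_less_top intro!: exI[of _ "c * N"])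
qed

lemma admissible_test_mono:
  assumes "admissible_test A" "B \<in> borel_measurable borel" "\<And>Z. B Z \<le> c * A Z" "c < top"
  shows "admissible_test B"
proof -
  obtain N where N: "N < top" "mixed_le (1 - sx) (1 - rx) A N" using assms(1) unfolding admissible_test_def by blast
  have "mixed_le (1 - sx) (1 - rx) B (c * N)" by (rule mixed_le_mono[OF N(2) assms(3)]) simp
  then show ?thesis unfolding admissible_test_def using assms(2,4) N(1) by (auto simp: ennreal_mult_less_top intro!: exI[of _ "c * N"])
qed

text \<open>\<open>4 * DIM('a)\<close> is twice the dimension of phase space, the decay that makes
  the kernel integrable in each of the two variables of a symbol transform.\<close>

lemma admissible_symbol_smear: "admissible_symbol A \<Longrightarrow> admissible_symbol (smear (4 * DIM('a)) A)"
proof -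
  assume A: "admissible_symbol A"
  then obtain N where N: "N < top" "mixed_le \<pi> \<theta> A N" unfolding admissible_symbol_def by blast
  show "admissible_symbol (smear (4 * DIM('a)) A)"
  proof (rule mixed_le_smear[where n = "4 * DIM('a)" and s = \<pi> and s' = \<pi> and r = \<theta> and r' = \<theta> and 'u = "'a \<times> 'a" and 'w = "'a \<times> 'a"])
    fix C :: ennreal assume "C < \<infinity>" "\<And>(F :: ('a \<times> 'a) \<times> ('a \<times> 'a) \<Rightarrow> ennreal) N. mixed_le \<pi> \<theta> F N \<Longrightarrow> mixed_le \<pi> \<theta> (smear (4 * DIM('a)) F) (C * N)"
    then show "admissible_symbol (smear (4 * DIM('a)) A)" using N A unfolding admissible_symbol_def by (auto simp: ennreal_mult_less_top intro!: exI[of _ "C * N"])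
  qed (use e in auto)
qed

lemma admissible_test_smear: "admissible_test A \<Longrightarrow> admissible_test (smear (4 * DIM('a)) A)"
proof -
  assume A: "admissible_test A"
  then obtain N where N: "N < top" "mixed_le (1 - sx) (1 - rx) A N" unfolding admissible_test_def by blast
  show "admissible_test (smear (4 * DIM('a)) A)"
  proof (rule mixed_le_smear[where n = "4 * DIM('a)" and s = "1 - sx" and s' = "1 - sx" and r = "1 - rx" and r' = "1 - rx" and 'u = 'a and 'w = 'a])
    fix C :: ennreal assume "C < \<infinity>" "\<And>(F :: 'a \<times> 'a \<Rightarrow> ennreal) N. mixed_le (1 - sx) (1 - rx) F N \<Longrightarrow> mixed_le (1 - sx) (1 - rx) (smear (4 * DIM('a)) F) (C * N)"
    then show "admissible_test (smear (4 * DIM('a)) A)" using N A unfolding admissible_test_def by (auto simp: ennreal_mult_less_top intro!: exI[of _ "C * N"])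
  qed (use e in auto)
qed

text \<open>Young's inequality puts the integral over z' into the mixed norm dual to that of the
  test function; \<open>mixed_pairing\<close> does the rest.\<close>

lemma admissible_input_mixed_le:
  assumes [measurable]: "F \<in> borel_measurable borel" and F: "mixed_le \<sigma> \<rho> F NF" "NF < top"
  shows "admissible_input F"
  unfolding admissible_input_def
proof (intro conjI allI impI assms(1))
  fix \<tau> A G assume "admissible_symbol A" "admissible_test G"
  then obtain NA NG where A: "NA < top" "mixed_le \<pi> \<theta> A NA" and G: "NG < top" "mixed_le (1 - sx) (1 - rx) G NG"
    and [measurable]: "A \<in> borel_measurable borel" "G \<in> borel_measurable borel" unfolding admissible_symbol_def admissible_test_def by blast
  show "gabor_form \<tau> A F G < top"
  proof (rule mixed_le_gabor_matrix[OF e, where 'a = 'a])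
    fix C :: ennreal assume C: "C < top" "\<And>\<tau> (A :: ('a \<times> 'a) \<times> ('a \<times> 'a) \<Rightarrow> ennreal) F NA NF.
       mixed_le \<pi> \<theta> A NA \<Longrightarrow> mixed_le \<sigma> \<rho> F NF \<Longrightarrow>
       mixed_le sx rx (\<lambda>z. \<integral>\<^sup>+ z'. A (gmap \<tau> z z') * F z' \<partial>lborel) (C * (NA * NF))"
    have "gabor_form \<tau> A F G = (\<integral>\<^sup>+ z. \<integral>\<^sup>+ z'. A (gmap \<tau> z z') * F z' * G z \<partial>lborel \<partial>lborel)"
      unfolding gabor_form_def by (subst nn_integral_lborel_pair(1)) auto
    also have "\<dots> = (\<integral>\<^sup>+ z. (\<integral>\<^sup>+ z'. A (gmap \<tau> z z') * F z' \<partial>lborel) * G z \<partial>lborel)"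
      by (intro nn_integral_cong nn_integral_multc) measurable
    also have "\<dots> \<le> C * (NA * NF) * NG"
      by (rule mixed_pairing[OF C(2)[OF A(2) F(1)] G(2)]) (use e in auto)
    also have "\<dots> < top" using C(1) A(1) G(1) F(2) by (simp add: ennreal_mult_less_top)
    finally show "gabor_form \<tau> A F G < top" .
  qed
qed

text \<open>By moderateness \<open>\<mu> (gmap \<tau> z z') * m z' * (1 / m z)\<close> is at least
  1, so the three weights can be inserted.\<close>

lemma gabor_form_bound:
  "(\<integral>\<^sup>+ p. X (gmap \<tau> (fst p) (snd p)) * Y (snd p) * h (fst p) \<partial>lborel) \<le>
   gabor_form \<tau> (\<lambda>Z. X Z * ennreal (\<mu> Z)) (\<lambda>z. Y z * ennreal (m z)) (\<lambda>z. h z * ennreal (1 / m z))"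
  unfolding gabor_form_def
proof (intro nn_integral_mono)
  fix p :: "('a \<times> 'a) \<times> 'a \<times> 'a"
  obtain z z' where p: "p = (z, z')" by (cases p)
  have "1 \<le> \<mu> (gmap \<tau> z z') * m z' * (1 / m z)" using weight_le[of z \<tau> z'] m_pos[of z] by simp
  then have "ennreal 1 \<le> ennreal (\<mu> (gmap \<tau> z z') * m z' * (1 / m z))" by (rule ennreal_leI)
  also have "\<dots> = ennreal (\<mu> (gmap \<tau> z z')) * ennreal (m z') * ennreal (1 / m z)"
    using m_pos[of z] m_pos[of z'] \<mu>_pos[of "gmap \<tau> z z'"] by (simp only: ennreal_mult'' ennreal_mult' less_imp_le zero_le_divide_1_iff)
  finally have "(X (gmap \<tau> z z') * Y z' * h z) * 1 \<le> (X (gmap \<tau> z z') * Y z' * h z) * (ennreal (\<mu> (gmap \<tau> z z')) * ennreal (m z') * ennreal (1 / m z))"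
    by (intro mult_left_mono) auto
  then show "X (gmap \<tau> (fst p) (snd p)) * Y (snd p) * h (fst p) \<le>
      X (gmap \<tau> (fst p) (snd p)) * ennreal (\<mu> (gmap \<tau> (fst p) (snd p))) * (Y (snd p) * ennreal (m (snd p))) * (h (fst p) * ennreal (1 / m (fst p)))"
    by (simp add: p mult_ac)
qed

lemma symbols_tempered: "a \<in> symbols \<Longrightarrow> tempered a"
  and inputs_tempered: "f \<in> inputs \<Longrightarrow> tempered f"
  and tests_tempered: "g \<in> tests \<Longrightarrow> tempered g"
  by (simp_all add: symbols_def inputs_def tests_def)

text \<open>The function h need not be the modulus of a transform: it will also be a smeared
  transform and a common majorant for a sequence of test functions.\<close>

lemma form_finite:
  assumes a: "a \<in> symbols" and f: "f \<in> inputs" and h: "admissible_test (\<lambda>z. h z * ennreal (1 / m z))"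
  shows "(\<integral>\<^sup>+ p. ennreal (norm (gabor_kernel \<tau> a (fst p) (snd p))) * ennreal (norm (stft \<phi> f (snd p))) * h (fst p) \<partial>lborel) < top"
proof -
  have "admissible_symbol (\<lambda>Z. ennreal (norm (stft (wigner \<tau> \<phi> \<phi>) a Z)) * ennreal (\<mu> Z))"
    using a wigner_window by (simp add: symbols_def)
  moreover have "admissible_input (\<lambda>z. ennreal (norm (stft \<phi> f z)) * ennreal (m z))"
    using f by (simp add: inputs_def)
  ultimately have "gabor_form \<tau> (\<lambda>Z. ennreal (norm (stft (wigner \<tau> \<phi> \<phi>) a Z)) * ennreal (\<mu> Z)) (\<lambda>z. ennreal (norm (stft \<phi> f z)) * ennreal (m z))
       (\<lambda>z. h z * ennreal (1 / m z)) < top" using h unfolding admissible_input_def by blast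
  with gabor_form_bound show ?thesis unfolding norm_gabor_kernel[OF symbols_tempered[OF a]] by (rule order.strict_trans1)
qed

lemma form_integrable:
  assumes a: "a \<in> symbols" and f: "f \<in> inputs" and g: "g \<in> tests"
  shows "integrable lborel (\<lambda>p. cnj (stft \<phi> g (fst p)) * stft \<phi> f (snd p) * gabor_kernel \<tau> a (fst p) (snd p))"
proof (rule integrableI_bounded)
  note [measurable] = stft_measurable[OF inputs_tempered[OF f] \<phi>(1)] stft_measurable[OF tests_tempered[OF g] \<phi>(1)]
    gabor_kernel_measurable[OF symbols_tempered[OF a]]
  show "(\<lambda>p. cnj (stft \<phi> g (fst p)) * stft \<phi> f (snd p) * gabor_kernel \<tau> a (fst p) (snd p)) \<in> borel_measurable lborel" by measurable
  have "admissible_test (\<lambda>z. ennreal (norm (stft \<phi> g z)) * ennreal (1 / m z))" using g \<phi>(1) by (simp add: tests_def)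
  from form_finite[OF a f this, of \<tau>]
  show "(\<integral>\<^sup>+ p. ennreal (norm (cnj (stft \<phi> g (fst p)) * stft \<phi> f (snd p) * gabor_kernel \<tau> a (fst p) (snd p))) \<partial>lborel) < \<infinity>"
    by (simp add: norm_mult ennreal_mult' mult_ac)
qed

lemma fstft_wigner:
  assumes \<Psi>: "schwartz \<Psi>"
  shows "fstft \<Psi> (wigner \<tau> (tfz z \<phi>) (tfz z' \<phi>)) Z =
    cis (2 * pi * ((fst z - fst z') \<bullet> (\<tau> *\<^sub>R snd z + (1 - \<tau>) *\<^sub>R snd z'))) *
    (cis (2 * pi * ((snd (gmap \<tau> z z') - snd Z) \<bullet> fst (gmap \<tau> z z'))) * fstft \<Psi> (wigner \<tau> \<phi> \<phi>) (Z - gmap \<tau> z z'))"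
  by (simp add: wigner_tfz[OF schwartz_measurable[OF \<phi>(1)] schwartz_measurable[OF \<phi>(1)]] fstft_cmult
      fstft_tfz[OF schwartz_measurable[OF wigner_window] schwartz_measurable[OF \<Psi>]])

lemma norm_fstft_wigner:
  assumes "schwartz \<Psi>"
  shows "norm (fstft \<Psi> (wigner \<tau> (tfz z \<phi>) (tfz z' \<phi>)) Z) = norm (fstft \<Psi> (wigner \<tau> \<phi> \<phi>) (Z - gmap \<tau> z z'))"
  by (simp add: fstft_wigner[OF assms] norm_mult)

section \<open>Both extended pairings equal the form\<close>

text \<open>Fubini for U in Z and the pair p. The integral over Z yields the Gabor kernel, by the
  reproducing formula for a; the integral over p yields the conjugate transform of
  \<open>wigner_dist \<tau> g f\<close>, by its expansion.\<close>

theorem wigner_pairing: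
  assumes a: "a \<in> symbols" and f: "f \<in> inputs" and g: "g \<in> tests"
  shows "has_pairing a (wigner_dist \<tau> g f) (op_form \<tau> a f g)"
  unfolding has_pairing_def
proof (intro allI impI)
  fix \<Psi> :: "'a \<times> 'a \<Rightarrow> complex" assume \<Psi>: "schwartz \<Psi>"
  note ta = symbols_tempered[OF a] and tf = inputs_tempered[OF f] and tg = tests_tempered[OF g]
  have en: "energy \<phi> > 0" by (rule energy_pos[OF \<phi>])
  define W where "W z z' = wigner \<tau> (tfz z \<phi>) (tfz z' \<phi>)" for z z'
  define c where "c z z' = cnj (stft \<phi> g z) * stft \<phi> f z'" for z z'
  define U where "U Z p = stft \<Psi> a Z * (cnj (fstft \<Psi> (W (fst p) (snd p)) Z) * c (fst p) (snd p))" for Z and p :: "('a \<times> 'a) \<times> 'a \<times> 'a"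
  have W: "schwartz (W z z')" for z z' unfolding W_def by (intro schwartz_wigner schwartz_tfz \<phi>)
  note [measurable] = stft_measurable[OF tf \<phi>(1)] stft_measurable[OF tg \<phi>(1)] stft_measurable[OF ta \<Psi>]
    schwartz_measurable[OF schwartz_fstft[OF \<Psi> wigner_window]]
  have fm [measurable]: "(\<lambda>x. fstft \<Psi> (W (k x) (l x)) (h x)) \<in> borel_measurable M"
    if [measurable]: "k \<in> borel_measurable M" "l \<in> borel_measurable M" "h \<in> borel_measurable M"
    for M :: "'m measure" and k l h
    unfolding W_def fstft_wigner[OF \<Psi>] by measurable
  have cm [measurable]: "(\<lambda>x. c (k x) (l x)) \<in> borel_measurable M"
    if [measurable]: "k \<in> borel_measurable M" "l \<in> borel_measurable M" for M :: "'m measure" and k l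
    unfolding c_def by measurable
  define R where "R Z = (LINT z|lborel. LINT z'|lborel. cnj (fstft \<Psi> (W z z') Z) * c z z')" for Z
  have R: "R Z = cnj (stft \<Psi> (wigner_dist \<tau> g f) Z) * of_real ((energy \<phi>)\<^sup>2)" for Z
  proof -
    have co: "wigner_coeff \<phi> \<tau> (tfz Z \<Psi>) z z' = cnj (fstft \<Psi> (W z z') Z)" for z z'
      unfolding wigner_coeff_def fstft_def W_def by (simp only: Bochner_Integration.integral_cnj[symmetric] complex_cnj_mult complex_cnj_cnj mult.commute)
    have "stft \<Psi> (wigner_dist \<tau> g f) Z * of_real ((energy \<phi>)\<^sup>2) = (LINT z|lborel. stft \<phi> g z * (LINT z'|lborel. cnj (stft \<phi> f z' * cnj (fstft \<Psi> (W z z') Z))))"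
      unfolding stft_eq[of \<Psi>] wigner_dist_expansion[OF tf tg \<phi> schwartz_tfz[OF \<Psi>]] co ..
    then have "cnj (stft \<Psi> (wigner_dist \<tau> g f) Z * of_real ((energy \<phi>)\<^sup>2)) = (LINT z|lborel. cnj (stft \<phi> g z) * (LINT z'|lborel. stft \<phi> f z' * cnj (fstft \<Psi> (W z z') Z)))"
      by (simp only: Bochner_Integration.integral_cnj[symmetric] complex_cnj_mult complex_cnj_cnj)
    also have "\<dots> = R Z" unfolding R_def c_def by (simp add: integral_mult_right_zero[symmetric] mult_ac del: integral_mult_right_zero)
    finally show ?thesis by simp
  qed
  have Rm [measurable]: "R \<in> borel_measurable borel"
    unfolding R_def[abs_def] by measurable
  have int: "integrable lborel (\<lambda>(Z, p). U Z p)"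
  proof (rule integrableI_bounded)
    show m1: "(\<lambda>(Z, p). U Z p) \<in> borel_measurable lborel" unfolding U_def split_def by measurable
    \<comment> \<open>Integrating out Z smears the transform of a by a rapidly decaying kernel. The
      result is again an admissible symbol, so absolute convergence follows as for the form
      itself.\<close>
    define X where "X Y = (\<integral>\<^sup>+ Z. ennreal (norm (stft \<Psi> a Z)) * ennreal (norm (fstft \<Psi> (wigner \<tau> \<phi> \<phi>) (Z - Y))) \<partial>lborel)" for Y
    have [measurable]: "X \<in> borel_measurable borel" unfolding X_def[abs_def] by measurable
    have ok: "admissible_symbol (\<lambda>Z. ennreal (norm (stft \<Psi> a Z)) * ennreal (\<mu> Z))" using a \<Psi> by (simp add: symbols_def)
    have okX: "admissible_symbol (\<lambda>Z. X Z * ennreal (\<mu> Z))"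
    proof -
      obtain C K where C: "C \<ge> 0" "\<forall>n f k D z. f \<in> borel_measurable borel \<longrightarrow> k \<in> borel_measurable borel \<longrightarrow> D \<ge> 0 \<longrightarrow>
        (\<forall>y. 0 \<le> k y \<and> k y \<le> D * inverse (bk y ^ (2 * n + K))) \<longrightarrow>
        (\<integral>\<^sup>+ z'. f z' * ennreal (k (z' - z)) \<partial>lborel) * ennreal (\<mu> z) \<le> ennreal (C * D) * smear n (\<lambda>z. f z * ennreal (\<mu> z)) z"
        by (rule smear_kernel[OF poly_weight_one_tensor_J[OF v]])
      obtain D where D: "D \<ge> 0" "\<And>Y. norm (fstft \<Psi> (wigner \<tau> \<phi> \<phi>) Y) \<le> D * inverse (bk Y ^ (2 * (4 * DIM('a)) + K))"
        by (rule schwartz_decay[OF schwartz_fstft[OF \<Psi> wigner_window]]) (rule that)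
      have "X Y * ennreal (\<mu> Y) \<le> ennreal (C * D) * smear (4 * DIM('a)) (\<lambda>Z. ennreal (norm (stft \<Psi> a Z)) * ennreal (\<mu> Z)) Y" for Y
        unfolding X_def
        by (rule C(2)[rule_format, where k = "\<lambda>Y. norm (fstft \<Psi> (wigner \<tau> \<phi> \<phi>) Y)"]) (use D in auto)
      then show ?thesis by (intro admissible_symbol_mono[OF admissible_symbol_smear[OF ok]]) auto
    qed
    have admissible_input: "admissible_input (\<lambda>z. ennreal (norm (stft \<phi> f z)) * ennreal (m z))" using f by (simp add: inputs_def)
    have admissible_test: "admissible_test (\<lambda>z. ennreal (norm (stft \<phi> g z)) * ennreal (1 / m z))" using g \<phi>(1) by (simp add: tests_def)
    have "(\<integral>\<^sup>+ q. ennreal (norm (case q of (Z, p) \<Rightarrow> U Z p)) \<partial>lborel) = (\<integral>\<^sup>+ p. \<integral>\<^sup>+ Z. ennreal (norm (U Z p)) \<partial>lborel \<partial>lborel)"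
      using m1 by (subst nn_integral_lborel_pair(2)) auto
    also have "\<dots> = (\<integral>\<^sup>+ p. X (gmap \<tau> (fst p) (snd p)) * ennreal (norm (stft \<phi> f (snd p))) * ennreal (norm (stft \<phi> g (fst p))) \<partial>lborel)"
    proof (intro nn_integral_cong)
      fix p :: "('a \<times> 'a) \<times> 'a \<times> 'a"
      have "ennreal (norm (U Z p)) = ennreal (norm (stft \<phi> f (snd p))) * ennreal (norm (stft \<phi> g (fst p))) *
          (ennreal (norm (stft \<Psi> a Z)) * ennreal (norm (fstft \<Psi> (wigner \<tau> \<phi> \<phi>) (Z - gmap \<tau> (fst p) (snd p)))))" for Z
        by (simp add: U_def c_def W_def norm_mult norm_fstft_wigner[OF \<Psi>] ennreal_mult' mult_ac)
      then show "(\<integral>\<^sup>+ Z. ennreal (norm (U Z p)) \<partial>lborel) = X (gmap \<tau> (fst p) (snd p)) * ennreal (norm (stft \<phi> f (snd p))) * ennreal (norm (stft \<phi> g (fst p)))"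
        unfolding X_def by (simp only:) (subst nn_integral_cmult, measurable, simp add: mult_ac)
    qed
    also have "\<dots> \<le> gabor_form \<tau> (\<lambda>Z. X Z * ennreal (\<mu> Z)) (\<lambda>z. ennreal (norm (stft \<phi> f z)) * ennreal (m z)) (\<lambda>z. ennreal (norm (stft \<phi> g z)) * ennreal (1 / m z))"
      by (rule gabor_form_bound)
    also have "\<dots> < \<infinity>" using admissible_input okX admissible_test unfolding admissible_input_def by simp
    finally show "(\<integral>\<^sup>+ q. ennreal (norm (case q of (Z, p) \<Rightarrow> U Z p)) \<partial>lborel) < \<infinity>" .
  qed
  have inner: "(LINT Z|lborel. U Z p) = of_real (energy \<Psi>) * (c (fst p) (snd p) * gabor_kernel \<tau> a (fst p) (snd p))" for p
    using stft_reproducing(2)[OF ta \<Psi> W[of "fst p" "snd p"]]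
    by (simp add: U_def W_def gabor_kernel_def mult.assoc[symmetric])
  have "AE Z in lborel. (LINT p|lborel. U Z p) = stft \<Psi> a Z * cnj (stft \<Psi> (wigner_dist \<tau> g f) Z) * of_real ((energy \<phi>)\<^sup>2)"
    using fubini_lborel(5)[OF int]
  proof eventually_elim
    case (elim Z)
    show ?case
    \<comment> \<open>Fubini gives integrability of the expansion only after multiplication by
      \<open>stft \<Psi> a Z\<close>; where this factor vanishes, both sides are 0.\<close>
    proof (cases "stft \<Psi> a Z = 0")
      case False
      then have i: "integrable lborel (\<lambda>(z, z'). cnj (fstft \<Psi> (W z z') Z) * c z z')"
        using integrable_mult_right[OF elim, of "1 / stft \<Psi> a Z"] by (simp add: U_def split_def)
      have "(LINT p|lborel. U Z p) = stft \<Psi> a Z * R Z"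
        using fubini_lborel(1)[OF i] by (simp add: U_def R_def)
      then show ?thesis by (simp add: R)
    qed (simp add: U_def)
  qed
  moreover have "has_bochner_integral lborel (\<lambda>Z. LINT p|lborel. U Z p) (of_real (energy \<Psi>) * (LINT p|lborel. c (fst p) (snd p) * gabor_kernel \<tau> a (fst p) (snd p)))"
    using fubini_lborel(3)[OF int] fubini_lborel_swap[OF int] by (simp add: has_bochner_integral_iff inner)
  moreover have "stft \<Psi> a Z * cnj (stft \<Psi> (wigner_dist \<tau> g f) Z) * of_real ((energy \<phi>)\<^sup>2) = stft \<Psi> a Z * R Z" for Z
    by (simp add: R)
  ultimately have "has_bochner_integral lborel (\<lambda>Z. stft \<Psi> a Z * R Z) (of_real (energy \<Psi>) * (LINT p|lborel. c (fst p) (snd p) * gabor_kernel \<tau> a (fst p) (snd p)))"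
    using borel_measurable_integrable[OF fubini_lborel(3)[OF int]] by (subst has_bochner_integral_cong_AE[symmetric]) auto
  then have "has_bochner_integral lborel (\<lambda>Z. stft \<Psi> a Z * R Z / of_real ((energy \<phi>)\<^sup>2))
      (of_real (energy \<Psi>) * (LINT p|lborel. c (fst p) (snd p) * gabor_kernel \<tau> a (fst p) (snd p)) / of_real ((energy \<phi>)\<^sup>2))"
    by (rule has_bochner_integral_divide_zero)
  then show "has_bochner_integral lborel (\<lambda>Z. stft \<Psi> a Z * cnj (stft \<Psi> (wigner_dist \<tau> g f) Z)) (op_form \<tau> a f g * of_real (energy \<Psi>))"
    using en by (simp add: R op_form_def c_def mult_ac)
qed


text \<open>1 / m grows at most polynomially, and the transforms of a bounded family decay rapidly
  and uniformly. The majorant is common to all i, as temperedness of the operator's values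
  requires.\<close>

lemma family_test_bound:
  assumes \<Psi>: "schwartz \<Psi>" and g: "schwartz_family (\<lambda>_. 0::real) g"
  shows "\<exists>C\<ge>0. \<forall>i z. ennreal (norm (fstft \<Psi> (g i) z)) * ennreal (1 / m z) \<le> ennreal C * ennreal (prod_kernel (4 * DIM('a)) z)"
proof -
  obtain C K where C: "C \<ge> 0" "\<And>z h. 1 / m (z + h) \<le> C * bk h ^ K * (1 / m z)"
    using poly_weight_inverse[OF m] unfolding poly_weight_def by blast
  obtain D M where D: "D \<ge> 0" "\<And>i z. norm (fstft \<Psi> (g i) z) \<le> D * bk (0::real) ^ M * inverse (bk z ^ (K + 2 * (4 * DIM('a))))"
    by (rule schwartz_family_decay[OF schwartz_family_fstft[OF schwartz_family_const_iff[OF \<Psi>] g]]) (rule that)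
  show ?thesis
  proof (intro exI[of _ "D * C / m 0"] conjI allI)
    show "0 \<le> D * C / m 0" using C(1) D(1) m_pos[of 0] by simp
    fix i z
    have "norm (fstft \<Psi> (g i) z) * (1 / m z) \<le> (D * inverse (bk z ^ (K + 2 * (4 * DIM('a))))) * (C * bk z ^ K * (1 / m 0))"
      using D(2)[of i z] C(2)[of 0 z] m_pos[of z] D(1) by (intro mult_mono) (auto simp: bk_nonneg less_imp_le)
    also have "\<dots> = (D * C / m 0) * inverse (bk z ^ (2 * (4 * DIM('a))))"
      using bk_power_pos[of z K] by (simp add: power_add field_simps)
    also have "\<dots> \<le> (D * C / m 0) * prod_kernel (4 * DIM('a)) z"
      using C(1) D(1) m_pos[of 0] by (intro mult_left_mono bk_prod_kernel) simp
    finally have "ennreal (norm (fstft \<Psi> (g i) z) * (1 / m z)) \<le> ennreal ((D * C / m 0) * prod_kernel (4 * DIM('a)) z)" by (rule ennreal_leI)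
    then show "ennreal (norm (fstft \<Psi> (g i) z)) * ennreal (1 / m z) \<le> ennreal (D * C / m 0) * ennreal (prod_kernel (4 * DIM('a)) z)"
      using C(1) D(1) m_pos[of 0] m_pos[of z] by (simp add: ennreal_mult'[symmetric])
  qed
qed

lemma prod_kernel_measurable [measurable]: "prod_kernel n \<in> borel_measurable borel"
  unfolding prod_kernel_def[abs_def] by measurable

lemma admissible_test_prod_kernel: "admissible_test (\<lambda>z. ennreal (prod_kernel (4 * DIM('a)) z))"
  unfolding admissible_test_def by (intro conjI mixed_le_prod_kernel) (use e in auto)

lemma dist_of_tests:
  assumes g: "schwartz g" shows "dist_of g \<in> tests"
  unfolding tests_def
proof (intro CollectI conjI allI impI tempered_dist_of g)
  fix \<Psi> :: "'a \<Rightarrow> complex" assume \<Psi>: "schwartz \<Psi>"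
  obtain C where C: "C \<ge> 0" "\<And>z. ennreal (norm (fstft \<Psi> g z)) * ennreal (1 / m z) \<le> ennreal C * ennreal (prod_kernel (4 * DIM('a)) z)"
    using family_test_bound[OF \<Psi> schwartz_family_const_iff[OF g], where 'b = unit] by blast
  note [measurable] = schwartz_measurable[OF schwartz_fstft[OF \<Psi> g]]
  show "admissible_test (\<lambda>z. ennreal (norm (stft \<Psi> (dist_of g) z)) * ennreal (1 / m z))"
    unfolding stft_dist_of[OF \<Psi>] by (rule admissible_test_mono[OF admissible_test_prod_kernel _ C(2)]) auto
qed

text \<open>Uniqueness of the pairing on phase space needs some nonzero window there; the tensor
  square of \<phi> is one.\<close>

lemma tensor_window:
  shows "schwartz (\<lambda>(x, y). \<phi> x * \<phi> y)" "(\<lambda>(x, y). \<phi> x * \<phi> y) \<noteq> (\<lambda>_. 0)"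
proof -
  show "schwartz (\<lambda>(x, y). \<phi> x * \<phi> y)"
    using \<phi>(1) unfolding schwartz_iff_family by (intro schwartz_family_tensor)
  obtain x where "\<phi> x \<noteq> 0" using \<phi>(2) by auto
  then show "(\<lambda>(x, y). \<phi> x * \<phi> y) \<noteq> (\<lambda>_. 0)" by (auto simp: fun_eq_iff intro!: exI[of _ x])
qed

text \<open>\<open>tau_op\<close> is a definite description; existence by
  \<open>wigner_pairing\<close> and uniqueness of the pairing replace it by an integral.\<close>

lemma tau_op_eq:
  assumes "a \<in> symbols" "f \<in> inputs" "schwartz g"
  shows "tau_op \<tau> a f g = op_form \<tau> a f (dist_of g)"
  using pairing_eq[OF wigner_pairing[OF assms(1,2) dist_of_tests[OF assms(3)]] tensor_window] assms(3)
  by (simp add: tau_op_def)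

lemma inputs_lincomb:
  assumes f: "f \<in> inputs" and h: "h \<in> inputs"
  shows "(\<lambda>\<psi>. c * f \<psi> + h \<psi>) \<in> inputs"
proof -
  let ?F = "\<lambda>f z. ennreal (norm (stft \<phi> f z)) * ennreal (m z)"
  note [measurable] = stft_measurable[OF inputs_tempered[OF f] \<phi>(1)] stft_measurable[OF inputs_tempered[OF h] \<phi>(1)]
  have s: "stft \<phi> (\<lambda>\<psi>. c * f \<psi> + h \<psi>) z = c * stft \<phi> f z + stft \<phi> h z" for z by (simp add: stft_eq)
  have "admissible_input (?F (\<lambda>\<psi>. c * f \<psi> + h \<psi>))"
    unfolding admissible_input_def s
  proof (intro conjI allI impI)
    fix \<tau> A G assume A: "admissible_symbol A" and G: "admissible_test G"
    then have [measurable]: "A \<in> borel_measurable borel" "G \<in> borel_measurable borel" by (auto simp: admissible_symbol_def admissible_test_def)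
    have le: "ennreal (norm (c * stft \<phi> f z + stft \<phi> h z)) * ennreal (m z) \<le> ennreal (norm c) * ?F f z + ?F h z" for z
    proof -
      have "ennreal (norm (c * stft \<phi> f z + stft \<phi> h z)) \<le> ennreal (norm c) * ennreal (norm (stft \<phi> f z)) + ennreal (norm (stft \<phi> h z))"
        using norm_triangle_ineq[of "c * stft \<phi> f z" "stft \<phi> h z"]
        by (simp add: norm_mult ennreal_mult'[symmetric] ennreal_plus[symmetric] del: ennreal_plus)
      then have "ennreal (norm (c * stft \<phi> f z + stft \<phi> h z)) * ennreal (m z) \<le> (ennreal (norm c) * ennreal (norm (stft \<phi> f z)) + ennreal (norm (stft \<phi> h z))) * ennreal (m z)"
        by (rule mult_right_mono) simp
      then show ?thesis by (simp add: distrib_right mult.assoc)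
    qed
    have "gabor_form \<tau> A (\<lambda>z. ennreal (norm (c * stft \<phi> f z + stft \<phi> h z)) * ennreal (m z)) G \<le>
        gabor_form \<tau> A (\<lambda>z. ennreal (norm c) * ?F f z + ?F h z) G"
      unfolding gabor_form_def by (intro nn_integral_mono mult_right_mono mult_left_mono le) auto
    also have "\<dots> = (\<integral>\<^sup>+ p. ennreal (norm c) * (A (gmap \<tau> (fst p) (snd p)) * ?F f (snd p) * G (fst p)) + A (gmap \<tau> (fst p) (snd p)) * ?F h (snd p) * G (fst p) \<partial>lborel)"
      unfolding gabor_form_def by (intro nn_integral_cong) (simp add: distrib_left distrib_right mult_ac)
    also have "\<dots> = ennreal (norm c) * gabor_form \<tau> A (?F f) G + gabor_form \<tau> A (?F h) G"
      unfolding gabor_form_def by (subst nn_integral_add, measurable, subst nn_integral_cmult, measurable)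
    also have "\<dots> < top"
      using f h A G unfolding inputs_def admissible_input_def by (auto simp: ennreal_mult_less_top)
    finally show "gabor_form \<tau> A (\<lambda>z. ennreal (norm (c * stft \<phi> f z + stft \<phi> h z)) * ennreal (m z)) G < top" .
  qed measurable
  then show ?thesis using f h by (simp add: inputs_def tempered_lincomb)
qed

lemma tau_op_linear:
  assumes a: "a \<in> symbols" and f: "f \<in> inputs" and h: "h \<in> inputs"
  shows "tau_op \<tau> a (\<lambda>\<psi>. c * f \<psi> + h \<psi>) = (\<lambda>\<psi>. c * tau_op \<tau> a f \<psi> + tau_op \<tau> a h \<psi>)"
proof
  fix \<psi>
  show "tau_op \<tau> a (\<lambda>\<psi>. c * f \<psi> + h \<psi>) \<psi> = c * tau_op \<tau> a f \<psi> + tau_op \<tau> a h \<psi>"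
  proof (cases "schwartz \<psi>")
    case True
    have e: "cnj (stft \<phi> (dist_of \<psi>) (fst p)) * stft \<phi> (\<lambda>\<psi>. c * f \<psi> + h \<psi>) (snd p) * gabor_kernel \<tau> a (fst p) (snd p) =
       c * (cnj (stft \<phi> (dist_of \<psi>) (fst p)) * stft \<phi> f (snd p) * gabor_kernel \<tau> a (fst p) (snd p)) +
       cnj (stft \<phi> (dist_of \<psi>) (fst p)) * stft \<phi> h (snd p) * gabor_kernel \<tau> a (fst p) (snd p)" for p
      by (simp add: stft_eq algebra_simps)
    note I = form_integrable[OF a _ dist_of_tests[OF True], where \<tau> = \<tau>]
    show ?thesis
      unfolding tau_op_eq[OF a inputs_lincomb[OF f h] True] tau_op_eq[OF a f True] tau_op_eq[OF a h True] op_form_def e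
      using I[OF f] I[OF h] by (subst Bochner_Integration.integral_add) (auto simp: add_divide_distrib)
  qed (simp add: tau_op_def)
qed

lemma fstft_lincomb:
  assumes "schwartz \<Psi>" "schwartz f" "schwartz g"
  shows "fstft \<Psi> (\<lambda>x. c * f x + g x) z = c * fstft \<Psi> f z + fstft \<Psi> g z"
proof -
  have i: "integrable lborel (\<lambda>t. h t * cnj (tfz z \<Psi> t))" if "schwartz h" for h
    by (intro schwartz_integrable schwartz_mult schwartz_cnj schwartz_tfz assms(1) that)
  show ?thesis using i[OF assms(2)] i[OF assms(3)] by (simp add: fstft_def distrib_right mult.assoc)
qed

lemma norm_form_le:
  assumes a: "a \<in> symbols" and f: "f \<in> inputs"
  shows "ennreal (norm (op_form \<tau> a f g)) \<le> ennreal (1 / (energy \<phi>)\<^sup>2) *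
    (\<integral>\<^sup>+ p. ennreal (norm (gabor_kernel \<tau> a (fst p) (snd p))) * ennreal (norm (stft \<phi> f (snd p))) * ennreal (norm (stft \<phi> g (fst p))) \<partial>lborel)"
proof -
  let ?I = "LINT p|lborel. cnj (stft \<phi> g (fst p)) * stft \<phi> f (snd p) * gabor_kernel \<tau> a (fst p) (snd p)"
  have "ennreal (norm (op_form \<tau> a f g)) = ennreal (1 / (energy \<phi>)\<^sup>2) * ennreal (norm ?I)"
    by (simp add: op_form_def norm_divide norm_power ennreal_mult'[symmetric])
  also have "ennreal (norm ?I) \<le> (\<integral>\<^sup>+ p. ennreal (norm (cnj (stft \<phi> g (fst p)) * stft \<phi> f (snd p) * gabor_kernel \<tau> a (fst p) (snd p))) \<partial>lborel)"
    by (cases "integrable lborel (\<lambda>p. cnj (stft \<phi> g (fst p)) * stft \<phi> f (snd p) * gabor_kernel \<tau> a (fst p) (snd p))")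
       (auto intro: integral_norm_bound_ennreal simp: not_integrable_integral_eq)
  also have "\<dots> = (\<integral>\<^sup>+ p. ennreal (norm (gabor_kernel \<tau> a (fst p) (snd p))) * ennreal (norm (stft \<phi> f (snd p))) * ennreal (norm (stft \<phi> g (fst p))) \<partial>lborel)"
    by (simp add: norm_mult ennreal_mult' mult_ac)
  finally show ?thesis by (simp add: mult_left_mono)
qed

text \<open>By \<open>temperedI\<close> it suffices to bound the values along a bounded sequence of
  test functions; a common majorant of their transforms gives the same finite integral for all of
  them.\<close>

lemma tempered_tau_op:
  assumes a: "a \<in> symbols" and f: "f \<in> inputs"
  shows "tempered (tau_op \<tau> a f)"
proof (rule temperedI)
  fix \<psi> \<eta> :: "'a \<Rightarrow> complex" and c assume s: "schwartz \<psi>" "schwartz \<eta>"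
  then have s': "schwartz (\<lambda>x. c * \<psi> x + \<eta> x)" by (intro schwartz_add schwartz_cmult)
  have e: "cnj (stft \<phi> (dist_of (\<lambda>x. c * \<psi> x + \<eta> x)) (fst p)) * stft \<phi> f (snd p) * gabor_kernel \<tau> a (fst p) (snd p) =
     cnj c * (cnj (stft \<phi> (dist_of \<psi>) (fst p)) * stft \<phi> f (snd p) * gabor_kernel \<tau> a (fst p) (snd p)) +
     cnj (stft \<phi> (dist_of \<eta>) (fst p)) * stft \<phi> f (snd p) * gabor_kernel \<tau> a (fst p) (snd p)" for p
    unfolding stft_dist_of[OF \<phi>(1)] fstft_lincomb[OF \<phi>(1) s] by (simp add: algebra_simps)
  note I = form_integrable[OF a f dist_of_tests, of _ \<tau>]
  show "tau_op \<tau> a f (\<lambda>x. c * \<psi> x + \<eta> x) = cnj c * tau_op \<tau> a f \<psi> + tau_op \<tau> a f \<eta>"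
    unfolding tau_op_eq[OF a f s'] tau_op_eq[OF a f s(1)] tau_op_eq[OF a f s(2)] op_form_def e
    using I[OF s(1)] I[OF s(2)] by (subst Bochner_Integration.integral_add) (auto simp: add_divide_distrib)
next
  fix \<psi> :: "nat \<Rightarrow> 'a \<Rightarrow> complex" assume \<psi>: "schwartz_family (\<lambda>_. 0::real) \<psi>"
  let ?n = "4 * DIM('a)"
  obtain C where C: "C \<ge> 0" "\<forall>i z. ennreal (norm (fstft \<phi> (\<psi> i) z)) * ennreal (1 / m z) \<le> ennreal C * ennreal (prod_kernel ?n z)"
    using family_test_bound[OF \<phi>(1) \<psi>] by blast
  \<comment> \<open>The factor m cancels the weight 1 / m by which tests are measured, leaving the
    product kernel.\<close>
  define h where "h z = (ennreal C * ennreal (prod_kernel ?n z)) * ennreal (m z)" for z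
  have mm: "ennreal (1 / m z) * ennreal (m z) = 1" for z
    using m_pos[of z] by (simp add: ennreal_mult'[symmetric])
  have h1: "h z * ennreal (1 / m z) = ennreal C * ennreal (prod_kernel ?n z)" for z
    using mm[of z] by (simp add: h_def mult.assoc mult.commute[of "ennreal (m z)"])
  have "admissible_test (\<lambda>z. h z * ennreal (1 / m z))"
    unfolding h1 by (rule admissible_test_mono[OF admissible_test_prod_kernel _ order_refl]) auto
  note B = form_finite[OF a f this, of \<tau>]
  define B where "B = (\<integral>\<^sup>+ p. ennreal (norm (gabor_kernel \<tau> a (fst p) (snd p))) * ennreal (norm (stft \<phi> f (snd p))) * h (fst p) \<partial>lborel)"
  have "norm (tau_op \<tau> a f (\<psi> i)) \<le> enn2real (ennreal (1 / (energy \<phi>)\<^sup>2) * B)" for i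
  proof -
    have s: "schwartz (\<psi> i)" by (rule schwartz_family_imp_schwartz[OF \<psi>])
    have "ennreal (norm (stft \<phi> (dist_of (\<psi> i)) z)) \<le> h z" for z
    proof -
      have "ennreal (norm (fstft \<phi> (\<psi> i) z)) * 1 = ennreal (norm (fstft \<phi> (\<psi> i) z)) * ennreal (1 / m z) * ennreal (m z)"
        by (simp only: mm mult.assoc)
      also have "\<dots> \<le> h z" unfolding h_def using C(2) by (intro mult_right_mono) (blast, simp)
      finally show ?thesis by (simp add: stft_dist_of \<phi>)
    qed
    then have "ennreal (norm (tau_op \<tau> a f (\<psi> i))) \<le> ennreal (1 / (energy \<phi>)\<^sup>2) * B"
      unfolding tau_op_eq[OF a f s] B_def
      by (intro order_trans[OF norm_form_le[OF a f]] mult_left_mono nn_integral_mono) auto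
    moreover have "ennreal (1 / (energy \<phi>)\<^sup>2) * B < top" using B by (simp add: B_def ennreal_mult_less_top)
    ultimately show ?thesis using enn2real_mono[of "ennreal (norm (tau_op \<tau> a f (\<psi> i)))"] by fastforce
  qed
  then show "\<exists>C. \<forall>n. norm (tau_op \<tau> a f (\<psi> n)) \<le> C" by blast
qed (simp add: tau_op_def)

text \<open>Fubini in w and the pair p. The integral over w recovers \<open>stft \<phi> g\<close> by
  the reproducing formula; the integral over p is the transform of \<open>tau_op \<tau> a f\<close>
  at w, since its value at a shifted window is itself an \<open>op_form\<close>.\<close>

theorem op_pairing:
  assumes a: "a \<in> symbols" and f: "f \<in> inputs" and g: "g \<in> tests"
  shows "has_pairing (tau_op \<tau> a f) g (op_form \<tau> a f g)"
  unfolding has_pairing_def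
proof (intro allI impI)
  fix \<Psi> :: "'a \<Rightarrow> complex" assume \<Psi>: "schwartz \<Psi>"
  note ta = symbols_tempered[OF a] and tf = inputs_tempered[OF f] and tg = tests_tempered[OF g]
  have en: "energy \<phi> > 0" by (rule energy_pos[OF \<phi>])
  define k where "k p = stft \<phi> f (snd p) * gabor_kernel \<tau> a (fst p) (snd p)" for p
  define U where "U w p = cnj (stft \<Psi> g w) * (cnj (fstft \<phi> (tfz w \<Psi>) (fst p)) * k p)" for w and p :: "('a \<times> 'a) \<times> 'a \<times> 'a"
  note [measurable] = stft_measurable[OF tf \<phi>(1)] stft_measurable[OF tg \<Psi>] gabor_kernel_measurable[OF ta]
    schwartz_measurable[OF schwartz_fstft[OF \<Psi> \<phi>(1)]]
  have int: "integrable lborel (\<lambda>(w, p). U w p)"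
  proof (rule integrableI_bounded)
    show m1: "(\<lambda>(w, p). U w p) \<in> borel_measurable lborel"
      unfolding U_def k_def split_def fstft_swap[of \<phi> _ \<Psi>] fstft_tfz[OF schwartz_measurable[OF \<phi>(1)] schwartz_measurable[OF \<Psi>]] by measurable
    define X where "X z = (\<integral>\<^sup>+ w. ennreal (norm (stft \<Psi> g w)) * ennreal (norm (fstft \<Psi> \<phi> (w - z))) \<partial>lborel)" for z
    have [measurable]: "X \<in> borel_measurable borel" unfolding X_def[abs_def] by measurable
    have ok: "admissible_test (\<lambda>z. ennreal (norm (stft \<Psi> g z)) * ennreal (1 / m z))" using g \<Psi> by (simp add: tests_def)
    have okX: "admissible_test (\<lambda>z. X z * ennreal (1 / m z))"
    proof -
      obtain C K where C: "C \<ge> 0" "\<forall>n f k D z. f \<in> borel_measurable borel \<longrightarrow> k \<in> borel_measurable borel \<longrightarrow> D \<ge> 0 \<longrightarrow>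
        (\<forall>y. 0 \<le> k y \<and> k y \<le> D * inverse (bk y ^ (2 * n + K))) \<longrightarrow>
        (\<integral>\<^sup>+ z'. f z' * ennreal (k (z' - z)) \<partial>lborel) * ennreal (1 / m z) \<le> ennreal (C * D) * smear n (\<lambda>z. f z * ennreal (1 / m z)) z"
        by (rule smear_kernel[OF poly_weight_inverse[OF m]])
      obtain D where D: "D \<ge> 0" "\<And>y. norm (fstft \<Psi> \<phi> y) \<le> D * inverse (bk y ^ (2 * (4 * DIM('a)) + K))"
        by (rule schwartz_decay[OF schwartz_fstft[OF \<Psi> \<phi>(1)]]) (rule that)
      have "X z * ennreal (1 / m z) \<le> ennreal (C * D) * smear (4 * DIM('a)) (\<lambda>z. ennreal (norm (stft \<Psi> g z)) * ennreal (1 / m z)) z" for z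
        unfolding X_def
        by (rule C(2)[rule_format, where k = "\<lambda>y. norm (fstft \<Psi> \<phi> y)"]) (use D in auto)
      then show ?thesis by (intro admissible_test_mono[OF admissible_test_smear[OF ok]]) auto
    qed
    have "(\<integral>\<^sup>+ q. ennreal (norm (case q of (w, p) \<Rightarrow> U w p)) \<partial>lborel) = (\<integral>\<^sup>+ p. \<integral>\<^sup>+ w. ennreal (norm (U w p)) \<partial>lborel \<partial>lborel)"
      using m1 by (subst nn_integral_lborel_pair(2)) auto
    also have "\<dots> = (\<integral>\<^sup>+ p. ennreal (norm (gabor_kernel \<tau> a (fst p) (snd p))) * ennreal (norm (stft \<phi> f (snd p))) * X (fst p) \<partial>lborel)"
    proof (intro nn_integral_cong)
      fix p :: "('a \<times> 'a) \<times> 'a \<times> 'a"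
      have "ennreal (norm (U w p)) = ennreal (norm (gabor_kernel \<tau> a (fst p) (snd p))) * ennreal (norm (stft \<phi> f (snd p))) *
          (ennreal (norm (stft \<Psi> g w)) * ennreal (norm (fstft \<Psi> \<phi> (w - fst p))))" for w
        by (simp add: U_def k_def norm_mult fstft_swap[of \<phi> _ \<Psi>] norm_fstft_tfz[OF schwartz_measurable[OF \<phi>(1)] schwartz_measurable[OF \<Psi>]] ennreal_mult' mult_ac)
      then show "(\<integral>\<^sup>+ w. ennreal (norm (U w p)) \<partial>lborel) = ennreal (norm (gabor_kernel \<tau> a (fst p) (snd p))) * ennreal (norm (stft \<phi> f (snd p))) * X (fst p)"
        unfolding X_def by (simp only:) (subst nn_integral_cmult, measurable)
    qed
    also have "\<dots> < \<infinity>" using form_finite[OF a f okX] by simp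
    finally show "(\<integral>\<^sup>+ q. ennreal (norm (case q of (w, p) \<Rightarrow> U w p)) \<partial>lborel) < \<infinity>" .
  qed
  have inner1: "(LINT w|lborel. U w p) = of_real (energy \<Psi>) * (cnj (stft \<phi> g (fst p)) * k p)" for p
  proof -
    have "(LINT w|lborel. U w p) = cnj (LINT w|lborel. stft \<Psi> g w * cnj (fstft \<Psi> (tfz (fst p) \<phi>) w)) * k p"
      unfolding U_def fstft_swap[of \<phi> _ \<Psi>]
      by (simp only: Bochner_Integration.integral_cnj[symmetric] complex_cnj_mult complex_cnj_cnj mult.assoc[symmetric] integral_mult_left_zero)
    then show ?thesis unfolding stft_reproducing(2)[OF tg \<Psi> schwartz_tfz[OF \<phi>(1)]] by (simp add: stft_eq)
  qed
  have inner2: "(LINT p|lborel. U w p) = stft \<Psi> (tau_op \<tau> a f) w * cnj (stft \<Psi> g w) * of_real ((energy \<phi>)\<^sup>2)" for w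
    unfolding stft_eq[of \<Psi> "tau_op \<tau> a f"] tau_op_eq[OF a f schwartz_tfz[OF \<Psi>]] op_form_def stft_dist_of[OF \<phi>(1)]
    using en by (simp add: U_def k_def mult_ac)
  have "has_bochner_integral lborel (\<lambda>w. LINT p|lborel. U w p) (of_real (energy \<Psi>) * (LINT p|lborel. cnj (stft \<phi> g (fst p)) * k p))"
    using fubini_lborel(3)[OF int] fubini_lborel_swap[OF int] by (simp add: has_bochner_integral_iff inner1)
  then have "has_bochner_integral lborel (\<lambda>w. (LINT p|lborel. U w p) / of_real ((energy \<phi>)\<^sup>2))
      (of_real (energy \<Psi>) * (LINT p|lborel. cnj (stft \<phi> g (fst p)) * k p) / of_real ((energy \<phi>)\<^sup>2))"
    by (rule has_bochner_integral_divide_zero)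
  then show "has_bochner_integral lborel (\<lambda>w. stft \<Psi> (tau_op \<tau> a f) w * cnj (stft \<Psi> g w)) (op_form \<tau> a f g * of_real (energy \<Psi>))"
    using en by (simp add: inner2 op_form_def k_def mult_ac)
qed

section \<open>The norm estimate\<close>

text \<open>The transform of the output at w is the form tested on the shift of \<phi> by w, whose
  own transform is concentrated near w by covariance. The outer integral is therefore a smearing of
  the Gabor matrix applied to the input.\<close>

lemma op_pointwise:
  obtains C where "C \<ge> 0" "\<forall>\<tau> a f w. a \<in> symbols \<longrightarrow> f \<in> inputs \<longrightarrow>
    ennreal (norm (stft \<phi> (tau_op \<tau> a f) w)) * ennreal (m w) \<le> ennreal C * smear (4 * DIM('a))
      (\<lambda>z. \<integral>\<^sup>+ z'. (\<lambda>Z. ennreal (norm (stft (wigner \<tau> \<phi> \<phi>) a Z)) * ennreal (\<mu> Z)) (gmap \<tau> z z') * (ennreal (norm (stft \<phi> f z')) * ennreal (m z')) \<partial>lborel) w"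
proof -
  obtain C K where C: "C \<ge> 0" "\<forall>n f k D z. f \<in> borel_measurable borel \<longrightarrow> k \<in> borel_measurable borel \<longrightarrow> D \<ge> 0 \<longrightarrow>
    (\<forall>y. 0 \<le> k y \<and> k y \<le> D * inverse (bk y ^ (2 * n + K))) \<longrightarrow>
    (\<integral>\<^sup>+ z'. f z' * ennreal (k (z' - z)) \<partial>lborel) * ennreal (m z) \<le> ennreal (C * D) * smear n (\<lambda>z. f z * ennreal (m z)) z"
    by (rule smear_kernel[OF m])
  obtain D where D: "D \<ge> 0" "\<And>y. norm (fstft \<phi> \<phi> y) \<le> D * inverse (bk y ^ (2 * (4 * DIM('a)) + K))"
    by (rule schwartz_decay[OF schwartz_fstft[OF \<phi>(1) \<phi>(1)]]) (rule that)
  define E where "E = 1 / (energy \<phi>)\<^sup>2"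
  have E: "0 \<le> E" by (simp add: E_def)
  have "ennreal (norm (stft \<phi> (tau_op \<tau> a f) w)) * ennreal (m w) \<le> ennreal (E * (C * D)) * smear (4 * DIM('a))
      (\<lambda>z. \<integral>\<^sup>+ z'. (\<lambda>Z. ennreal (norm (stft (wigner \<tau> \<phi> \<phi>) a Z)) * ennreal (\<mu> Z)) (gmap \<tau> z z') * (ennreal (norm (stft \<phi> f z')) * ennreal (m z')) \<partial>lborel) w"
    if a: "a \<in> symbols" and f: "f \<in> inputs" for \<tau> a f w
  proof -
    note ta = symbols_tempered[OF a] and tf = inputs_tempered[OF f]
    note [measurable] = stft_measurable[OF tf \<phi>(1)] gabor_kernel_measurable[OF ta] schwartz_measurable[OF schwartz_fstft[OF \<phi>(1) \<phi>(1)]]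
    define h where "h z = (\<integral>\<^sup>+ z'. ennreal (norm (gabor_kernel \<tau> a z z')) * ennreal (norm (stft \<phi> f z')) \<partial>lborel)" for z
    have [measurable]: "h \<in> borel_measurable borel" unfolding h_def[abs_def] by measurable
    have "ennreal (norm (stft \<phi> (tau_op \<tau> a f) w)) \<le> ennreal E * (\<integral>\<^sup>+ p. ennreal (norm (gabor_kernel \<tau> a (fst p) (snd p))) * ennreal (norm (stft \<phi> f (snd p))) * ennreal (norm (fstft \<phi> (tfz w \<phi>) (fst p))) \<partial>lborel)"
      unfolding stft_eq[of \<phi> "tau_op \<tau> a f"] tau_op_eq[OF a f schwartz_tfz[OF \<phi>(1)]] E_def
      using norm_form_le[OF a f, of \<tau> "dist_of (tfz w \<phi>)"] by (simp add: stft_dist_of \<phi>)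
    also have "(\<integral>\<^sup>+ p. ennreal (norm (gabor_kernel \<tau> a (fst p) (snd p))) * ennreal (norm (stft \<phi> f (snd p))) * ennreal (norm (fstft \<phi> (tfz w \<phi>) (fst p))) \<partial>lborel) =
        (\<integral>\<^sup>+ z. h z * ennreal (norm (fstft \<phi> \<phi> (z - w))) \<partial>lborel)"
      unfolding norm_fstft_tfz[OF schwartz_measurable[OF \<phi>(1)] schwartz_measurable[OF \<phi>(1)]] h_def
      by (subst nn_integral_lborel_pair(1)) (simp_all add: nn_integral_multc)
    finally have "ennreal (norm (stft \<phi> (tau_op \<tau> a f) w)) * ennreal (m w) \<le> ennreal E * (\<integral>\<^sup>+ z. h z * ennreal (norm (fstft \<phi> \<phi> (z - w))) \<partial>lborel) * ennreal (m w)"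
      by (rule mult_right_mono) simp
    also have "\<dots> \<le> ennreal E * (ennreal (C * D) * smear (4 * DIM('a)) (\<lambda>z. h z * ennreal (m z)) w)"
      unfolding mult.assoc[of "ennreal E"]
      by (intro mult_left_mono C(2)[rule_format, where k = "\<lambda>y. norm (fstft \<phi> \<phi> y)"]) (use D in auto)
    also have "\<dots> = ennreal (E * (C * D)) * smear (4 * DIM('a)) (\<lambda>z. h z * ennreal (m z)) w"
      using E C(1) D(1) by (simp only: ennreal_mult' mult.assoc mult_nonneg_nonneg)
    also have "\<dots> \<le> ennreal (E * (C * D)) * smear (4 * DIM('a))
      (\<lambda>z. \<integral>\<^sup>+ z'. (\<lambda>Z. ennreal (norm (stft (wigner \<tau> \<phi> \<phi>) a Z)) * ennreal (\<mu> Z)) (gmap \<tau> z z') * (ennreal (norm (stft \<phi> f z')) * ennreal (m z')) \<partial>lborel) w"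
    proof (intro mult_left_mono smear_mono)
      fix z
      have "h z * ennreal (m z) = (\<integral>\<^sup>+ z'. ennreal (norm (gabor_kernel \<tau> a z z')) * ennreal (norm (stft \<phi> f z')) * ennreal (m z) \<partial>lborel)"
        unfolding h_def by (rule nn_integral_multc[symmetric]) measurable
      also have "\<dots> \<le> (\<integral>\<^sup>+ z'. (\<lambda>Z. ennreal (norm (stft (wigner \<tau> \<phi> \<phi>) a Z)) * ennreal (\<mu> Z)) (gmap \<tau> z z') * (ennreal (norm (stft \<phi> f z')) * ennreal (m z')) \<partial>lborel)"
      proof (intro nn_integral_mono)
        fix z'
        have "ennreal (m z) \<le> ennreal (\<mu> (gmap \<tau> z z')) * ennreal (m z')"
          using weight_le[of z \<tau> z'] m_pos[of z'] by (simp add: ennreal_mult''[symmetric] ennreal_leI)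
        then have "ennreal (norm (gabor_kernel \<tau> a z z')) * ennreal (norm (stft \<phi> f z')) * ennreal (m z) \<le>
            ennreal (norm (gabor_kernel \<tau> a z z')) * ennreal (norm (stft \<phi> f z')) * (ennreal (\<mu> (gmap \<tau> z z')) * ennreal (m z'))"
          by (rule mult_left_mono) simp
        then show "ennreal (norm (gabor_kernel \<tau> a z z')) * ennreal (norm (stft \<phi> f z')) * ennreal (m z) \<le>
            (\<lambda>Z. ennreal (norm (stft (wigner \<tau> \<phi> \<phi>) a Z)) * ennreal (\<mu> Z)) (gmap \<tau> z z') * (ennreal (norm (stft \<phi> f z')) * ennreal (m z'))"
          by (simp add: norm_gabor_kernel[OF ta] mult_ac)
      qed
      finally show "h z * ennreal (m z) \<le> \<dots>" .
    qed simp
    finally show ?thesis .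
  qed
  moreover have "0 \<le> E * (C * D)" using E C(1) D(1) by simp
  ultimately show ?thesis by (intro that[of "E * (C * D)"]) auto
qed

text \<open>Young's inequality gives the reciprocals \<open>sx\<close>, \<open>rx\<close> for the
  matrix applied to the input; the smearing from \<open>op_pointwise\<close> lowers them to s',
  r'.\<close>

lemma op_mixed_le:
  assumes s: "0 \<le> s'" "s' \<le> sx" "0 \<le> r'" "r' \<le> rx"
  obtains C where "C < top" "\<forall>\<tau> a f NA NF. a \<in> symbols \<longrightarrow> f \<in> inputs \<longrightarrow>
     mixed_le \<pi> \<theta> (\<lambda>Z. ennreal (norm (stft (wigner \<tau> \<phi> \<phi>) a Z)) * ennreal (\<mu> Z)) NA \<longrightarrow>
     mixed_le \<sigma> \<rho> (\<lambda>z. ennreal (norm (stft \<phi> f z)) * ennreal (m z)) NF \<longrightarrow>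
     mixed_le s' r' (\<lambda>w. ennreal (norm (stft \<phi> (tau_op \<tau> a f) w)) * ennreal (m w)) (C * (NA * NF))"
proof -
  let ?n = "4 * DIM('a)"
  obtain C1 where C1: "C1 \<ge> 0" "\<forall>\<tau> a f w. a \<in> symbols \<longrightarrow> f \<in> inputs \<longrightarrow>
    ennreal (norm (stft \<phi> (tau_op \<tau> a f) w)) * ennreal (m w) \<le> ennreal C1 * smear ?n
      (\<lambda>z. \<integral>\<^sup>+ z'. (\<lambda>Z. ennreal (norm (stft (wigner \<tau> \<phi> \<phi>) a Z)) * ennreal (\<mu> Z)) (gmap \<tau> z z') * (ennreal (norm (stft \<phi> f z')) * ennreal (m z')) \<partial>lborel) w"
    by (rule op_pointwise)
  obtain C2 where C2: "C2 < top" "\<forall>\<tau> (A :: ('a \<times> 'a) \<times> ('a \<times> 'a) \<Rightarrow> ennreal) F NA NF.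
       mixed_le \<pi> \<theta> A NA \<longrightarrow> mixed_le \<sigma> \<rho> F NF \<longrightarrow>
       mixed_le sx rx (\<lambda>z. \<integral>\<^sup>+ z'. A (gmap \<tau> z z') * F z' \<partial>lborel) (C2 * (NA * NF))"
  proof (rule mixed_le_gabor_matrix[OF e, where 'a = 'a])
    fix C :: ennreal assume "C < top" "\<And>\<tau> (A :: ('a \<times> 'a) \<times> ('a \<times> 'a) \<Rightarrow> ennreal) F NA NF.
       mixed_le \<pi> \<theta> A NA \<Longrightarrow> mixed_le \<sigma> \<rho> F NF \<Longrightarrow>
       mixed_le sx rx (\<lambda>z. \<integral>\<^sup>+ z'. A (gmap \<tau> z z') * F z' \<partial>lborel) (C * (NA * NF))"
    then show thesis by (intro that) blast+
  qed
  obtain C3 where C3: "C3 < \<infinity>" "\<forall>(F :: 'a \<times> 'a \<Rightarrow> ennreal) N. mixed_le sx rx F N \<longrightarrow> mixed_le s' r' (smear ?n F) (C3 * N)"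
  proof (rule mixed_le_smear[where n = ?n and s = sx and s' = s' and r = rx and r' = r' and 'u = 'a and 'w = 'a])
    fix C :: ennreal assume "C < \<infinity>" "\<And>(F :: 'a \<times> 'a \<Rightarrow> ennreal) N. mixed_le sx rx F N \<Longrightarrow> mixed_le s' r' (smear ?n F) (C * N)"
    then show thesis by (intro that) blast+
  qed (use s e in auto)
  show ?thesis
  proof (rule that[of "ennreal C1 * (C3 * C2)"])
    show "ennreal C1 * (C3 * C2) < top" using C2(1) C3(1) by (simp add: ennreal_mult_less_top)
    show "\<forall>\<tau> a f NA NF. a \<in> symbols \<longrightarrow> f \<in> inputs \<longrightarrow>
     mixed_le \<pi> \<theta> (\<lambda>Z. ennreal (norm (stft (wigner \<tau> \<phi> \<phi>) a Z)) * ennreal (\<mu> Z)) NA \<longrightarrow>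
     mixed_le \<sigma> \<rho> (\<lambda>z. ennreal (norm (stft \<phi> f z)) * ennreal (m z)) NF \<longrightarrow>
     mixed_le s' r' (\<lambda>w. ennreal (norm (stft \<phi> (tau_op \<tau> a f) w)) * ennreal (m w)) (ennreal C1 * (C3 * C2) * (NA * NF))"
    proof (intro allI impI)
      fix \<tau> a f NA NF assume af: "a \<in> symbols" "f \<in> inputs"
        and A: "mixed_le \<pi> \<theta> (\<lambda>Z. ennreal (norm (stft (wigner \<tau> \<phi> \<phi>) a Z)) * ennreal (\<mu> Z)) NA"
        and F: "mixed_le \<sigma> \<rho> (\<lambda>z. ennreal (norm (stft \<phi> f z)) * ennreal (m z)) NF"
      from mixed_le_mono[OF C3(2)[rule_format, OF C2(2)[rule_format, OF A F]] C1(2)[rule_format, OF af]]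
      show "mixed_le s' r' (\<lambda>w. ennreal (norm (stft \<phi> (tau_op \<tau> a f) w)) * ennreal (m w)) (ennreal C1 * (C3 * C2) * (NA * NF))"
        by (simp add: mult.assoc)
    qed
  qed
qed

end

section \<open>Arithmetic of exponents and the main estimate\<close>

lemma ennreal_inverse_antimono: "x \<le> y \<Longrightarrow> inverse y \<le> inverse (x :: ennreal)"
  by (auto simp: less_eq_ennreal.rep_eq inverse_ennreal.rep_eq intro!: ereal_inverse_antimono)

lemma inverse_exp:
  assumes "1 \<le> p" shows "inverse p = ennreal (inv_exp p)" "inverse (conj_exp p) = ennreal (1 - inv_exp p)" "1 \<le> conj_exp p"
    and "inv_exp (conj_exp p) = 1 - inv_exp p"
proof -
  have le: "inverse p \<le> 1" using assms by (metis ennreal_inverse_antimono ennreal_inverse_1)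
  then show 1: "inverse p = ennreal (inv_exp p)" by (metis ennreal_enn2real ennreal_one_less_top order_le_less_trans)
  have "1 - inverse p = ennreal (1 - inv_exp p)"
    using inv_exp_bounds[OF assms] by (subst 1) (simp add: ennreal_minus flip: ennreal_1)
  then show 2: "inverse (conj_exp p) = ennreal (1 - inv_exp p)"
    using inv_exp_bounds[OF assms]
    by (cases "1 - inv_exp p = 0") (simp_all add: conj_exp_def inverse_ennreal del: diff_eq_diff_less_eq right_minus_eq)
  show "1 \<le> conj_exp p" unfolding conj_exp_def by (metis diff_le_self_ennreal ennreal_inverse_antimono ennreal_inverse_1)
  show "inv_exp (conj_exp p) = 1 - inv_exp p" using 2 inv_exp_bounds[OF assms] by simp
qed

lemma mod_norm_mono:
  assumes "1 \<le> p" "1 \<le> q" "\<And>z. \<mu> z \<le> \<mu>' z"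
  shows "mod_norm g p q \<mu> u \<le> mod_norm g p q \<mu>' u"
  unfolding mod_norm_def using assms by (intro Lp_norm_mono ennreal_leI mult_left_mono) auto

text \<open>Mixed bounds are available only for positive finite constants strictly above the norms;
  letting these decrease gives the bound by the norms themselves, zero norms included.\<close>

lemma le_mult_limit:
  fixes X A F :: ennreal
  assumes "A < top" "F < top" "0 \<le> K" "\<And>N N'. A < N \<Longrightarrow> N < top \<Longrightarrow> F < N' \<Longrightarrow> N' < top \<Longrightarrow> X \<le> ennreal K * N * N'"
  shows "X \<le> ennreal K * A * F"
proof -
  obtain a where a: "A = ennreal a" "0 \<le> a" using assms(1) by (cases A) auto
  obtain f where f: "F = ennreal f" "0 \<le> f" using assms(2) by (cases F) auto
  have 1: "X \<le> ennreal (K * (a + \<epsilon>) * (f + \<epsilon>))" if "0 < \<epsilon>" for \<epsilon>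
    using assms(4)[of "ennreal (a + \<epsilon>)" "ennreal (f + \<epsilon>)"] that a f assms(3)
    by (simp add: ennreal_mult' ennreal_less_iff)
  have "X < top" by (rule order_le_less_trans[OF 1[of 1]]) simp_all
  then obtain x where x: "X = ennreal x" "0 \<le> x" by (cases X) auto
  have lim: "((\<lambda>\<epsilon>. K * (a + \<epsilon>) * (f + \<epsilon>)) \<longlongrightarrow> K * (a + 0) * (f + 0)) (at_right 0)"
    by (intro tendsto_intros)
  have "x \<le> K * (a + 0) * (f + 0)"
  proof (rule tendsto_lowerbound[OF lim])
    show "\<forall>\<^sub>F \<epsilon> in at_right 0. x \<le> K * (a + \<epsilon>) * (f + \<epsilon>)"
      using eventually_at_right_less[of 0]
    proof eventually_elim
      case (elim \<epsilon>)
      then have "0 \<le> K * (a + \<epsilon>) * (f + \<epsilon>)" using a(2) f(2) assms(3) by simp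
      then show ?case using 1[OF elim] x by (simp add: ennreal_le_iff)
    qed
  qed simp
  then show ?thesis using x a f assms(3) by (simp add: ennreal_mult'[symmetric] ennreal_leI)
qed

theorem theorem5p1:
  fixes p1 p2 q1 q2 p q :: ennreal
    and v m :: "'a::euclidean_space \<times> 'a \<Rightarrow> real"
    and \<phi> :: "'a \<Rightarrow> complex"
    and \<Phi> :: "'a \<times> 'a \<Rightarrow> complex"
  assumes "1 \<le> p1" "1 \<le> p2" "1 \<le> q1" "1 \<le> q2" "1 \<le> p" "1 \<le> q"
    and "p1 \<le> conj_exp q" "conj_exp p2 \<le> conj_exp q" "q1 \<le> conj_exp q" "conj_exp q2 \<le> conj_exp q"
    and "inverse p1 + inverse (conj_exp p2) \<ge> inverse (conj_exp p) + inverse (conj_exp q)"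
    and "inverse q1 + inverse (conj_exp q2) \<ge> inverse (conj_exp p) + inverse (conj_exp q)"
    and "submultiplicative_weight v" and "polynomial_growth v"
    and "m \<in> moderate_weights v"
    and "schwartz \<phi>" "\<phi> \<noteq> (\<lambda>_. 0)" \<comment> \<open>the fixed window on \<open>\<real>\<^sup>d\<close>\<close>
    and "schwartz \<Phi>" "\<Phi> \<noteq> (\<lambda>_. 0)" \<comment> \<open>the fixed window on \<open>\<real>\<^sup>2\<^sup>d\<close>\<close>
  shows "\<exists>C::real. C > 0 \<and>
    (\<forall>\<tau>\<in>{0..1}. \<forall>a\<in>mod_space \<Phi> p q (one_tensor_J v).
      \<comment> \<open>\<open>tau_op \<tau> a\<close> is the operator defined by duality on Schwartz functions \<dots>\<close>
      (\<forall>f g. schwartz f \<longrightarrow> schwartz g \<longrightarrow>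
         tau_op \<tau> a (dist_of f) g = a (wigner \<tau> g f)) \<and>
      \<comment> \<open>\<dots> and on the modulation space\<close>
      (\<forall>f\<in>mod_space \<phi> p1 q1 m.
         \<forall>g\<in>mod_space \<phi> (conj_exp p2) (conj_exp q2) (\<lambda>z. 1 / m z).
           \<exists>c. has_pairing (tau_op \<tau> a f) g c \<and> has_pairing a (wigner_dist \<tau> g f) c) \<and>
      \<comment> \<open>linearity\<close>
      (\<forall>f\<in>mod_space \<phi> p1 q1 m. \<forall>h\<in>mod_space \<phi> p1 q1 m. \<forall>c.
         tau_op \<tau> a (\<lambda>\<psi>. c * f \<psi> + h \<psi>) = (\<lambda>\<psi>. c * tau_op \<tau> a f \<psi> + tau_op \<tau> a h \<psi>)) \<and>
      \<comment> \<open>boundedness\<close>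
      (\<forall>f\<in>mod_space \<phi> p1 q1 m.
         tau_op \<tau> a f \<in> mod_space \<phi> p2 q2 m \<and>
         mod_norm \<phi> p2 q2 m (tau_op \<tau> a f)
           \<le> ennreal C * mod_norm \<Phi> p q (one_tensor_J v) a * mod_norm \<phi> p1 q1 m f))"
proof -
  note pq = assms(1-6) and wt = assms(13-15) and win = assms(16-19)
  obtain m' Cm where m': "poly_weight m'" "\<And>z. m z \<le> m' z" "Cm > 0" "\<And>z. m' z \<le> Cm * m z" "\<And>z h. m' (z + h) \<le> v h * m' z"
    by (rule moderate_weight_regularize[OF wt]) (rule that)
  \<comment> \<open>After this scaling m1 \<le> m, so norms of inputs with m control those with m1;
    for the output, m \<le> Cm m1 is used.\<close>
  define m1 where "m1 z = m' z / Cm" for z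
  have m1_le: "m1 z \<le> m z" "m z \<le> Cm * m1 z" for z using m'(2)[of z] m'(4)[of z] m'(3) by (simp_all add: m1_def divide_simps mult.commute)
  have mp: "0 < m z" "0 < m' z" "0 < m1 z" for z
  proof -
    show "0 < m z" "0 < m' z" using wt(3) m'(1) unfolding moderate_weights_def poly_weight_def by blast+
    then show "0 < m1 z" using m'(3) by (simp add: m1_def)
  qed
  have m1_mod: "m1 (z + h) \<le> v h * m1 z" for z h using m'(5)[of z h] m'(3) by (simp add: m1_def divide_right_mono)
  have pm1: "poly_weight m1"
    unfolding poly_weight_def
  proof (intro conjI allI mp(3))
    obtain C K where C: "continuous_on UNIV m'" "C \<ge> 0" "\<And>z h. m' (z + h) \<le> C * bk h ^ K * m' z"
      using m'(1) unfolding poly_weight_def by blast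
    show "continuous_on UNIV m1" unfolding m1_def using m'(3) by (intro continuous_intros C(1)) auto
    have "m1 (z + h) \<le> C * bk h ^ K * m1 z" for z h using C(3)[of z h] m'(3) by (simp add: m1_def divide_right_mono)
    with C(2) show "\<exists>C K. 0 \<le> C \<and> (\<forall>z h. m1 (z + h) \<le> C * bk h ^ K * m1 z)" by blast
  qed
  \<comment> \<open>The minima enforce what Young's inequality needs: \<pi> \<le> \<theta> and
    \<sigma>, \<rho> \<le> 1 - \<pi>. The lower bounds 1 - \<theta> survive because p1 and q1 are at
    most q'.\<close>
  define \<theta> where "\<theta> = inv_exp q"
  define \<pi> where "\<pi> = min (inv_exp p) \<theta>"
  define \<sigma> where "\<sigma> = min (inv_exp p1) (1 - \<pi>)"
  define \<rho> where "\<rho> = min (inv_exp q1) (1 - \<pi>)"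
  have b: "0 \<le> inv_exp x" "inv_exp x \<le> 1" if "1 \<le> x" for x using inv_exp_bounds[OF that] by auto
  have anti: "1 - \<theta> \<le> inv_exp x" if "x \<le> conj_exp q" "1 \<le> x" for x
  proof -
    have "ennreal (1 - \<theta>) \<le> ennreal (inv_exp x)"
      unfolding \<theta>_def inverse_exp(2)[OF pq(6), symmetric] inverse_exp(1)[OF that(2), symmetric]
      by (rule ennreal_inverse_antimono[OF that(1)])
    then show ?thesis using b[OF that(2)] by (simp add: ennreal_le_iff)
  qed
  have sum: "(1 - inv_exp p) + (1 - \<theta>) \<le> inv_exp x + (1 - inv_exp y)"
    if "inverse x + inverse (conj_exp y) \<ge> inverse (conj_exp p) + inverse (conj_exp q)" "1 \<le> x" "1 \<le> y" for x y
  proof -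
    have nn: "0 \<le> 1 - inv_exp p" "0 \<le> 1 - inv_exp q" "0 \<le> inv_exp x" "0 \<le> 1 - inv_exp y"
      using b[OF that(2)] b[OF that(3)] b[OF pq(5)] b[OF pq(6)] by auto
    have "ennreal ((1 - inv_exp p) + (1 - \<theta>)) \<le> ennreal (inv_exp x + (1 - inv_exp y))"
      unfolding \<theta>_def ennreal_plus[OF nn(1,2)] ennreal_plus[OF nn(3,4)] inverse_exp(2)[OF pq(5), symmetric]
        inverse_exp(2)[OF pq(6), symmetric] inverse_exp(1)[OF that(2), symmetric] inverse_exp(2)[OF that(3), symmetric]
      by (rule that(1))
    then show ?thesis by (rule ennreal_le_iff[THEN iffD1, rotated]) (use nn in auto)
  qed
  have e1: "1 - \<theta> \<le> inv_exp p1" "1 - \<theta> \<le> inv_exp q1" "inv_exp p2 \<le> \<theta>" "inv_exp q2 \<le> \<theta>"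
    using anti[OF assms(7) pq(1)] anti[OF assms(9) pq(3)] anti[OF assms(8) inverse_exp(3)[OF pq(2)]] anti[OF assms(10) inverse_exp(3)[OF pq(4)]]
    by (auto simp: inverse_exp(4) pq)
  note e2 = sum[OF assms(11) pq(1,2)] sum[OF assms(12) pq(3,4)]
  have e: "0 \<le> \<pi>" "\<pi> \<le> \<theta>" "\<theta> \<le> 1" "1 - \<theta> \<le> \<sigma>" "\<sigma> \<le> 1 - \<pi>" "1 - \<theta> \<le> \<rho>" "\<rho> \<le> 1 - \<pi>"
    using b[OF pq(5)] b[OF pq(6)] e1 by (auto simp: \<pi>_def \<sigma>_def \<rho>_def \<theta>_def)
  \<comment> \<open>If \<sigma> = 1 - \<pi>, the output reciprocal is \<theta>, and p2' \<le> q'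
    means 1/p2 \<le> \<theta>. If \<sigma> = 1/p1 and \<pi> = 1/p, this is the assumed sum
    inequality. If \<sigma> = 1/p1 and \<pi> = \<theta>, then 1/p1 \<ge> 1 - \<theta> makes it at
    least \<theta> again. The same holds for q2.\<close>
  have s: "inv_exp p2 \<le> \<pi> + (\<sigma> + \<theta> - 1)" "inv_exp q2 \<le> \<pi> + (\<rho> + \<theta> - 1)"
    using e1 e2 by (auto simp: \<sigma>_def \<rho>_def \<pi>_def min_def split: if_splits)
  have le: "\<pi> \<le> inv_exp p" "\<theta> \<le> inv_exp q" "\<sigma> \<le> inv_exp p1" "\<rho> \<le> inv_exp q1" "0 \<le> \<theta>" "0 \<le> \<sigma>" "0 \<le> \<rho>"
    using e b[OF pq(6)] by (auto simp: \<pi>_def \<sigma>_def \<rho>_def \<theta>_def)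
  have le': "0 \<le> 1 - (\<pi> + (\<sigma> + \<theta> - 1))" "0 \<le> 1 - (\<pi> + (\<rho> + \<theta> - 1))"
    "1 - (\<pi> + (\<sigma> + \<theta> - 1)) \<le> inv_exp (conj_exp p2)" "1 - (\<pi> + (\<rho> + \<theta> - 1)) \<le> inv_exp (conj_exp q2)"
    using e s by (auto simp: inverse_exp(4) pq)
  interpret tau_calculus v m1 \<phi> \<pi> \<theta> \<sigma> \<rho>
    by unfold_locales (use wt pm1 m1_mod win e in auto)
  have p\<mu>: "poly_weight (one_tensor_J v)" by (rule poly_weight_one_tensor_J[OF wt(1,2)])
  have sy: "a \<in> symbols" if a: "a \<in> mod_space \<Phi> p q (one_tensor_J v)" for a
    unfolding symbols_def
  proof (intro CollectI conjI allI impI)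
    show t: "tempered a" using a by (simp add: mod_space_def)
    fix \<Psi> :: "'a \<times> 'a \<Rightarrow> complex" assume \<Psi>: "schwartz \<Psi>"
    obtain C M where C: "C \<ge> 0" "\<forall>u (i::unit) N. tempered u \<longrightarrow> mod_norm \<Phi> p q (one_tensor_J v) u \<le> N \<longrightarrow> 0 < N \<longrightarrow> N < top \<longrightarrow>
       mixed_le \<pi> \<theta> (\<lambda>z. ennreal (norm (stft \<Psi> u z)) * ennreal (one_tensor_J v z)) (ennreal (C * bk (0::real) ^ M) * N)"
      by (rule mod_norm_mixed_le[OF win(3,4) schwartz_family_const_iff[OF \<Psi>] p\<mu> pq(5,6) e(1) le(1,5,2)])
    \<comment> \<open>The summand 1 makes the bound strictly positive when the norm is 0.\<close>
    let ?N = "mod_norm \<Phi> p q (one_tensor_J v) a + 1"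
    have N: "0 < ?N" "?N < top" using a by (auto simp: mod_space_def intro: add_nonneg_pos)
    note [measurable] = stft_measurable[OF t \<Psi>]
    show "admissible_symbol (\<lambda>Z. ennreal (norm (stft \<Psi> a Z)) * ennreal (one_tensor_J v Z))"
      unfolding admissible_symbol_def using C(2)[rule_format, OF t _ N] N(2) by (auto simp: ennreal_mult_less_top intro!: exI[of _ "ennreal (C * bk (0::real) ^ M) * ?N"])
  qed
  obtain Cf Mf where Cf: "Cf \<ge> 0" "\<forall>u (i::unit) N. tempered u \<longrightarrow> mod_norm \<phi> p1 q1 m1 u \<le> N \<longrightarrow> 0 < N \<longrightarrow> N < top \<longrightarrow>
       mixed_le \<sigma> \<rho> (\<lambda>z. ennreal (norm (stft \<phi> u z)) * ennreal (m1 z)) (ennreal (Cf * bk (0::real) ^ Mf) * N)"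
    by (rule mod_norm_mixed_le[OF win(1,2) schwartz_family_const_iff[OF win(1)] pm1 pq(1,3) le(6,3,7,4)])
  have f_mixed: "mixed_le \<sigma> \<rho> (\<lambda>z. ennreal (norm (stft \<phi> f z)) * ennreal (m1 z)) (ennreal Cf * N)"
    if "tempered f" "mod_norm \<phi> p1 q1 m f < N" "N < top" for f N
  proof -
    have "mod_norm \<phi> p1 q1 m1 f \<le> mod_norm \<phi> p1 q1 m f" by (rule mod_norm_mono[OF pq(1,3) m1_le(1)])
    also have "\<dots> \<le> N" using that(2) by simp
    finally show ?thesis using Cf(2)[rule_format, OF that(1) _ _ that(3)] that(2) by (simp add: order_le_less_trans[OF zero_le])
  qed
  have inp: "f \<in> inputs" if f: "f \<in> mod_space \<phi> p1 q1 m" for f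
  proof -
    have t: "tempered f" and n: "mod_norm \<phi> p1 q1 m f < top" using f by (auto simp: mod_space_def)
    note [measurable] = stft_measurable[OF t win(1)] poly_weight_measurable[OF pm1]
    obtain N where "mod_norm \<phi> p1 q1 m f < N" "N < top" using dense[OF n] by blast
    from f_mixed[OF t this] this(2) show ?thesis
      unfolding inputs_def using t by (auto intro!: admissible_input_mixed_le simp: ennreal_mult_less_top)
  qed
  have tst: "g \<in> tests" if g: "g \<in> mod_space \<phi> (conj_exp p2) (conj_exp q2) (\<lambda>z. 1 / m z)" for g
    unfolding tests_def
  proof (intro CollectI conjI allI impI)
    show t: "tempered g" using g by (simp add: mod_space_def)
    fix \<Psi> :: "'a \<Rightarrow> complex" assume \<Psi>: "schwartz \<Psi>"
    obtain C M where C: "C \<ge> 0" "\<forall>u (i::unit) N. tempered u \<longrightarrow> mod_norm \<phi> (conj_exp p2) (conj_exp q2) (\<lambda>z. 1 / m' z) u \<le> N \<longrightarrow> 0 < N \<longrightarrow> N < top \<longrightarrow>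
       mixed_le (1 - sx) (1 - rx) (\<lambda>z. ennreal (norm (stft \<Psi> u z)) * ennreal (1 / m' z)) (ennreal (C * bk (0::real) ^ M) * N)"
      by (rule mod_norm_mixed_le[OF win(1,2) schwartz_family_const_iff[OF \<Psi>] poly_weight_inverse[OF m'(1)] inverse_exp(3)[OF pq(2)] inverse_exp(3)[OF pq(4)] le'(1,3,2,4)])
    have n: "mod_norm \<phi> (conj_exp p2) (conj_exp q2) (\<lambda>z. 1 / m' z) g \<le> mod_norm \<phi> (conj_exp p2) (conj_exp q2) (\<lambda>z. 1 / m z) g"
      using m'(2) mp by (intro mod_norm_mono inverse_exp(3) pq) (simp add: frac_le)
    let ?N = "mod_norm \<phi> (conj_exp p2) (conj_exp q2) (\<lambda>z. 1 / m' z) g + 1"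
    have N: "0 < ?N" "?N < top" using g n by (auto simp: mod_space_def intro: order_le_less_trans add_nonneg_pos)
    note [measurable] = stft_measurable[OF t \<Psi>] poly_weight_measurable[OF pm1] poly_weight_measurable[OF m'(1)]
    have "admissible_test (\<lambda>z. ennreal (norm (stft \<Psi> g z)) * ennreal (1 / m' z))"
      unfolding admissible_test_def using C(2)[rule_format, OF t _ N] N(2) by (auto simp: ennreal_mult_less_top intro!: exI[of _ "ennreal (C * bk (0::real) ^ M) * ?N"])
    then show "admissible_test (\<lambda>z. ennreal (norm (stft \<Psi> g z)) * ennreal (1 / m1 z))"
    proof (rule admissible_test_mono)
      fix z
      have "ennreal (1 / m1 z) = ennreal Cm * ennreal (1 / m' z)"
        using m'(3) by (simp add: m1_def ennreal_mult'[symmetric])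
      then show "ennreal (norm (stft \<Psi> g z)) * ennreal (1 / m1 z) \<le> ennreal Cm * (ennreal (norm (stft \<Psi> g z)) * ennreal (1 / m' z))"
        by (simp add: mult_ac)
    qed auto
  qed
  obtain Ca Ma where Ca: "Ca \<ge> 0" "\<forall>u \<tau> N. tempered u \<longrightarrow> mod_norm \<Phi> p q (one_tensor_J v) u \<le> N \<longrightarrow> 0 < N \<longrightarrow> N < top \<longrightarrow>
       mixed_le \<pi> \<theta> (\<lambda>z. ennreal (norm (stft (wigner \<tau> \<phi> \<phi>) u z)) * ennreal (one_tensor_J v z)) (ennreal (Ca * bk \<tau> ^ Ma) * N)"
  proof -
    \<comment> \<open>The windows of the symbol are treated as one family indexed by \<tau> with
      weight \<tau>, so the constant \<open>Ca * bk \<tau> ^ Ma\<close> is explicit in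
      \<tau>.\<close>
    have "schwartz_family (\<lambda>\<tau>::real. \<tau>) (\<lambda>\<tau>. wigner \<tau> \<phi> \<phi>)"
      by (intro schwartz_family_wigner schwartz_family_const_iff win tame_mono[OF tame_self norm_le_bk])
    from mod_norm_mixed_le[OF win(3,4) this p\<mu> pq(5,6) e(1) le(1,5,2)] that show thesis by blast
  qed
  obtain C0 where C0: "C0 < top" "\<forall>\<tau> a f NA NF. a \<in> symbols \<longrightarrow> f \<in> inputs \<longrightarrow>
     mixed_le \<pi> \<theta> (\<lambda>Z. ennreal (norm (stft (wigner \<tau> \<phi> \<phi>) a Z)) * ennreal (one_tensor_J v Z)) NA \<longrightarrow>
     mixed_le \<sigma> \<rho> (\<lambda>z. ennreal (norm (stft \<phi> f z)) * ennreal (m1 z)) NF \<longrightarrow>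
     mixed_le (inv_exp p2) (inv_exp q2) (\<lambda>w. ennreal (norm (stft \<phi> (tau_op \<tau> a f) w)) * ennreal (m1 w)) (C0 * (NA * NF))"
    by (rule op_mixed_le[OF b(1)[OF pq(2)] s(1) b(1)[OF pq(4)] s(2)])
  obtain c0 where c0: "C0 = ennreal c0" "0 \<le> c0" using C0(1) by (cases C0) auto
  define K where "K = Cm * (c0 * ((Ca * 2 ^ Ma) * Cf))"
  have K: "0 \<le> K" using m'(3) c0(2) Ca(1) Cf(1) by (simp add: K_def)
  have bound: "mod_norm \<phi> p2 q2 m (tau_op \<tau> a f) \<le> ennreal K * mod_norm \<Phi> p q (one_tensor_J v) a * mod_norm \<phi> p1 q1 m f"
    if \<tau>: "\<tau> \<in> {0..1}" and a: "a \<in> mod_space \<Phi> p q (one_tensor_J v)" and f: "f \<in> mod_space \<phi> p1 q1 m" for \<tau> a f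
  proof (rule le_mult_limit)
    have ta: "tempered a" and tf: "tempered f" using a f by (auto simp: mod_space_def)
    show "mod_norm \<Phi> p q (one_tensor_J v) a < top" "mod_norm \<phi> p1 q1 m f < top" using a f by (auto simp: mod_space_def)
    fix N N' assume N: "mod_norm \<Phi> p q (one_tensor_J v) a < N" "N < top" and N': "mod_norm \<phi> p1 q1 m f < N'" "N' < top"
    have A: "mixed_le \<pi> \<theta> (\<lambda>z. ennreal (norm (stft (wigner \<tau> \<phi> \<phi>) a z)) * ennreal (one_tensor_J v z)) (ennreal (Ca * 2 ^ Ma) * N)"
    proof (rule mixed_le_mono[where c = 1])
      show "mixed_le \<pi> \<theta> (\<lambda>z. ennreal (norm (stft (wigner \<tau> \<phi> \<phi>) a z)) * ennreal (one_tensor_J v z)) (ennreal (Ca * bk \<tau> ^ Ma) * N)"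
        using Ca(2)[rule_format, OF ta _ _ N(2)] N(1) by (simp add: order_le_less_trans[OF zero_le] less_imp_le)
      \<comment> \<open>Here \<tau> in [0,1] enters: it replaces the power of
        \<open>bk \<tau>\<close> by \<open>2 ^ Ma\<close> and makes the constant uniform.\<close>
      have "bk \<tau> \<le> 2" using \<tau> by (simp add: bk_def)
      then show "1 * (ennreal (Ca * bk \<tau> ^ Ma) * N) \<le> ennreal (Ca * 2 ^ Ma) * N"
        using Ca(1) by (auto intro!: mult_right_mono ennreal_leI mult_left_mono power_mono simp: bk_nonneg)
    qed simp
    have "mixed_le (inv_exp p2) (inv_exp q2) (\<lambda>w. ennreal (norm (stft \<phi> (tau_op \<tau> a f) w)) * ennreal (m1 w))
        (C0 * ((ennreal (Ca * 2 ^ Ma) * N) * (ennreal Cf * N')))"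
      by (rule C0(2)[rule_format, OF sy[OF a] inp[OF f] A f_mixed[OF tf N']])
    then have "mixed_le (inv_exp p2) (inv_exp q2) (\<lambda>w. ennreal (norm (stft \<phi> (tau_op \<tau> a f) w) * m w)) (ennreal K * N * N')"
    proof (rule mixed_le_mono)
      fix w
      have "ennreal (norm (stft \<phi> (tau_op \<tau> a f) w) * m w) \<le> ennreal (norm (stft \<phi> (tau_op \<tau> a f) w) * (Cm * m1 w))"
        by (intro ennreal_leI mult_left_mono m1_le) simp
      then show "ennreal (norm (stft \<phi> (tau_op \<tau> a f) w) * m w) \<le> ennreal Cm * (ennreal (norm (stft \<phi> (tau_op \<tau> a f) w)) * ennreal (m1 w))"
        using m'(3) mp(3)[of w] by (simp add: ennreal_mult'[symmetric] mult_ac)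
      have "ennreal K = ennreal Cm * (ennreal c0 * (ennreal (Ca * 2 ^ Ma) * ennreal Cf))"
        using m'(3) c0(2) Ca(1) Cf(1) by (simp add: K_def ennreal_mult'[symmetric])
      then show "ennreal Cm * (C0 * ((ennreal (Ca * 2 ^ Ma) * N) * (ennreal Cf * N'))) \<le> ennreal K * N * N'"
        by (simp add: c0(1) mult_ac)
    qed
    then show "mod_norm \<phi> p2 q2 m (tau_op \<tau> a f) \<le> ennreal K * N * N'"
      unfolding mod_norm_def by (rule mixed_le_imp_Lp_norm[OF pq(2,4)])
  qed (rule K)
  show ?thesis
  proof (intro exI[of _ "K + 1"] conjI ballI allI impI)
    \<comment> \<open>K is only known to be nonnegative, whereas a positive constant is asked
      for.\<close>
    show "0 < K + 1" using K by simp
    fix \<tau> a assume \<tau>: "\<tau> \<in> {0..1::real}" and a: "a \<in> mod_space \<Phi> p q (one_tensor_J v)"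
    have ta: "tempered a" using a by (simp add: mod_space_def)
    show "tau_op \<tau> a (dist_of f) g = a (wigner \<tau> g f)" if "schwartz f" "schwartz g" for f g
      by (rule tau_op_dist_of[OF ta that win(3,4)])
    fix f assume f: "f \<in> mod_space \<phi> p1 q1 m"
    show "\<exists>c. has_pairing (tau_op \<tau> a f) g c \<and> has_pairing a (wigner_dist \<tau> g f) c"
      if "g \<in> mod_space \<phi> (conj_exp p2) (conj_exp q2) (\<lambda>z. 1 / m z)" for g
      using op_pairing[OF sy[OF a] inp[OF f] tst[OF that]] wigner_pairing[OF sy[OF a] inp[OF f] tst[OF that]] by blast
    show "tau_op \<tau> a (\<lambda>\<psi>. c * f \<psi> + h \<psi>) = (\<lambda>\<psi>. c * tau_op \<tau> a f \<psi> + tau_op \<tau> a h \<psi>)"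
      if "h \<in> mod_space \<phi> p1 q1 m" for h c
      by (rule tau_op_linear[OF sy[OF a] inp[OF f] inp[OF that]])
    have "ennreal K * mod_norm \<Phi> p q (one_tensor_J v) a * mod_norm \<phi> p1 q1 m f \<le> ennreal (K + 1) * mod_norm \<Phi> p q (one_tensor_J v) a * mod_norm \<phi> p1 q1 m f"
      by (intro mult_right_mono ennreal_leI) auto
    then show B: "mod_norm \<phi> p2 q2 m (tau_op \<tau> a f) \<le> ennreal (K + 1) * mod_norm \<Phi> p q (one_tensor_J v) a * mod_norm \<phi> p1 q1 m f"
      by (rule order_trans[OF bound[OF \<tau> a f]])
    also have "\<dots> < \<infinity>" using a f by (simp add: mod_space_def ennreal_mult_less_top)
    finally show "tau_op \<tau> a f \<in> mod_space \<phi> p2 q2 m"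
      using tempered_tau_op[OF sy[OF a] inp[OF f]] by (simp add: mod_space_def)
  qed
qed

end
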